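(* Let $\xi=(\xi_1\ge\dots\ge\xi_r\ge0)$ be a partition, $n=|\xi|$, and let $\rho=(1^{\xi^t_1}2^{\xi^t_2}\cdots)$ be the partition in which each $j\ge1$ appears exactly $\xi^t_j$ times, where $\xi^t$ is the transposed partition of $\xi$. Then there is an isomorphism of $\mathfrak{gl}_r$-modules $$V(\xi)\cong\mathcal{F}_n^r\left(\mathbb{C}\mathrm{PF}_n(\rho)\otimes\mathrm{Sign}\right),$$ where $\mathfrak{gl}_r$ acts on $V(\xi)$ through $\mathfrak{gl}_r\otimes1\subset\mathfrak{gl}_r\otimes\mathbb{C}[x,y]$ and $\mathrm{Sign}$ is the sign representation of $\Sigma_n$.
   Context: Frobenius map: for a partition $\eta$ of $n$ let $\pi_\eta$ be the corresponding irreducible complex representation of the symmetric group $\Sigma_n$, and, when $\eta$ has at most $r$ nonzero parts, let $\pi^\eta$ be the irreducible $\mathfrak{gl}_r$-module with highest weight $\eta$. $\mathcal{F}_n^r$ is the additive map from the Grothendieck ring of $\Sigma_n$ to that of $\mathfrak{gl}_r$ sending $\pi_\eta$ to $\pi^\eta$ if $\eta_{r+1}=0$ and to $0$ otherwise. Parking functions: for a partition $\rho=(\rho_1\ge\dots\ge\rho_k\ge0)$, a function $f:\{1,\dots,n\}\to\{1,\dots,n\}$ is a $\rho$-parking function if $|f^{-1}(\{1,\dots,\rho_{k-s+1}\})|\ge s$ for $s=1,\dots,k$. $\mathrm{PF}_n(\rho)$ is the set of these; $\Sigma_n$ acts on it by permuting the domain, and $\mathbb{C}\mathrm{PF}_n(\rho)$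 is the corresponding complex permutation representation. $|\xi|=\sum_j\xi_j$ and $\xi^t_i=\#\{j:\xi_j\ge i\}$. Module $V(\xi)$: $\mathbb{C}\langle\mathcal{X},\mathcal{Y}\rangle$ is the associative algebra generated by $\mathcal{X},\mathcal{Y}$ with $\mathcal{Y}\mathcal{X}-\mathcal{X}\mathcal{Y}=\mathcal{X}$; it acts on $\mathbb{C}[x,x^{-1}]$ by $\mathcal{X}=x$, $\mathcal{Y}=x\,\partial/\partial x$, preserving each $x^N\mathbb{C}[x]$. $\mathcal{G}_r=\mathfrak{gl}_r\otimes\mathbb{C}\langle\mathcal{X},\mathcal{Y}\rangle$ (Lie algebra of matrices with the commutator). $V_r=\mathbb{C}^r$ with basis $u_1,\dots,u_r$; $V_r^{(N)}=V_r\otimes(\mathbb{C}[x,x^{-1}]/x^N\mathbb{C}[x])$ is a $\mathcal{G}_r$-module with basis $u_j^i=u_j\otimes x^i$, $i<N$. $v_\xi^{(N)}=\bigwedge_{j=1}^r\bigwedge_{i=N-\xi_j}^{N-1}u_j^i\in\bigwedge^{|\xi|}V_r^{(N)}$, $\mathcal{V}(\xi,N)=U(\mathcal{G}_r)v_\xi^{(N)}$. $F^n\mathcal{G}_r$ is the span of $g\otimes\mathcal{X}^i\mathcal{Y}^j$ with $g\in\mathfrak{gl}_r$, $j\le n$, so $\operatorname{gr}\mathcal{G}_r=\mathfrak{gl}_r\otimes\mathbb{C}[x,y]$; $U^{\le m}(\mathcal{G}_r)$ is the span of products $a_1\cdots a_k$ with $a_i\in F^{m_i}\mathcal{G}_r$,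 $\sum m_i\le m$; $F^m\mathcal{V}(\xi,N)=U^{\le m}(\mathcal{G}_r)v_\xi^{(N)}$. Then $V(\xi)=\bigoplus_mF^m\mathcal{V}(\xi,N)/F^{m-1}\mathcal{V}(\xi,N)$, a $\mathfrak{gl}_r\otimes\mathbb{C}[x,y]$-module which up to isomorphism does not depend on the integer $N$. *)

theory Defs
  imports
    "HOL-Library.Function_Algebras"
    "HOL-Library.FuncSet"
    "HOL-Library.Poly_Mapping"
    "HOL-Combinatorics.Permutations"
    "HOL-Algebra.Sym_Groups"
    "HOL-Algebra.AbelCoset"
    "HOL-Algebra.Module"
    "Jordan_Normal_Form.Matrix"
begin

section \<open>Complex representations\<close>

definition complex_ring :: "complex ring" where
  "complex_ring = \<lparr>carrier = UNIV, mult = (*), one = 1, zero = 0, add = (+)\<rparr>"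

text \<open>A complex vector space (a \<^const>\<open>carrier\<close>-based module as in HOL-Algebra; its ring
  multiplication and unit are irrelevant) with operators indexed by the type \<open>'g\<close>.\<close>

record ('a, 'b, 'g) rep = "('a, 'b) module" +
  act :: "'g \<Rightarrow> 'b \<Rightarrow> 'b"

definition with_act :: "('a, 'b, 'c) module_scheme \<Rightarrow> ('g \<Rightarrow> 'b \<Rightarrow> 'b) \<Rightarrow> ('a, 'b, 'g) rep" where
  "with_act M f = \<lparr>carrier = carrier M, mult = mult M, one = one M, zero = zero M,
     add = add M, smult = smult M, act = f\<rparr>"

definition rep_iso ::
  "'g set \<Rightarrow> (complex, 'v, 'g, 'c) rep_scheme \<Rightarrow> (complex, 'w, 'g, 'd) rep_scheme \<Rightarrow> bool" where
  "rep_iso G M M' \<longleftrightarrow> (\<exists>h. bij_betw h (carrier M) (carrier M')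
     \<and> (\<forall>v\<in>carrier M. \<forall>w\<in>carrier M. h (v \<oplus>\<^bsub>M\<^esub> w) = h v \<oplus>\<^bsub>M'\<^esub> h w)
     \<and> (\<forall>c. \<forall>v\<in>carrier M. h (c \<odot>\<^bsub>M\<^esub> v) = c \<odot>\<^bsub>M'\<^esub> h v)
     \<and> (\<forall>g\<in>G. \<forall>v\<in>carrier M. h (act M g v) = act M' g (h v)))"

interpretation cfun: vector_space "\<lambda>(c::complex) (f::'i \<Rightarrow> complex) x. c * f x"
  by unfold_locales (auto simp: fun_eq_iff algebra_simps)

definition fun_mod :: "('i \<Rightarrow> complex) set \<Rightarrow> (complex, 'i \<Rightarrow> complex) module" where
  "fun_mod S = \<lparr>carrier = S, mult = undefined, one = undefined, zero = 0, add = (+),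
     smult = (\<lambda>c f x. c * f x)\<rparr>"

definition quot_mod :: "(complex, 'v, 'c) module_scheme \<Rightarrow> 'v set \<Rightarrow> (complex, 'v set) module" where
  "quot_mod M W = \<lparr>carrier = a_rcosets\<^bsub>M\<^esub> W, mult = undefined, one = undefined,
     zero = W, add = set_add M,
     smult = (\<lambda>c A. \<Union>a\<in>A. W +>\<^bsub>M\<^esub> (c \<odot>\<^bsub>M\<^esub> a))\<rparr>"

definition dsum_mod ::
  "'i set \<Rightarrow> ('i \<Rightarrow> (complex, 'v, 'c) module_scheme) \<Rightarrow> (complex, 'i \<Rightarrow> 'v) module" where
  "dsum_mod I M =
     \<lparr>carrier = {x \<in> (\<Pi>\<^sub>E i\<in>I. carrier (M i)). finite {i\<in>I. x i \<noteq> \<zero>\<^bsub>M i\<^esub>}},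
      mult = undefined, one = undefined,
      zero = (\<lambda>i\<in>I. \<zero>\<^bsub>M i\<^esub>),
      add = (\<lambda>x y. \<lambda>i\<in>I. x i \<oplus>\<^bsub>M i\<^esub> y i),
      smult = (\<lambda>c x. \<lambda>i\<in>I. c \<odot>\<^bsub>M i\<^esub> x i)\<rparr>"

definition dsum_rep ::
  "'i set \<Rightarrow> ('i \<Rightarrow> (complex, 'v, 'g, 'c) rep_scheme) \<Rightarrow> (complex, 'i \<Rightarrow> 'v, 'g) rep" where
  "dsum_rep I M = with_act (dsum_mod I M) (\<lambda>g x. \<lambda>i\<in>I. act (M i) g (x i))"

section \<open>Partitions and Grothendieck groups\<close>

text \<open>Partitions are listed without zero parts, so \<open>\<eta>\<^sub>r\<^sub>+\<^sub>1 = 0\<close> means \<open>length \<eta> \<le> r\<close>.\<close>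

definition partitions :: "nat \<Rightarrow> nat list set" where
  "partitions n = {\<eta>. sorted_wrt (\<ge>) \<eta> \<and> 0 \<notin> set \<eta> \<and> sum_list \<eta> = n}"

definition transposed :: "nat list \<Rightarrow> nat \<Rightarrow> nat" where
  "transposed \<xi> i = card {j. j < length \<xi> \<and> \<xi> ! j \<ge> i}"

text \<open>Elements of a Grothendieck group are integral combinations of irreducible classes, encoded
  as elements of the free abelian group on partitions. If \<open>\<pi>\<close> assigns to every partition the
  irreducible module labelled by it, then for \<open>c\<close> with nonnegative coefficients \<open>irr_sum \<pi> c\<close>
  is the semisimple module with class \<open>c\<close>.\<close>

definition irr_sum ::
  "(nat list \<Rightarrow> (complex, 'v, 'g) rep) \<Rightarrow> (nat list \<Rightarrow>\<^sub>0 int)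
    \<Rightarrow> (complex, nat list \<times> nat \<Rightarrow> 'v, 'g) rep" where
  "irr_sum \<pi> c = dsum_rep {(\<eta>, k). k < nat (Poly_Mapping.lookup c \<eta>)} (\<lambda>(\<eta>, k). \<pi> \<eta>)"

definition frobenius_map :: "nat \<Rightarrow> (nat list \<Rightarrow>\<^sub>0 int) \<Rightarrow> (nat list \<Rightarrow>\<^sub>0 int)" where
  "frobenius_map r = frag_extend (\<lambda>\<eta>. if length \<eta> \<le> r then frag_of \<eta> else 0)"

section \<open>Representations of symmetric groups\<close>

text \<open>The permutation representation on a set \<open>X\<close> of functions on \<open>{1..n}\<close>: as \<open>\<sigma>\<close> sends the
  basis vector of \<open>f\<close> to that of \<open>f \<circ> \<sigma>\<inverse>\<close>, it sends the coefficient function \<open>c\<close> to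
  \<open>\<lambda>f. c (f \<circ> \<sigma>)\<close>.\<close>

definition perm_act :: "(nat \<Rightarrow> nat) \<Rightarrow> ((nat \<Rightarrow> nat) \<Rightarrow> complex) \<Rightarrow> (nat \<Rightarrow> nat) \<Rightarrow> complex" where
  "perm_act \<sigma> c = (\<lambda>f. c (f \<circ> \<sigma>))"

definition perm_rep ::
  "(nat \<Rightarrow> nat) set \<Rightarrow> (complex, (nat \<Rightarrow> nat) \<Rightarrow> complex, nat \<Rightarrow> nat) rep" where
  "perm_rep X = with_act (fun_mod {c. \<forall>f. f \<notin> X \<longrightarrow> c f = 0}) perm_act"

text \<open>The tensor product with the sign representation, on the space \<open>W \<otimes> \<complex> = W\<close>.\<close>

definition tensor_sign :: "(complex, 'v, nat \<Rightarrow> nat) rep \<Rightarrow> (complex, 'v, nat \<Rightarrow> nat) rep" where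
  "tensor_sign W = with_act W (\<lambda>\<sigma> v. of_int (sign \<sigma>) \<odot>\<^bsub>W\<^esub> act W \<sigma> v)"

text \<open>The irreducible representation labelled by \<open>\<eta>\<close> is the Specht module of \<open>\<eta>\<close> (so \<open>[n]\<close>
  labels the trivial representation), spanned by polytabloids inside the permutation
  representation on tabloids. The tableau is the one whose rows are filled consecutively with
  \<open>1, 2, \<dots>, n\<close>; a tabloid is the function sending an entry to the index of its row.\<close>

definition tab_row :: "nat list \<Rightarrow> nat \<Rightarrow> nat" where
  "tab_row \<eta> x = (LEAST i. x \<le> sum_list (take (Suc i) \<eta>))"

definition tab_col :: "nat list \<Rightarrow> nat \<Rightarrow> nat" where
  "tab_col \<eta> x = x - sum_list (take (tab_row \<eta> x) \<eta>)"

definition polytabloid :: "nat \<Rightarrow> nat list \<Rightarrow> (nat \<Rightarrow> nat) \<Rightarrow> complex" where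
  "polytabloid n \<eta> f =
     (\<Sum>q | q permutes {1..n} \<and> (\<forall>x\<in>{1..n}. tab_col \<eta> (q x) = tab_col \<eta> x).
        if f = restrict (tab_row \<eta>) {1..n} \<circ> inv\<^bsub>sym_group n\<^esub> q then of_int (sign q) else 0)"

definition specht ::
  "nat \<Rightarrow> nat list \<Rightarrow> (complex, (nat \<Rightarrow> nat) \<Rightarrow> complex, nat \<Rightarrow> nat) rep" where
  "specht n \<eta> = with_act
     (fun_mod (cfun.span ((\<lambda>\<sigma>. perm_act \<sigma> (polytabloid n \<eta>)) ` carrier (sym_group n)))) perm_act"

text \<open>The class of a finite-dimensional representation of the symmetric group: its
  multiplicities in a decomposition into irreducibles (they are uniquely determined).\<close>

definition sym_class :: "nat \<Rightarrow> (complex, 'v, nat \<Rightarrow> nat) rep \<Rightarrow> (nat list \<Rightarrow>\<^sub>0 int)" where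
  "sym_class n W = (SOME c. Poly_Mapping.keys c \<subseteq> partitions n \<and> (\<forall>\<eta>. 0 \<le> Poly_Mapping.lookup c \<eta>)
     \<and> rep_iso (carrier (sym_group n)) W (irr_sum (specht n) c))"

text \<open>The \<open>s\<close>-th smallest part of \<open>\<rho>\<close> is \<open>\<rho> ! (length \<rho> - s)\<close>.\<close>

definition parking_functions :: "nat \<Rightarrow> nat list \<Rightarrow> (nat \<Rightarrow> nat) set" where
  "parking_functions n \<rho> = {f \<in> {1..n} \<rightarrow>\<^sub>E {1..n}.
     \<forall>s\<in>{1..length \<rho>}. card {x\<in>{1..n}. f x \<in> {1..\<rho> ! (length \<rho> - s)}} \<ge> s}"

section \<open>Representations of the general linear Lie algebra\<close>

locale gl_rep = module complex_ring M
  for r :: nat and M :: "(complex, 'v, complex mat) rep" (structure) +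
  assumes act_closed: "\<lbrakk>g \<in> carrier_mat r r; v \<in> carrier M\<rbrakk> \<Longrightarrow> act M g v \<in> carrier M"
    and act_add: "\<lbrakk>g \<in> carrier_mat r r; v \<in> carrier M; w \<in> carrier M\<rbrakk>
      \<Longrightarrow> act M g (v \<oplus>\<^bsub>M\<^esub> w) = act M g v \<oplus>\<^bsub>M\<^esub> act M g w"
    and act_smult: "\<lbrakk>g \<in> carrier_mat r r; v \<in> carrier M\<rbrakk>
      \<Longrightarrow> act M g (c \<odot>\<^bsub>M\<^esub> v) = c \<odot>\<^bsub>M\<^esub> act M g v"
    and add_act: "\<lbrakk>g \<in> carrier_mat r r; h \<in> carrier_mat r r; v \<in> carrier M\<rbrakk>
      \<Longrightarrow> act M (g + h) v = act M g v \<oplus>\<^bsub>M\<^esub> act M h v"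
    and smult_act: "\<lbrakk>g \<in> carrier_mat r r; v \<in> carrier M\<rbrakk>
      \<Longrightarrow> act M (c \<cdot>\<^sub>m g) v = c \<odot>\<^bsub>M\<^esub> act M g v"
    and bracket_act: "\<lbrakk>g \<in> carrier_mat r r; h \<in> carrier_mat r r; v \<in> carrier M\<rbrakk>
      \<Longrightarrow> act M (g * h - h * g) v = act M g (act M h v) \<ominus>\<^bsub>M\<^esub> act M h (act M g v)"

definition gl_irreducible :: "nat \<Rightarrow> (complex, 'v, complex mat) rep \<Rightarrow> bool" where
  "gl_irreducible r M \<longleftrightarrow> gl_rep r M \<and> carrier M \<noteq> {\<zero>\<^bsub>M\<^esub>}
     \<and> (\<forall>S. submodule S complex_ring M \<and> (\<forall>g\<in>carrier_mat r r. \<forall>v\<in>S. act M g v \<in> S)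
          \<longrightarrow> S = {\<zero>\<^bsub>M\<^esub>} \<or> S = carrier M)"

definition elem_mat :: "nat \<Rightarrow> nat \<Rightarrow> nat \<Rightarrow> complex mat" where
  "elem_mat r p q = mat r r (\<lambda>(i, j). if i = p \<and> j = q then 1 else 0)"

definition has_highest_weight :: "nat \<Rightarrow> nat list \<Rightarrow> (complex, 'v, complex mat) rep \<Rightarrow> bool" where
  "has_highest_weight r \<eta> M \<longleftrightarrow> (\<exists>v\<in>carrier M. v \<noteq> \<zero>\<^bsub>M\<^esub>
     \<and> (\<forall>p q. p < q \<and> q < r \<longrightarrow> act M (elem_mat r p q) v = \<zero>\<^bsub>M\<^esub>)
     \<and> (\<forall>p<r. act M (elem_mat r p p) v
          = of_nat (if p < length \<eta> then \<eta> ! p else 0) \<odot>\<^bsub>M\<^esub> v))"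

text \<open>A representative of the isomorphism class of irreducible modules with highest weight \<open>\<eta>\<close>.
  These modules are finite-dimensional, so \<^typ>\<open>nat \<Rightarrow> complex\<close> has room for one.\<close>

definition gl_irrep :: "nat \<Rightarrow> nat list \<Rightarrow> (complex, nat \<Rightarrow> complex, complex mat) rep" where
  "gl_irrep r \<eta> = (SOME M. gl_irreducible r M \<and> has_highest_weight r \<eta> M)"

section \<open>The module \<open>V(\<xi>)\<close>\<close>

text \<open>\<open>V\<^sub>r\<^sup>(\<^sup>N\<^sup>)\<close> consists of the finitely supported functions on \<open>{(j, i). j < r \<and> i < N}\<close>, the
  coordinates with respect to the basis \<open>u\<^sub>j \<otimes> x\<^sup>i\<close> (\<open>j\<close> counted from 0). The operators below are
  multiplication by \<open>x\<close> (followed by reduction modulo \<open>x\<^sup>N\<close>), \<open>x \<partial>/\<partial>x\<close>, and a matrix.\<close>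

definition basis_vec :: "nat \<times> int \<Rightarrow> nat \<times> int \<Rightarrow> complex" where
  "basis_vec b = (\<lambda>a. if a = b then 1 else 0)"

definition op_X :: "int \<Rightarrow> (nat \<times> int \<Rightarrow> complex) \<Rightarrow> (nat \<times> int \<Rightarrow> complex)" where
  "op_X N f = (\<lambda>(j, i). if i < N then f (j, i - 1) else 0)"

definition op_Y :: "(nat \<times> int \<Rightarrow> complex) \<Rightarrow> (nat \<times> int \<Rightarrow> complex)" where
  "op_Y f = (\<lambda>(j, i). of_int i * f (j, i))"

definition op_mat :: "nat \<Rightarrow> complex mat \<Rightarrow> (nat \<times> int \<Rightarrow> complex) \<Rightarrow> (nat \<times> int \<Rightarrow> complex)" where
  "op_mat r g f = (\<lambda>(p, i). if p < r then \<Sum>q<r. g $$ (p, q) * f (q, i) else 0)"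

lemma op_Y_op_X: "op_Y (op_X N f) - op_X N (op_Y f) = op_X N f"
  by (auto simp: fun_eq_iff op_X_def op_Y_def algebra_simps)

definition op_monom ::
  "nat \<Rightarrow> int \<Rightarrow> complex mat \<Rightarrow> nat \<Rightarrow> nat \<Rightarrow> (nat \<times> int \<Rightarrow> complex) \<Rightarrow> (nat \<times> int \<Rightarrow> complex)" where
  "op_monom r N g i j f = op_mat r g ((op_X N ^^ i) ((op_Y ^^ j) f))"

text \<open>An element \<open>\<Sum> a i j \<otimes> \<X>\<^sup>i \<Y>\<^sup>j\<close> of \<open>\<G>\<^sub>r\<close> is given by its family of coefficients \<open>a\<close>
  (the \<open>\<X>\<^sup>i \<Y>\<^sup>j\<close> form a basis). The same encoding, with \<open>x\<^sup>i y\<^sup>j\<close> in place of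
  \<open>\<X>\<^sup>i \<Y>\<^sup>j\<close>, is used for \<open>gr \<G>\<^sub>r = gl\<^sub>r \<otimes> \<complex>[x, y]\<close>.\<close>

type_synonym coeffs = "nat \<Rightarrow> nat \<Rightarrow> complex mat"

definition lie_G :: "nat \<Rightarrow> coeffs set" where
  "lie_G r = {a. (\<forall>i j. a i j \<in> carrier_mat r r) \<and> finite {(i, j). a i j \<noteq> 0\<^sub>m r r}}"

definition filt_G :: "nat \<Rightarrow> nat \<Rightarrow> coeffs set" where
  "filt_G r m = {a \<in> lie_G r. \<forall>i j. j > m \<longrightarrow> a i j = 0\<^sub>m r r}"

definition op_G :: "nat \<Rightarrow> int \<Rightarrow> coeffs \<Rightarrow> (nat \<times> int \<Rightarrow> complex) \<Rightarrow> (nat \<times> int \<Rightarrow> complex)" where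
  "op_G r N a f = (\<Sum>(i, j) | a i j \<noteq> 0\<^sub>m r r. op_monom r N (a i j) i j f)"

text \<open>The exterior power \<open>\<And>\<^sup>n\<close> is realised inside the \<open>n\<close>-th tensor power as the space of
  alternating tensors, a tensor being given by its coordinates, indexed by lists of length \<open>n\<close> of
  indices of basis vectors. Thus \<open>v\<^sub>1 \<and> \<dots> \<and> v\<^sub>n\<close> is the tensor with entries \<open>det (v\<^sub>i (a\<^sub>k))\<close>, and
  a linear operator \<open>A\<close> acts as the derivation \<open>\<Sum>\<^sub>k 1 \<otimes> \<dots> \<otimes> A \<otimes> \<dots> \<otimes> 1\<close>.\<close>

definition wedge :: "('i \<Rightarrow> complex) list \<Rightarrow> 'i list \<Rightarrow> complex" where
  "wedge vs = (\<lambda>as. if length as = length vs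
     then \<Sum>p | p permutes {..<length vs}. of_int (sign p) * (\<Prod>i<length vs. (vs ! i) (as ! p i))
     else 0)"

definition derivation ::
  "(('i \<Rightarrow> complex) \<Rightarrow> ('i \<Rightarrow> complex)) \<Rightarrow> ('i list \<Rightarrow> complex) \<Rightarrow> ('i list \<Rightarrow> complex)" where
  "derivation A t = (\<lambda>as. \<Sum>k<length as. A (\<lambda>b. t (as[k := b])) (as ! k))"

definition v_vec :: "int \<Rightarrow> nat list \<Rightarrow> (nat \<times> int) list \<Rightarrow> complex" where
  "v_vec N \<xi> = wedge (map basis_vec
     (concat (map (\<lambda>j. map (\<lambda>i. (j, i)) [N - int (\<xi> ! j)..N - 1]) [0..<length \<xi>])))"

text \<open>\<open>F\<^sup>m\<V>(\<xi>, N) = U\<^sup>\<le>\<^sup>m(\<G>\<^sub>r) v\<close>, where \<open>U(\<G>\<^sub>r)\<close> acts through products of elements of \<open>\<G>\<^sub>r\<close>.\<close>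

definition filt_V :: "nat \<Rightarrow> int \<Rightarrow> nat list \<Rightarrow> nat \<Rightarrow> ((nat \<times> int) list \<Rightarrow> complex) set" where
  "filt_V r N \<xi> m = cfun.span
     {foldr (\<lambda>a. derivation (op_G r N a)) as (v_vec N \<xi>) | as ms.
        list_all2 (\<lambda>a m'. a \<in> filt_G r m') as ms \<and> sum_list ms \<le> m}"

definition filt_V_pred :: "nat \<Rightarrow> int \<Rightarrow> nat list \<Rightarrow> nat \<Rightarrow> ((nat \<times> int) list \<Rightarrow> complex) set" where
  "filt_V_pred r N \<xi> m = (if m = 0 then {0} else filt_V r N \<xi> (m - 1))"

definition gr_V :: "nat \<Rightarrow> int \<Rightarrow> nat list \<Rightarrow> nat \<Rightarrow> (complex, ((nat \<times> int) list \<Rightarrow> complex) set) module"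
  where "gr_V r N \<xi> m = quot_mod (fun_mod (filt_V r N \<xi> m)) (filt_V_pred r N \<xi> m)"

text \<open>\<open>g \<otimes> x\<^sup>i y\<^sup>j\<close> maps the class of \<open>t\<close> in degree \<open>m - j\<close> to the class of
  \<open>(g \<otimes> \<X>\<^sup>i \<Y>\<^sup>j) t\<close> in degree \<open>m\<close>.\<close>

definition V_mod ::
  "nat \<Rightarrow> int \<Rightarrow> nat list \<Rightarrow> (complex, nat \<Rightarrow> ((nat \<times> int) list \<Rightarrow> complex) set, coeffs) rep" where
  "V_mod r N \<xi> = with_act (dsum_mod UNIV (gr_V r N \<xi>))
     (\<lambda>b x m. finsum (gr_V r N \<xi> m)
        (\<lambda>(i, j). \<Union>t\<in>x (m - j). filt_V_pred r N \<xi> m +>\<^bsub>fun_mod (filt_V r N \<xi> m)\<^esub>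
            derivation (op_monom r N (b i j) i j) t)
        {(i, j). j \<le> m \<and> b i j \<noteq> 0\<^sub>m r r})"

definition restrict_gl :: "nat \<Rightarrow> (complex, 'v, coeffs) rep \<Rightarrow> (complex, 'v, complex mat) rep" where
  "restrict_gl r M = with_act M (\<lambda>g. act M (\<lambda>i j. if i = 0 \<and> j = 0 then g else 0\<^sub>m r r))"

end

theory Submission
  imports Defs "HOL-Computational_Algebra.Polynomial"
begin

text \<open>
  Let the depth of the basis vector \<open>u\<^sub>j\<^sup>i\<close> be \<open>N - i\<close>. The operators of \<open>gl\<^sub>r \<otimes> \<complex>\<langle>\<X>,\<Y>\<rangle>\<close> change the letter
  \<open>j\<close> arbitrarily but never increase the depth. Conversely, a polynomial in \<open>\<Y>\<close> singles out
  one level, so one factor of a wedge can be given any letter and any smaller depth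
  (\<open>gen_move\<close>). Hence the module generated by the top wedge consists of all alternating tensors
  supported on words which have, for each \<open>k\<close>, at most as many factors of depth greater than
  \<open>k\<close> as the top wedge (\<open>gen_module_alt\<close>). The top wedge has as many of these as \<open>\<rho>\<close> has parts
  greater than \<open>k\<close>, so this condition says that the depths of the factors form a
  \<open>\<rho>\<close>-parking function (\<open>reachable_to_list\<close>); the letters are free.

  Passing to the associated graded module does not change the \<open>gl\<^sub>r\<close>-module: \<open>gl\<^sub>r \<otimes> 1\<close>
  preserves every step of the filtration and is closed under adjoints for the standard
  inner product, so that orthogonal complements split the filtration (\<open>graded_iso\<close>). A word
  being a pair of letters and depths, \<open>V(\<xi>)\<close> becomes the space of tensors with letters
  in \<open>\<complex>\<^sup>r\<close> and coefficients in the functions on parking functions that change by the sign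
  under simultaneous permutations (\<open>alt_schur_iso\<close>). This is the Schur functor
  \<open>W \<mapsto> ((\<complex>\<^sup>r)\<^sup>\<otimes>\<^sup>n \<otimes> W)\<^sup>\<Sigma>\<close> at the representation \<open>\<complex>PF \<otimes> Sign\<close>.

  It remains to identify the Schur functor with the Frobenius map. It is additive
  (\<open>schur_irr_sum\<close>), permutation representations twisted by a sign are sums of Specht modules
  (\<open>specht_decomposition\<close>), and the Specht module of \<open>\<eta>\<close> is sent to 0 if \<open>\<eta>\<close> has more than
  \<open>r\<close> parts (\<open>schur_specht_zero\<close>) and otherwise to an irreducible module of highest weight
  \<open>\<eta>\<close> (\<open>schur_specht_irreducible\<close>), which is unique (\<open>irreducible_hw_unique\<close>). Irreducibility
  holds because \<open>gl\<^sub>r\<close> generates all operators on tensors that commute with the symmetric group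
  (\<open>stable_kernel_op\<close>). The same fact provides highest weight vectors
  (\<open>highest_weight_exists\<close>), and these give a nonzero map from some Specht module to any given
  nonzero representation (\<open>specht_hom_exists\<close>). In this way complete reducibility over the
  symmetric group is deduced from highest weight theory for \<open>gl\<^sub>n\<close>.
\<close>

(* leaves the short name to the scalar multiplication of modules *)
hide_const (open) Polynomial.smult

section \<open>Orthogonal projection in spaces of functions\<close>

lemma fun_mod_simps [simp]:
  "carrier (fun_mod S) = S" "zero (fun_mod S) = 0" "add (fun_mod S) = (+)"
  "smult (fun_mod S) = (\<lambda>c f x. c * f x)"
  by (simp_all add: fun_mod_def)

lemma with_act_simps [simp]:
  "carrier (with_act M f) = carrier M" "zero (with_act M f) = zero M"
  "add (with_act M f) = add M" "smult (with_act M f) = smult M" "act (with_act M f) = f"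
  by (simp_all add: with_act_def)

definition funs_on :: "'i set \<Rightarrow> ('i \<Rightarrow> complex) set" where
  "funs_on X = {u. \<forall>i. i \<notin> X \<longrightarrow> u i = 0}"

definition ip :: "'i set \<Rightarrow> ('i \<Rightarrow> complex) \<Rightarrow> ('i \<Rightarrow> complex) \<Rightarrow> complex" where
  "ip X u v = (\<Sum>i\<in>X. u i * cnj (v i))"

lemma subspace_add: "cfun.subspace W \<Longrightarrow> u \<in> W \<Longrightarrow> v \<in> W \<Longrightarrow> u + v \<in> W"
  by (rule cfun.subspace_add)

lemma subspace_smult: "cfun.subspace W \<Longrightarrow> u \<in> W \<Longrightarrow> (\<lambda>i. c * u i) \<in> W"
  by (rule cfun.subspace_scale)

lemma subspace_sum: "cfun.subspace W \<Longrightarrow> (\<And>a. a \<in> A \<Longrightarrow> u a \<in> W) \<Longrightarrow> (\<lambda>i. \<Sum>a\<in>A. c a * u a i) \<in> W"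
proof -
  assume "cfun.subspace W" "\<And>a. a \<in> A \<Longrightarrow> u a \<in> W"
  then have "(\<Sum>a\<in>A. (\<lambda>i. c a * u a i)) \<in> W"
    by (intro cfun.subspace_sum subspace_smult)
  moreover have "(\<Sum>a\<in>A. (\<lambda>i. c a * u a i)) = (\<lambda>i. \<Sum>a\<in>A. c a * u a i)"
    by (induction A rule: infinite_finite_induct) (auto simp: fun_eq_iff)
  ultimately show ?thesis by simp
qed

lemma subspace_funs_on: "cfun.subspace (funs_on X)"
  by (rule cfun.subspaceI) (auto simp: funs_on_def)

lemma ip_add_left: "ip X (u + v) w = ip X u w + ip X v w"
  by (simp add: ip_def algebra_simps sum.distrib)

lemma ip_diff_left: "ip X (u - v) w = ip X u w - ip X v w"
  by (simp add: ip_def algebra_simps sum_subtractf)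

lemma ip_smult_left: "ip X (\<lambda>i. c * u i) w = c * ip X u w"
  by (simp add: ip_def sum_distrib_left mult.assoc)

lemma ip_add_right: "ip X u (v + w) = ip X u v + ip X u w"
  by (simp add: ip_def algebra_simps sum.distrib)

lemma ip_smult_right: "ip X u (\<lambda>i. c * w i) = cnj c * ip X u w"
  by (simp add: ip_def sum_distrib_left algebra_simps)

lemma ip_zero [simp]: "ip X 0 v = 0" "ip X u 0 = 0"
  by (simp_all add: ip_def)

lemma cnj_ip: "cnj (ip X u v) = ip X v u"
  by (simp add: ip_def mult.commute)

lemma ip_self: "ip X u u = of_real (\<Sum>i\<in>X. (cmod (u i))\<^sup>2)"
  by (simp only: ip_def complex_norm_square of_real_sum)

lemma ip_self_eq_0:
  assumes "finite X" "u \<in> funs_on X" "ip X u u = 0"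
  shows "u = 0"
proof -
  have "(\<Sum>i\<in>X. (cmod (u i))\<^sup>2) = 0"
    using assms(3) unfolding ip_self of_real_eq_0_iff .
  then have "\<forall>i\<in>X. u i = 0"
    using assms(1) by (subst (asm) sum_nonneg_eq_0_iff) auto
  then show ?thesis
    using assms(2) by (auto simp: funs_on_def fun_eq_iff)
qed

lemma finite_dim_subspace:
  fixes X :: "'i set"
  assumes "finite X" "cfun.subspace W" "W \<subseteq> funs_on X"
  obtains B where "finite B" "B \<subseteq> W" "cfun.independent B" "cfun.span B = W"
proof -
  define d where "d = (\<lambda>(a::'i) (i::'i). if i = a then 1 else (0::complex))"
  have sub: "W \<subseteq> cfun.span (d ` X)"
  proof
    fix u assume "u \<in> W"
    then have u: "u \<in> funs_on X" using assms by auto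
    have "u = (\<Sum>a\<in>X. (\<lambda>i. u a * d a i))"
    proof
      fix i
      have "(\<Sum>a\<in>X. (\<lambda>i. u a * d a i)) i = (\<Sum>a\<in>X. u a * d a i)"
        by (induction X rule: infinite_finite_induct) auto
      also have "\<dots> = u i"
        using u assms(1) by (auto simp: d_def funs_on_def if_distrib cong: if_cong)
      finally show "u i = (\<Sum>a\<in>X. (\<lambda>i. u a * d a i)) i" by simp
    qed
    also have "\<dots> \<in> cfun.span (d ` X)"
      by (intro cfun.span_sum cfun.span_scale cfun.span_base) auto
    finally show "u \<in> cfun.span (d ` X)" .
  qed
  obtain B where B: "B \<subseteq> W" "cfun.independent B" "W \<subseteq> cfun.span B"
    using cfun.basis_exists[of W] by metis
  have "finite B"
    using cfun.independent_span_bound[of "d ` X" B] B sub assms(1) by blast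
  moreover have "cfun.span B = W"
    using B assms(2) by (metis cfun.span_minimal subset_antisym)
  ultimately show ?thesis using that B by auto
qed

lemma orth_span:
  assumes "\<forall>b\<in>B. ip X w b = 0" "b \<in> cfun.span B"
  shows "ip X w b = 0"
proof -
  have "cfun.subspace {b. ip X w b = 0}"
    by (rule cfun.subspaceI) (auto simp: ip_def algebra_simps sum.distrib simp flip: sum_distrib_left)
  then show ?thesis
    using cfun.span_minimal[of B "{b. ip X w b = 0}"] assms by blast
qed

text \<open>One Gram--Schmidt step per spanning vector.\<close>

lemma orth_proj_span:
  assumes "finite B" "finite X" "B \<subseteq> funs_on X"
  shows "\<exists>p\<in>cfun.span B. \<forall>b\<in>B. ip X (u - p) b = 0"
  using assms(1,3)
proof (induction B arbitrary: u rule: finite_induct)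
  case empty
  then show ?case by auto
next
  case (insert s B)
  obtain p where p: "p \<in> cfun.span B" "\<forall>b\<in>B. ip X (s - p) b = 0"
    using insert.IH insert.prems by blast
  obtain q where q: "q \<in> cfun.span B" "\<forall>b\<in>B. ip X (u - q) b = 0"
    using insert.IH insert.prems by blast
  define s' where "s' = s - p"
  have pin: "p \<in> cfun.span (insert s B)" "q \<in> cfun.span (insert s B)"
    using p q cfun.span_mono[of B "insert s B"] by auto
  have s'in: "s' \<in> cfun.span (insert s B)"
    unfolding s'_def by (intro cfun.span_diff pin cfun.span_base) auto
  have s'X: "s' \<in> funs_on X"
    using s'in insert.prems cfun.span_minimal[OF insert.prems subspace_funs_on] by auto
  define c where "c = ip X (u - q) s' / ip X s' s'"
  define m where "m = q + (\<lambda>i. c * s' i)"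
  have m: "m \<in> cfun.span (insert s B)"
    unfolding m_def by (intro cfun.span_add cfun.span_scale pin s'in)
  have um: "ip X (u - m) b = ip X (u - q) b - c * ip X s' b" for b
    by (simp add: m_def ip_add_left ip_diff_left ip_smult_left)
  have 1: "ip X (u - m) b = 0" if "b \<in> B" for b
    using that p q unfolding um by (simp add: s'_def)
  have "ip X (u - m) s' = 0"
    using ip_self_eq_0[OF assms(2) s'X] unfolding um by (cases "s' = 0") (auto simp: c_def)
  moreover have "ip X (u - m) p = 0"
    using orth_span[of B X "u - m" p] 1 p by auto
  moreover have "s = s' + p" by (simp add: s'_def)
  ultimately have "ip X (u - m) s = 0"
    by (simp add: ip_add_right)
  then show ?case
    using 1 m by (intro bexI[of _ m]) blast+
qed

definition orth_proj :: "'i set \<Rightarrow> ('i \<Rightarrow> complex) set \<Rightarrow> ('i \<Rightarrow> complex) \<Rightarrow> 'i \<Rightarrow> complex" where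
  "orth_proj X W u = (SOME p. p \<in> W \<and> (\<forall>b\<in>W. ip X (u - p) b = 0))"

locale fun_subspace =
  fixes X :: "'i set" and W :: "('i \<Rightarrow> complex) set"
  assumes fin: "finite X" and sub: "cfun.subspace W" and supp: "W \<subseteq> funs_on X"
begin

lemma orth_proj: "orth_proj X W u \<in> W" "b \<in> W \<Longrightarrow> ip X (u - orth_proj X W u) b = 0"
proof -
  obtain B where B: "finite B" "B \<subseteq> W" "cfun.span B = W"
    using finite_dim_subspace[OF fin sub supp] by metis
  obtain p where p: "p \<in> cfun.span B" "\<forall>b\<in>B. ip X (u - p) b = 0"
    using orth_proj_span[OF B(1) fin] B supp by blast
  have "ip X (u - p) b = 0" if "b \<in> cfun.span B" for b
    using orth_span[OF p(2) that] .
  then have "\<exists>p. p \<in> W \<and> (\<forall>b\<in>W. ip X (u - p) b = 0)"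
    using p B by auto
  from someI_ex[OF this]
  show "orth_proj X W u \<in> W" "b \<in> W \<Longrightarrow> ip X (u - orth_proj X W u) b = 0"
    by (auto simp: orth_proj_def)
qed

lemma orth_zero: "u \<in> W \<Longrightarrow> (\<And>b. b \<in> W \<Longrightarrow> ip X u b = 0) \<Longrightarrow> u = 0"
  using ip_self_eq_0[OF fin, of u] supp by auto

lemma orth_projI:
  assumes "p \<in> W" "\<And>b. b \<in> W \<Longrightarrow> ip X (u - p) b = 0"
  shows "orth_proj X W u = p"
proof -
  have "orth_proj X W u - p = 0"
  proof (rule orth_zero)
    show "orth_proj X W u - p \<in> W"
      using orth_proj assms cfun.subspace_diff[OF sub] by auto
    fix b assume "b \<in> W"
    then show "ip X (orth_proj X W u - p) b = 0"
      using assms(2)[of b] orth_proj(2)[of b u] by (simp add: ip_diff_left)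
  qed
  then show ?thesis by simp
qed

lemma orth_proj_id: "u \<in> W \<Longrightarrow> orth_proj X W u = u"
  by (rule orth_projI) auto

lemma orth_proj_add: "orth_proj X W (u + v) = orth_proj X W u + orth_proj X W v"
proof (rule orth_projI)
  show "orth_proj X W u + orth_proj X W v \<in> W"
    by (intro subspace_add[OF sub] orth_proj)
  fix b assume "b \<in> W"
  then show "ip X (u + v - (orth_proj X W u + orth_proj X W v)) b = 0"
    using orth_proj(2)[of b u] orth_proj(2)[of b v]
    unfolding ip_diff_left ip_add_left by (simp add: algebra_simps)
qed

lemma orth_proj_smult: "orth_proj X W (\<lambda>i. c * u i) = (\<lambda>i. c * orth_proj X W u i)"
proof (rule orth_projI)
  show "(\<lambda>i. c * orth_proj X W u i) \<in> W"
    by (intro subspace_smult[OF sub] orth_proj)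
  fix b assume "b \<in> W"
  moreover have "(\<lambda>i. c * u i) - (\<lambda>i. c * orth_proj X W u i) = (\<lambda>i. c * (u - orth_proj X W u) i)"
    by (auto simp: algebra_simps)
  ultimately show "ip X ((\<lambda>i. c * u i) - (\<lambda>i. c * orth_proj X W u i)) b = 0"
    using orth_proj(2) by (simp only: ip_smult_left) simp
qed

lemma orth_proj_zero: "(\<And>b. b \<in> W \<Longrightarrow> ip X u b = 0) \<Longrightarrow> orth_proj X W u = 0"
  by (rule orth_projI) (auto simp: cfun.subspace_0[OF sub])

lemma orth_proj_sum: "orth_proj X W (\<Sum>a\<in>A. u a) = (\<Sum>a\<in>A. orth_proj X W (u a))"
proof (induction A rule: infinite_finite_induct)
  case (insert a A)
  show ?case by (simp only: sum.insert[OF insert(1,2)] orth_proj_add insert.IH)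
qed (simp_all only: sum.infinite sum.empty not_False_eq_True orth_proj_id[OF cfun.subspace_0[OF sub]])

text \<open>An operator whose adjoint preserves \<open>W\<close> preserves the orthogonal complement of \<open>W\<close>.\<close>

lemma orth_proj_commute:
  assumes "\<And>v. v \<in> W \<Longrightarrow> D v \<in> W" "\<And>v. v \<in> W \<Longrightarrow> D' v \<in> W"
    and "D (u - orth_proj X W u) = D u - D (orth_proj X W u)"
    and "\<And>v. v \<in> W \<Longrightarrow> ip X (D (u - orth_proj X W u)) v = ip X (u - orth_proj X W u) (D' v)"
  shows "orth_proj X W (D u) = D (orth_proj X W u)"
proof (rule orth_projI)
  show "D (orth_proj X W u) \<in> W"
    by (intro assms orth_proj)
  fix b assume b: "b \<in> W"
  show "ip X (D u - D (orth_proj X W u)) b = 0"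
    unfolding assms(3)[symmetric] assms(4)[OF b] by (intro orth_proj assms b)
qed

end

section \<open>Highest weight theory of the general linear Lie algebra\<close>

subsection \<open>Elementary matrices\<close>

lemma elem_mat_carrier [simp, intro]: "elem_mat r p q \<in> carrier_mat r r"
  by (simp add: elem_mat_def)

lemma elem_mat_index [simp]:
  "i < r \<Longrightarrow> j < r \<Longrightarrow> elem_mat r p q $$ (i, j) = (if i = p \<and> j = q then 1 else 0)"
  by (simp add: elem_mat_def)

lemma mat_induct_elem [consumes 1, case_names zero elem add smult]:
  assumes g: "g \<in> carrier_mat r r" and z: "P (0\<^sub>m r r)"
    and e: "\<And>p q. p < r \<Longrightarrow> q < r \<Longrightarrow> P (elem_mat r p q)"
    and a: "\<And>a b. a \<in> carrier_mat r r \<Longrightarrow> b \<in> carrier_mat r r \<Longrightarrow> P a \<Longrightarrow> P b \<Longrightarrow> P (a + b)"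
    and s: "\<And>a c. a \<in> carrier_mat r r \<Longrightarrow> P a \<Longrightarrow> P (c \<cdot>\<^sub>m a)"
  shows "P g"
proof -
  (* the entries of g are switched on one by one, in reading order *)
  define T where "T k = mat r r (\<lambda>(i, j). if i * r + j < k then g $$ (i, j) else 0)" for k
  have T: "T k \<in> carrier_mat r r" for k by (simp add: T_def)
  have "P (T k)" if "k \<le> r * r" for k
    using that
  proof (induction k)
    case 0
    have "T 0 = 0\<^sub>m r r" by (rule eq_matI) (auto simp: T_def)
    then show ?case using z by simp
  next
    case (Suc k)
    then have k: "k < r * r" by simp
    then have r: "r > 0" by (cases r) auto
    have kr: "k div r < r" "k mod r < r"
      using k r by (simp_all add: less_mult_imp_div_less)
    have eq: "i * r + j < Suc k \<longleftrightarrow> i * r + j < k \<or> i = k div r \<and> j = k mod r" if "j < r" for i j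
    proof -
      have "i * r + j = k \<longleftrightarrow> i = k div r \<and> j = k mod r"
        using that r by (metis Euclidean_Rings.div_eq_0_iff add.commute add.right_neutral div_mult_mod_eq
            div_mult_self1 less_nat_zero_code mod_less mod_mult_self1 not_gr0)
      then show ?thesis by auto
    qed
    have "T (Suc k) = T k + (g $$ (k div r, k mod r)) \<cdot>\<^sub>m elem_mat r (k div r) (k mod r)"
      by (rule eq_matI) (auto simp: T_def eq elem_mat_def)
    then show ?case
      using a[OF T _ _ s[OF _ e]] kr Suc by auto
  qed
  then have "P (T (r * r))" by simp
  moreover have "T (r * r) = g"
  proof (rule eq_matI)
    show "dim_row (T (r * r)) = dim_row g" "dim_col (T (r * r)) = dim_col g"
      using g by (auto simp: T_def)
    fix i j assume "i < dim_row g" "j < dim_col g"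
    then have ij: "i < r" "j < r" using g by auto
    then have "Suc i * r \<le> r * r" by (intro mult_le_mono1) simp
    then have "i * r + j < r * r" using ij by simp
    then show "T (r * r) $$ (i, j) = g $$ (i, j)"
      using ij by (simp add: T_def)
  qed
  ultimately show ?thesis by simp
qed

lemma elem_mat_mult:
  assumes "p < r" "q < r" "a < r" "b < r"
  shows "elem_mat r p q * elem_mat r a b = (if q = a then elem_mat r p b else 0\<^sub>m r r)"
proof (rule eq_matI)
  fix i j
  assume "i < dim_row (if q = a then elem_mat r p b else 0\<^sub>m r r)"
    "j < dim_col (if q = a then elem_mat r p b else 0\<^sub>m r r)"
  then have ij: "i < r" "j < r" by (auto simp: elem_mat_def split: if_splits)
  have "(elem_mat r p q * elem_mat r a b) $$ (i, j)
      = (\<Sum>k<r. (if i = p \<and> k = q then 1 else 0) * (if k = a \<and> j = b then 1 else 0))"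
    using ij by (auto simp: elem_mat_def scalar_prod_def atLeast0LessThan)
  also have "\<dots> = (\<Sum>k<r. if k = q then (if i = p \<and> q = a \<and> j = b then 1 else 0) else 0)"
    by (intro sum.cong) auto
  finally show "(elem_mat r p q * elem_mat r a b) $$ (i, j)
      = (if q = a then elem_mat r p b else 0\<^sub>m r r) $$ (i, j)"
    using ij assms by (simp add: sum.delta elem_mat_def)
qed (auto simp: elem_mat_def)

text \<open>For \<open>k = r\<close> the eigenvalues measure how far a vector has been lowered, since \<open>E\<^sub>p\<^sub>q\<close>
  changes them by \<open>q - p\<close>. The smaller \<open>k\<close> serve to build the matrix up from the \<open>E\<^sub>p\<^sub>p\<close>.\<close>

definition height_mat :: "nat \<Rightarrow> nat \<Rightarrow> complex mat" where
  "height_mat r k = mat r r (\<lambda>(i, j). if i = j \<and> i < k then - of_nat i else 0)"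

lemma height_mat_carrier [simp, intro]: "height_mat r k \<in> carrier_mat r r"
  by (simp add: height_mat_def)

lemma height_mat_Suc:
  "height_mat r (Suc k) = height_mat r k + (- of_nat k) \<cdot>\<^sub>m elem_mat r k k"
  by (rule eq_matI) (auto simp: height_mat_def elem_mat_def)

lemma height_mat_0: "height_mat r 0 = 0\<^sub>m r r"
  by (rule eq_matI) (auto simp: height_mat_def)

lemma height_mat_bracket:
  assumes "p < r" "q < r"
  shows "height_mat r r * elem_mat r p q - elem_mat r p q * height_mat r r
    = (of_nat q - of_nat p) \<cdot>\<^sub>m elem_mat r p q"
proof (rule eq_matI)
  fix i j
  assume "i < dim_row ((of_nat q - of_nat p) \<cdot>\<^sub>m elem_mat r p q :: complex mat)"
    "j < dim_col ((of_nat q - of_nat p) \<cdot>\<^sub>m elem_mat r p q :: complex mat)"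
  then have ij: "i < r" "j < r" by (auto simp: elem_mat_def)
  have "(height_mat r r * elem_mat r p q) $$ (i, j) = (\<Sum>k<r. (if i = k then - of_nat i else 0) * (if k = p \<and> j = q then 1 else 0))"
    using ij by (auto simp: height_mat_def elem_mat_def scalar_prod_def atLeast0LessThan intro!: sum.cong)
  also have "\<dots> = (if i = p \<and> j = q then - of_nat i else 0)"
  proof -
    have "(\<Sum>k<r. (if i = k then - of_nat i else 0) * (if k = p \<and> j = q then 1 else 0))
      = (\<Sum>k<r. if k = i then (if i = p \<and> j = q then - of_nat i else 0) else (0::complex))"
      by (intro sum.cong) auto
    then show ?thesis using ij by (simp add: sum.delta)
  qed
  finally have 1: "(height_mat r r * elem_mat r p q) $$ (i, j) = (if i = p \<and> j = q then - of_nat i else 0)" .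
  have "(elem_mat r p q * height_mat r r) $$ (i, j) = (\<Sum>k<r. (if i = p \<and> k = q then 1 else 0) * (if k = j then - of_nat k else 0))"
    using ij by (auto simp: height_mat_def elem_mat_def scalar_prod_def atLeast0LessThan intro!: sum.cong)
  also have "\<dots> = (if i = p \<and> j = q then - of_nat j else 0)"
  proof -
    have "(\<Sum>k<r. (if i = p \<and> k = q then 1 else 0) * (if k = j then - of_nat k else 0))
      = (\<Sum>k<r. if k = j then (if i = p \<and> j = q then - of_nat j else 0) else (0::complex))"
      by (intro sum.cong) auto
    then show ?thesis using ij by (simp add: sum.delta)
  qed
  finally show "(height_mat r r * elem_mat r p q - elem_mat r p q * height_mat r r) $$ (i, j)
     = ((of_nat q - of_nat p) \<cdot>\<^sub>m elem_mat r p q) $$ (i, j)"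
    using 1 ij by (auto simp: height_mat_def elem_mat_def)
qed (auto simp: height_mat_def elem_mat_def)

subsection \<open>Generalities on modules\<close>

lemma complex_ring_simps [simp]:
  "carrier complex_ring = UNIV" "add complex_ring = (+)" "mult complex_ring = (*)"
  "zero complex_ring = 0" "one complex_ring = 1"
  by (simp_all add: complex_ring_def)

lemma cring_complex_ring: "cring complex_ring"
proof (rule cringI)
  show "abelian_group complex_ring"
    by (rule abelian_groupI) (auto simp: algebra_simps intro: exI[of _ "- _"])
  show "comm_monoid complex_ring"
    by (rule comm_monoidI) (auto simp: algebra_simps)
qed (simp add: algebra_simps)

context gl_rep
begin

lemma neg_smult: "x \<in> carrier M \<Longrightarrow> \<ominus> x = (-1) \<odot> x"
proof -
  assume x: "x \<in> carrier M"
  have "(-1) \<odot> x \<oplus> x = ((-1) + 1) \<odot> x"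
    using smult_l_distr[of "-1" 1 x] smult_one[OF x] x by simp
  also have "\<dots> = \<zero>" using smult_l_null[OF x] by simp
  finally show ?thesis
    using x by (intro M.minus_equality) auto
qed

lemma minus_smult: "x \<in> carrier M \<Longrightarrow> y \<in> carrier M \<Longrightarrow> x \<ominus> y = x \<oplus> (-1) \<odot> y"
  by (simp add: M.minus_eq neg_smult)

lemma smult_smult: "x \<in> carrier M \<Longrightarrow> a \<odot> (b \<odot> x) = (a * b) \<odot> x"
  using smult_assoc1[of a b x] by simp

lemma smult_add_left: "x \<in> carrier M \<Longrightarrow> (a + b) \<odot> x = a \<odot> x \<oplus> b \<odot> x"
  using smult_l_distr[of a b x] by simp

lemma smult_add_right: "x \<in> carrier M \<Longrightarrow> y \<in> carrier M \<Longrightarrow> a \<odot> (x \<oplus> y) = a \<odot> x \<oplus> a \<odot> y"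
  using smult_r_distr[of a x y] by simp

lemma smult_0 [simp]: "x \<in> carrier M \<Longrightarrow> 0 \<odot> x = \<zero>"
  using smult_l_null[of x] by simp

lemma smult_1 [simp]: "x \<in> carrier M \<Longrightarrow> 1 \<odot> x = x"
  using smult_one[of x] by simp

lemma smult_zero [simp]: "a \<odot> \<zero> = \<zero>"
  using smult_r_null[of a] by simp

lemma smult_in [simp, intro]: "x \<in> carrier M \<Longrightarrow> a \<odot> x \<in> carrier M"
  using smult_closed[of a x] by simp

lemma smult_eq_0: "x \<in> carrier M \<Longrightarrow> a \<odot> x = \<zero> \<Longrightarrow> a \<noteq> 0 \<Longrightarrow> x = \<zero>"
proof -
  assume x: "x \<in> carrier M" and "a \<odot> x = \<zero>" "a \<noteq> 0"
  then have "inverse a \<odot> (a \<odot> x) = \<zero>" by simp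
  then show "x = \<zero>" using x \<open>a \<noteq> 0\<close> by (simp add: smult_smult)
qed

lemma act_zero_mat: "v \<in> carrier M \<Longrightarrow> act M (0\<^sub>m r r) v = \<zero>"
proof -
  assume v: "v \<in> carrier M"
  have "0\<^sub>m r r = (0::complex) \<cdot>\<^sub>m (0\<^sub>m r r)" by (rule eq_matI) auto
  then show ?thesis
    using smult_act[of "0\<^sub>m r r" v 0] act_closed[of "0\<^sub>m r r" v] v by simp
qed

lemma act_zero [simp]: "g \<in> carrier_mat r r \<Longrightarrow> act M g \<zero> = \<zero>"
  using act_smult[of g \<zero> 0] act_closed[of g \<zero>] by simp

lemma act_diff_mat:
  assumes "g \<in> carrier_mat r r" "h \<in> carrier_mat r r" "v \<in> carrier M"
  shows "act M (g - h) v = act M g v \<ominus> act M h v"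
proof -
  have "g - h = g + (-1) \<cdot>\<^sub>m h"
    by (rule eq_matI) (use assms in auto)
  then show ?thesis
    using assms by (simp add: add_act smult_act act_closed minus_smult)
qed

lemma minus_eq_zeroD: "x \<in> carrier M \<Longrightarrow> y \<in> carrier M \<Longrightarrow> x \<ominus> y = \<zero> \<Longrightarrow> x = y"
  using M.minus_equality[of x "\<ominus> y"] by (simp add: M.minus_eq)

lemma act_commute:
  assumes "g \<in> carrier_mat r r" "h \<in> carrier_mat r r" "v \<in> carrier M"
  shows "act M g (act M h v) = act M (g * h - h * g) v \<oplus> act M h (act M g v)"
proof -
  have c: "act M g (act M h v) \<in> carrier M" "act M h (act M g v) \<in> carrier M"
    using assms act_closed by auto
  then show ?thesis
    unfolding bracket_act[OF assms] M.minus_eq using M.a_assoc M.l_neg by auto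
qed

lemma stable_subspaceI:
  assumes "S \<subseteq> carrier M" "\<zero> \<in> S" "\<And>x y. x \<in> S \<Longrightarrow> y \<in> S \<Longrightarrow> x \<oplus> y \<in> S"
    and "\<And>c x. x \<in> S \<Longrightarrow> c \<odot> x \<in> S"
  shows "submodule S complex_ring M"
  by (rule submoduleI) (use assms in \<open>auto simp: neg_smult subset_iff\<close>)

lemma stable_under_gl:
  assumes "S \<subseteq> carrier M" "\<zero> \<in> S" "\<And>x y. x \<in> S \<Longrightarrow> y \<in> S \<Longrightarrow> x \<oplus> y \<in> S"
    and "\<And>c x. x \<in> S \<Longrightarrow> c \<odot> x \<in> S"
    and "\<And>p q x. p < r \<Longrightarrow> q < r \<Longrightarrow> x \<in> S \<Longrightarrow> act M (elem_mat r p q) x \<in> S"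
    and "g \<in> carrier_mat r r" "x \<in> S"
  shows "act M g x \<in> S"
  using assms(6)
proof (induction rule: mat_induct_elem)
  case zero
  then show ?case using act_zero_mat assms by (auto simp: subset_iff)
next
  case (add a b)
  then show ?case using add_act[of a b x] assms by auto
next
  case (smult a c)
  then show ?case using smult_act[of a x c] assms by auto
qed (use assms in auto)

end

subsection \<open>The submodule generated by a highest weight vector\<close>

locale hw_vector = gl_rep r M for r and M :: "(complex, 'v, complex mat) rep" (structure) +
  fixes v :: 'v and lam :: "nat \<Rightarrow> complex"
  assumes hw_in: "v \<in> carrier M"
    and hw_raise: "\<And>p q. p < q \<Longrightarrow> q < r \<Longrightarrow> act M (elem_mat r p q) v = \<zero>"
    and hw_weight: "\<And>p. p < r \<Longrightarrow> act M (elem_mat r p p) v = lam p \<odot> v"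
begin

text \<open>The second argument is the total height by which the lowering operators have brought \<open>v\<close>
  down.\<close>

inductive lowered :: "'v \<Rightarrow> nat \<Rightarrow> bool" where
  base: "lowered v 0"
| step: "lowered u k \<Longrightarrow> q < p \<Longrightarrow> p < r \<Longrightarrow> lowered (act M (elem_mat r p q) u) (k + (p - q))"

inductive_set hw_span :: "'v set" where
  mono: "lowered u k \<Longrightarrow> u \<in> hw_span"
| add: "x \<in> hw_span \<Longrightarrow> y \<in> hw_span \<Longrightarrow> x \<oplus> y \<in> hw_span"
| smult: "x \<in> hw_span \<Longrightarrow> c \<odot> x \<in> hw_span"

abbreviation "top_height \<equiv> - (\<Sum>p<r. of_nat p * lam p)"

lemma height_of_weight:
  assumes "u \<in> carrier M" "\<And>p. p < r \<Longrightarrow> act M (elem_mat r p p) u = lam p \<odot> u"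
  shows "act M (height_mat r r) u = top_height \<odot> u"
proof -
  have "act M (height_mat r k) u = (- (\<Sum>p<k. of_nat p * lam p)) \<odot> u" if "k \<le> r" for k
    using that
  proof (induction k)
    case 0
    then show ?case using assms by (simp add: height_mat_0 act_zero_mat)
  next
    case (Suc k)
    have "act M (height_mat r (Suc k)) u
        = act M (height_mat r k) u \<oplus> (- of_nat k) \<odot> act M (elem_mat r k k) u"
      unfolding height_mat_Suc using assms by (simp add: add_act smult_act)
    then show ?case
      using assms Suc by (simp add: smult_smult flip: smult_add_left)
  qed
  then show ?thesis by simp
qed

lemma lowered_height:
  "lowered u k \<Longrightarrow> u \<in> carrier M \<and> act M (height_mat r r) u = (top_height - of_nat k) \<odot> u"
proof (induction rule: lowered.induct)
  case base
  then show ?case using height_of_weight[OF hw_in hw_weight] hw_in by simp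
next
  case (step u k q p)
  let ?E = "elem_mat r p q"
  have c: "act M ?E u \<in> carrier M" using step act_closed by auto
  have "act M (height_mat r r) (act M ?E u)
      = (of_nat q - of_nat p) \<odot> act M ?E u \<oplus> act M ?E (act M (height_mat r r) u)"
    using act_commute[of "height_mat r r" ?E u] height_mat_bracket[of p r q] step
    by (simp add: smult_act)
  also have "\<dots> = ((of_nat q - of_nat p) + (top_height - of_nat k)) \<odot> act M ?E u"
    using step c by (simp add: act_smult smult_add_left)
  also have "(of_nat q - of_nat p) + (top_height - of_nat k) = top_height - of_nat (k + (p - q))"
    using step by (simp add: of_nat_diff)
  finally show ?case using c by simp
qed

lemma hw_span_in: "u \<in> hw_span \<Longrightarrow> u \<in> carrier M"
  by (induction rule: hw_span.induct) (use lowered_height in auto)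

lemma hw_in_span: "v \<in> hw_span"
  by (rule hw_span.mono) (rule lowered.base)

lemma hw_span_zero: "\<zero> \<in> hw_span"
  using hw_span.smult[OF hw_in_span, of 0] hw_in by simp

lemma hw_span_lower:
  "u \<in> hw_span \<Longrightarrow> q < p \<Longrightarrow> p < r \<Longrightarrow> act M (elem_mat r p q) u \<in> hw_span"
proof (induction rule: hw_span.induct)
  case (mono u k)
  then show ?case by (auto intro: hw_span.mono lowered.step)
next
  case (add x y)
  then show ?case using act_add[of "elem_mat r p q" x y] hw_span_in by (auto intro: hw_span.add)
next
  case (smult x c)
  then show ?case using act_smult[of "elem_mat r p q" x c] hw_span_in by (auto intro: hw_span.smult)
qed

text \<open>A raising operator is commuted to the right past the lowering operators until it kills
  the highest weight vector; each commutator shortens the product.\<close>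

lemma lowered_elem:
  "lowered u k \<Longrightarrow> p < r \<Longrightarrow> q < r \<Longrightarrow> act M (elem_mat r p q) u \<in> hw_span"
proof (induction arbitrary: p q rule: lowered.induct)
  case base
  consider "p < q" | "p = q" | "q < p" by linarith
  then show ?case
  proof cases
    case 1
    then show ?thesis using hw_raise base hw_span_zero by simp
  next
    case 2
    then show ?thesis using hw_weight base hw_span.smult[OF hw_in_span] by simp
  next
    case 3
    then show ?thesis using hw_span_lower[OF hw_in_span] base by simp
  qed
next
  case (step u k b a)
  let ?E = "elem_mat r p q" and ?F = "elem_mat r a b"
  have u: "u \<in> carrier M" using step lowered_height by auto
  have br: "?E * ?F = (if q = a then elem_mat r p b else 0\<^sub>m r r)"
    "?F * ?E = (if b = p then elem_mat r a q else 0\<^sub>m r r)"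
    using step by (auto simp: elem_mat_mult)
  have "act M (?E * ?F) u \<in> hw_span" "act M (?F * ?E) u \<in> hw_span"
    unfolding br using step.IH step.prems step.hyps u by (auto simp: act_zero_mat hw_span_zero)
  then have "act M (?E * ?F - ?F * ?E) u \<in> hw_span"
    using u by (subst act_diff_mat)
      (auto intro!: mult_carrier_mat hw_span.add hw_span.smult simp: minus_smult hw_span_in)
  moreover have "act M ?F (act M ?E u) \<in> hw_span"
    by (rule hw_span_lower[OF step.IH[OF step.prems] step.hyps(2,3)])
  ultimately show ?case
    using act_commute[of ?E ?F u] u by (auto intro: hw_span.add)
qed

lemma hw_span_elem:
  "u \<in> hw_span \<Longrightarrow> p < r \<Longrightarrow> q < r \<Longrightarrow> act M (elem_mat r p q) u \<in> hw_span"
proof (induction rule: hw_span.induct)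
  case (mono u k)
  then show ?case using lowered_elem by auto
next
  case (add x y)
  then show ?case using act_add[of "elem_mat r p q" x y] hw_span_in by (auto intro: hw_span.add)
next
  case (smult x c)
  then show ?case using act_smult[of "elem_mat r p q" x c] hw_span_in by (auto intro: hw_span.smult)
qed

lemma hw_span_stable: "u \<in> hw_span \<Longrightarrow> g \<in> carrier_mat r r \<Longrightarrow> act M g u \<in> hw_span"
  by (rule stable_under_gl[of hw_span])
    (use hw_span_in hw_span_zero hw_span_elem in \<open>auto intro: hw_span.intros\<close>)

text \<open>The operator \<open>(H - \<kappa> + 1) \<dots> (H - \<kappa> + K)\<close>, where \<open>\<kappa>\<close> is the height of \<open>v\<close>. It kills whatever
  has been lowered by at least 1 and at most \<open>K\<close> steps, but acts on vectors of height
  \<open>\<kappa>\<close> as the nonzero number \<open>K!\<close>.\<close>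

primrec kill_lowered :: "nat \<Rightarrow> 'v \<Rightarrow> 'v" where
  "kill_lowered 0 x = x"
| "kill_lowered (Suc K) x = act M (height_mat r r) (kill_lowered K x)
     \<oplus> (of_nat (Suc K) - top_height) \<odot> kill_lowered K x"

lemma kill_lowered_in: "x \<in> carrier M \<Longrightarrow> kill_lowered K x \<in> carrier M"
  by (induction K) (auto simp: act_closed)

lemma kill_lowered_add:
  "x \<in> carrier M \<Longrightarrow> y \<in> carrier M \<Longrightarrow> kill_lowered K (x \<oplus> y) = kill_lowered K x \<oplus> kill_lowered K y"
  by (induction K)
    (auto simp: act_add kill_lowered_in smult_add_right act_closed M.a_ac M.a_assoc)

lemma kill_lowered_smult:
  "x \<in> carrier M \<Longrightarrow> kill_lowered K (c \<odot> x) = c \<odot> kill_lowered K x"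
  by (induction K)
    (auto simp: act_smult kill_lowered_in smult_add_right act_closed smult_smult mult.commute)

lemma kill_lowered_eigen:
  assumes "x \<in> carrier M" "act M (height_mat r r) x = \<mu> \<odot> x"
  shows "kill_lowered K x = (\<Prod>j=1..K. \<mu> - top_height + of_nat j) \<odot> x"
proof (induction K)
  case (Suc K)
  let ?P = "\<Prod>j=1..K. \<mu> - top_height + of_nat j"
  have "kill_lowered (Suc K) x
      = (?P * \<mu> + (of_nat (Suc K) - top_height) * ?P) \<odot> x"
    using assms Suc by (simp add: act_smult smult_smult smult_add_left)
  also have "?P * \<mu> + (of_nat (Suc K) - top_height) * ?P = (\<Prod>j=1..Suc K. \<mu> - top_height + of_nat j)"
    by (simp add: algebra_simps)
  finally show ?case .
qed (use assms in simp)

lemma kill_lowered_mono: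
  assumes "kill_lowered K x = \<zero>" "K \<le> K'"
  shows "kill_lowered K' x = \<zero>"
  using assms(2) by (induction rule: dec_induct) (auto simp: assms(1))

lemma hw_span_decomp:
  "u \<in> hw_span \<Longrightarrow> \<exists>c K x. x \<in> carrier M \<and> u = c \<odot> v \<oplus> x \<and> kill_lowered K x = \<zero>"
proof (induction rule: hw_span.induct)
  case (mono u k)
  show ?case
  proof (cases "k = 0")
    case True
    from mono True have "u = v"
      by (cases rule: lowered.cases) auto
    then show ?thesis
      using hw_in by (intro exI[of _ 1] exI[of _ 0] exI[of _ \<zero>]) auto
  next
    case False
    have u: "u \<in> carrier M" using lowered_height[OF mono] by simp
    have "kill_lowered k u = (\<Prod>j=1..k. of_nat j - of_nat k) \<odot> u"
      using kill_lowered_eigen[of u "top_height - of_nat k" k] lowered_height[OF mono]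
      by (simp add: algebra_simps)
    also have "(\<Prod>j=1..k. of_nat j - of_nat k) = (0::complex)"
      using False by (intro prod_zero) (auto intro: bexI[of _ k])
    finally have "kill_lowered k u = \<zero>" using u by simp
    then show ?thesis
      using u hw_in by (intro exI[of _ 0] exI[of _ k] exI[of _ u]) auto
  qed
next
  case (add x y)
  then obtain c K a d L b where
    x: "a \<in> carrier M" "x = c \<odot> v \<oplus> a" "kill_lowered K a = \<zero>" and
    y: "b \<in> carrier M" "y = d \<odot> v \<oplus> b" "kill_lowered L b = \<zero>"
    by blast
  have "x \<oplus> y = (c + d) \<odot> v \<oplus> (a \<oplus> b)"
    using x y hw_in by (simp add: smult_add_left M.a_ac)
  moreover have "kill_lowered (max K L) (a \<oplus> b) = \<zero>"
    using x y kill_lowered_mono[of K a "max K L"] kill_lowered_mono[of L b "max K L"]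
    by (simp add: kill_lowered_add)
  ultimately show ?case using x y by blast
next
  case (smult x c)
  then obtain d K a where
    x: "a \<in> carrier M" "x = d \<odot> v \<oplus> a" "kill_lowered K a = \<zero>"
    by blast
  have "c \<odot> x = (c * d) \<odot> v \<oplus> c \<odot> a"
    using x hw_in by (simp add: smult_add_right smult_smult)
  moreover have "kill_lowered K (c \<odot> a) = \<zero>"
    using x by (simp add: kill_lowered_smult)
  ultimately show ?case using x by blast
qed

text \<open>Such a \<open>u\<close> has the height of \<open>v\<close>, hence so has the remainder \<open>x\<close> of \<open>hw_span_decomp\<close>. Then
  \<^const>\<open>kill_lowered\<close> acts on \<open>x\<close> both as 0 and as a nonzero number, and \<open>x\<close> is 0.\<close>

lemma hw_span_weight:
  assumes u: "u \<in> hw_span" and w: "\<And>p. p < r \<Longrightarrow> act M (elem_mat r p p) u = lam p \<odot> u"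
  obtains c where "u = c \<odot> v"
proof -
  obtain c K x where x: "x \<in> carrier M" "u = c \<odot> v \<oplus> x" "kill_lowered K x = \<zero>"
    using hw_span_decomp[OF u] by auto
  have hw: "act M (height_mat r r) v = top_height \<odot> v"
    by (rule height_of_weight[OF hw_in hw_weight])
  have hu: "act M (height_mat r r) u = top_height \<odot> u"
    by (rule height_of_weight[OF hw_span_in[OF u] w])
  have "act M (height_mat r r) u = top_height \<odot> (c \<odot> v) \<oplus> act M (height_mat r r) x"
    using x hw_in hw by (simp add: act_add act_smult smult_smult mult.commute)
  moreover have "top_height \<odot> u = top_height \<odot> (c \<odot> v) \<oplus> top_height \<odot> x"
    using x hw_in by (simp add: smult_add_right)
  ultimately have "act M (height_mat r r) x = top_height \<odot> x"
    using hu x hw_in act_closed[of "height_mat r r" x]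
      M.r_neg1[of "top_height \<odot> (c \<odot> v)" "act M (height_mat r r) x"]
      M.r_neg1[of "top_height \<odot> (c \<odot> v)" "top_height \<odot> x"]
    by simp
  then have "kill_lowered K x = (\<Prod>j=1..K. of_nat j) \<odot> x"
    using kill_lowered_eigen[of x top_height K] x by simp
  then have "x = \<zero>"
    using x smult_eq_0[of x "\<Prod>j=1..K. of_nat j"] by simp
  then show ?thesis using x hw_in that[of c] by simp
qed

end

subsection \<open>Uniqueness of irreducible modules with a given highest weight\<close>

definition prod_rep ::
  "(complex, 'v, 'g) rep \<Rightarrow> (complex, 'w, 'g) rep \<Rightarrow> (complex, 'v \<times> 'w, 'g) rep" where
  "prod_rep M M' = \<lparr>carrier = carrier M \<times> carrier M', mult = undefined, one = undefined,
     zero = (\<zero>\<^bsub>M\<^esub>, \<zero>\<^bsub>M'\<^esub>), add = (\<lambda>x y. (fst x \<oplus>\<^bsub>M\<^esub> fst y, snd x \<oplus>\<^bsub>M'\<^esub> snd y)),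
     smult = (\<lambda>c x. (c \<odot>\<^bsub>M\<^esub> fst x, c \<odot>\<^bsub>M'\<^esub> snd x)),
     act = (\<lambda>g x. (act M g (fst x), act M' g (snd x)))\<rparr>"

lemma prod_rep_simps [simp]:
  "carrier (prod_rep M M') = carrier M \<times> carrier M'"
  "zero (prod_rep M M') = (\<zero>\<^bsub>M\<^esub>, \<zero>\<^bsub>M'\<^esub>)"
  "add (prod_rep M M') x y = (fst x \<oplus>\<^bsub>M\<^esub> fst y, snd x \<oplus>\<^bsub>M'\<^esub> snd y)"
  "smult (prod_rep M M') c x = (c \<odot>\<^bsub>M\<^esub> fst x, c \<odot>\<^bsub>M'\<^esub> snd x)"
  "act (prod_rep M M') g x = (act M g (fst x), act M' g (snd x))"
  by (simp_all add: prod_rep_def)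

lemma gl_rep_prod_rep:
  assumes "gl_rep r M" "gl_rep r M'"
  shows "gl_rep r (prod_rep M M')"
proof -
  interpret A: gl_rep r M by fact
  interpret B: gl_rep r M' by fact
  have ag: "abelian_group (prod_rep M M')"
  proof (rule abelian_groupI)
    fix x assume "x \<in> carrier (prod_rep M M')"
    then show "\<exists>y\<in>carrier (prod_rep M M'). y \<oplus>\<^bsub>prod_rep M M'\<^esub> x = \<zero>\<^bsub>prod_rep M M'\<^esub>"
      by (intro bexI[of _ "(\<ominus>\<^bsub>M\<^esub> fst x, \<ominus>\<^bsub>M'\<^esub> snd x)"]) (auto simp: A.M.l_neg B.M.l_neg)
  qed (auto simp: A.M.a_ac B.M.a_ac)
  have m: "module complex_ring (prod_rep M M')"
    by (rule moduleI[OF cring_complex_ring ag])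
      (auto simp: A.smult_add_left B.smult_add_left A.smult_add_right B.smult_add_right
        A.smult_smult B.smult_smult)
  interpret P: abelian_group "prod_rep M M'" by fact
  have neg: "\<ominus>\<^bsub>prod_rep M M'\<^esub> x = (\<ominus>\<^bsub>M\<^esub> fst x, \<ominus>\<^bsub>M'\<^esub> snd x)" if "x \<in> carrier (prod_rep M M')" for x
    using that by (intro P.minus_equality) (auto simp: A.M.l_neg B.M.l_neg)
  have minus: "x \<ominus>\<^bsub>prod_rep M M'\<^esub> y = (fst x \<ominus>\<^bsub>M\<^esub> fst y, snd x \<ominus>\<^bsub>M'\<^esub> snd y)"
    if "y \<in> carrier (prod_rep M M')" for x y
    unfolding P.minus_eq neg[OF that] by (simp add: A.M.minus_eq B.M.minus_eq)
  show ?thesis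
  proof (rule gl_rep.intro[OF m], unfold_locales)
    fix g h :: "complex mat" and x
    assume "g \<in> carrier_mat r r" "h \<in> carrier_mat r r" "x \<in> carrier (prod_rep M M')"
    then show "act (prod_rep M M') (g * h - h * g) x = act (prod_rep M M') g (act (prod_rep M M') h x)
        \<ominus>\<^bsub>prod_rep M M'\<^esub> act (prod_rep M M') h (act (prod_rep M M') g x)"
      by (subst minus) (auto simp: A.bracket_act B.bracket_act A.act_closed B.act_closed)
  qed (auto simp: A.act_closed B.act_closed A.act_add B.act_add A.act_smult B.act_smult
      A.add_act B.add_act A.smult_act B.smult_act)
qed

lemma rep_isoI:
  assumes "bij_betw h (carrier M) (carrier M')"
    and "\<And>v w. v \<in> carrier M \<Longrightarrow> w \<in> carrier M \<Longrightarrow> h (v \<oplus>\<^bsub>M\<^esub> w) = h v \<oplus>\<^bsub>M'\<^esub> h w"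
    and "\<And>c v. v \<in> carrier M \<Longrightarrow> h (c \<odot>\<^bsub>M\<^esub> v) = c \<odot>\<^bsub>M'\<^esub> h v"
    and "\<And>g v. g \<in> G \<Longrightarrow> v \<in> carrier M \<Longrightarrow> h (act M g v) = act M' g (h v)"
  shows "rep_iso G M M'"
  unfolding rep_iso_def using assms by blast

text \<open>The submodule of \<open>M \<oplus> M'\<close> generated by the pair of highest weight vectors is the graph of
  an isomorphism: it meets \<open>0 \<oplus> M'\<close> and \<open>M \<oplus> 0\<close> in proper submodules, because its vectors
  of highest weight are the multiples of that pair.\<close>

theorem irreducible_hw_unique:
  assumes irr: "gl_irreducible r M" "gl_irreducible r M'"
    and hw: "has_highest_weight r \<eta> M" "has_highest_weight r \<eta> M'"
  shows "rep_iso (carrier_mat r r) M M'"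
proof -
  interpret A: gl_rep r M using irr by (simp add: gl_irreducible_def)
  interpret B: gl_rep r M' using irr by (simp add: gl_irreducible_def)
  define lam :: "nat \<Rightarrow> complex" where "lam p = of_nat (if p < length \<eta> then \<eta> ! p else 0)" for p
  obtain v where v: "v \<in> carrier M" "v \<noteq> \<zero>\<^bsub>M\<^esub>"
    "\<And>p q. p < q \<Longrightarrow> q < r \<Longrightarrow> act M (elem_mat r p q) v = \<zero>\<^bsub>M\<^esub>"
    "\<And>p. p < r \<Longrightarrow> act M (elem_mat r p p) v = lam p \<odot>\<^bsub>M\<^esub> v"
    using hw(1) unfolding has_highest_weight_def lam_def by metis
  obtain v' where v': "v' \<in> carrier M'" "v' \<noteq> \<zero>\<^bsub>M'\<^esub>"
    "\<And>p q. p < q \<Longrightarrow> q < r \<Longrightarrow> act M' (elem_mat r p q) v' = \<zero>\<^bsub>M'\<^esub>"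
    "\<And>p. p < r \<Longrightarrow> act M' (elem_mat r p p) v' = lam p \<odot>\<^bsub>M'\<^esub> v'"
    using hw(2) unfolding has_highest_weight_def lam_def by metis
  let ?P = "prod_rep M M'"
  interpret H: hw_vector r ?P "(v, v')" lam
    by (intro hw_vector.intro gl_rep_prod_rep A.gl_rep_axioms B.gl_rep_axioms hw_vector_axioms.intro)
      (use v v' in auto)
  let ?N = "H.hw_span"
  note N = H.hw_span.add H.hw_span.smult H.hw_span_stable H.hw_span_zero
  have N_add: "(x, y) \<in> ?N \<Longrightarrow> (x', y') \<in> ?N \<Longrightarrow> (x \<oplus>\<^bsub>M\<^esub> x', y \<oplus>\<^bsub>M'\<^esub> y') \<in> ?N" for x y x' y'
    using N(1)[of "(x, y)" "(x', y')"] by simp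
  have N_smult: "(x, y) \<in> ?N \<Longrightarrow> (c \<odot>\<^bsub>M\<^esub> x, c \<odot>\<^bsub>M'\<^esub> y) \<in> ?N" for c x y
    using N(2)[of "(x, y)" c] by simp
  have N_act: "(x, y) \<in> ?N \<Longrightarrow> g \<in> carrier_mat r r \<Longrightarrow> (act M g x, act M' g y) \<in> ?N" for g x y
    using N(3)[of "(x, y)" g] by simp
  have N_in: "(x, y) \<in> ?N \<Longrightarrow> x \<in> carrier M \<and> y \<in> carrier M'" for x y
    using H.hw_span_in[of "(x, y)"] by simp
  have N_zero: "(\<zero>\<^bsub>M\<^esub>, \<zero>\<^bsub>M'\<^esub>) \<in> ?N" using N(4) by simp
  have N_v: "(v, v') \<in> ?N" by (rule H.hw_in_span)
  have irrA: "S = {\<zero>\<^bsub>M\<^esub>} \<or> S = carrier M"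
    if "submodule S complex_ring M" "\<And>g x. g \<in> carrier_mat r r \<Longrightarrow> x \<in> S \<Longrightarrow> act M g x \<in> S" for S
    using irr(1) that unfolding gl_irreducible_def by blast
  have irrB: "S = {\<zero>\<^bsub>M'\<^esub>} \<or> S = carrier M'"
    if "submodule S complex_ring M'" "\<And>g x. g \<in> carrier_mat r r \<Longrightarrow> x \<in> S \<Longrightarrow> act M' g x \<in> S" for S
    using irr(2) that unfolding gl_irreducible_def by blast
  have fst_all: "{x. \<exists>y. (x, y) \<in> ?N} = carrier M"
  proof -
    let ?Y = "{x. \<exists>y. (x, y) \<in> ?N}"
    have "?Y = {\<zero>\<^bsub>M\<^esub>} \<or> ?Y = carrier M"
    proof (rule irrA)
      show "submodule ?Y complex_ring M"
      proof (rule A.stable_subspaceI)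
        show "?Y \<subseteq> carrier M" using N_in by blast
        show "\<zero>\<^bsub>M\<^esub> \<in> ?Y" using N_zero by blast
        show "x \<oplus>\<^bsub>M\<^esub> y \<in> ?Y" if "x \<in> ?Y" "y \<in> ?Y" for x y
          using that N_add by blast
        show "c \<odot>\<^bsub>M\<^esub> x \<in> ?Y" if "x \<in> ?Y" for c x
          using that N_smult by blast
      qed
      show "act M g x \<in> ?Y" if "g \<in> carrier_mat r r" "x \<in> ?Y" for g x
        using that N_act by blast
    qed
    then show ?thesis using N_v v by blast
  qed
  have snd_all: "{y. \<exists>x. (x, y) \<in> ?N} = carrier M'"
  proof -
    let ?Y = "{y. \<exists>x. (x, y) \<in> ?N}"
    have "?Y = {\<zero>\<^bsub>M'\<^esub>} \<or> ?Y = carrier M'"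
    proof (rule irrB)
      show "submodule ?Y complex_ring M'"
      proof (rule B.stable_subspaceI)
        show "?Y \<subseteq> carrier M'" using N_in by blast
        show "\<zero>\<^bsub>M'\<^esub> \<in> ?Y" using N_zero by blast
        show "x \<oplus>\<^bsub>M'\<^esub> y \<in> ?Y" if "x \<in> ?Y" "y \<in> ?Y" for x y
          using that N_add by blast
        show "c \<odot>\<^bsub>M'\<^esub> x \<in> ?Y" if "x \<in> ?Y" for c x
          using that N_smult by blast
      qed
      show "act M' g x \<in> ?Y" if "g \<in> carrier_mat r r" "x \<in> ?Y" for g x
        using that N_act by blast
    qed
    then show ?thesis using N_v v' by blast
  qed
  have kerB: "y = \<zero>\<^bsub>M'\<^esub>" if "(\<zero>\<^bsub>M\<^esub>, y) \<in> ?N" for y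
  proof -
    let ?Y = "{y. (\<zero>\<^bsub>M\<^esub>, y) \<in> ?N}"
    have "?Y = {\<zero>\<^bsub>M'\<^esub>} \<or> ?Y = carrier M'"
    proof (rule irrB)
      show "submodule ?Y complex_ring M'"
      proof (rule B.stable_subspaceI)
        show "x \<oplus>\<^bsub>M'\<^esub> y \<in> ?Y" if "x \<in> ?Y" "y \<in> ?Y" for x y
          using that N_add[of "\<zero>\<^bsub>M\<^esub>" x "\<zero>\<^bsub>M\<^esub>" y] by simp
        show "c \<odot>\<^bsub>M'\<^esub> x \<in> ?Y" if "x \<in> ?Y" for c x
          using that N_smult[of "\<zero>\<^bsub>M\<^esub>" x c] by simp
      qed (use N_in N_zero in auto)
      show "act M' g x \<in> ?Y" if "g \<in> carrier_mat r r" "x \<in> ?Y" for g x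
        using that N_act[of "\<zero>\<^bsub>M\<^esub>" x g] by simp
    qed
    moreover have "?Y \<noteq> carrier M'"
    proof
      assume "?Y = carrier M'"
      then have "(\<zero>\<^bsub>M\<^esub>, v') \<in> ?N" using v' by blast
      then obtain c where "(\<zero>\<^bsub>M\<^esub>, v') = c \<odot>\<^bsub>?P\<^esub> (v, v')"
        by (rule H.hw_span_weight) (use v' in auto)
      then have "\<zero>\<^bsub>M\<^esub> = c \<odot>\<^bsub>M\<^esub> v" "v' = c \<odot>\<^bsub>M'\<^esub> v'" by auto
      then have "c = 0" using A.smult_eq_0[of v c] v by auto
      then show False using \<open>v' = c \<odot>\<^bsub>M'\<^esub> v'\<close> v' by simp
    qed
    ultimately show ?thesis using that by blast
  qed
  have kerA: "x = \<zero>\<^bsub>M\<^esub>" if "(x, \<zero>\<^bsub>M'\<^esub>) \<in> ?N" for x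
  proof -
    let ?Y = "{x. (x, \<zero>\<^bsub>M'\<^esub>) \<in> ?N}"
    have "?Y = {\<zero>\<^bsub>M\<^esub>} \<or> ?Y = carrier M"
    proof (rule irrA)
      show "submodule ?Y complex_ring M"
      proof (rule A.stable_subspaceI)
        show "x \<oplus>\<^bsub>M\<^esub> y \<in> ?Y" if "x \<in> ?Y" "y \<in> ?Y" for x y
          using that N_add[of x "\<zero>\<^bsub>M'\<^esub>" y "\<zero>\<^bsub>M'\<^esub>"] by simp
        show "c \<odot>\<^bsub>M\<^esub> x \<in> ?Y" if "x \<in> ?Y" for c x
          using that N_smult[of x "\<zero>\<^bsub>M'\<^esub>" c] by simp
      qed (use N_in N_zero in auto)
      show "act M g x \<in> ?Y" if "g \<in> carrier_mat r r" "x \<in> ?Y" for g x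
        using that N_act[of x "\<zero>\<^bsub>M'\<^esub>" g] by simp
    qed
    moreover have "?Y \<noteq> carrier M"
    proof
      assume "?Y = carrier M"
      then have "(v, \<zero>\<^bsub>M'\<^esub>) \<in> ?N" using v by blast
      then obtain c where "(v, \<zero>\<^bsub>M'\<^esub>) = c \<odot>\<^bsub>?P\<^esub> (v, v')"
        by (rule H.hw_span_weight) (use v in auto)
      then have "\<zero>\<^bsub>M'\<^esub> = c \<odot>\<^bsub>M'\<^esub> v'" "v = c \<odot>\<^bsub>M\<^esub> v" by auto
      then have "c = 0" using B.smult_eq_0[of v' c] v' by auto
      then show False using \<open>v = c \<odot>\<^bsub>M\<^esub> v\<close> v by simp
    qed
    ultimately show ?thesis using that by blast
  qed
  have fun_N: "y = y'" if "(x, y) \<in> ?N" "(x, y') \<in> ?N" for x y y'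
  proof -
    have c: "x \<in> carrier M" "y \<in> carrier M'" "y' \<in> carrier M'" using N_in that by auto
    have "(x \<oplus>\<^bsub>M\<^esub> (-1) \<odot>\<^bsub>M\<^esub> x, y \<oplus>\<^bsub>M'\<^esub> (-1) \<odot>\<^bsub>M'\<^esub> y') \<in> ?N"
      using that by (intro N_add N_smult)
    then have "(\<zero>\<^bsub>M\<^esub>, y \<ominus>\<^bsub>M'\<^esub> y') \<in> ?N"
      using c by (simp add: A.minus_smult[symmetric] B.minus_smult[symmetric] A.M.minus_eq A.M.r_neg)
    then have "y \<ominus>\<^bsub>M'\<^esub> y' = \<zero>\<^bsub>M'\<^esub>" by (rule kerB)
    then show ?thesis by (rule B.minus_eq_zeroD[OF c(2,3)])
  qed
  have inj_N: "x = x'" if "(x, y) \<in> ?N" "(x', y) \<in> ?N" for x x' y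
  proof -
    have c: "y \<in> carrier M'" "x \<in> carrier M" "x' \<in> carrier M" using N_in that by auto
    have "(x \<oplus>\<^bsub>M\<^esub> (-1) \<odot>\<^bsub>M\<^esub> x', y \<oplus>\<^bsub>M'\<^esub> (-1) \<odot>\<^bsub>M'\<^esub> y) \<in> ?N"
      using that by (intro N_add N_smult)
    then have "(x \<ominus>\<^bsub>M\<^esub> x', \<zero>\<^bsub>M'\<^esub>) \<in> ?N"
      using c by (simp add: A.minus_smult[symmetric] B.minus_smult[symmetric] B.M.minus_eq B.M.r_neg)
    then have "x \<ominus>\<^bsub>M\<^esub> x' = \<zero>\<^bsub>M\<^esub>" by (rule kerA)
    then show ?thesis by (rule A.minus_eq_zeroD[OF c(2,3)])
  qed
  define h where "h x = (THE y. (x, y) \<in> ?N)" for x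
  have h: "h x = y" if "(x, y) \<in> ?N" for x y
    unfolding h_def using that fun_N by blast
  have hN: "(x, h x) \<in> ?N" if "x \<in> carrier M" for x
    proof -
    have "x \<in> {x. \<exists>y. (x, y) \<in> ?N}" using that fst_all by simp
    then show ?thesis using h by auto
  qed
  show ?thesis
  proof (rule rep_isoI)
    show "bij_betw h (carrier M) (carrier M')"
    proof (rule bij_betwI')
      show "(h x = h y) = (x = y)" if "x \<in> carrier M" "y \<in> carrier M" for x y
        using hN[OF that(1)] hN[OF that(2)] inj_N by auto
      show "h x \<in> carrier M'" if "x \<in> carrier M" for x using hN[OF that] N_in by blast
      show "\<exists>x\<in>carrier M. y = h x" if "y \<in> carrier M'" for y
      proof -
        have "y \<in> {y. \<exists>x. (x, y) \<in> ?N}" using that snd_all by simp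
        then obtain x where "(x, y) \<in> ?N" by blast
        then show ?thesis using h N_in by blast
      qed
    qed
    show "h (x \<oplus>\<^bsub>M\<^esub> y) = h x \<oplus>\<^bsub>M'\<^esub> h y" if "x \<in> carrier M" "y \<in> carrier M" for x y
      by (rule h, rule N_add) (rule hN that)+
    show "h (c \<odot>\<^bsub>M\<^esub> x) = c \<odot>\<^bsub>M'\<^esub> h x" if "x \<in> carrier M" for c x
      by (rule h, rule N_smult) (rule hN that)+
    show "h (act M g x) = act M' g (h x)" if "g \<in> carrier_mat r r" "x \<in> carrier M" for g x
      by (rule h, rule N_act) (rule hN that)+
  qed
qed

section \<open>The action on words and its commutant\<close>

subsection \<open>Function spaces as modules\<close>

lemma sum_fun_apply: "(\<Sum>a\<in>A. f a) x = (\<Sum>a\<in>A. f a x)" for f :: "'a \<Rightarrow> 'b \<Rightarrow> complex"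
  by (induction A rule: infinite_finite_induct) auto

lemma module_fun_mod:
  assumes "cfun.subspace T"
  shows "module complex_ring (with_act (fun_mod T) f)"
proof (rule moduleI[OF cring_complex_ring])
  show "abelian_group (with_act (fun_mod T) f)"
  proof (rule abelian_groupI)
    fix x assume "x \<in> carrier (with_act (fun_mod T) f)"
    then show "\<exists>y\<in>carrier (with_act (fun_mod T) f).
        y \<oplus>\<^bsub>with_act (fun_mod T) f\<^esub> x = \<zero>\<^bsub>with_act (fun_mod T) f\<^esub>"
      by (intro bexI[of _ "- x"]) (auto intro: cfun.subspace_neg assms)
  next
    show "x \<oplus>\<^bsub>with_act (fun_mod T) f\<^esub> y = y \<oplus>\<^bsub>with_act (fun_mod T) f\<^esub> x" for x y
      unfolding with_act_simps fun_mod_simps by (rule add.commute)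
    show "x \<oplus>\<^bsub>with_act (fun_mod T) f\<^esub> y \<oplus>\<^bsub>with_act (fun_mod T) f\<^esub> z
      = x \<oplus>\<^bsub>with_act (fun_mod T) f\<^esub> (y \<oplus>\<^bsub>with_act (fun_mod T) f\<^esub> z)" for x y z
      unfolding with_act_simps fun_mod_simps by (rule add.assoc)
    show "\<zero>\<^bsub>with_act (fun_mod T) f\<^esub> \<in> carrier (with_act (fun_mod T) f)"
      unfolding with_act_simps fun_mod_simps by (rule cfun.subspace_0[OF assms])
    show "x \<oplus>\<^bsub>with_act (fun_mod T) f\<^esub> y \<in> carrier (with_act (fun_mod T) f)"
      if "x \<in> carrier (with_act (fun_mod T) f)" "y \<in> carrier (with_act (fun_mod T) f)" for x y
      using that unfolding with_act_simps fun_mod_simps by (rule cfun.subspace_add[OF assms])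
    show "\<zero>\<^bsub>with_act (fun_mod T) f\<^esub> \<oplus>\<^bsub>with_act (fun_mod T) f\<^esub> x = x" for x
      unfolding with_act_simps fun_mod_simps by (rule add_0)
  qed
qed (simp_all add: subspace_smult assms, simp_all add: fun_eq_iff algebra_simps)

lemma minus_fun_mod:
  assumes "cfun.subspace T" "y \<in> T"
  shows "x \<ominus>\<^bsub>with_act (fun_mod T) f\<^esub> y = x - y"
proof -
  interpret module complex_ring "with_act (fun_mod T) f" by (rule module_fun_mod) fact
  have "\<ominus>\<^bsub>with_act (fun_mod T) f\<^esub> y = - y"
    by (rule M.minus_equality) (use assms cfun.subspace_neg in auto)
  then show ?thesis by (simp add: M.minus_eq)
qed

subsection \<open>Words\<close>

text \<open>A word of length \<open>n\<close> is a basis vector of the \<open>n\<close>-th tensor power of \<open>\<complex>\<^sup>r\<close>. A function of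
  \<open>(w, i)\<close> is a vector of this tensor power with coefficients in the functions of \<open>i\<close>.\<close>

definition words :: "nat \<Rightarrow> nat \<Rightarrow> (nat \<Rightarrow> nat) set" where
  "words n r = {1..n} \<rightarrow>\<^sub>E {..<r}"

definition word_act :: "nat \<Rightarrow> nat \<Rightarrow> complex mat \<Rightarrow> ((nat \<Rightarrow> nat) \<times> 'i \<Rightarrow> complex) \<Rightarrow> (nat \<Rightarrow> nat) \<times> 'i \<Rightarrow> complex" where
  "word_act n r g \<Phi> = (\<lambda>(w, i). if w \<in> words n r
     then \<Sum>x\<in>{1..n}. \<Sum>q<r. g $$ (w x, q) * \<Phi> (w(x := q), i) else 0)"

definition word_funs :: "nat \<Rightarrow> nat \<Rightarrow> ((nat \<Rightarrow> nat) \<times> 'i \<Rightarrow> complex) set" where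
  "word_funs n r = funs_on (words n r \<times> UNIV)"

lemma finite_words: "finite (words n r)"
  by (auto simp: words_def intro: finite_PiE)

lemma words_lt: "w \<in> words n r \<Longrightarrow> x \<in> {1..n} \<Longrightarrow> w x < r"
  by (auto simp: words_def PiE_def Pi_def)

lemma words_upd: "w \<in> words n r \<Longrightarrow> x \<in> {1..n} \<Longrightarrow> q < r \<Longrightarrow> w(x := q) \<in> words n r"
  by (auto simp: words_def PiE_def extensional_def)

lemma words_comp:
  assumes "\<sigma> permutes {1..n}"
  shows "w \<circ> \<sigma> \<in> words n r \<longleftrightarrow> w \<in> words n r"
proof -
  have *: "w \<circ> \<sigma> \<in> words n r" if "w \<in> words n r" "\<sigma> permutes {1..n}" for w \<sigma>
    using that permutes_in_image[OF that(2)]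
    by (auto simp: words_def PiE_def extensional_def permutes_not_in Pi_def)
  show ?thesis
    using *[of w \<sigma>] *[of "w \<circ> \<sigma>" "inv' \<sigma>"] assms
    by (auto simp: permutes_inv comp_assoc permutes_inv_o)
qed

lemma bij_betw_words_comp:
  "\<sigma> permutes {1..n} \<Longrightarrow> bij_betw (\<lambda>w. w \<circ> \<sigma>) (words n r) (words n r)"
proof (rule bij_betw_byWitness[where f' = "\<lambda>w. w \<circ> inv' \<sigma>"])
  assume s: "\<sigma> permutes {1..n}"
  show "\<forall>w\<in>words n r. w \<circ> \<sigma> \<circ> inv' \<sigma> = w" "\<forall>w\<in>words n r. w \<circ> inv' \<sigma> \<circ> \<sigma> = w"
    using permutes_inv_o[OF s] by (auto simp: comp_assoc)
  show "(\<lambda>w. w \<circ> \<sigma>) ` words n r \<subseteq> words n r" "(\<lambda>w. w \<circ> inv' \<sigma>) ` words n r \<subseteq> words n r"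
    using words_comp s permutes_inv[OF s] by blast+
qed

lemma word_act_in: "word_act n r g \<Phi> \<in> word_funs n r"
  by (auto simp: word_act_def word_funs_def funs_on_def)

lemma word_act_add: "word_act n r g (\<Phi> + \<Psi>) = word_act n r g \<Phi> + word_act n r g \<Psi>"
  by (auto simp: word_act_def fun_eq_iff algebra_simps sum.distrib)

lemma word_act_smult: "word_act n r g (\<lambda>a. c * \<Phi> a) = (\<lambda>a. c * word_act n r g \<Phi> a)"
  by (auto simp: word_act_def fun_eq_iff algebra_simps sum_distrib_left)

lemma word_act_0: "word_act n r g 0 = 0"
  by (auto simp: word_act_def fun_eq_iff)

lemma word_act_add_mat:
  assumes "g \<in> carrier_mat r r" "h \<in> carrier_mat r r"
  shows "word_act n r (g + h) \<Phi> = word_act n r g \<Phi> + word_act n r h \<Phi>"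
proof (rule ext, clarify)
  fix w i
  have "(g + h) $$ (w x, q) = g $$ (w x, q) + h $$ (w x, q)" if "w \<in> words n r" "x \<in> {1..n}" "q < r" for x q
    using assms words_lt[OF that(1,2)] that by auto
  then show "word_act n r (g + h) \<Phi> (w, i) = (word_act n r g \<Phi> + word_act n r h \<Phi>) (w, i)"
    by (simp add: word_act_def algebra_simps flip: sum.distrib)
qed

lemma word_act_smult_mat:
  assumes "g \<in> carrier_mat r r"
  shows "word_act n r (c \<cdot>\<^sub>m g) \<Phi> = (\<lambda>a. c * word_act n r g \<Phi> a)"
proof (rule ext, clarify)
  fix w i
  have "(c \<cdot>\<^sub>m g) $$ (w x, q) = c * g $$ (w x, q)" if "w \<in> words n r" "x \<in> {1..n}" "q < r" for x q
    using assms words_lt[OF that(1,2)] that by auto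
  then show "word_act n r (c \<cdot>\<^sub>m g) \<Phi> (w, i) = c * word_act n r g \<Phi> (w, i)"
    by (simp add: word_act_def algebra_simps sum_distrib_left)
qed

text \<open>The terms of a product of two operators in which they act on different tensor factors. They
  are symmetric in the operators, so the commutator only sees the terms in which both act on
  the same factor.\<close>

definition cross_act :: "nat \<Rightarrow> nat \<Rightarrow> complex mat \<Rightarrow> complex mat \<Rightarrow> ((nat \<Rightarrow> nat) \<times> 'i \<Rightarrow> complex)
    \<Rightarrow> (nat \<Rightarrow> nat) \<Rightarrow> 'i \<Rightarrow> complex" where
  "cross_act n r g h \<Phi> w i = (\<Sum>x\<in>{1..n}. \<Sum>y\<in>{1..n}. if x = y then 0 else
     (\<Sum>q<r. \<Sum>s<r. g $$ (w x, q) * h $$ (w y, s) * \<Phi> (w(x := q, y := s), i)))"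

lemma cross_act_sym: "cross_act n r g h \<Phi> w i = cross_act n r h g \<Phi> w i"
proof -
  have "cross_act n r g h \<Phi> w i = (\<Sum>y\<in>{1..n}. \<Sum>x\<in>{1..n}. if x = y then 0 else
     (\<Sum>q<r. \<Sum>s<r. g $$ (w x, q) * h $$ (w y, s) * \<Phi> (w(x := q, y := s), i)))"
    unfolding cross_act_def by (rule sum.swap)
  also have "\<dots> = cross_act n r h g \<Phi> w i"
    unfolding cross_act_def
  proof (intro sum.cong refl)
    fix x y
    show "(if x = y then 0 else (\<Sum>q<r. \<Sum>s<r. g $$ (w x, q) * h $$ (w y, s) * \<Phi> (w(x := q, y := s), i)))
      = (if y = x then 0 else (\<Sum>q<r. \<Sum>s<r. h $$ (w y, q) * g $$ (w x, s) * \<Phi> (w(y := q, x := s), i)))"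
    proof (cases "x = y")
      case False
      have "(\<Sum>q<r. \<Sum>s<r. g $$ (w x, q) * h $$ (w y, s) * \<Phi> (w(x := q, y := s), i))
        = (\<Sum>s<r. \<Sum>q<r. g $$ (w x, q) * h $$ (w y, s) * \<Phi> (w(x := q, y := s), i))"
        by (rule sum.swap)
      then show ?thesis using False by (simp add: fun_upd_twist mult.commute)
    qed simp
  qed
  finally show ?thesis .
qed

lemma word_act_twice:
  assumes g: "g \<in> carrier_mat r r" and h: "h \<in> carrier_mat r r" and w: "w \<in> words n r"
  shows "word_act n r g (word_act n r h \<Phi>) (w, i)
    = word_act n r (g * h) \<Phi> (w, i) + cross_act n r g h \<Phi> w i"
proof -
  have "word_act n r g (word_act n r h \<Phi>) (w, i)
    = (\<Sum>x\<in>{1..n}. \<Sum>q<r. g $$ (w x, q) * (\<Sum>y\<in>{1..n}. \<Sum>s<r. h $$ ((w(x := q)) y, s) * \<Phi> (w(x := q, y := s), i)))"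
    using w words_upd[OF w] by (simp add: word_act_def)
  also have "\<dots> = (\<Sum>x\<in>{1..n}. (\<Sum>s<r. (g * h) $$ (w x, s) * \<Phi> (w(x := s), i)) +
      (\<Sum>y\<in>{1..n}. if x = y then 0 else
        (\<Sum>q<r. \<Sum>s<r. g $$ (w x, q) * h $$ (w y, s) * \<Phi> (w(x := q, y := s), i))))"
  proof (intro sum.cong refl)
    fix x assume x: "x \<in> {1..n}"
    have split: "(\<Sum>y\<in>{1..n}. F y) = F x + (\<Sum>y\<in>{1..n}. if x = y then 0 else F y)" for F :: "nat \<Rightarrow> complex"
    proof -
      have "(\<Sum>y\<in>{1..n}. F y) = (\<Sum>y\<in>{1..n}. (if x = y then F y else 0) + (if x = y then 0 else F y))"
        by (intro sum.cong) auto
      also have "\<dots> = F x + (\<Sum>y\<in>{1..n}. if x = y then 0 else F y)"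
        using x by (subst sum.distrib) (simp add: sum.delta')
      finally show ?thesis .
    qed
    have gh: "(g * h) $$ (w x, s) = (\<Sum>q<r. g $$ (w x, q) * h $$ (q, s))" if "s < r" for s
      using that g h words_lt[OF w x] by (simp add: scalar_prod_def atLeast0LessThan)
    have "(\<Sum>q<r. g $$ (w x, q) * (\<Sum>y\<in>{1..n}. \<Sum>s<r. h $$ ((w(x := q)) y, s) * \<Phi> (w(x := q, y := s), i)))
      = (\<Sum>q<r. g $$ (w x, q) * (\<Sum>s<r. h $$ (q, s) * \<Phi> (w(x := s), i)))
        + (\<Sum>q<r. g $$ (w x, q) * (\<Sum>y\<in>{1..n}. if x = y then 0 else
            (\<Sum>s<r. h $$ ((w(x := q)) y, s) * \<Phi> (w(x := q, y := s), i))))"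
      by (subst split) (simp add: algebra_simps sum.distrib)
    also have "(\<Sum>q<r. g $$ (w x, q) * (\<Sum>s<r. h $$ (q, s) * \<Phi> (w(x := s), i)))
      = (\<Sum>q<r. \<Sum>s<r. g $$ (w x, q) * h $$ (q, s) * \<Phi> (w(x := s), i))"
      by (simp add: sum_distrib_left mult.assoc)
    also have "\<dots> = (\<Sum>s<r. \<Sum>q<r. g $$ (w x, q) * h $$ (q, s) * \<Phi> (w(x := s), i))"
      by (rule sum.swap)
    also have "\<dots> = (\<Sum>s<r. (g * h) $$ (w x, s) * \<Phi> (w(x := s), i))"
      by (simp add: gh sum_distrib_right)
    also have "(\<Sum>q<r. g $$ (w x, q) * (\<Sum>y\<in>{1..n}. if x = y then 0 else
            (\<Sum>s<r. h $$ ((w(x := q)) y, s) * \<Phi> (w(x := q, y := s), i))))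
      = (\<Sum>q<r. \<Sum>y\<in>{1..n}. if x = y then 0 else
            (\<Sum>s<r. g $$ (w x, q) * h $$ (w y, s) * \<Phi> (w(x := q, y := s), i)))"
      unfolding sum_distrib_left by (intro sum.cong refl) (auto simp: sum_distrib_left mult.assoc)
    also have "\<dots> = (\<Sum>y\<in>{1..n}. \<Sum>q<r. if x = y then 0 else
            (\<Sum>s<r. g $$ (w x, q) * h $$ (w y, s) * \<Phi> (w(x := q, y := s), i)))"
      by (rule sum.swap)
    also have "\<dots> = (\<Sum>y\<in>{1..n}. if x = y then 0 else
        (\<Sum>q<r. \<Sum>s<r. g $$ (w x, q) * h $$ (w y, s) * \<Phi> (w(x := q, y := s), i)))"
      by (intro sum.cong refl) auto
    finally show "(\<Sum>q<r. g $$ (w x, q) * (\<Sum>y\<in>{1..n}. \<Sum>s<r. h $$ ((w(x := q)) y, s) * \<Phi> (w(x := q, y := s), i)))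
      = (\<Sum>s<r. (g * h) $$ (w x, s) * \<Phi> (w(x := s), i)) + (\<Sum>y\<in>{1..n}. if x = y then 0 else
        (\<Sum>q<r. \<Sum>s<r. g $$ (w x, q) * h $$ (w y, s) * \<Phi> (w(x := q, y := s), i)))" .
  qed
  also have "\<dots> = word_act n r (g * h) \<Phi> (w, i) + cross_act n r g h \<Phi> w i"
    using w by (simp add: word_act_def cross_act_def sum.distrib)
  finally show ?thesis .
qed

lemma word_act_bracket:
  assumes g: "g \<in> carrier_mat r r" and h: "h \<in> carrier_mat r r"
  shows "word_act n r (g * h - h * g) \<Phi>
    = word_act n r g (word_act n r h \<Phi>) - word_act n r h (word_act n r g \<Phi>)"
proof (rule ext, clarify)
  fix w i
  show "word_act n r (g * h - h * g) \<Phi> (w, i)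
    = (word_act n r g (word_act n r h \<Phi>) - word_act n r h (word_act n r g \<Phi>)) (w, i)"
  proof (cases "w \<in> words n r")
    case True
    have "g * h - h * g = g * h + (-1) \<cdot>\<^sub>m (h * g)"
      by (rule eq_matI) (use g h in auto)
    then have "word_act n r (g * h - h * g) \<Phi> (w, i)
      = word_act n r (g * h) \<Phi> (w, i) - word_act n r (h * g) \<Phi> (w, i)"
      using g h by (simp add: word_act_add_mat[of _ r] word_act_smult_mat[of _ r])
    then show ?thesis
      using word_act_twice[OF g h True, of \<Phi> i] word_act_twice[OF h g True, of \<Phi> i]
      by (simp add: cross_act_sym[of n r g])
  qed (simp add: word_act_def)
qed

definition stable_words :: "nat \<Rightarrow> nat \<Rightarrow> ((nat \<Rightarrow> nat) \<times> 'i \<Rightarrow> complex) set \<Rightarrow> bool" where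
  "stable_words n r T \<longleftrightarrow> cfun.subspace T \<and> T \<subseteq> word_funs n r
     \<and> (\<forall>g\<in>carrier_mat r r. \<forall>\<Phi>\<in>T. word_act n r g \<Phi> \<in> T)"

abbreviation word_rep ::
  "nat \<Rightarrow> nat \<Rightarrow> ((nat \<Rightarrow> nat) \<times> 'i \<Rightarrow> complex) set \<Rightarrow> (complex, (nat \<Rightarrow> nat) \<times> 'i \<Rightarrow> complex, complex mat) rep" where
  "word_rep n r T \<equiv> with_act (fun_mod T) (word_act n r)"

lemma gl_rep_words:
  assumes "stable_words n r T"
  shows "gl_rep r (word_rep n r T)"
proof -
  have T: "cfun.subspace T" "\<And>g \<Phi>. g \<in> carrier_mat r r \<Longrightarrow> \<Phi> \<in> T \<Longrightarrow> word_act n r g \<Phi> \<in> T"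
    using assms by (auto simp: stable_words_def)
  show ?thesis
    by (rule gl_rep.intro[OF module_fun_mod[OF T(1)]], unfold_locales)
      (auto simp: T word_act_add word_act_smult word_act_add_mat word_act_smult_mat word_act_bracket
        minus_fun_mod)
qed

subsection \<open>Operators commuting with the symmetric group\<close>

definition kernel_op :: "nat \<Rightarrow> nat \<Rightarrow> ((nat \<Rightarrow> nat) \<Rightarrow> (nat \<Rightarrow> nat) \<Rightarrow> complex)
    \<Rightarrow> ((nat \<Rightarrow> nat) \<times> 'i \<Rightarrow> complex) \<Rightarrow> (nat \<Rightarrow> nat) \<times> 'i \<Rightarrow> complex" where
  "kernel_op n r a \<Phi> = (\<lambda>(w, i). if w \<in> words n r then \<Sum>w'\<in>words n r. a w w' * \<Phi> (w', i) else 0)"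

text \<open>The matrix unit \<open>E\<^sub>p\<^sub>q\<close> in the tensor factor \<open>x\<close>.\<close>

definition unit_at :: "nat \<Rightarrow> nat \<Rightarrow> nat \<times> nat \<times> nat \<Rightarrow> ((nat \<Rightarrow> nat) \<times> 'i \<Rightarrow> complex) \<Rightarrow> (nat \<Rightarrow> nat) \<times> 'i \<Rightarrow> complex" where
  "unit_at n r = (\<lambda>(x, p, q) \<Phi> (w, i). if w \<in> words n r \<and> w x = p then \<Phi> (w(x := q), i) else 0)"

abbreviation units_at :: "nat \<Rightarrow> nat \<Rightarrow> (nat \<times> nat \<times> nat) list \<Rightarrow> ((nat \<Rightarrow> nat) \<times> 'i \<Rightarrow> complex) \<Rightarrow> (nat \<Rightarrow> nat) \<times> 'i \<Rightarrow> complex" where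
  "units_at n r \<equiv> foldr (unit_at n r)"

definition inj_lists :: "nat \<Rightarrow> nat \<Rightarrow> nat list set" where
  "inj_lists n k = {xs. length xs = k \<and> distinct xs \<and> set xs \<subseteq> {1..n}}"

text \<open>The sum over all ways of distributing the matrix units of a list to distinct tensor factors.\<close>

definition orbit_op :: "nat \<Rightarrow> nat \<Rightarrow> (nat \<times> nat) list \<Rightarrow> ((nat \<Rightarrow> nat) \<times> 'i \<Rightarrow> complex) \<Rightarrow> (nat \<Rightarrow> nat) \<times> 'i \<Rightarrow> complex" where
  "orbit_op n r L \<Phi> = (\<Sum>xs\<in>inj_lists n (length L). units_at n r (zip xs L) \<Phi>)"

lemma finite_inj_lists: "finite (inj_lists n k)"
proof -
  have "inj_lists n k \<subseteq> {xs. set xs \<subseteq> {1..n} \<and> length xs = k}" by (auto simp: inj_lists_def)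
  then show ?thesis using finite_lists_length_eq[of "{1..n}" k] finite_subset by auto
qed

lemma unit_at_0: "unit_at n r u 0 = 0"
  by (auto simp: unit_at_def fun_eq_iff split: prod.splits)

lemma unit_at_sum: "unit_at n r u (\<Sum>a\<in>A. \<Phi> a) = (\<Sum>a\<in>A. unit_at n r u (\<Phi> a))"
proof -
  have "unit_at n r u (\<Phi> + \<Psi>) = unit_at n r u \<Phi> + unit_at n r u \<Psi>" for \<Phi> \<Psi> :: "(nat \<Rightarrow> nat) \<times> 'a \<Rightarrow> complex"
    by (auto simp: unit_at_def fun_eq_iff split: prod.splits)
  then show ?thesis
    by (induction A rule: infinite_finite_induct)
      (simp_all only: sum.infinite sum.empty sum.insert unit_at_0 not_False_eq_True)
qed

lemma word_act_elem:
  assumes "p < r" "q < r"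
  shows "word_act n r (elem_mat r p q) \<Phi> = (\<Sum>x\<in>{1..n}. unit_at n r (x, p, q) \<Phi>)"
proof (rule ext, clarify)
  fix w i
  show "word_act n r (elem_mat r p q) \<Phi> (w, i) = (\<Sum>x\<in>{1..n}. unit_at n r (x, p, q) \<Phi>) (w, i)"
  proof (cases "w \<in> words n r")
    case True
    have "(\<Sum>s<r. elem_mat r p q $$ (w x, s) * \<Phi> (w(x := s), i)) = unit_at n r (x, p, q) \<Phi> (w, i)"
      if "x \<in> {1..n}" for x
    proof -
      have "(\<Sum>s<r. elem_mat r p q $$ (w x, s) * \<Phi> (w(x := s), i))
        = (\<Sum>s<r. if s = q then (if w x = p then \<Phi> (w(x := q), i) else 0) else 0)"
        using words_lt[OF True that] by (intro sum.cong) auto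
      then show ?thesis using True assms by (simp add: unit_at_def sum.delta)
    qed
    then show ?thesis using True by (simp add: word_act_def sum_fun_apply)
  qed (simp add: word_act_def sum_fun_apply unit_at_def)
qed

lemma unit_at_commute:
  assumes "x \<in> {1..n}" "y \<in> {1..n}" "x \<noteq> y" "q < r" "q' < r"
  shows "unit_at n r (x, p, q) (unit_at n r (y, p', q') \<Phi>) = unit_at n r (y, p', q') (unit_at n r (x, p, q) \<Phi>)"
  using assms by (auto simp: unit_at_def fun_eq_iff words_upd fun_upd_twist)

lemma unit_at_same:
  assumes "x \<in> {1..n}" "q < r"
  shows "unit_at n r (x, p, q) (unit_at n r (x, p', q') \<Phi>) = (if q = p' then unit_at n r (x, p, q') \<Phi> else 0)"
  using assms by (auto simp: unit_at_def fun_eq_iff words_upd)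

text \<open>If the factor \<open>x\<close> is already occupied, the two matrix units there multiply to a single one.\<close>

lemma unit_at_absorb:
  assumes "distinct (map fst zs)" "fst ` set zs \<subseteq> {1..n}" "snd ` set zs \<subseteq> {..<r} \<times> {..<r}" "q < r"
    and "j < length zs" "zs ! j = (x, p', q')"
  shows "unit_at n r (x, p, q) (units_at n r zs \<Phi>)
    = (if q = p' then units_at n r (zs[j := (x, p, q')]) \<Phi> else 0)"
  using assms
proof (induction zs arbitrary: j)
  case (Cons z zs)
  obtain y a b where z: "z = (y, a, b)" by (metis prod.collapse)
  have yn: "y \<in> {1..n}" "a < r" "b < r" using Cons.prems z by auto
  show ?case
  proof (cases j)
    case 0
    then have "y = x" "a = p'" "b = q'" using Cons.prems z by auto
    then show ?thesis using 0 z yn Cons.prems by (simp add: unit_at_same)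
  next
    case (Suc k)
    have xk: "(x, p', q') \<in> set zs" "k < length zs" "zs ! k = (x, p', q')"
      using Suc Cons.prems nth_mem[of k zs] by auto
    then have xy: "x \<in> {1..n}" "x \<noteq> y"
      using Cons.prems z by (auto simp: image_iff subset_iff)
    have "unit_at n r (x, p, q) (units_at n r (z # zs) \<Phi>)
      = unit_at n r (y, a, b) (unit_at n r (x, p, q) (units_at n r zs \<Phi>))"
      using z xy yn Cons.prems by (simp add: unit_at_commute)
    also have "unit_at n r (x, p, q) (units_at n r zs \<Phi>)
      = (if q = p' then units_at n r (zs[k := (x, p, q')]) \<Phi> else 0)"
      by (rule Cons.IH) (use Cons.prems xk in auto)
    finally show ?thesis
      using Suc z unit_at_0[of n r "(y, a, b)"] by (cases "q = p'") (simp_all add: zero_fun_def)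
  qed
qed simp

text \<open>The new matrix unit meets either a free tensor factor or one of those occupied by \<open>L\<close>.\<close>

lemma word_act_orbit_op:
  assumes L: "set L \<subseteq> {..<r} \<times> {..<r}" and p: "p < r" "q < r"
  shows "word_act n r (elem_mat r p q) (orbit_op n r L \<Phi>)
    = orbit_op n r ((p, q) # L) \<Phi> + (\<Sum>j<length L. if q = fst (L ! j) then orbit_op n r (L[j := (p, snd (L ! j))]) \<Phi> else 0)"
proof -
  let ?I = "inj_lists n (length L)"
  let ?U = "\<lambda>x xs. unit_at n r (x, p, q) (units_at n r (zip xs L) \<Phi>)"
  have "word_act n r (elem_mat r p q) (orbit_op n r L \<Phi>) = (\<Sum>x\<in>{1..n}. \<Sum>xs\<in>?I. ?U x xs)"
    by (simp add: word_act_elem[OF p] orbit_op_def unit_at_sum)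
  also have "\<dots> = (\<Sum>xs\<in>?I. \<Sum>x\<in>{1..n}. ?U x xs)"
    by (rule sum.swap)
  also have "\<dots> = (\<Sum>xs\<in>?I. (\<Sum>x\<in>{1..n} - set xs. ?U x xs) + (\<Sum>x\<in>set xs. ?U x xs))"
    by (intro sum.cong refl sum.subset_diff) (auto simp: inj_lists_def)
  also have "\<dots> = (\<Sum>xs\<in>?I. \<Sum>x\<in>{1..n} - set xs. ?U x xs) + (\<Sum>xs\<in>?I. \<Sum>x\<in>set xs. ?U x xs)"
    by (rule sum.distrib)
  also have "(\<Sum>xs\<in>?I. \<Sum>x\<in>{1..n} - set xs. ?U x xs) = orbit_op n r ((p, q) # L) \<Phi>"
  proof -
    have "(\<Sum>xs\<in>?I. \<Sum>x\<in>{1..n} - set xs. ?U x xs) = (\<Sum>(xs, x)\<in>(SIGMA xs:?I. {1..n} - set xs). ?U x xs)"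
      using finite_inj_lists by (subst sum.Sigma) auto
    also have "\<dots> = (\<Sum>ys\<in>inj_lists n (Suc (length L)). units_at n r (zip ys ((p, q) # L)) \<Phi>)"
    proof (rule sum.reindex_bij_witness[where j = "\<lambda>(xs, x). x # xs" and i = "\<lambda>ys. (tl ys, hd ys)"])
      fix ys assume "ys \<in> inj_lists n (Suc (length L))"
      then obtain y ys' where "ys = y # ys'" "length ys' = length L" "distinct ys" "set ys \<subseteq> {1..n}"
        by (auto simp: inj_lists_def length_Suc_conv)
      then show "(case (tl ys, hd ys) of (xs, x) \<Rightarrow> x # xs) = ys"
        "(tl ys, hd ys) \<in> (SIGMA xs:?I. {1..n} - set xs)"
        by (auto simp: inj_lists_def)
    qed (auto simp: inj_lists_def)
    finally show ?thesis by (simp add: orbit_op_def)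
  qed
  also have "(\<Sum>xs\<in>?I. \<Sum>x\<in>set xs. ?U x xs)
    = (\<Sum>xs\<in>?I. \<Sum>j<length L. if q = fst (L ! j) then units_at n r (zip xs (L[j := (p, snd (L ! j))])) \<Phi> else 0)"
  proof (rule sum.cong[OF refl])
    fix xs assume xs: "xs \<in> ?I"
    then have len: "length xs = length L" and d: "distinct xs" and s: "set xs \<subseteq> {1..n}"
      by (auto simp: inj_lists_def)
    have "(\<Sum>x\<in>set xs. ?U x xs) = (\<Sum>j<length L. ?U (xs ! j) xs)"
      using sum.reindex_bij_betw[OF bij_betw_nth[OF d refl refl], of "\<lambda>x. ?U x xs"] len by simp
    also have "\<dots> = (\<Sum>j<length L. if q = fst (L ! j) then units_at n r (zip xs (L[j := (p, snd (L ! j))])) \<Phi> else 0)"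
    proof (rule sum.cong[OF refl])
      fix j assume "j \<in> {..<length L}"
      then have j: "j < length L" by simp
      have sn: "snd ` set (zip xs L) \<subseteq> {..<r} \<times> {..<r}"
        using L by (auto dest: set_zip_rightD)
      have fs: "fst ` set (zip xs L) \<subseteq> {1..n}"
        using s by (auto dest: set_zip_leftD)
      have "?U (xs ! j) xs = (if q = fst (L ! j) then units_at n r ((zip xs L)[j := (xs ! j, p, snd (L ! j))]) \<Phi> else 0)"
        by (rule unit_at_absorb[OF _ fs sn p(2)]) (use len d j in auto)
      also have "(zip xs L)[j := (xs ! j, p, snd (L ! j))] = zip xs (L[j := (p, snd (L ! j))])"
        using update_zip[of xs L j "(xs ! j, p, snd (L ! j))"] by simp
      finally show "?U (xs ! j) xs = (if q = fst (L ! j) then units_at n r (zip xs (L[j := (p, snd (L ! j))])) \<Phi> else 0)" .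
    qed
    finally show "(\<Sum>x\<in>set xs. ?U x xs) = (\<Sum>j<length L. if q = fst (L ! j) then units_at n r (zip xs (L[j := (p, snd (L ! j))])) \<Phi> else 0)" .
  qed
  also have "\<dots> = (\<Sum>j<length L. \<Sum>xs\<in>?I. if q = fst (L ! j) then units_at n r (zip xs (L[j := (p, snd (L ! j))])) \<Phi> else 0)"
    by (rule sum.swap)
  also have "\<dots> = (\<Sum>j<length L. if q = fst (L ! j) then orbit_op n r (L[j := (p, snd (L ! j))]) \<Phi> else 0)"
    by (intro sum.cong refl) (auto simp: orbit_op_def)
  finally show ?thesis .
qed

text \<open>By induction on the length: \<open>word_act_orbit_op\<close> is solved for the term with the longer list.\<close>

lemma stable_orbit_op:
  assumes T: "stable_words n r T" and \<Phi>: "\<Phi> \<in> T"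
  shows "set L \<subseteq> {..<r} \<times> {..<r} \<Longrightarrow> orbit_op n r L \<Phi> \<in> T"
proof (induction "length L" arbitrary: L)
  case 0
  moreover have "inj_lists n 0 = {[]}" by (auto simp: inj_lists_def)
  ultimately show ?case using \<Phi> by (simp add: orbit_op_def)
next
  case (Suc k)
  have sub: "cfun.subspace T" using T by (simp add: stable_words_def)
  obtain p q L' where L: "L = (p, q) # L'" using Suc by (cases L) auto
  have pq: "p < r" "q < r" and L': "set L' \<subseteq> {..<r} \<times> {..<r}" "length L' = k" using Suc L by auto
  have IH: "orbit_op n r M \<Phi> \<in> T" if "length M = k" "set M \<subseteq> {..<r} \<times> {..<r}" for M
    using Suc.hyps(1) that by auto
  have "word_act n r (elem_mat r p q) (orbit_op n r L' \<Phi>) \<in> T"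
    using IH L' T by (auto simp: stable_words_def)
  moreover have "(\<Sum>j<length L'. if q = fst (L' ! j) then orbit_op n r (L'[j := (p, snd (L' ! j))]) \<Phi> else 0) \<in> T"
  proof (intro cfun.subspace_sum[OF sub])
    fix j assume "j \<in> {..<length L'}"
    then have "L' ! j \<in> set L'" by simp
    then have "snd (L' ! j) < r" using L' by auto
    moreover have "set (L'[j := (p, snd (L' ! j))]) \<subseteq> insert (p, snd (L' ! j)) (set L')"
      by (rule set_update_subset_insert)
    ultimately have "set (L'[j := (p, snd (L' ! j))]) \<subseteq> {..<r} \<times> {..<r}"
      using L' pq by auto
    then show "(if q = fst (L' ! j) then orbit_op n r (L'[j := (p, snd (L' ! j))]) \<Phi> else 0) \<in> T"
      using IH[of "L'[j := (p, snd (L' ! j))]"] L' cfun.subspace_0[OF sub] by simp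
  qed
  ultimately have "word_act n r (elem_mat r p q) (orbit_op n r L' \<Phi>)
    - (\<Sum>j<length L'. if q = fst (L' ! j) then orbit_op n r (L'[j := (p, snd (L' ! j))]) \<Phi> else 0) \<in> T"
    by (rule cfun.subspace_diff[OF sub])
  then show ?case
    unfolding L word_act_orbit_op[OF L'(1) pq] by simp
qed

lemma units_at_apply:
  assumes "distinct (map fst zs)" "fst ` set zs \<subseteq> {1..n}" "snd ` set zs \<subseteq> {..<r} \<times> {..<r}"
    and "\<Phi> \<in> word_funs n r" "w' \<in> words n r"
    and "\<And>x p q. (x, p, q) \<in> set zs \<Longrightarrow> w' x = q" "\<And>x. x \<notin> fst ` set zs \<Longrightarrow> w' x = w x"
  shows "units_at n r zs \<Phi> (w, i)
    = (if w \<in> words n r \<and> (\<forall>(x, p, q)\<in>set zs. w x = p) then \<Phi> (w', i) else 0)"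
  using assms
proof (induction zs arbitrary: w)
  case Nil
  then have "w' = w" by auto
  then show ?case using Nil by (auto simp: word_funs_def funs_on_def)
next
  case (Cons z zs)
  obtain x p q where z: "z = (x, p, q)" by (metis prod.collapse)
  have x: "x \<in> {1..n}" "q < r" "x \<notin> fst ` set zs" using Cons.prems z by auto
  have "units_at n r zs \<Phi> (w(x := q), i)
    = (if w(x := q) \<in> words n r \<and> (\<forall>(y, p, q')\<in>set zs. (w(x := q)) y = p) then \<Phi> (w', i) else 0)"
  proof (rule Cons.IH)
    show "w' y = (w(x := q)) y" if "y \<notin> fst ` set zs" for y
      using Cons.prems(6)[of x p q] Cons.prems(7)[of y] that z by auto
  qed (use Cons.prems in auto)
  moreover have "(\<forall>(y, p, q')\<in>set zs. (w(x := q)) y = p) \<longleftrightarrow> (\<forall>(y, p, q')\<in>set zs. w y = p)"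
    using x by (intro ball_cong refl) (force simp: image_iff)
  ultimately show ?case
    using z x words_upd[of w n r x q] by (auto simp: unit_at_def)
qed

lemma bij_betw_perms_inj_lists:
  "bij_betw (\<lambda>\<sigma>. map \<sigma> [1..<Suc n]) {\<sigma>. \<sigma> permutes {1..n}} (inj_lists n n)"
proof (rule bij_betw_byWitness[where f' = "\<lambda>xs x. if x \<in> {1..n} then xs ! (x - 1) else x"])
  show "\<forall>\<sigma>\<in>{\<sigma>. \<sigma> permutes {1..n}}. (\<lambda>x. if x \<in> {1..n} then map \<sigma> [1..<Suc n] ! (x - 1) else x) = \<sigma>"
    by (auto simp: fun_eq_iff permutes_def simp del: upt_Suc)
  show "\<forall>xs\<in>inj_lists n n. map (\<lambda>x. if x \<in> {1..n} then xs ! (x - 1) else x) [1..<Suc n] = xs"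
    by (auto simp: inj_lists_def intro!: nth_equalityI simp del: upt_Suc)
  show "(\<lambda>\<sigma>. map \<sigma> [1..<Suc n]) ` {\<sigma>. \<sigma> permutes {1..n}} \<subseteq> inj_lists n n"
  proof clarify
    fix \<sigma> :: "nat \<Rightarrow> nat" assume s: "\<sigma> permutes {1..n}"
    have "set (map \<sigma> [1..<Suc n]) = {1..n}"
      using permutes_image[OF s] by (simp add: atLeastLessThanSuc_atLeastAtMost del: upt_Suc)
    moreover have "distinct (map \<sigma> [1..<Suc n])"
      using permutes_inj[OF s] by (simp add: distinct_map inj_on_def)
    ultimately show "map \<sigma> [1..<Suc n] \<in> inj_lists n n" by (simp add: inj_lists_def)
  qed
  show "(\<lambda>xs x. if x \<in> {1..n} then xs ! (x - 1) else x) ` inj_lists n n \<subseteq> {\<sigma>. \<sigma> permutes {1..n}}"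
  proof clarify
    fix xs assume "xs \<in> inj_lists n n"
    then have xs: "length xs = n" "distinct xs" "set xs \<subseteq> {1..n}" by (auto simp: inj_lists_def)
    have inj: "inj_on (\<lambda>x. if x \<in> {1..n} then xs ! (x - 1) else x) {1..n}"
      using xs by (auto simp: inj_on_def nth_eq_iff_index_eq)
    have sub: "(\<lambda>x. if x \<in> {1..n} then xs ! (x - 1) else x) ` {1..n} \<subseteq> {1..n}"
    proof clarify
      fix x assume "x \<in> {1..n}"
      moreover from this have "xs ! (x - 1) \<in> set xs" using xs(1) by (intro nth_mem) auto
      ultimately show "(if x \<in> {1..n} then xs ! (x - 1) else x) \<in> {1..n}" using xs(3) by (metis subsetD)
    qed
    have "bij_betw (\<lambda>x. if x \<in> {1..n} then xs ! (x - 1) else x) {1..n} {1..n}"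
      unfolding bij_betw_def by (intro conjI inj endo_inj_surj[OF _ sub inj]) simp
    then show "(\<lambda>x. if x \<in> {1..n} then xs ! (x - 1) else x) permutes {1..n}"
      by (intro bij_imp_permutes) auto
  qed
qed

lemma orbit_op_full:
  assumes "\<Phi> \<in> word_funs n r" "w1 \<in> words n r" "w2 \<in> words n r" "w \<in> words n r"
  shows "orbit_op n r (map (\<lambda>x. (w1 x, w2 x)) [1..<Suc n]) \<Phi> (w, i)
    = (\<Sum>\<sigma> | \<sigma> permutes {1..n}. if w \<circ> \<sigma> = w1 then \<Phi> (w2 \<circ> inv' \<sigma>, i) else 0)"
proof -
  let ?L = "map (\<lambda>x. (w1 x, w2 x)) [1..<Suc n]"
  have "orbit_op n r ?L \<Phi> (w, i) = (\<Sum>xs\<in>inj_lists n n. units_at n r (zip xs ?L) \<Phi> (w, i))"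
    by (simp add: orbit_op_def sum_fun_apply del: upt_Suc)
  also have "\<dots> = (\<Sum>\<sigma> | \<sigma> permutes {1..n}. units_at n r (zip (map \<sigma> [1..<Suc n]) ?L) \<Phi> (w, i))"
    using sum.reindex_bij_betw[OF bij_betw_perms_inj_lists[of n],
      of "\<lambda>xs. units_at n r (zip xs ?L) \<Phi> (w, i)"] by (rule sym)
  also have "\<dots> = (\<Sum>\<sigma> | \<sigma> permutes {1..n}. if w \<circ> \<sigma> = w1 then \<Phi> (w2 \<circ> inv' \<sigma>, i) else 0)"
  proof (intro sum.cong refl)
    fix \<sigma> :: "nat \<Rightarrow> nat" assume "\<sigma> \<in> {\<sigma>. \<sigma> permutes {1..n}}"
    then have s: "\<sigma> permutes {1..n}" by simp
    define zs where "zs = map (\<lambda>x. (\<sigma> x, w1 x, w2 x)) [1..<Suc n]"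
    have zs: "zip (map \<sigma> [1..<Suc n]) ?L = zs"
      by (simp add: zs_def zip_map_map zip_same_conv_map)
    have set_zs: "set zs = (\<lambda>x. (\<sigma> x, w1 x, w2 x)) ` {1..n}"
      by (simp add: zs_def atLeastLessThanSuc_atLeastAtMost del: upt_Suc)
    have fst_zs: "fst ` set zs = {1..n}"
      using permutes_image[OF s] by (simp add: set_zs image_image)
    have inv_s: "inv' \<sigma> (\<sigma> x) = x" for x using permutes_inverses[OF s] by simp
    have "units_at n r zs \<Phi> (w, i)
      = (if w \<in> words n r \<and> (\<forall>(x, p, q)\<in>set zs. w x = p) then \<Phi> (w2 \<circ> inv' \<sigma>, i) else 0)"
    proof (rule units_at_apply)
      show "distinct (map fst zs)"
        using permutes_inj[OF s] by (simp add: zs_def comp_def distinct_map inj_on_def)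
      show "fst ` set zs \<subseteq> {1..n}" using fst_zs by simp
      show "snd ` set zs \<subseteq> {..<r} \<times> {..<r}"
        using assms words_lt by (auto simp: set_zs)
      show "w2 \<circ> inv' \<sigma> \<in> words n r"
        using assms permutes_inv[OF s] by (simp add: words_comp)
      show "(w2 \<circ> inv' \<sigma>) x = q" if "(x, p, q) \<in> set zs" for x p q
        using that inv_s by (auto simp: set_zs)
      show "(w2 \<circ> inv' \<sigma>) x = w x" if "x \<notin> fst ` set zs" for x
      proof -
        have x: "x \<notin> {1..n}" using that fst_zs by simp
        then have "inv' \<sigma> x = x" using permutes_inv[OF s] by (simp add: permutes_not_in)
        then show ?thesis
          using assms x by (auto simp: words_def PiE_def extensional_def)
      qed
    qed (use assms in auto)
    moreover have "(\<forall>(x, p, q)\<in>set zs. w x = p) \<longleftrightarrow> w \<circ> \<sigma> = w1"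
    proof
      assume "\<forall>(x, p, q)\<in>set zs. w x = p"
      then have "w (\<sigma> x) = w1 x" if "x \<in> {1..n}" for x using that by (auto simp: set_zs)
      moreover have "w (\<sigma> x) = w1 x" if "x \<notin> {1..n}" for x
        using that s assms by (auto simp: permutes_not_in words_def PiE_def extensional_def)
      ultimately show "w \<circ> \<sigma> = w1" by (metis comp_apply ext)
    qed (auto simp: set_zs)
    ultimately show "units_at n r (zip (map \<sigma> [1..<Suc n]) ?L) \<Phi> (w, i)
      = (if w \<circ> \<sigma> = w1 then \<Phi> (w2 \<circ> inv' \<sigma>, i) else 0)"
      using zs assms by simp
  qed
  finally show ?thesis .
qed

text \<open>The commutant of the symmetric group is generated by the general linear Lie algebra:
  multiplying \<open>orbit_op\<close> of a list by one more operator of \<open>gl\<^sub>r\<close> gives \<open>orbit_op\<close> of a longer list,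
  up to terms of the same length, and the lists of length \<open>n\<close> give the orbit sums of matrix
  units of the whole tensor power.\<close>

theorem stable_kernel_op:
  assumes T: "stable_words n r T" and \<Phi>: "\<Phi> \<in> T"
    and a: "\<And>\<sigma> w w'. \<sigma> permutes {1..n} \<Longrightarrow> w \<in> words n r \<Longrightarrow> w' \<in> words n r
      \<Longrightarrow> a (w \<circ> \<sigma>) (w' \<circ> \<sigma>) = a w w'"
  shows "kernel_op n r a \<Phi> \<in> T"
proof -
  have sub: "cfun.subspace T" and vf: "T \<subseteq> word_funs n r"
    using T by (auto simp: stable_words_def)
  let ?W = "words n r"
  define L where "L w1 w2 = map (\<lambda>x. (w1 x, w2 x)) [1..<Suc n]" for w1 w2 :: "nat \<Rightarrow> nat"
  (* each orbit sum of matrix units occurs here n! times *)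
  define \<Psi> where "\<Psi> = (\<Sum>w1\<in>?W. \<Sum>w2\<in>?W. (\<lambda>b. a w1 w2 * orbit_op n r (L w1 w2) \<Phi> b))"
  have "\<Psi> \<in> T"
    unfolding \<Psi>_def
  proof (intro cfun.subspace_sum[OF sub] subspace_smult[OF sub] stable_orbit_op[OF T \<Phi>])
    fix w1 w2 assume "w1 \<in> ?W" "w2 \<in> ?W"
    then show "set (L w1 w2) \<subseteq> {..<r} \<times> {..<r}"
      using words_lt[of _ n r] by (auto simp: L_def)
  qed
  moreover have "\<Psi> (w, i) = fact n * kernel_op n r a \<Phi> (w, i)" for w i
  proof (cases "w \<in> ?W")
    case w: True
    let ?S = "{\<sigma>. \<sigma> permutes {1..n}}"
    have "\<Psi> (w, i) = (\<Sum>w1\<in>?W. \<Sum>w2\<in>?W. a w1 w2 * (\<Sum>\<sigma>\<in>?S. if w \<circ> \<sigma> = w1 then \<Phi> (w2 \<circ> inv' \<sigma>, i) else 0))"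
      unfolding \<Psi>_def sum_fun_apply
      by (intro sum.cong refl) (use orbit_op_full[of \<Phi> n r] vf \<Phi> w in \<open>auto simp: L_def simp del: upt_Suc\<close>)
    also have "\<dots> = (\<Sum>w1\<in>?W. \<Sum>\<sigma>\<in>?S. \<Sum>w2\<in>?W. a w1 w2 * (if w \<circ> \<sigma> = w1 then \<Phi> (w2 \<circ> inv' \<sigma>, i) else 0))"
      unfolding sum_distrib_left by (intro sum.cong refl sum.swap)
    also have "\<dots> = (\<Sum>\<sigma>\<in>?S. \<Sum>w1\<in>?W. \<Sum>w2\<in>?W. a w1 w2 * (if w \<circ> \<sigma> = w1 then \<Phi> (w2 \<circ> inv' \<sigma>, i) else 0))"
      by (rule sum.swap)
    also have "\<dots> = (\<Sum>\<sigma>\<in>?S. \<Sum>w2\<in>?W. a w w2 * \<Phi> (w2, i))"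
    proof (rule sum.cong[OF refl])
      fix \<sigma> :: "nat \<Rightarrow> nat" assume "\<sigma> \<in> ?S"
      then have s: "\<sigma> permutes {1..n}" by simp
      have "(\<Sum>w1\<in>?W. \<Sum>w2\<in>?W. a w1 w2 * (if w \<circ> \<sigma> = w1 then \<Phi> (w2 \<circ> inv' \<sigma>, i) else 0))
        = (\<Sum>w1\<in>?W. if w1 = w \<circ> \<sigma> then (\<Sum>w2\<in>?W. a (w \<circ> \<sigma>) w2 * \<Phi> (w2 \<circ> inv' \<sigma>, i)) else 0)"
        by (intro sum.cong refl) auto
      also have "\<dots> = (\<Sum>w2\<in>?W. a (w \<circ> \<sigma>) w2 * \<Phi> (w2 \<circ> inv' \<sigma>, i))"
        using w words_comp[OF s] finite_words by (simp add: sum.delta)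
      also have "\<dots> = (\<Sum>w2\<in>?W. a (w \<circ> \<sigma>) (w2 \<circ> \<sigma>) * \<Phi> (w2 \<circ> \<sigma> \<circ> inv' \<sigma>, i))"
        using sum.reindex_bij_betw[OF bij_betw_words_comp[OF s],
          of "\<lambda>w2. a (w \<circ> \<sigma>) w2 * \<Phi> (w2 \<circ> inv' \<sigma>, i)" r] by simp
      also have "\<dots> = (\<Sum>w2\<in>?W. a w w2 * \<Phi> (w2, i))"
        using permutes_inv_o[OF s] w by (intro sum.cong refl) (simp add: a[OF s] comp_assoc)
      finally show "(\<Sum>w1\<in>?W. \<Sum>w2\<in>?W. a w1 w2 * (if w \<circ> \<sigma> = w1 then \<Phi> (w2 \<circ> inv' \<sigma>, i) else 0))
        = (\<Sum>w2\<in>?W. a w w2 * \<Phi> (w2, i))" .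
    qed
    also have "\<dots> = fact n * kernel_op n r a \<Phi> (w, i)"
      using w card_permutations[of "{1..n}" n] by (simp add: kernel_op_def)
    finally show ?thesis .
  next
    case False
    have "\<Psi> \<in> word_funs n r" using \<open>\<Psi> \<in> T\<close> vf by auto
    then show ?thesis using False by (simp add: kernel_op_def word_funs_def funs_on_def)
  qed
  then have "kernel_op n r a \<Phi> = (\<lambda>b. (1 / fact n) * \<Psi> b)"
    by (auto simp: fun_eq_iff)
  ultimately show ?thesis using subspace_smult[OF sub, of \<Psi> "1 / fact n"] by simp
qed

subsection \<open>Existence of highest weight vectors\<close>

definition content :: "nat \<Rightarrow> (nat \<Rightarrow> nat) \<Rightarrow> nat \<Rightarrow> nat" where
  "content n w p = card {x\<in>{1..n}. w x = p}"

lemma content_comp: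
  assumes "\<sigma> permutes {1..n}"
  shows "content n (w \<circ> \<sigma>) p = content n w p"
proof -
  have "bij_betw \<sigma> {x\<in>{1..n}. (w \<circ> \<sigma>) x = p} {x\<in>{1..n}. w x = p}"
  proof (rule bij_betw_byWitness[where f' = "inv' \<sigma>"])
    show "\<sigma> ` {x\<in>{1..n}. (w \<circ> \<sigma>) x = p} \<subseteq> {x\<in>{1..n}. w x = p}"
      using permutes_in_image[OF assms] by auto
    show "inv' \<sigma> ` {x\<in>{1..n}. w x = p} \<subseteq> {x\<in>{1..n}. (w \<circ> \<sigma>) x = p}"
      using permutes_in_image[OF permutes_inv[OF assms]] permutes_inverses[OF assms] by auto
  qed (use permutes_inverses[OF assms] in auto)
  then show ?thesis
    unfolding content_def by (rule bij_betw_same_card)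
qed

lemma sum_comp_perm:
  assumes "\<sigma> permutes {1..n}"
  shows "(\<Sum>x\<in>{1..n}. (w \<circ> \<sigma>) x) = (\<Sum>x\<in>{1..n}. w x)"
  by (simp add: sum.permute[OF assms, of w])

lemma word_act_elem_apply:
  assumes "p < r" "q < r" "w \<in> words n r"
  shows "word_act n r (elem_mat r p q) \<Phi> (w, i) = (\<Sum>x | x \<in> {1..n} \<and> w x = p. \<Phi> (w(x := q), i))"
proof -
  have "word_act n r (elem_mat r p q) \<Phi> (w, i) = (\<Sum>x\<in>{1..n}. if w x = p then \<Phi> (w(x := q), i) else 0)"
    using assms by (simp add: word_act_elem sum_fun_apply unit_at_def)
  then show ?thesis by (simp only: sum.inter_filter[OF finite_atLeastAtMost])
qed

lemma word_act_diag:
  assumes "p < r" and c: "\<And>w i. \<Phi> (w, i) \<noteq> 0 \<Longrightarrow> content n w p = m" and "\<Phi> \<in> word_funs n r"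
  shows "word_act n r (elem_mat r p p) \<Phi> = (\<lambda>b. of_nat m * \<Phi> b)"
proof (rule ext, clarify)
  fix w i
  show "word_act n r (elem_mat r p p) \<Phi> (w, i) = of_nat m * \<Phi> (w, i)"
  proof (cases "w \<in> words n r")
    case True
    have "word_act n r (elem_mat r p p) \<Phi> (w, i) = (\<Sum>x | x \<in> {1..n} \<and> w x = p. \<Phi> (w, i))"
      using True assms by (auto simp: word_act_elem_apply fun_upd_idem intro!: sum.cong)
    also have "\<dots> = of_nat (content n w p) * \<Phi> (w, i)" by (simp add: content_def)
    finally show ?thesis using c[of w i] by (cases "\<Phi> (w, i) = 0") auto
  next
    case False
    then show ?thesis using assms(3) by (auto simp: word_act_def word_funs_def funs_on_def)
  qed
qed

text \<open>A nonzero vector supported on words whose sum of letters is as small as possible is killed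
  by the raising operators, which decrease that sum. Its content is a partition, since
  interchanging two letters commutes with the symmetric group and must not decrease the sum
  either.\<close>

theorem highest_weight_exists:
  assumes T: "stable_words n r T" and nz: "T \<noteq> {0}"
  obtains \<Phi> \<eta> where "\<Phi> \<in> T" "\<Phi> \<noteq> 0" "\<eta> \<in> partitions n" "length \<eta> \<le> r"
    "\<And>w i p. \<Phi> (w, i) \<noteq> 0 \<Longrightarrow> content n w p = (if p < length \<eta> then \<eta> ! p else 0)"
    "\<And>p q. p < q \<Longrightarrow> q < r \<Longrightarrow> word_act n r (elem_mat r p q) \<Phi> = 0"
proof -
  have sub: "cfun.subspace T" and vf: "T \<subseteq> word_funs n r"
    using T by (auto simp: stable_words_def)
  let ?s = "\<lambda>w. \<Sum>x\<in>{1..n}. w x :: nat"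
  define Q where "Q P \<longleftrightarrow> (\<exists>\<Phi>\<in>T. \<exists>w i. \<Phi> (w, i) \<noteq> 0 \<and> ?s w = P)" for P
  have "\<exists>P. Q P"
  proof -
    obtain \<Phi> where "\<Phi> \<in> T" "\<Phi> \<noteq> 0" using nz cfun.subspace_0[OF sub] by blast
    moreover from this obtain b where "\<Phi> b \<noteq> 0" by (auto simp: fun_eq_iff)
    moreover obtain w i where "b = (w, i)" by (cases b)
    ultimately show ?thesis unfolding Q_def by blast
  qed
  define P where "P = (LEAST P. Q P)"
  have QP: "Q P" and least: "\<And>P'. Q P' \<Longrightarrow> P \<le> P'"
    using \<open>\<exists>P. Q P\<close> unfolding P_def by (auto intro: LeastI Least_le)
  obtain \<Psi> w0 i0 where \<Psi>: "\<Psi> \<in> T" "\<Psi> (w0, i0) \<noteq> 0" "?s w0 = P"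
    using QP unfolding Q_def by blast
  define \<mu> where "\<mu> = content n w0"
  have w0: "w0 \<in> words n r" using \<Psi> vf by (auto simp: word_funs_def funs_on_def)
  define a :: "(nat \<Rightarrow> nat) \<Rightarrow> (nat \<Rightarrow> nat) \<Rightarrow> complex"
    where "a w w' = (if w = w' \<and> content n w = \<mu> \<and> ?s w = P then 1 else 0)" for w w'
  define \<Phi> where "\<Phi> = kernel_op n r a \<Psi>"
  have comp_eq: "w \<circ> \<sigma> = w' \<circ> \<sigma> \<longleftrightarrow> w = w'" if "\<sigma> permutes {1..n}" for \<sigma> and w w' :: "nat \<Rightarrow> nat"
    using permutes_surj[OF that] by (metis surj_fun_eq comp_apply)
  have \<Phi>T: "\<Phi> \<in> T"
    unfolding \<Phi>_def
  proof (rule stable_kernel_op[OF T \<Psi>(1)])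
    fix \<sigma> w w' assume s: "\<sigma> permutes {1..n}"
    have "content n (w \<circ> \<sigma>) = content n w"
      by (rule ext) (rule content_comp[OF s])
    then show "a (w \<circ> \<sigma>) (w' \<circ> \<sigma>) = a w w'"
      unfolding a_def sum_comp_perm[OF s] comp_eq[OF s] by simp
  qed
  have \<Phi>_eq: "\<Phi> (w, i) = (if w \<in> words n r \<and> content n w = \<mu> \<and> ?s w = P then \<Psi> (w, i) else 0)" for w i
  proof (cases "w \<in> words n r")
    case True
    have "(\<Sum>w'\<in>words n r. a w w' * \<Psi> (w', i))
      = (\<Sum>w'\<in>words n r. if w' = w then (if content n w = \<mu> \<and> ?s w = P then \<Psi> (w, i) else 0) else 0)"
      by (intro sum.cong refl) (auto simp: a_def)
    then show ?thesis using True finite_words by (simp add: \<Phi>_def kernel_op_def sum.delta)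
  qed (simp add: \<Phi>_def kernel_op_def)
  have \<Phi>w0: "\<Phi> (w0, i0) \<noteq> 0" using w0 \<Psi> by (simp add: \<Phi>_eq \<mu>_def)
  have raise: "word_act n r (elem_mat r p q) \<Phi> = 0" if pq: "p < q" "q < r" for p q
  proof (rule ccontr)
    let ?R = "word_act n r (elem_mat r p q) \<Phi>"
    assume "?R \<noteq> 0"
    then obtain b where "?R b \<noteq> 0" by (auto simp: fun_eq_iff)
    then obtain w i where wi: "?R (w, i) \<noteq> 0" by (cases b) auto
    have "?R \<in> word_funs n r" by (rule word_act_in)
    then have w: "w \<in> words n r" using wi by (auto simp: word_funs_def funs_on_def)
    have "?R (w, i) = (\<Sum>x | x \<in> {1..n} \<and> w x = p. \<Phi> (w(x := q), i))"
      using pq by (intro word_act_elem_apply w) auto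
    then obtain x where x: "x \<in> {1..n}" "w x = p" "\<Phi> (w(x := q), i) \<noteq> 0"
      using wi sum.not_neutral_contains_not_neutral by (metis (mono_tags, lifting) mem_Collect_eq)
    then have "?s (w(x := q)) = P" by (auto simp: \<Phi>_eq split: if_splits)
    moreover have "?s (w(x := q)) = q + (\<Sum>y\<in>{1..n} - {x}. w y)"
      using x by (subst sum.remove[of _ x]) auto
    moreover have "?s w = p + (\<Sum>y\<in>{1..n} - {x}. w y)"
      using x by (subst sum.remove[of _ x]) auto
    ultimately have "?s w < P" using pq by simp
    moreover have "Q (?s w)"
      unfolding Q_def using wi T \<Phi>T by (auto simp: stable_words_def)
    ultimately show False using least by force
  qed
  have dom: "\<mu> q \<le> \<mu> p" if pq: "p < q" "q < r" for p q
  proof (rule ccontr)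
    assume "\<not> \<mu> q \<le> \<mu> p"
    define t where "t w = restrict (transpose p q \<circ> w) {1..n}" for w :: "nat \<Rightarrow> nat"
    have t_words: "t w \<in> words n r" if "w \<in> words n r" for w
      using that pq words_lt[OF that] by (auto simp: t_def words_def transpose_def)
    have tt: "t (t w) = w" if "w \<in> words n r" for w
      using that by (auto simp: t_def words_def fun_eq_iff PiE_def extensional_def)
    have t_comp: "t (w \<circ> \<sigma>) = t w \<circ> \<sigma>" if "\<sigma> permutes {1..n}" for w \<sigma>
      using permutes_in_image[OF that] by (auto simp: t_def fun_eq_iff restrict_def)
    define b :: "(nat \<Rightarrow> nat) \<Rightarrow> (nat \<Rightarrow> nat) \<Rightarrow> complex" where "b w w' = (if w' = t w then 1 else 0)" for w w'
    have "kernel_op n r b \<Phi> \<in> T"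
      by (rule stable_kernel_op[OF T \<Phi>T]) (simp add: b_def t_comp comp_eq)
    moreover have "kernel_op n r b \<Phi> (t w0, i0) \<noteq> 0"
      using t_words[OF w0] finite_words[of n r] \<Phi>w0 w0 tt[OF w0]
      by (simp add: kernel_op_def b_def sum.delta if_distrib[of "\<lambda>x. x * _"] cong: if_cong)
    ultimately have "Q (?s (t w0))" unfolding Q_def by blast
    then have "P \<le> ?s (t w0)" by (rule least)
    moreover have "int (?s (t w0)) - int (?s w0) = (int q - int p) * (int (\<mu> p) - int (\<mu> q))"
    proof -
      have "int (?s (t w0)) - int (?s w0) = (\<Sum>x\<in>{1..n}. int (t w0 x) - int (w0 x))"
        by (simp add: sum_subtractf)
      also have "\<dots> = (\<Sum>x\<in>{1..n}. (if w0 x = p then int q - int p else 0) + (if w0 x = q then int p - int q else 0))"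
        using pq by (intro sum.cong refl) (auto simp: t_def transpose_def)
      also have "\<dots> = (int q - int p) * int (\<mu> p) + (int p - int q) * int (\<mu> q)"
        by (simp add: sum.distrib \<mu>_def content_def flip: sum.inter_filter)
      finally show ?thesis by (simp add: algebra_simps)
    qed
    moreover have "(int q - int p) * (int (\<mu> p) - int (\<mu> q)) < 0"
      using pq \<open>\<not> \<mu> q \<le> \<mu> p\<close> by (intro mult_pos_neg) auto
    ultimately show False using \<Psi>(3) by linarith
  qed
  have \<mu>_ge: "\<mu> p = 0" if "p \<ge> r" for p
    using words_lt[OF w0] that by (force simp: \<mu>_def content_def)
  define k where "k = (LEAST k. \<mu> k = 0)"
  have k: "\<mu> k = 0" "k \<le> r" and k_least: "\<And>p. p < k \<Longrightarrow> \<mu> p \<noteq> 0"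
    unfolding k_def using \<mu>_ge[of r] by (auto intro: LeastI Least_le dest: not_less_Least)
  have \<mu>_k: "\<mu> p = 0" if "p \<ge> k" for p
    using dom[of k p] k \<mu>_ge[of p] that by (cases "p = k"; cases "p < r") auto
  define \<eta> where "\<eta> = map \<mu> [0..<k]"
  have \<eta>_nth: "(if p < length \<eta> then \<eta> ! p else 0) = \<mu> p" for p
    using \<mu>_k[of p] by (auto simp: \<eta>_def)
  have "sum_list \<eta> = (\<Sum>p<k. \<mu> p)"
    by (simp add: \<eta>_def interv_sum_list_conv_sum_set_nat atLeast0LessThan)
  also have "\<dots> = (\<Sum>p<r. \<mu> p)"
    using k \<mu>_k by (intro sum.mono_neutral_left) auto
  also have "\<dots> = card (\<Union>p\<in>{..<r}. {x\<in>{1..n}. w0 x = p})"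
    unfolding \<mu>_def content_def by (subst card_UN_disjoint) auto
  also have "(\<Union>p\<in>{..<r}. {x\<in>{1..n}. w0 x = p}) = {1..n}"
    using words_lt[OF w0] by auto
  finally have "sum_list \<eta> = n" by simp
  moreover have "sorted_wrt (\<ge>) \<eta>"
    using dom k by (auto simp: \<eta>_def sorted_wrt_iff_nth_less)
  moreover have "0 \<notin> set \<eta>"
    using k_least by (force simp: \<eta>_def)
  ultimately have "\<eta> \<in> partitions n" by (simp add: partitions_def)
  moreover have "length \<eta> \<le> r" using k by (simp add: \<eta>_def)
  moreover have "\<Phi> \<noteq> 0" using \<Phi>w0 by auto
  moreover have "content n w p = (if p < length \<eta> then \<eta> ! p else 0)" if "\<Phi> (w, i) \<noteq> 0" for w i p
    using that unfolding \<eta>_nth by (auto simp: \<Phi>_eq split: if_splits)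
  ultimately show ?thesis using that \<Phi>T raise by blast
qed

section \<open>Specht modules and the Schur functor\<close>

subsection \<open>Function spaces with permutations acting\<close>

definition perm_stable :: "nat \<Rightarrow> ((nat \<Rightarrow> nat) \<Rightarrow> complex) set \<Rightarrow> bool" where
  "perm_stable n W \<longleftrightarrow> cfun.subspace W \<and> (\<forall>\<sigma>. \<sigma> permutes {1..n} \<longrightarrow> (\<forall>v\<in>W. perm_act \<sigma> v \<in> W))"

definition comp_closed :: "nat \<Rightarrow> (nat \<Rightarrow> nat) set \<Rightarrow> bool" where
  "comp_closed n X \<longleftrightarrow> finite X \<and> (\<forall>\<sigma>. \<sigma> permutes {1..n} \<longrightarrow> (\<forall>f\<in>X. f \<circ> \<sigma> \<in> X))"

lemma perm_act_apply: "perm_act \<sigma> v f = v (f \<circ> \<sigma>)"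
  by (simp add: perm_act_def)

lemma perm_act_add: "perm_act \<sigma> (u + v) = perm_act \<sigma> u + perm_act \<sigma> v"
  by (simp add: perm_act_def fun_eq_iff)

lemma perm_act_diff: "perm_act \<sigma> (u - v) = perm_act \<sigma> u - perm_act \<sigma> v"
  by (simp add: perm_act_def fun_eq_iff)

lemma perm_act_smult: "perm_act \<sigma> (\<lambda>f. c * v f) = (\<lambda>f. c * perm_act \<sigma> v f)"
  by (simp add: perm_act_def)

lemma perm_act_0: "perm_act \<sigma> 0 = 0"
  by (simp add: perm_act_def fun_eq_iff)

lemma perm_act_comp: "perm_act \<sigma> (perm_act \<tau> v) = perm_act (\<sigma> \<circ> \<tau>) v"
  by (simp add: perm_act_def comp_assoc)

lemma perm_act_inv:
  assumes "\<sigma> permutes {1..n}"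
  shows "perm_act \<sigma> (perm_act (inv' \<sigma>) v) = v" "perm_act (inv' \<sigma>) (perm_act \<sigma> v) = v"
  using permutes_inv_o[OF assms] by (simp_all add: perm_act_comp) (simp_all add: perm_act_def)

lemma comp_closed_iff:
  assumes "comp_closed n X" "\<sigma> permutes {1..n}"
  shows "f \<circ> \<sigma> \<in> X \<longleftrightarrow> f \<in> X"
proof
  assume "f \<circ> \<sigma> \<in> X"
  then have "f \<circ> \<sigma> \<circ> inv' \<sigma> \<in> X"
    using assms permutes_inv[OF assms(2)] unfolding comp_closed_def by blast
  then show "f \<in> X" using permutes_inv_o[OF assms(2)] by (simp add: comp_assoc)
qed (use assms in \<open>auto simp: comp_closed_def\<close>)

lemma bij_betw_comp_closed:
  assumes "comp_closed n X" "\<sigma> permutes {1..n}"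
  shows "bij_betw (\<lambda>f. f \<circ> \<sigma>) X X"
proof (rule bij_betw_byWitness[where f' = "\<lambda>f. f \<circ> inv' \<sigma>"])
  show "\<forall>f\<in>X. f \<circ> \<sigma> \<circ> inv' \<sigma> = f" "\<forall>f\<in>X. f \<circ> inv' \<sigma> \<circ> \<sigma> = f"
    using permutes_inv_o[OF assms(2)] by (auto simp: comp_assoc)
  show "(\<lambda>f. f \<circ> \<sigma>) ` X \<subseteq> X" "(\<lambda>f. f \<circ> inv' \<sigma>) ` X \<subseteq> X"
    using comp_closed_iff[OF assms(1)] assms(2) permutes_inv[OF assms(2)] by blast+
qed

lemma ip_perm_act:
  assumes "comp_closed n X" "\<sigma> permutes {1..n}"
  shows "ip X (perm_act \<sigma> u) (perm_act \<sigma> v) = ip X u v"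
  using sum.reindex_bij_betw[OF bij_betw_comp_closed[OF assms], of "\<lambda>f. u f * cnj (v f)"]
  by (simp add: ip_def perm_act_apply)

lemma ip_perm_act_adjoint:
  assumes "comp_closed n X" "\<sigma> permutes {1..n}"
  shows "ip X (perm_act \<sigma> u) v = ip X u (perm_act (inv' \<sigma>) v)"
  using ip_perm_act[OF assms, of u "perm_act (inv' \<sigma>) v"] by (simp only: perm_act_inv[OF assms(2)])

lemma orth_proj_perm_act:
  assumes "comp_closed n X" "perm_stable n W" "W \<subseteq> funs_on X" "\<sigma> permutes {1..n}"
  shows "orth_proj X W (perm_act \<sigma> u) = perm_act \<sigma> (orth_proj X W u)"
proof -
  interpret fun_subspace X W
    using assms by unfold_locales (auto simp: comp_closed_def perm_stable_def)
  show ?thesis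
  proof (rule orth_proj_commute[where D' = "perm_act (inv' \<sigma>)"])
    show "perm_act \<sigma> v \<in> W" "perm_act (inv' \<sigma>) v \<in> W" if "v \<in> W" for v
      using that assms(2,4) permutes_inv[OF assms(4)] unfolding perm_stable_def by blast+
  qed (rule perm_act_diff ip_perm_act_adjoint[OF assms(1,4)])+
qed

subsection \<open>The Schur functor\<close>

text \<open>A vector of the \<open>n\<close>-th tensor power of \<open>\<complex>\<^sup>r\<close> with coefficients in \<open>W\<close> that is invariant under
  the diagonal action of the symmetric group, where \<open>\<sigma>\<close> acts on \<open>W\<close> as \<^const>\<open>perm_act\<close>
  multiplied by \<open>\<epsilon> \<sigma>\<close>.\<close>

definition schur :: "nat \<Rightarrow> nat \<Rightarrow> ((nat \<Rightarrow> nat) \<Rightarrow> complex) \<Rightarrow> ((nat \<Rightarrow> nat) \<Rightarrow> complex) set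
    \<Rightarrow> ((nat \<Rightarrow> nat) \<times> (nat \<Rightarrow> nat) \<Rightarrow> complex) set" where
  "schur n r \<epsilon> W = {\<Phi> \<in> word_funs n r. (\<forall>w. (\<lambda>f. \<Phi> (w, f)) \<in> W)
     \<and> (\<forall>\<sigma> w f. \<sigma> permutes {1..n} \<longrightarrow> \<Phi> (w \<circ> \<sigma>, f \<circ> \<sigma>) = \<epsilon> \<sigma> * \<Phi> (w, f))}"

lemma schurD:
  assumes "\<Phi> \<in> schur n r \<epsilon> W"
  shows "\<Phi> \<in> word_funs n r" "(\<lambda>f. \<Phi> (w, f)) \<in> W"
    "\<sigma> permutes {1..n} \<Longrightarrow> \<Phi> (w \<circ> \<sigma>, f \<circ> \<sigma>) = \<epsilon> \<sigma> * \<Phi> (w, f)"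
    "w \<notin> words n r \<Longrightarrow> \<Phi> (w, f) = 0"
  using assms by (auto simp: schur_def word_funs_def funs_on_def)

lemma upd_comp_perm:
  assumes "\<sigma> permutes {1..n}"
  shows "(w \<circ> \<sigma>)(x := q) = w(\<sigma> x := q) \<circ> \<sigma>"
  using permutes_inj[OF assms] by (auto simp: fun_eq_iff inj_eq)

lemma stable_schur:
  assumes "cfun.subspace W"
  shows "stable_words n r (schur n r \<epsilon> W)"
  unfolding stable_words_def
proof (intro conjI ballI)
  show "cfun.subspace (schur n r \<epsilon> W)"
  proof (rule cfun.subspaceI)
    show "0 \<in> schur n r \<epsilon> W"
      using cfun.subspace_0[OF assms] by (auto simp: schur_def word_funs_def funs_on_def zero_fun_def)
    show "\<Phi> + \<Psi> \<in> schur n r \<epsilon> W" if "\<Phi> \<in> schur n r \<epsilon> W" "\<Psi> \<in> schur n r \<epsilon> W" for \<Phi> \<Psi>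
      using that subspace_add[OF assms, unfolded plus_fun_def]
      by (auto simp: schur_def word_funs_def funs_on_def algebra_simps)
    show "(\<lambda>x. c * \<Phi> x) \<in> schur n r \<epsilon> W" if "\<Phi> \<in> schur n r \<epsilon> W" for c \<Phi>
      using that subspace_smult[OF assms] by (auto simp: schur_def word_funs_def funs_on_def)
  qed
  show "schur n r \<epsilon> W \<subseteq> word_funs n r" by (auto simp: schur_def)
  fix g :: "complex mat" and \<Phi> :: "(nat \<Rightarrow> nat) \<times> (nat \<Rightarrow> nat) \<Rightarrow> complex"
  assume g: "g \<in> carrier_mat r r" and \<Phi>: "\<Phi> \<in> schur n r \<epsilon> W"
  show "word_act n r g \<Phi> \<in> schur n r \<epsilon> W"
    unfolding schur_def
  proof (intro CollectI conjI allI impI word_act_in)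
    fix w
    show "(\<lambda>f. word_act n r g \<Phi> (w, f)) \<in> W"
    proof (cases "w \<in> words n r")
      case True
      have "(\<lambda>f. \<Sum>x\<in>{1..n}. 1 * (\<Sum>q<r. g $$ (w x, q) * \<Phi> (w(x := q), f))) \<in> W"
        by (intro subspace_sum[OF assms] schurD(2)[OF \<Phi>])
      then show ?thesis using True by (simp add: word_act_def)
    next
      case False
      then show ?thesis using cfun.subspace_0[OF assms] by (simp add: word_act_def zero_fun_def)
    qed
    fix \<sigma> :: "nat \<Rightarrow> nat" and f :: "nat \<Rightarrow> nat" assume s: "\<sigma> permutes {1..n}"
    have "(\<Sum>x\<in>{1..n}. \<Sum>q<r. g $$ ((w \<circ> \<sigma>) x, q) * \<Phi> ((w \<circ> \<sigma>)(x := q), f \<circ> \<sigma>))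
      = (\<Sum>x\<in>{1..n}. (\<lambda>x. \<Sum>q<r. g $$ (w x, q) * (\<epsilon> \<sigma> * \<Phi> (w(x := q), f))) (\<sigma> x))"
      unfolding upd_comp_perm[OF s] schurD(3)[OF \<Phi> s] by simp
    also have "\<dots> = (\<Sum>x\<in>{1..n}. \<Sum>q<r. g $$ (w x, q) * (\<epsilon> \<sigma> * \<Phi> (w(x := q), f)))"
      using sum.permute[OF s] by (metis (no_types, lifting) comp_apply sum.cong)
    finally show "word_act n r g \<Phi> (w \<circ> \<sigma>, f \<circ> \<sigma>) = \<epsilon> \<sigma> * word_act n r g \<Phi> (w, f)"
      using words_comp[OF s] by (simp add: word_act_def sum_distrib_left algebra_simps del: comp_apply)
  qed
qed

lemma subspace_schur: "cfun.subspace W \<Longrightarrow> cfun.subspace (schur n r \<epsilon> W)"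
  using stable_schur[of W n r \<epsilon>] by (simp add: stable_words_def)

subsection \<open>The standard tableau\<close>

locale specht_shape =
  fixes n :: nat and \<eta> :: "nat list"
  assumes shape: "\<eta> \<in> partitions n"
begin

abbreviation "psum k \<equiv> sum_list (take k \<eta>)"

lemma psum_mono: "i \<le> j \<Longrightarrow> psum i \<le> psum j"
  by (metis le_add1 le_iff_add sum_list_append take_add)

lemma psum_Suc: "i < length \<eta> \<Longrightarrow> psum (Suc i) = psum i + \<eta> ! i"
  by (simp add: take_Suc_conv_app_nth)

lemma psum_le: "psum i \<le> n"
  using psum_mono[of i "i + length \<eta>"] shape by (auto simp: partitions_def)

lemma psum_length: "psum (length \<eta>) = n"
  using shape by (simp add: partitions_def)

lemma part_pos: "i < length \<eta> \<Longrightarrow> \<eta> ! i \<ge> 1"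
  using shape nth_mem[of i \<eta>] by (cases "\<eta> ! i") (auto simp: partitions_def)

lemma part_mono: "i \<le> j \<Longrightarrow> j < length \<eta> \<Longrightarrow> \<eta> ! j \<le> \<eta> ! i"
  using shape by (cases "i = j") (auto simp: partitions_def sorted_wrt_iff_nth_less)

lemma tab_row_eqI: "psum i < x \<Longrightarrow> x \<le> psum (Suc i) \<Longrightarrow> tab_row \<eta> x = i"
  unfolding tab_row_def
proof (rule Least_equality)
  fix j assume "psum i < x" "x \<le> psum (Suc j)"
  then show "i \<le> j" using psum_mono[of "Suc j" i] by (cases "i \<le> j") auto
qed

lemma tab_row_bounds:
  assumes "x \<in> {1..n}"
  shows "psum (tab_row \<eta> x) < x" "x \<le> psum (Suc (tab_row \<eta> x))" "tab_row \<eta> x < length \<eta>"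
proof -
  have "length \<eta> \<noteq> 0" using assms psum_length by auto
  then have ex: "x \<le> psum (Suc (length \<eta> - 1))" using assms psum_length by simp
  show "x \<le> psum (Suc (tab_row \<eta> x))"
    unfolding tab_row_def by (rule LeastI) (rule ex)
  have "tab_row \<eta> x \<le> length \<eta> - 1"
    unfolding tab_row_def by (rule Least_le) (rule ex)
  then show "tab_row \<eta> x < length \<eta>" using \<open>length \<eta> \<noteq> 0\<close> by linarith
  show "psum (tab_row \<eta> x) < x"
  proof (cases "tab_row \<eta> x")
    case (Suc i)
    then have "\<not> x \<le> psum (Suc i)"
      using not_less_Least[of i "\<lambda>i. x \<le> psum (Suc i)"] by (simp add: tab_row_def)
    then show ?thesis using Suc by simp
  qed (use assms in auto)
qed

lemma tab_pos: "x \<in> {1..n} \<Longrightarrow> x = psum (tab_row \<eta> x) + tab_col \<eta> x"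
  using tab_row_bounds(1)[of x] by (simp add: tab_col_def)

lemma tab_col_bounds:
  assumes "x \<in> {1..n}"
  shows "1 \<le> tab_col \<eta> x" "tab_col \<eta> x \<le> \<eta> ! tab_row \<eta> x"
  using tab_row_bounds[OF assms] psum_Suc[of "tab_row \<eta> x"] by (auto simp: tab_col_def)

lemma tab_inj:
  "x \<in> {1..n} \<Longrightarrow> y \<in> {1..n} \<Longrightarrow> tab_row \<eta> x = tab_row \<eta> y \<Longrightarrow> tab_col \<eta> x = tab_col \<eta> y \<Longrightarrow> x = y"
  using tab_pos[of x] tab_pos[of y] by simp

lemma tab_surj:
  assumes "i < length \<eta>" "1 \<le> c" "c \<le> \<eta> ! i"
  obtains x where "x \<in> {1..n}" "tab_row \<eta> x = i" "tab_col \<eta> x = c"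
proof -
  have r: "tab_row \<eta> (psum i + c) = i"
    by (rule tab_row_eqI) (use assms psum_Suc in auto)
  then have "tab_col \<eta> (psum i + c) = c" by (simp add: tab_col_def)
  moreover have "psum i + c \<in> {1..n}"
    using assms psum_Suc[of i] psum_le[of "Suc i"] by auto
  ultimately show ?thesis using that r by blast
qed

definition tabloid :: "nat \<Rightarrow> nat" where
  "tabloid = restrict (tab_row \<eta>) {1..n}"

definition tabloids :: "(nat \<Rightarrow> nat) set" where
  "tabloids = {tabloid \<circ> \<sigma> | \<sigma>. \<sigma> permutes {1..n}}"

definition col_perms :: "(nat \<Rightarrow> nat) set" where
  "col_perms = {q. q permutes {1..n} \<and> (\<forall>x\<in>{1..n}. tab_col \<eta> (q x) = tab_col \<eta> x)}"

abbreviation "e \<equiv> polytabloid n \<eta>"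

definition specht_space :: "((nat \<Rightarrow> nat) \<Rightarrow> complex) set" where
  "specht_space = cfun.span ((\<lambda>\<sigma>. perm_act \<sigma> e) ` carrier (sym_group n))"

lemma tabloid_apply: "x \<in> {1..n} \<Longrightarrow> tabloid x = tab_row \<eta> x"
  by (simp add: tabloid_def)

lemma content_tabloid: "content n tabloid p = (if p < length \<eta> then \<eta> ! p else 0)"
proof (cases "p < length \<eta>")
  case True
  have "{x\<in>{1..n}. tabloid x = p} = {psum p<..psum (Suc p)}"
  proof (rule equalityI; rule subsetI)
    fix x assume "x \<in> {psum p<..psum (Suc p)}"
    then show "x \<in> {x\<in>{1..n}. tabloid x = p}"
      using tab_row_eqI[of p x] psum_le[of "Suc p"] tabloid_apply[of x] by auto
  next
    fix x assume "x \<in> {x\<in>{1..n}. tabloid x = p}"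
    then show "x \<in> {psum p<..psum (Suc p)}"
      using tab_row_bounds[of x] tabloid_apply[of x] by auto
  qed
  then show ?thesis using True psum_Suc[OF True] by (simp add: content_def)
next
  case False
  then have "{x\<in>{1..n}. tabloid x = p} = {}"
    using tab_row_bounds(3) tabloid_apply by auto
  then show ?thesis using False by (simp only: content_def) simp
qed

lemma comp_closed_tabloids: "comp_closed n tabloids"
proof -
  have "tabloids = (\<lambda>\<sigma>. tabloid \<circ> \<sigma>) ` {\<sigma>. \<sigma> permutes {1..n}}" by (auto simp: tabloids_def)
  then have "finite tabloids" by (simp add: finite_permutations)
  moreover have "f \<circ> \<sigma> \<in> tabloids" if "f \<in> tabloids" "\<sigma> permutes {1..n}" for f \<sigma>
    using that unfolding tabloids_def by (auto simp: comp_assoc intro!: permutes_compose)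
  ultimately show ?thesis by (auto simp: comp_closed_def)
qed

lemma tabloid_in: "tabloid \<in> tabloids"
  unfolding tabloids_def using permutes_id by (metis (mono_tags, lifting) CollectI comp_id)

lemma finite_col_perms: "finite col_perms"
  by (rule finite_subset[OF _ finite_permutations[of "{1..n}"]]) (auto simp: col_perms_def)

lemma col_permsD: "q \<in> col_perms \<Longrightarrow> q permutes {1..n}"
  "q \<in> col_perms \<Longrightarrow> x \<in> {1..n} \<Longrightarrow> tab_col \<eta> (q x) = tab_col \<eta> x"
  by (auto simp: col_perms_def)

lemma col_perms_comp: "p \<in> col_perms \<Longrightarrow> q \<in> col_perms \<Longrightarrow> p \<circ> q \<in> col_perms"
  using permutes_compose[of q "{1..n}" p] permutes_in_image[of q "{1..n}"]
  by (auto simp: col_perms_def)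

lemma col_perms_inv: "q \<in> col_perms \<Longrightarrow> inv' q \<in> col_perms"
proof -
  assume q: "q \<in> col_perms"
  then have p: "q permutes {1..n}" by (rule col_permsD)
  have "tab_col \<eta> (inv' q x) = tab_col \<eta> x" if "x \<in> {1..n}" for x
  proof -
    have "inv' q x \<in> {1..n}" using permutes_in_image[OF permutes_inv[OF p]] that by blast
    then show ?thesis using col_permsD(2)[OF q, of "inv' q x"] permutes_inverses[OF p] by simp
  qed
  then show ?thesis using permutes_inv[OF p] by (simp add: col_perms_def)
qed

lemma col_perms_transpose:
  assumes "x \<in> {1..n}" "y \<in> {1..n}" "tab_col \<eta> x = tab_col \<eta> y"
  shows "transpose x y \<in> col_perms"
  using assms permutes_swap_id[of x "{1..n}" y] by (auto simp: col_perms_def transpose_def)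

lemma polytabloid_eq:
  "e f = (\<Sum>q\<in>col_perms. if f = tabloid \<circ> inv' q then of_int (sign q) else 0)"
proof -
  have "inv\<^bsub>sym_group n\<^esub> q = inv' q" if "q permutes {1..n}" for q
    using that sym_group_inv_equality[of q n] by (simp add: sym_group_carrier)
  then show ?thesis
    unfolding polytabloid_def tabloid_def[symmetric] col_perms_def
    by (intro sum.cong refl) simp
qed

lemma polytabloid_nonzero:
  assumes "e f \<noteq> 0"
  obtains q where "q \<in> col_perms" "f = tabloid \<circ> q"
proof -
  obtain q where "q \<in> col_perms"
      "(if f = tabloid \<circ> inv' q then of_int (sign q) else (0::complex)) \<noteq> 0"
    using assms unfolding polytabloid_eq by (rule sum.not_neutral_contains_not_neutral)
  then have "inv' q \<in> col_perms" "f = tabloid \<circ> inv' q"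
    using col_perms_inv by (auto split: if_splits)
  then show ?thesis by (rule that)
qed

lemma polytabloid_tabloids: "e f \<noteq> 0 \<Longrightarrow> f \<in> tabloids"
  by (erule polytabloid_nonzero) (use col_permsD(1) in \<open>auto simp: tabloids_def\<close>)

lemma perm_cancel: "\<tau> permutes {1..n} \<Longrightarrow> f \<circ> \<tau> = g \<longleftrightarrow> f = g \<circ> inv' \<tau>" for f g :: "nat \<Rightarrow> nat"
  using permutes_inv_o[of \<tau> "{1..n}"] by (metis comp_assoc comp_id)

lemma polytabloid_antisym:
  assumes "\<tau> \<in> col_perms"
  shows "e (f \<circ> \<tau>) = of_int (sign \<tau>) * e f"
proof -
  have p: "\<tau> permutes {1..n}" using assms by (rule col_permsD)
  have "e (f \<circ> \<tau>) = (\<Sum>q\<in>col_perms. if f \<circ> \<tau> = tabloid \<circ> inv' q then of_int (sign q) else 0)"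
    by (rule polytabloid_eq)
  also have "\<dots> = (\<Sum>q\<in>col_perms. if f = tabloid \<circ> inv' q then of_int (sign \<tau> * sign q) else 0)"
  proof (rule sum.reindex_bij_witness[where i = "\<lambda>q. inv' \<tau> \<circ> q" and j = "\<lambda>q. \<tau> \<circ> q"])
    fix q assume q: "q \<in> col_perms"
    then have qp: "q permutes {1..n}" by (rule col_permsD)
    show "inv' \<tau> \<circ> (\<tau> \<circ> q) = q" "\<tau> \<circ> (inv' \<tau> \<circ> q) = q"
      using permutes_inv_o[OF p] by (simp_all flip: comp_assoc)
    show "\<tau> \<circ> q \<in> col_perms" "inv' \<tau> \<circ> q \<in> col_perms"
      using q assms col_perms_inv col_perms_comp by blast+
    have fin: "permutation \<tau>" "permutation q"
      using p qp permutation_permutes by blast+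
    have "f \<circ> \<tau> = tabloid \<circ> inv' q \<longleftrightarrow> f = tabloid \<circ> inv' (\<tau> \<circ> q)"
      unfolding perm_cancel[OF p] o_inv_distrib[OF permutes_bij[OF p] permutes_bij[OF qp]] comp_assoc
      by (rule refl)
    moreover have "sign \<tau> * sign (\<tau> \<circ> q) = sign q"
      using fin by (simp add: sign_compose sign_idempotent flip: mult.assoc)
    ultimately show "(if f = tabloid \<circ> inv' (\<tau> \<circ> q) then of_int (sign \<tau> * sign (\<tau> \<circ> q)) else 0)
      = (if f \<circ> \<tau> = tabloid \<circ> inv' q then of_int (sign q) else (0::complex))"
      by simp
  qed
  also have "\<dots> = of_int (sign \<tau>) * e f"
    unfolding polytabloid_eq sum_distrib_left by (intro sum.cong refl) auto
  finally show ?thesis .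
qed

lemma polytabloid_tabloid: "e tabloid = 1"
proof -
  have "tabloid = tabloid \<circ> inv' q \<longleftrightarrow> q = id" if q: "q \<in> col_perms" for q
  proof
    assume a: "tabloid = tabloid \<circ> inv' q"
    have p: "q permutes {1..n}" using q by (rule col_permsD)
    have in_x: "inv' q x = x" if x: "x \<in> {1..n}" for x
    proof -
      have i: "inv' q x \<in> {1..n}" using permutes_in_image[OF permutes_inv[OF p]] x by blast
      have "tabloid x = tabloid (inv' q x)" using a by (metis comp_apply)
      then show ?thesis
        using tab_inj[OF i x] i x col_permsD(2)[OF col_perms_inv[OF q] x] by (simp add: tabloid_apply)
    qed
    have out_x: "inv' q x = x" if "x \<notin> {1..n}" for x
      using permutes_inv[OF p] that by (rule permutes_not_in)
    have "inv' q = id" by (rule ext) (metis in_x out_x id_apply)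
    then show "q = id" using permutes_inv_o[OF p] by (metis id_comp comp_id)
  qed auto
  then have "e tabloid = (\<Sum>q\<in>col_perms. if q = id then 1 else 0)"
    unfolding polytabloid_eq by (intro sum.cong refl) auto
  moreover have "id \<in> col_perms" by (auto simp: col_perms_def permutes_id)
  ultimately show ?thesis using finite_col_perms by simp
qed

text \<open>Compare, column by column, the entries in rows above \<open>i\<close>: a tabloid that is injective on
  columns has at most as many of them as the standard one, and in total equally many. Hence
  each column has its entries in the top rows, like the standard tableau.\<close>

lemma column_injective:
  assumes f: "f \<in> tabloids"
    and inj: "\<And>x y. x \<in> {1..n} \<Longrightarrow> y \<in> {1..n} \<Longrightarrow> tab_col \<eta> x = tab_col \<eta> y \<Longrightarrow> f x = f y \<Longrightarrow> x = y"
  obtains q where "q \<in> col_perms" "f = tabloid \<circ> q"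
proof -
  define col where "col c = {x\<in>{1..n}. tab_col \<eta> x = c}" for c
  define low where "low g c i = {x\<in>col c. g x < i}" for g :: "nat \<Rightarrow> nat" and c i
  obtain \<sigma> where \<sigma>: "\<sigma> permutes {1..n}" "f = tabloid \<circ> \<sigma>" using f by (auto simp: tabloids_def)
  have fin: "finite (col c)" "finite (low g c i)" for g c i by (auto simp: col_def low_def)
  have tab_image: "tabloid ` col c = {..<card (col c)}" for c
  proof -
    have inj_t: "inj_on tabloid (col c)"
      using tab_inj by (auto simp: inj_on_def col_def tabloid_apply)
    have down: "i' \<in> tabloid ` col c" if d: "i \<in> tabloid ` col c" "i' < i" for i i'
    proof -
      obtain x where x0: "x \<in> col c" "i = tabloid x"
        using d(1) by blast
      then have x: "x \<in> {1..n}" "tab_col \<eta> x = c" "tab_row \<eta> x = i"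
        using tabloid_apply[of x] by (auto simp: col_def)
      have "c \<le> \<eta> ! i'"
        using tab_col_bounds[OF x(1)] part_mono[of i' i] tab_row_bounds(3)[OF x(1)] x that by auto
      moreover have "1 \<le> c" "i' < length \<eta>"
        using tab_col_bounds[OF x(1)] tab_row_bounds(3)[OF x(1)] x that by auto
      ultimately obtain y where "y \<in> {1..n}" "tab_row \<eta> y = i'" "tab_col \<eta> y = c"
        using tab_surj by blast
      then show ?thesis by (auto simp: col_def tabloid_apply intro!: image_eqI[of _ _ y])
    qed
    define A where "A = tabloid ` col c"
    have cA: "card A = card (col c)" unfolding A_def using inj_t by (rule card_image)
    have finA: "finite A" unfolding A_def using fin by simp
    have "A = {..<card A}"
    proof (cases "A = {}")
      case False
      then have "{..Max A} \<subseteq> A"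
        using down Max_in[OF finA False] unfolding A_def[symmetric]
        by (metis atMost_iff le_neq_implies_less subsetI)
      moreover have "A \<subseteq> {..Max A}" using finA by auto
      ultimately have "A = {..Max A}" by blast
      then show ?thesis by (metis card_atMost lessThan_Suc_atMost)
    qed simp
    then show ?thesis unfolding A_def[symmetric] cA .
  qed
  have f_inj: "inj_on f (col c)" for c using inj by (auto simp: inj_on_def col_def)
  have t_inj: "inj_on tabloid (col c)" for c
    using tab_inj by (auto simp: inj_on_def col_def tabloid_apply)
  have low_t: "card (low tabloid c i) = min (card (col c)) i" for c i
  proof -
    have "tabloid ` low tabloid c i = {..<card (col c)} \<inter> {..<i}"
      using tab_image[of c] by (auto simp: low_def)
    moreover have "card (tabloid ` low tabloid c i) = card (low tabloid c i)"
      by (intro card_image inj_on_subset[OF t_inj[of c]]) (auto simp: low_def)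
    moreover have "{..<card (col c)} \<inter> {..<i} = {..<min (card (col c)) i}" by auto
    ultimately show ?thesis by simp
  qed
  have low_f: "card (low f c i) \<le> min (card (col c)) i" for c i
  proof -
    have "card (f ` low f c i) = card (low f c i)"
      by (intro card_image inj_on_subset[OF f_inj[of c]]) (auto simp: low_def)
    moreover have "card (f ` low f c i) \<le> card {..<i}"
      by (intro card_mono) (auto simp: low_def)
    moreover have "card (low f c i) \<le> card (col c)"
      by (intro card_mono fin) (auto simp: low_def)
    ultimately show ?thesis by simp
  qed
  define C where "C = tab_col \<eta> ` {1..n}"
  have total: "(\<Sum>c\<in>C. card (low g c i)) = card {x\<in>{1..n}. g x < i}" for g i
  proof -
    have "(\<Sum>c\<in>C. card (low g c i)) = card (\<Union>c\<in>C. low g c i)"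
      by (rule card_UN_disjoint[symmetric]) (auto simp: fin C_def, auto simp: low_def col_def)
    also have "(\<Union>c\<in>C. low g c i) = {x\<in>{1..n}. g x < i}"
      by (auto simp: low_def col_def C_def)
    finally show ?thesis .
  qed
  have same: "card {x\<in>{1..n}. f x < i} = card {x\<in>{1..n}. tabloid x < i}" for i
  proof (rule bij_betw_same_card[of \<sigma>], rule bij_betw_byWitness[where f' = "inv' \<sigma>"])
    show "\<sigma> ` {x\<in>{1..n}. f x < i} \<subseteq> {x\<in>{1..n}. tabloid x < i}"
      using permutes_in_image[OF \<sigma>(1)] \<sigma>(2) by auto
    show "inv' \<sigma> ` {x\<in>{1..n}. tabloid x < i} \<subseteq> {x\<in>{1..n}. f x < i}"
      using permutes_in_image[OF permutes_inv[OF \<sigma>(1)]] permutes_inverses[OF \<sigma>(1)] \<sigma>(2) by auto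
  qed (use permutes_inverses[OF \<sigma>(1)] in auto)
  have low_eq: "card (low f c i) = min (card (col c)) i" if "c \<in> C" for c i
  proof (rule ccontr)
    assume "card (low f c i) \<noteq> min (card (col c)) i"
    then have "card (low f c i) < card (low tabloid c i)"
      using low_f[of c i] low_t[of c i] by linarith
    then have "(\<Sum>c\<in>C. card (low f c i)) < (\<Sum>c\<in>C. card (low tabloid c i))"
      using that low_f low_t by (intro sum_strict_mono_ex1) (auto simp: C_def)
    then show False using total[of f i] total[of tabloid i] same[of i] by simp
  qed
  have f_image: "f x \<in> tabloid ` col (tab_col \<eta> x)" if x: "x \<in> {1..n}" for x
  proof -
    let ?c = "tab_col \<eta> x"
    have "?c \<in> C" using x by (auto simp: C_def)
    then have "card (low f ?c (card (col ?c))) = card (col ?c)"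
      using low_eq by simp
    then have "low f ?c (card (col ?c)) = col ?c"
      using fin by (intro card_subset_eq) (auto simp: low_def)
    moreover have "x \<in> col ?c" using x by (simp add: col_def)
    ultimately have "f x < card (col ?c)" by (auto simp: low_def)
    then show ?thesis by (simp add: tab_image)
  qed
  define q where "q x = (if x \<in> {1..n} then SOME y. y \<in> col (tab_col \<eta> x) \<and> tabloid y = f x else x)" for x
  have q: "q x \<in> {1..n}" "tab_col \<eta> (q x) = tab_col \<eta> x" "tabloid (q x) = f x" if "x \<in> {1..n}" for x
  proof -
    have "\<exists>y. y \<in> col (tab_col \<eta> x) \<and> tabloid y = f x" using f_image[OF that] by auto
    then have "q x \<in> col (tab_col \<eta> x) \<and> tabloid (q x) = f x"
      using that someI_ex[of "\<lambda>y. y \<in> col (tab_col \<eta> x) \<and> tabloid y = f x"] by (simp add: q_def)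
    then show "q x \<in> {1..n}" "tab_col \<eta> (q x) = tab_col \<eta> x" "tabloid (q x) = f x"
      by (auto simp: col_def)
  qed
  have "inj_on q {1..n}" using q inj by (metis inj_onI)
  moreover have "q ` {1..n} \<subseteq> {1..n}" using q by blast
  ultimately have "bij_betw q {1..n} {1..n}"
    by (metis bij_betw_def endo_inj_surj finite_atLeastAtMost)
  then have "q permutes {1..n}"
    by (rule bij_imp_permutes) (auto simp: q_def)
  then have "q \<in> col_perms" using q by (simp add: col_perms_def)
  moreover have "f = tabloid \<circ> q"
  proof
    fix x
    show "f x = (tabloid \<circ> q) x"
    proof (cases "x \<in> {1..n}")
      case False
      have "\<sigma> x = x" using \<sigma>(1) False by (rule permutes_not_in)
      moreover have "q x = x" unfolding q_def using False by (rule if_not_P)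
      ultimately show ?thesis by (simp add: \<sigma>(2))
    qed (use q in auto)
  qed
  ultimately show ?thesis using that by blast
qed

text \<open>A tabloid with two equal letters in a column is fixed by an odd column permutation, so \<open>u\<close>
  vanishes there. All other tabloids are column permutations of the standard one.\<close>

lemma antisym_unique:
  assumes u: "u \<in> funs_on tabloids"
    and anti: "\<And>q f. q \<in> col_perms \<Longrightarrow> u (f \<circ> q) = of_int (sign q) * u f"
  shows "u = (\<lambda>f. u tabloid * e f)"
proof
  fix f
  show "u f = u tabloid * e f"
  proof (cases "f \<in> tabloids")
    case False
    then show ?thesis using u polytabloid_tabloids[of f] by (auto simp: funs_on_def)
  next
    case True
    show ?thesis
    proof (cases "\<exists>x\<in>{1..n}. \<exists>y\<in>{1..n}. x \<noteq> y \<and> tab_col \<eta> x = tab_col \<eta> y \<and> f x = f y")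
      case True
      then obtain x y where xy: "x \<in> {1..n}" "y \<in> {1..n}" "x \<noteq> y" "tab_col \<eta> x = tab_col \<eta> y" "f x = f y"
        by blast
      have t: "transpose x y \<in> col_perms" using col_perms_transpose xy by blast
      have "f \<circ> transpose x y = f" using xy by (auto simp: fun_eq_iff transpose_def)
      moreover have "sign (transpose x y) = -1" using xy by (simp add: sign_swap_id)
      ultimately have "u f = - u f" "e f = - e f"
        using anti[OF t, of f] polytabloid_antisym[OF t, of f] by simp_all
      then show ?thesis by simp
    next
      case False
      then obtain q where q: "q \<in> col_perms" "f = tabloid \<circ> q"
        using column_injective[OF True] by metis
      then show ?thesis
        using anti[OF q(1)] polytabloid_antisym[OF q(1)] polytabloid_tabloid by simp
    qed
  qed
qed

subsection \<open>Specht modules\<close>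

lemma specht_subspace: "cfun.subspace specht_space"
  by (simp add: specht_space_def cfun.subspace_span)

lemma specht_gen: "\<sigma> permutes {1..n} \<Longrightarrow> perm_act \<sigma> e \<in> specht_space"
  unfolding specht_space_def by (rule cfun.span_base) (auto simp: sym_group_def)

lemma specht_minimal:
  assumes "cfun.subspace U" "\<And>\<sigma>. \<sigma> permutes {1..n} \<Longrightarrow> perm_act \<sigma> e \<in> U"
  shows "specht_space \<subseteq> U"
  unfolding specht_space_def
  by (rule cfun.span_minimal) (use assms in \<open>auto simp: sym_group_def\<close>)

lemma polytabloid_in: "e \<in> specht_space"
  using specht_gen[OF permutes_id] by (simp add: perm_act_def)

lemma perm_stable_specht: "perm_stable n specht_space"
  unfolding perm_stable_def
proof (intro conjI specht_subspace allI impI)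
  fix \<sigma> :: "nat \<Rightarrow> nat" assume s: "\<sigma> permutes {1..n}"
  have "specht_space \<subseteq> {v. perm_act \<sigma> v \<in> specht_space}"
  proof (rule specht_minimal)
    show "cfun.subspace {v. perm_act \<sigma> v \<in> specht_space}"
      by (rule cfun.subspaceI)
        (simp_all only: mem_Collect_eq perm_act_0 perm_act_add perm_act_smult
          cfun.subspace_0[OF specht_subspace] subspace_add[OF specht_subspace]
          subspace_smult[OF specht_subspace])
    show "perm_act \<tau> e \<in> {v. perm_act \<sigma> v \<in> specht_space}" if "\<tau> permutes {1..n}" for \<tau>
      using specht_gen[OF permutes_compose[OF that s]] by (simp only: mem_Collect_eq perm_act_comp)
  qed
  then show "\<forall>v\<in>specht_space. perm_act \<sigma> v \<in> specht_space" by blast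
qed

lemma specht_supp: "specht_space \<subseteq> funs_on tabloids"
proof (rule specht_minimal[OF subspace_funs_on])
  fix \<sigma> :: "nat \<Rightarrow> nat" assume s: "\<sigma> permutes {1..n}"
  show "perm_act \<sigma> e \<in> funs_on tabloids"
    using polytabloid_tabloids comp_closed_iff[OF comp_closed_tabloids s]
    by (auto simp: funs_on_def perm_act_apply)
qed

sublocale fun_subspace tabloids specht_space
  using comp_closed_tabloids specht_subspace specht_supp by unfold_locales (auto simp: comp_closed_def)

text \<open>An endomorphism maps the polytabloid to a vector that is antisymmetric under column
  permutations too, hence to a multiple of the polytabloid, which generates the module.\<close>

lemma specht_endo_scalar:
  assumes supp: "\<And>v. v \<in> specht_space \<Longrightarrow> Q v \<in> funs_on tabloids"
    and add: "\<And>u v. u \<in> specht_space \<Longrightarrow> v \<in> specht_space \<Longrightarrow> Q (u + v) = Q u + Q v"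
    and smult: "\<And>c v. v \<in> specht_space \<Longrightarrow> Q (\<lambda>f. c * v f) = (\<lambda>f. c * Q v f)"
    and perm: "\<And>\<sigma> v. \<sigma> permutes {1..n} \<Longrightarrow> v \<in> specht_space \<Longrightarrow> Q (perm_act \<sigma> v) = perm_act \<sigma> (Q v)"
  obtains c where "\<And>v. v \<in> specht_space \<Longrightarrow> Q v = (\<lambda>f. c * v f)"
proof -
  have Qe: "Q e = (\<lambda>f. Q e tabloid * e f)"
  proof (rule antisym_unique[OF supp[OF polytabloid_in]])
    fix q f assume q: "q \<in> col_perms"
    have "perm_act q e = (\<lambda>f. of_int (sign q) * e f)"
      by (rule ext) (simp add: perm_act_apply polytabloid_antisym[OF q])
    then have "perm_act q (Q e) = (\<lambda>f. of_int (sign q) * Q e f)"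
      using perm[OF col_permsD(1)[OF q] polytabloid_in] smult[OF polytabloid_in] by simp
    then show "Q e (f \<circ> q) = of_int (sign q) * Q e f"
      by (metis perm_act_apply)
  qed
  define c where "c = Q e tabloid"
  have "specht_space \<subseteq> {v. v \<in> specht_space \<and> Q v = (\<lambda>f. c * v f)}"
  proof (rule specht_minimal)
    show "cfun.subspace {v. v \<in> specht_space \<and> Q v = (\<lambda>f. c * v f)}"
    proof (rule cfun.subspaceI)
      have "Q 0 = 0" using smult[OF cfun.subspace_0[OF specht_subspace], of 0] by (simp add: zero_fun_def)
      then show "0 \<in> {v. v \<in> specht_space \<and> Q v = (\<lambda>f. c * v f)}"
        using cfun.subspace_0[OF specht_subspace] by (simp add: zero_fun_def)
      show "x + y \<in> {v. v \<in> specht_space \<and> Q v = (\<lambda>f. c * v f)}"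
        if "x \<in> {v. v \<in> specht_space \<and> Q v = (\<lambda>f. c * v f)}" "y \<in> {v. v \<in> specht_space \<and> Q v = (\<lambda>f. c * v f)}" for x y
      proof -
        have xy: "x \<in> specht_space" "y \<in> specht_space" "Q x = (\<lambda>f. c * x f)" "Q y = (\<lambda>f. c * y f)"
          using that by auto
        have "Q (x + y) = (\<lambda>f. c * x f) + (\<lambda>f. c * y f)"
          by (simp only: add xy)
        also have "\<dots> = (\<lambda>f. c * (x + y) f)" by (rule ext) (simp add: algebra_simps)
        finally show ?thesis using xy subspace_add[OF specht_subspace, of x y] by blast
      qed
      show "(\<lambda>f. a * x f) \<in> {v. v \<in> specht_space \<and> Q v = (\<lambda>f. c * v f)}"
        if "x \<in> {v. v \<in> specht_space \<and> Q v = (\<lambda>f. c * v f)}" for a x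
      proof -
        have "Q (\<lambda>f. a * x f) = (\<lambda>f. a * (\<lambda>f. c * x f) f)" using that smult[of x a] by simp
        also have "\<dots> = (\<lambda>f. c * (a * x f))" by (rule ext) simp
        finally show ?thesis using that subspace_smult[OF specht_subspace, of x a] by blast
      qed
    qed
    show "perm_act \<sigma> e \<in> {v. v \<in> specht_space \<and> Q v = (\<lambda>f. c * v f)}" if s: "\<sigma> permutes {1..n}" for \<sigma>
    proof -
      have "Q (perm_act \<sigma> e) = perm_act \<sigma> (Q e)" by (rule perm[OF s polytabloid_in])
      also have "\<dots> = perm_act \<sigma> (\<lambda>f. c * e f)" using Qe by (simp add: c_def)
      also have "\<dots> = (\<lambda>f. c * perm_act \<sigma> e f)" by (rule perm_act_smult)
      finally show ?thesis using specht_gen[OF s] by simp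
    qed
  qed
  then show ?thesis using that by blast
qed

text \<open>If some term is nonzero, two equal letters of \<open>w\<close> lie in the same column, and the
  transposition of their places fixes the sum but changes its sign.\<close>

lemma polytabloid_raise:
  assumes "p < q"
  shows "(\<Sum>k | k \<in> {1..n} \<and> w k = p. e (w(k := q))) = 0"
proof (cases "\<forall>k\<in>{1..n}. w k = p \<longrightarrow> e (w(k := q)) = 0")
  case False
  then obtain k where k: "k \<in> {1..n}" "w k = p" "e (w(k := q)) \<noteq> 0" by blast
  obtain s where s: "s \<in> col_perms" "w(k := q) = tabloid \<circ> s"
    using polytabloid_nonzero[OF k(3)] by metis
  have sp: "s permutes {1..n}" using s(1) by (rule col_permsD)
  have sk: "s k \<in> {1..n}" using permutes_in_image[OF sp] k by blast
  have row: "tab_row \<eta> (s k) = q" using s(2) sk by (metis comp_apply fun_upd_same tabloid_apply)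
  have "tab_col \<eta> k \<le> \<eta> ! p"
    using tab_col_bounds[OF sk] col_permsD(2)[OF s(1) k(1)] row part_mono[of p q] assms
      tab_row_bounds(3)[OF sk] by simp
  moreover have "1 \<le> tab_col \<eta> k" "p < length \<eta>"
    using tab_col_bounds[OF k(1)] tab_row_bounds(3)[OF sk] row assms by auto
  ultimately obtain y where y: "y \<in> {1..n}" "tab_row \<eta> y = p" "tab_col \<eta> y = tab_col \<eta> k"
    using tab_surj by blast
  define z where "z = inv' s y"
  have z: "z \<in> {1..n}" "s z = y"
    using permutes_in_image[OF permutes_inv[OF sp]] y permutes_inverses[OF sp] by (auto simp: z_def)
  have "(w(k := q)) z = p" using s(2) z y by (simp add: tabloid_apply)
  then have zk: "z \<noteq> k" "w z = p" using assms by (auto split: if_splits)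
  have "tab_col \<eta> z = tab_col \<eta> k" using col_permsD(2)[OF s(1) z(1)] z y by simp
  then have t: "transpose k z \<in> col_perms" using k z by (intro col_perms_transpose) auto
  let ?t = "transpose k z"
  have tp: "?t permutes {1..n}" using t by (rule col_permsD)
  have wt: "w \<circ> ?t = w" using zk k by (auto simp: fun_eq_iff transpose_def)
  let ?S = "\<Sum>k | k \<in> {1..n} \<and> w k = p. e (w(k := q))"
  have "?S = (\<Sum>k | k \<in> {1..n} \<and> w k = p. e (w(?t k := q)))"
    by (rule sum.reindex_bij_witness[where i = ?t and j = ?t])
      (use zk k z in \<open>auto simp: transpose_def\<close>)
  also have "\<dots> = (\<Sum>k | k \<in> {1..n} \<and> w k = p. - e (w(k := q)))"
  proof (intro sum.cong refl)
    fix x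
    have "w(x := q) = w(?t x := q) \<circ> ?t"
      using upd_comp_perm[OF tp, of w x q] wt by simp
    then have "e (w(x := q)) = of_int (sign ?t) * e (w(?t x := q))"
      using polytabloid_antisym[OF t] by simp
    then show "e (w(?t x := q)) = - e (w(x := q))" using zk by (simp add: sign_swap_id)
  qed
  finally show ?thesis by (simp add: sum_negf)
qed (auto intro: sum.neutral)

end

subsection \<open>The Schur functor on Specht modules\<close>

lemma ip_sum_left: "ip X (\<lambda>f. \<Sum>a\<in>A. c a * u a f) v = (\<Sum>a\<in>A. c a * ip X (u a) v)"
  unfolding ip_def sum_distrib_right sum_distrib_left
  by (subst sum.swap) (simp add: mult.assoc)

abbreviation triv :: "(nat \<Rightarrow> nat) \<Rightarrow> complex" where
  "triv \<equiv> \<lambda>_. 1"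

lemma schur_perm_act:
  assumes "\<Phi> \<in> schur n r triv W" "\<sigma> permutes {1..n}"
  shows "perm_act \<sigma> (\<lambda>f. \<Phi> (w \<circ> \<sigma>, f)) = (\<lambda>f. \<Phi> (w, f))"
  using schurD(3)[OF assms] by (simp add: perm_act_def)

context specht_shape
begin

text \<open>A column with more than \<open>r\<close> places carries the same letter twice.\<close>

lemma schur_specht_zero:
  assumes r: "length \<eta> > r" and \<Phi>: "\<Phi> \<in> schur n r triv specht_space"
  shows "\<Phi> = 0"
proof -
  have "(\<lambda>f. \<Phi> (w, f)) = 0" if w: "w \<in> words n r" for w
  proof (rule orth_zero)
    let ?v = "\<lambda>f. \<Phi> (w, f)"
    show "?v \<in> specht_space" by (rule schurD(2)[OF \<Phi>])
    have orth: "specht_space \<subseteq> {b. ip tabloids ?v b = 0}"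
    proof (rule specht_minimal)
      show "cfun.subspace {b. ip tabloids ?v b = 0}"
        by (rule cfun.subspaceI) (auto simp: ip_def algebra_simps sum.distrib simp flip: sum_distrib_left)
      fix \<sigma> :: "nat \<Rightarrow> nat" assume s: "\<sigma> permutes {1..n}"
      define A where "A = {x\<in>{1..n}. tab_col \<eta> x = 1}"
      have "length \<eta> \<le> card A"
      proof -
        have "\<exists>x. x \<in> A \<and> tab_row \<eta> x = i" if "i < length \<eta>" for i
          using tab_surj[of i 1] part_pos[OF that] that unfolding A_def by blast
        then have "{..<length \<eta>} \<subseteq> tab_row \<eta> ` A" by blast
        then have "card {..<length \<eta>} \<le> card A"
          by (rule surj_card_le[rotated]) (simp add: A_def)
        then show ?thesis by simp
      qed
      moreover have "(w \<circ> \<sigma>) ` A \<subseteq> {..<r}"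
        using words_lt[OF w] permutes_in_image[OF s] by (auto simp: A_def)
      then have "card ((w \<circ> \<sigma>) ` A) \<le> r"
        using card_mono[of "{..<r}"] by fastforce
      ultimately have "\<not> inj_on (w \<circ> \<sigma>) A"
        using r card_image[of "w \<circ> \<sigma>" A] by linarith
      then obtain x y where xy: "x \<in> A" "y \<in> A" "x \<noteq> y" "w (\<sigma> x) = w (\<sigma> y)"
        by (auto simp: inj_on_def)
      let ?t = "transpose x y" and ?t' = "transpose (\<sigma> x) (\<sigma> y)"
      have t: "?t \<in> col_perms" using xy by (intro col_perms_transpose) (auto simp: A_def)
      have t': "?t' permutes {1..n}"
        using xy permutes_in_image[OF s] by (intro permutes_swap_id) (auto simp: A_def)
      have comm: "?t' \<circ> \<sigma> = \<sigma> \<circ> ?t"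
        using permutes_inj[OF s] by (auto simp: fun_eq_iff transpose_def inj_eq)
      have wt: "w \<circ> ?t' = w" using xy by (auto simp: fun_eq_iff transpose_def)
      have "perm_act ?t' ?v = ?v"
        using schur_perm_act[OF \<Phi> t', of w] by (simp only: wt)
      moreover have "perm_act ?t' (perm_act \<sigma> e) = (\<lambda>f. (-1) * perm_act \<sigma> e f)"
        unfolding perm_act_comp comm
        using polytabloid_antisym[OF t] xy by (simp add: perm_act_def sign_swap_id flip: comp_assoc)
      ultimately have "ip tabloids ?v (perm_act \<sigma> e) = ip tabloids ?v (\<lambda>f. (-1) * perm_act \<sigma> e f)"
        using ip_perm_act[OF comp_closed_tabloids t', of ?v "perm_act \<sigma> e"] by simp
      also have "\<dots> = - ip tabloids ?v (perm_act \<sigma> e)"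
        unfolding ip_smult_right by simp
      finally show "perm_act \<sigma> e \<in> {b. ip tabloids ?v b = 0}" by simp
    qed
    then show "ip tabloids ?v b = 0" if "b \<in> specht_space" for b
      using that by blast
  qed
  then show ?thesis
    using schurD(4)[OF \<Phi>] by (auto simp: fun_eq_iff)
qed

text \<open>The operator with kernel \<open>\<langle>\<Psi> w, \<Phi> w'\<rangle>\<close> maps \<open>\<Phi>\<close> to a multiple of \<open>\<Psi>\<close>, since
  \<open>v \<mapsto> \<Sum>\<^sub>w \<langle>v, \<Phi> w\<rangle> \<Phi> w\<close> is a positive endomorphism of the Specht module, hence a
  positive scalar.\<close>

lemma schur_specht_kernel:
  assumes \<Phi>S: "\<Phi> \<in> schur n r triv specht_space" and \<Phi>0: "\<Phi> \<noteq> 0"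
  obtains c where "c \<noteq> 0"
    "\<And>\<Psi>. \<Psi> \<in> schur n r triv specht_space
      \<Longrightarrow> kernel_op n r (\<lambda>w w'. ip tabloids (\<lambda>f. \<Psi> (w, f)) (\<lambda>f. \<Phi> (w', f))) \<Phi> = (\<lambda>b. c * \<Psi> b)"
proof -
  define Q where "Q v = (\<lambda>f. \<Sum>w\<in>words n r. ip tabloids v (\<lambda>f. \<Phi> (w, f)) * \<Phi> (w, f))" for v
  obtain c where c: "\<And>v. v \<in> specht_space \<Longrightarrow> Q v = (\<lambda>f. c * v f)"
  proof (rule specht_endo_scalar[of Q])
    show "Q v \<in> funs_on tabloids" for v
    proof -
      have "Q v \<in> specht_space"
        unfolding Q_def by (intro subspace_sum[OF specht_subspace] schurD(2)[OF \<Phi>S])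
      then show ?thesis using specht_supp by blast
    qed
    show "Q (u + v) = Q u + Q v" for u v
      by (rule ext) (simp add: Q_def ip_add_left algebra_simps sum.distrib)
    show "Q (\<lambda>f. c * v f) = (\<lambda>f. c * Q v f)" for c v
      by (rule ext) (simp add: Q_def ip_smult_left sum_distrib_left mult.assoc)
    fix \<sigma> :: "nat \<Rightarrow> nat" and v assume s: "\<sigma> permutes {1..n}"
    have "perm_act \<sigma> (Q v) f = Q (perm_act \<sigma> v) f" for f
    proof -
      have "perm_act \<sigma> (Q v) f = (\<Sum>w\<in>words n r. ip tabloids v (\<lambda>f. \<Phi> (w, f)) * \<Phi> (w, f \<circ> \<sigma>))"
        by (simp add: perm_act_def Q_def)
      also have "\<dots> = (\<Sum>w\<in>words n r. ip tabloids v (\<lambda>f. \<Phi> (w \<circ> \<sigma>, f)) * \<Phi> (w \<circ> \<sigma>, f \<circ> \<sigma>))"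
        using sum.reindex_bij_betw[OF bij_betw_words_comp[OF s],
          of "\<lambda>w. ip tabloids v (\<lambda>f. \<Phi> (w, f)) * \<Phi> (w, f \<circ> \<sigma>)" r] by simp
      also have "\<dots> = (\<Sum>w\<in>words n r. ip tabloids (perm_act \<sigma> v) (\<lambda>f. \<Phi> (w, f)) * \<Phi> (w, f))"
      proof (rule sum.cong[OF refl])
        fix w
        have "ip tabloids v (\<lambda>f. \<Phi> (w \<circ> \<sigma>, f)) = ip tabloids (perm_act \<sigma> v) (\<lambda>f. \<Phi> (w, f))"
          using ip_perm_act[OF comp_closed_tabloids s, of v "\<lambda>f. \<Phi> (w \<circ> \<sigma>, f)"]
          by (simp only: schur_perm_act[OF \<Phi>S s])
        then show "ip tabloids v (\<lambda>f. \<Phi> (w \<circ> \<sigma>, f)) * \<Phi> (w \<circ> \<sigma>, f \<circ> \<sigma>)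
          = ip tabloids (perm_act \<sigma> v) (\<lambda>f. \<Phi> (w, f)) * \<Phi> (w, f)"
          using schurD(3)[OF \<Phi>S s, of w f] by simp
      qed
      finally show ?thesis by (simp add: Q_def)
    qed
    then show "Q (perm_act \<sigma> v) = perm_act \<sigma> (Q v)" by (intro ext) simp
  qed blast
  have "c \<noteq> 0"
  proof
    assume c0: "c = 0"
    obtain w0 f0 where nz: "\<Phi> (w0, f0) \<noteq> 0" using \<Phi>0 by (auto simp: fun_eq_iff)
    then have w0: "w0 \<in> words n r" using schurD(4)[OF \<Phi>S] by blast
    let ?v = "\<lambda>f. \<Phi> (w0, f)" and ?s = "\<lambda>w f. \<Phi> (w, f)"
    have v: "?v \<in> specht_space" by (rule schurD(2)[OF \<Phi>S])
    have "of_real (\<Sum>w\<in>words n r. (cmod (ip tabloids ?v (?s w)))\<^sup>2)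
      = (\<Sum>w\<in>words n r. ip tabloids ?v (?s w) * ip tabloids (?s w) ?v)"
      unfolding of_real_sum complex_norm_square cnj_ip ..
    also have "\<dots> = ip tabloids (Q ?v) ?v"
      unfolding Q_def by (rule ip_sum_left[symmetric])
    also have "\<dots> = 0" using c[OF v] c0 by (simp add: ip_def)
    finally have "(\<Sum>w\<in>words n r. (cmod (ip tabloids ?v (?s w)))\<^sup>2) = 0"
      by (simp only: of_real_eq_0_iff)
    then have "ip tabloids ?v ?v = 0"
      using w0 finite_words[of n r] by (subst (asm) sum_nonneg_eq_0_iff) auto
    then have "?v = 0" using ip_self_eq_0[OF fin] v specht_supp by blast
    then show False using nz by (metis zero_fun_apply)
  qed
  show ?thesis
  proof (rule that[OF \<open>c \<noteq> 0\<close>], rule ext, clarify)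
    fix \<Psi> w f assume \<Psi>: "\<Psi> \<in> schur n r triv specht_space"
    show "kernel_op n r (\<lambda>w w'. ip tabloids (\<lambda>f. \<Psi> (w, f)) (\<lambda>f. \<Phi> (w', f))) \<Phi> (w, f) = c * \<Psi> (w, f)"
    proof (cases "w \<in> words n r")
      case True
      then have "kernel_op n r (\<lambda>w w'. ip tabloids (\<lambda>f. \<Psi> (w, f)) (\<lambda>f. \<Phi> (w', f))) \<Phi> (w, f)
        = Q (\<lambda>f. \<Psi> (w, f)) f"
        by (simp add: kernel_op_def Q_def)
      then show ?thesis using c[OF schurD(2)[OF \<Psi>]] by simp
    next
      case False
      then show ?thesis using schurD(4)[OF \<Psi>] by (simp add: kernel_op_def)
    qed
  qed
qed

lemma schur_ip_invariant:
  assumes "\<Phi> \<in> schur n r triv specht_space" "\<Psi> \<in> schur n r triv specht_space" "\<sigma> permutes {1..n}"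
  shows "ip tabloids (\<lambda>f. \<Psi> (w \<circ> \<sigma>, f)) (\<lambda>f. \<Phi> (w' \<circ> \<sigma>, f)) = ip tabloids (\<lambda>f. \<Psi> (w, f)) (\<lambda>f. \<Phi> (w', f))"
  using ip_perm_act[OF comp_closed_tabloids assms(3), of "\<lambda>f. \<Psi> (w \<circ> \<sigma>, f)" "\<lambda>f. \<Phi> (w' \<circ> \<sigma>, f)"]
  by (simp only: schur_perm_act[OF assms(1,3)] schur_perm_act[OF assms(2,3)])

text \<open>The kernel of \<open>schur_specht_kernel\<close> is invariant under simultaneous permutations, so the
  operator that it defines belongs to those generated by \<open>gl\<^sub>r\<close>.\<close>

lemma schur_specht_transitive:
  assumes T: "stable_words n r T" and sub: "T \<subseteq> schur n r triv specht_space"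
    and \<Phi>: "\<Phi> \<in> T" "\<Phi> \<noteq> 0" and \<Psi>: "\<Psi> \<in> schur n r triv specht_space"
  shows "\<Psi> \<in> T"
proof -
  have \<Phi>S: "\<Phi> \<in> schur n r triv specht_space" using sub \<Phi> by auto
  have Tsub: "cfun.subspace T" using T by (simp add: stable_words_def)
  obtain c where c: "c \<noteq> 0"
    "kernel_op n r (\<lambda>w w'. ip tabloids (\<lambda>f. \<Psi> (w, f)) (\<lambda>f. \<Phi> (w', f))) \<Phi> = (\<lambda>b. c * \<Psi> b)"
    using schur_specht_kernel[OF \<Phi>S \<Phi>(2)] \<Psi> by metis
  have "kernel_op n r (\<lambda>w w'. ip tabloids (\<lambda>f. \<Psi> (w, f)) (\<lambda>f. \<Phi> (w', f))) \<Phi> \<in> T"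
    by (rule stable_kernel_op[OF T \<Phi>(1)]) (rule schur_ip_invariant[OF \<Phi>S \<Psi>])
  then have "(\<lambda>b. (1 / c) * (c * \<Psi> b)) \<in> T"
    unfolding c(2) by (rule subspace_smult[OF Tsub])
  then show ?thesis using c(1) by simp
qed

text \<open>The sum of \<open>w \<otimes> P w\<close> over all words \<open>w\<close>, where \<open>P\<close> is the orthogonal projection to the
  Specht module. Only the words among the tabloids contribute, and all of these have content
  \<open>\<eta>\<close>.\<close>

definition specht_hw :: "nat \<Rightarrow> (nat \<Rightarrow> nat) \<times> (nat \<Rightarrow> nat) \<Rightarrow> complex" where
  "specht_hw r = (\<lambda>(w, f). if w \<in> words n r
     then orth_proj tabloids specht_space (\<lambda>f. if f = w then 1 else 0) f else 0)"

lemma ip_point: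
  "ip tabloids (\<lambda>f. if f = w then 1 else 0) b = (if w \<in> tabloids then cnj (b w) else 0)"
proof -
  have "ip tabloids (\<lambda>f. if f = w then 1 else 0) b = (\<Sum>f\<in>tabloids. if f = w then cnj (b w) else 0)"
    unfolding ip_def by (intro sum.cong refl) auto
  then show ?thesis using fin by simp
qed

lemma specht_hw_schur: "specht_hw r \<in> schur n r triv specht_space"
  unfolding schur_def
proof (intro CollectI conjI allI impI)
  show "specht_hw r \<in> word_funs n r"
    by (auto simp: specht_hw_def word_funs_def funs_on_def)
  show "(\<lambda>f. specht_hw r (w, f)) \<in> specht_space" for w
  proof (cases "w \<in> words n r")
    case True
    then show ?thesis using orth_proj(1) by (simp add: specht_hw_def)
  next
    case False
    then show ?thesis using cfun.subspace_0[OF specht_subspace]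
      by (simp add: specht_hw_def zero_fun_def)
  qed
  fix \<sigma> :: "nat \<Rightarrow> nat" and w f :: "nat \<Rightarrow> nat" assume s: "\<sigma> permutes {1..n}"
  have inj: "f \<circ> \<sigma> = w \<circ> \<sigma> \<longleftrightarrow> f = w" for f :: "nat \<Rightarrow> nat"
    using permutes_surj[OF s] by (metis surj_fun_eq comp_apply)
  have "perm_act \<sigma> (\<lambda>f. if f = w \<circ> \<sigma> then 1 else 0) = (\<lambda>f. if f = w then 1 else 0)"
    by (simp add: perm_act_def inj)
  then have "perm_act \<sigma> (orth_proj tabloids specht_space (\<lambda>f. if f = w \<circ> \<sigma> then 1 else 0))
    = orth_proj tabloids specht_space (\<lambda>f. if f = w then 1 else 0)"
    using orth_proj_perm_act[OF comp_closed_tabloids perm_stable_specht specht_supp s] by metis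
  then have "orth_proj tabloids specht_space (\<lambda>f. if f = w \<circ> \<sigma> then 1 else 0) (f \<circ> \<sigma>)
    = orth_proj tabloids specht_space (\<lambda>f. if f = w then 1 else 0) f"
    by (metis perm_act_apply)
  then show "specht_hw r (w \<circ> \<sigma>, f \<circ> \<sigma>) = 1 * specht_hw r (w, f)"
    using words_comp[OF s] by (simp add: specht_hw_def)
qed

lemma specht_hw_content:
  assumes "specht_hw r (w, f) \<noteq> 0"
  shows "content n w p = (if p < length \<eta> then \<eta> ! p else 0)"
proof -
  have "w \<in> tabloids"
  proof (rule ccontr)
    assume "w \<notin> tabloids"
    then have "orth_proj tabloids specht_space (\<lambda>f. if f = w then 1 else 0) = 0"
      by (intro orth_proj_zero) (simp add: ip_point)
    then show False using assms by (simp add: specht_hw_def split: if_splits)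
  qed
  then obtain \<sigma> where "\<sigma> permutes {1..n}" "w = tabloid \<circ> \<sigma>" by (auto simp: tabloids_def)
  then show ?thesis by (simp add: content_comp content_tabloid)
qed

lemma specht_hw_nonzero:
  assumes "length \<eta> \<le> r"
  shows "specht_hw r \<noteq> 0"
proof
  assume 0: "specht_hw r = 0"
  have t: "tabloid \<in> words n r"
    using assms tab_row_bounds(3) by (fastforce simp: tabloid_def words_def)
  let ?d = "\<lambda>f. if f = tabloid then 1 else (0::complex)"
  have "orth_proj tabloids specht_space ?d f = specht_hw r (tabloid, f)" for f
    using t by (simp add: specht_hw_def)
  then have "orth_proj tabloids specht_space ?d = 0" using 0 by (auto simp: fun_eq_iff)
  then have "ip tabloids ?d e = 0" using orth_proj(2)[OF polytabloid_in, of ?d] by (simp only: diff_zero)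
  then show False using tabloid_in by (simp add: ip_point polytabloid_tabloid)
qed

text \<open>By \<open>polytabloid_raise\<close> the sum of the words that are obtained by replacing one \<open>p\<close> by \<open>q\<close> is
  orthogonal to all polytabloids.\<close>

lemma specht_hw_raise:
  assumes "p < q" "q < r"
  shows "word_act n r (elem_mat r p q) (specht_hw r) = 0"
proof (rule ext, clarify)
  fix w f
  show "word_act n r (elem_mat r p q) (specht_hw r) (w, f) = 0 (w, f)"
  proof (cases "w \<in> words n r")
    case w: True
    let ?K = "{k. k \<in> {1..n} \<and> w k = p}"
    let ?d = "\<lambda>w f. if f = w then 1 else (0::complex)"
    have "word_act n r (elem_mat r p q) (specht_hw r) (w, f)
      = (\<Sum>k\<in>?K. orth_proj tabloids specht_space (?d (w(k := q))) f)"
      using assms w words_upd[OF w] by (subst word_act_elem_apply) (auto simp: specht_hw_def intro!: sum.cong)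
    also have "\<dots> = orth_proj tabloids specht_space (\<Sum>k\<in>?K. ?d (w(k := q))) f"
      unfolding orth_proj_sum sum_fun_apply ..
    also have "orth_proj tabloids specht_space (\<Sum>k\<in>?K. ?d (w(k := q))) = 0"
    proof (rule orth_proj_zero)
      let ?D = "\<Sum>k\<in>?K. ?d (w(k := q))"
      have "specht_space \<subseteq> {b. ip tabloids ?D b = 0}"
      proof (rule specht_minimal)
        show "cfun.subspace {b. ip tabloids ?D b = 0}"
          by (rule cfun.subspaceI) (auto simp: ip_def algebra_simps sum.distrib simp flip: sum_distrib_left)
        fix \<sigma> :: "nat \<Rightarrow> nat" assume s: "\<sigma> permutes {1..n}"
        have D: "?D = (\<lambda>f. \<Sum>k\<in>?K. 1 * ?d (w(k := q)) f)"
          by (rule ext) (simp add: sum_fun_apply)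
        have "ip tabloids ?D (perm_act \<sigma> e) = (\<Sum>k\<in>?K. 1 * ip tabloids (?d (w(k := q))) (perm_act \<sigma> e))"
          unfolding D by (rule ip_sum_left)
        also have "\<dots> = (\<Sum>k\<in>?K. cnj (e (w(k := q) \<circ> \<sigma>)))"
        proof (rule sum.cong[OF refl])
          fix k
          show "1 * ip tabloids (?d (w(k := q))) (perm_act \<sigma> e) = cnj (e (w(k := q) \<circ> \<sigma>))"
            using polytabloid_tabloids[of "w(k := q) \<circ> \<sigma>"] comp_closed_iff[OF comp_closed_tabloids s]
            unfolding ip_point by (auto simp: perm_act_apply)
        qed
        also have "\<dots> = (\<Sum>k | k \<in> {1..n} \<and> (w \<circ> \<sigma>) k = p. cnj (e ((w \<circ> \<sigma>)(k := q))))"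
        proof (rule sum.reindex_bij_witness[where i = \<sigma> and j = "inv' \<sigma>"])
          fix k assume "k \<in> ?K"
          then show "inv' \<sigma> k \<in> {k \<in> {1..n}. (w \<circ> \<sigma>) k = p}"
            using permutes_in_image[OF permutes_inv[OF s]] permutes_inverses[OF s] by auto
          show "cnj (e ((w \<circ> \<sigma>)(inv' \<sigma> k := q))) = cnj (e (w(k := q) \<circ> \<sigma>))"
            using upd_comp_perm[OF s, of w "inv' \<sigma> k" q] permutes_inverses[OF s] by simp
        qed (use permutes_in_image[OF s] permutes_inverses[OF s] in auto)
        also have "\<dots> = cnj (\<Sum>k | k \<in> {1..n} \<and> (w \<circ> \<sigma>) k = p. e ((w \<circ> \<sigma>)(k := q)))"
          by simp
        also have "\<dots> = 0" by (simp only: polytabloid_raise[OF assms(1)] complex_cnj_zero)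
        finally show "perm_act \<sigma> e \<in> {b. ip tabloids ?D b = 0}" by simp
      qed
      then show "ip tabloids ?D b = 0" if "b \<in> specht_space" for b using that by blast
    qed
    finally show ?thesis by simp
  qed (simp add: word_act_def)
qed

lemma schur_specht_irreducible:
  assumes r: "length \<eta> \<le> r"
  defines "M \<equiv> word_rep n r (schur n r triv specht_space)"
  shows "gl_irreducible r M" "has_highest_weight r \<eta> M"
proof -
  let ?S = "schur n r triv specht_space"
  have st: "stable_words n r ?S" by (rule stable_schur[OF specht_subspace])
  have hw_in: "specht_hw r \<in> ?S" by (rule specht_hw_schur)
  show "gl_irreducible r M"
    unfolding gl_irreducible_def
  proof (intro conjI allI impI)
    show "gl_rep r M" unfolding M_def by (rule gl_rep_words[OF st])
    show "carrier M \<noteq> {\<zero>\<^bsub>M\<^esub>}"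
      using hw_in specht_hw_nonzero[OF r] by (auto simp: M_def)
    fix T assume T: "submodule T complex_ring M \<and> (\<forall>g\<in>carrier_mat r r. \<forall>v\<in>T. act M g v \<in> T)"
    interpret module complex_ring M
      unfolding M_def by (rule module_fun_mod[OF subspace_schur[OF specht_subspace]])
    have sub: "submodule T complex_ring M" using T by blast
    have TS: "T \<subseteq> ?S" using submoduleE(1)[OF sub] by (simp add: M_def)
    have T0: "0 \<in> T"
      using subgroup.one_closed[OF submodule.axioms(1)[OF sub]] by (simp add: M_def)
    have "cfun.subspace T"
    proof (rule cfun.subspaceI[OF T0])
      show "x + y \<in> T" if "x \<in> T" "y \<in> T" for x y
        using submoduleE(5)[OF sub that] by (simp add: M_def)
      show "(\<lambda>a. c * x a) \<in> T" if "x \<in> T" for c x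
        using submoduleE(4)[OF sub, of c x] that by (simp add: M_def)
    qed
    then have "stable_words n r T"
      unfolding stable_words_def using T TS st by (auto simp: M_def stable_words_def)
    then have "?S \<subseteq> T" if "\<Phi> \<in> T" "\<Phi> \<noteq> 0" for \<Phi>
      using schur_specht_transitive[OF _ TS that] by blast
    then show "T = {\<zero>\<^bsub>M\<^esub>} \<or> T = carrier M"
      using T0 TS by (simp add: M_def) blast
  qed
  show "has_highest_weight r \<eta> M"
    unfolding has_highest_weight_def
  proof (intro bexI[of _ "specht_hw r"] conjI allI impI)
    show "specht_hw r \<noteq> \<zero>\<^bsub>M\<^esub>" using specht_hw_nonzero[OF r] by (simp add: M_def)
    show "act M (elem_mat r p q) (specht_hw r) = \<zero>\<^bsub>M\<^esub>" if "p < q \<and> q < r" for p q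
      using specht_hw_raise that by (simp add: M_def)
    show "act M (elem_mat r p p) (specht_hw r)
      = of_nat (if p < length \<eta> then \<eta> ! p else 0) \<odot>\<^bsub>M\<^esub> specht_hw r" if "p < r" for p
      using word_act_diag[OF that, of "specht_hw r" n, OF specht_hw_content schurD(1)[OF hw_in]]
      by (simp add: M_def)
    show "specht_hw r \<in> carrier M" using hw_in by (simp add: M_def)
  qed
qed

end

subsection \<open>The irreducible modules of the general linear Lie algebra\<close>

text \<open>Since \<open>M'\<close> is a priori only a record of operations, the module axioms have to be carried over
  along \<open>h\<close> as well.\<close>

lemma gl_transport:
  fixes M :: "(complex, 'v, complex mat) rep" and M' :: "(complex, 'w, complex mat) rep"
  assumes irr: "gl_irreducible r M" and hw: "has_highest_weight r \<eta> M"
    and bij: "bij_betw h (carrier M) (carrier M')"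
    and add: "\<And>v w. v \<in> carrier M \<Longrightarrow> w \<in> carrier M \<Longrightarrow> h (v \<oplus>\<^bsub>M\<^esub> w) = h v \<oplus>\<^bsub>M'\<^esub> h w"
    and smult: "\<And>c v. v \<in> carrier M \<Longrightarrow> h (c \<odot>\<^bsub>M\<^esub> v) = c \<odot>\<^bsub>M'\<^esub> h v"
    and acts: "\<And>g v. g \<in> carrier_mat r r \<Longrightarrow> v \<in> carrier M \<Longrightarrow> h (act M g v) = act M' g (h v)"
    and zero: "h \<zero>\<^bsub>M\<^esub> = \<zero>\<^bsub>M'\<^esub>"
  shows "gl_irreducible r M' \<and> has_highest_weight r \<eta> M'"
proof -
  interpret A: gl_rep r M using irr by (simp add: gl_irreducible_def)
  have C: "carrier M' = h ` carrier M" using bij by (simp add: bij_betw_def)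
  have inj: "h x = h y \<longleftrightarrow> x = y" if "x \<in> carrier M" "y \<in> carrier M" for x y
    using bij that by (auto simp: bij_betw_def inj_on_def)
  have ag: "abelian_group M'"
  proof (rule abelian_groupI)
    fix x assume "x \<in> carrier M'"
    then obtain y where y: "x = h y" "y \<in> carrier M" by (auto simp: C)
    then have "h (\<ominus>\<^bsub>M\<^esub> y) \<oplus>\<^bsub>M'\<^esub> x = \<zero>\<^bsub>M'\<^esub>"
      by (simp add: add[symmetric] A.M.l_neg zero)
    then show "\<exists>y\<in>carrier M'. y \<oplus>\<^bsub>M'\<^esub> x = \<zero>\<^bsub>M'\<^esub>"
      using y by (auto simp: C)
  qed (auto simp: C add[symmetric] zero[symmetric] A.M.a_ac)
  have md: "module complex_ring M'"
    by (rule moduleI[OF cring_complex_ring ag])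
      (auto simp: C add[symmetric] smult[symmetric] A.smult_add_left A.smult_add_right A.smult_smult)
  interpret B: module complex_ring M' by (rule md)
  have neg: "\<ominus>\<^bsub>M'\<^esub> h y = h (\<ominus>\<^bsub>M\<^esub> y)" if "y \<in> carrier M" for y
    using that by (intro B.M.minus_equality) (auto simp: C add[symmetric] A.M.l_neg zero)
  have minus: "h x \<ominus>\<^bsub>M'\<^esub> h y = h (x \<ominus>\<^bsub>M\<^esub> y)" if "x \<in> carrier M" "y \<in> carrier M" for x y
    using that by (simp add: B.M.minus_eq A.M.minus_eq neg add)
  have gl: "gl_rep r M'"
  proof (rule gl_rep.intro[OF md], unfold_locales)
    fix a b :: "complex mat" and x
    assume ab: "a \<in> carrier_mat r r" "b \<in> carrier_mat r r" and "x \<in> carrier M'"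
    then obtain y where y: "x = h y" "y \<in> carrier M" by (auto simp: C)
    have c: "a * b - b * a \<in> carrier_mat r r" "a + b \<in> carrier_mat r r" using ab by auto
    show "act M' (a * b - b * a) x = act M' a (act M' b x) \<ominus>\<^bsub>M'\<^esub> act M' b (act M' a x)"
      using y ab c by (simp add: acts[symmetric] A.act_closed minus A.bracket_act)
    show "act M' (a + b) x = act M' a x \<oplus>\<^bsub>M'\<^esub> act M' b x"
      using y ab c by (simp add: acts[symmetric] A.act_closed A.add_act add[symmetric])
  qed (auto simp: C acts[symmetric] add[symmetric] smult[symmetric] A.act_closed A.act_add
      A.act_smult A.smult_act)
  have "gl_irreducible r M'"
    unfolding gl_irreducible_def
  proof (intro conjI allI impI gl)
    obtain v where "v \<in> carrier M" "v \<noteq> \<zero>\<^bsub>M\<^esub>"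
      using irr A.M.zero_closed unfolding gl_irreducible_def by blast
    then have "h v \<in> carrier M'" "h v \<noteq> \<zero>\<^bsub>M'\<^esub>"
      using inj[of v "\<zero>\<^bsub>M\<^esub>"] zero by (auto simp: C)
    then show "carrier M' \<noteq> {\<zero>\<^bsub>M'\<^esub>}" by blast
    fix S assume S: "submodule S complex_ring M' \<and> (\<forall>g\<in>carrier_mat r r. \<forall>v\<in>S. act M' g v \<in> S)"
    have sub: "submodule S complex_ring M'" using S by blast
    let ?T = "{x \<in> carrier M. h x \<in> S}"
    have hT: "h ` ?T = S" using B.submoduleE(1)[OF sub] by (auto simp: C)
    have S0: "\<zero>\<^bsub>M'\<^esub> \<in> S"
      using subgroup.one_closed[OF submodule.axioms(1)[OF sub]] by simp
    have "submodule ?T complex_ring M"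
      by (rule A.stable_subspaceI)
        (use B.submoduleE(4,5)[OF sub] S0 in \<open>auto simp: zero add smult\<close>)
    moreover have "\<forall>g\<in>carrier_mat r r. \<forall>v\<in>?T. act M g v \<in> ?T"
      using S by (auto simp: acts A.act_closed)
    ultimately have "?T = {\<zero>\<^bsub>M\<^esub>} \<or> ?T = carrier M"
      using irr unfolding gl_irreducible_def by blast
    then show "S = {\<zero>\<^bsub>M'\<^esub>} \<or> S = carrier M'"
    proof
      assume "?T = {\<zero>\<^bsub>M\<^esub>}"
      then show ?thesis using hT zero by (metis image_empty image_insert)
    next
      assume "?T = carrier M"
      then show ?thesis using hT C by metis
    qed
  qed
  moreover have "has_highest_weight r \<eta> M'"
  proof -
    obtain v where v: "v \<in> carrier M" "v \<noteq> \<zero>\<^bsub>M\<^esub>"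
      "\<And>p q. p < q \<Longrightarrow> q < r \<Longrightarrow> act M (elem_mat r p q) v = \<zero>\<^bsub>M\<^esub>"
      "\<And>p. p < r \<Longrightarrow> act M (elem_mat r p p) v = of_nat (if p < length \<eta> then \<eta> ! p else 0) \<odot>\<^bsub>M\<^esub> v"
      using hw unfolding has_highest_weight_def by metis
    show ?thesis
      unfolding has_highest_weight_def
      by (rule bexI[of _ "h v"])
        (use v inj[of v "\<zero>\<^bsub>M\<^esub>"] zero in \<open>auto simp: C acts[symmetric] smult[symmetric]\<close>)
  qed
  ultimately show ?thesis by blast
qed

text \<open>The module \<^term>\<open>gl_irrep r \<eta>\<close> is a choice among modules of functions on the natural numbers.
  So that a candidate exists there, the finitely many pairs that support the image of the
  Specht module under the Schur functor are numbered.\<close>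

lemma gl_irrep:
  assumes "\<eta> \<in> partitions n" "length \<eta> \<le> r"
  shows "gl_irreducible r (gl_irrep r \<eta>)" "has_highest_weight r \<eta> (gl_irrep r \<eta>)"
proof -
  interpret specht_shape n \<eta> by unfold_locales fact
  let ?T = "schur n r triv specht_space" and ?Z = "words n r \<times> tabloids"
  have "finite ?Z" using fin finite_words by blast
  then obtain J :: "_ \<Rightarrow> nat" where J: "inj_on J ?Z"
    using finite_imp_inj_to_nat_seg by blast
  have supp: "\<Phi> b = 0" if "\<Phi> \<in> ?T" "b \<notin> ?Z" for \<Phi> b
  proof -
    obtain w f where b: "b = (w, f)" by (cases b)
    have "(\<lambda>f. \<Phi> (w, f)) \<in> funs_on tabloids" using schurD(2)[OF that(1)] specht_supp by blast
    then show ?thesis using that b schurD(4)[OF that(1)] by (auto simp: funs_on_def)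
  qed
  define h where "h \<Phi> = (\<lambda>k. if k \<in> J ` ?Z then \<Phi> (inv_into ?Z J k) else 0)"
    for \<Phi> :: "(nat \<Rightarrow> nat) \<times> (nat \<Rightarrow> nat) \<Rightarrow> complex"
  have h_J: "h \<Phi> (J b) = \<Phi> b" if "b \<in> ?Z" for \<Phi> b
    using that J by (simp add: h_def)
  have inj: "inj_on h ?T"
  proof (rule inj_onI)
    fix \<Phi> \<Psi> assume a: "\<Phi> \<in> ?T" "\<Psi> \<in> ?T" "h \<Phi> = h \<Psi>"
    show "\<Phi> = \<Psi>"
    proof
      fix b show "\<Phi> b = \<Psi> b"
        using supp[OF a(1), of b] supp[OF a(2), of b] h_J[of b] a(3) by (cases "b \<in> ?Z") metis+
    qed
  qed
  let ?M = "word_rep n r ?T"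
  let ?M' = "with_act (fun_mod (h ` ?T)) (\<lambda>g u. h (word_act n r g (inv_into ?T h u)))"
  have "gl_irreducible r ?M' \<and> has_highest_weight r \<eta> ?M'"
  proof (rule gl_transport[OF schur_specht_irreducible[OF assms(2)]])
    show "bij_betw h (carrier ?M) (carrier ?M')" using inj by (simp add: bij_betw_def)
    show "h (v \<oplus>\<^bsub>?M\<^esub> w) = h v \<oplus>\<^bsub>?M'\<^esub> h w" for v w by (auto simp: h_def)
    show "h (c \<odot>\<^bsub>?M\<^esub> v) = c \<odot>\<^bsub>?M'\<^esub> h v" for c v by (auto simp: h_def)
    show "h \<zero>\<^bsub>?M\<^esub> = \<zero>\<^bsub>?M'\<^esub>" by (auto simp: h_def)
    show "h (act ?M g v) = act ?M' g (h v)" if "v \<in> carrier ?M" for g v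
      using that inj by simp
  qed
  then have "\<exists>M :: (complex, nat \<Rightarrow> complex, complex mat) rep. gl_irreducible r M \<and> has_highest_weight r \<eta> M"
    by blast
  from someI_ex[OF this]
  show "gl_irreducible r (gl_irrep r \<eta>)" "has_highest_weight r \<eta> (gl_irrep r \<eta>)"
    by (simp_all add: gl_irrep_def)
qed

theorem schur_specht_iso:
  assumes "\<eta> \<in> partitions n" "length \<eta> \<le> r"
  shows "rep_iso (carrier_mat r r) (word_rep n r (schur n r triv (specht_shape.specht_space n \<eta>)))
    (gl_irrep r \<eta>)"
proof -
  interpret specht_shape n \<eta> by unfold_locales fact
  show ?thesis
    using schur_specht_irreducible[OF assms(2)] gl_irrep[OF assms] by (intro irreducible_hw_unique)
qed

section \<open>Decomposition into Specht modules\<close>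

locale perm_char =
  fixes n :: nat and \<epsilon> :: "(nat \<Rightarrow> nat) \<Rightarrow> complex"
  assumes char_comp: "\<sigma> permutes {1..n} \<Longrightarrow> \<tau> permutes {1..n} \<Longrightarrow> \<epsilon> (\<sigma> \<circ> \<tau>) = \<epsilon> \<sigma> * \<epsilon> \<tau>"
    and char_square: "\<sigma> permutes {1..n} \<Longrightarrow> \<epsilon> \<sigma> * \<epsilon> \<sigma> = 1"
begin

lemma char_id: "\<epsilon> id = 1"
  using char_comp[OF permutes_id permutes_id] char_square[OF permutes_id] by simp

definition twist :: "(nat \<Rightarrow> nat) \<Rightarrow> ((nat \<Rightarrow> nat) \<Rightarrow> complex) \<Rightarrow> (nat \<Rightarrow> nat) \<Rightarrow> complex" where
  "twist \<sigma> v = (\<lambda>f. \<epsilon> \<sigma> * perm_act \<sigma> v f)"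

text \<open>If \<open>r = n\<close>, the orbit of a word without repeated letters is a copy of the symmetric group, so
  any vector of \<open>W\<close> spreads over it to an invariant tensor.\<close>

lemma schur_nonzero:
  assumes W: "perm_stable n W" and v: "v \<in> W" "v \<noteq> 0"
  shows "schur n n \<epsilon> W \<noteq> {0}"
proof -
  have sub: "cfun.subspace W" using W by (simp add: perm_stable_def)
  obtain f0 where f0: "v f0 \<noteq> 0" using v(2) by (auto simp: fun_eq_iff)
  define \<iota> :: "nat \<Rightarrow> nat" where "\<iota> = restrict (\<lambda>x. x - 1) {1..n}"
  let ?P = "{\<sigma>. \<sigma> permutes {1..n}}"
  have \<iota>: "\<iota> \<in> words n n" by (auto simp: \<iota>_def words_def)
  define \<Phi> :: "(nat \<Rightarrow> nat) \<times> (nat \<Rightarrow> nat) \<Rightarrow> complex" where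
    "\<Phi> = (\<lambda>(w, f). \<Sum>\<sigma>\<in>?P. if w \<circ> \<sigma> = \<iota> then \<epsilon> \<sigma> * v (f \<circ> \<sigma>) else 0)"
  have "\<Phi> \<in> schur n n \<epsilon> W"
    unfolding schur_def
  proof (intro CollectI conjI allI impI)
    have "\<Phi> (w, f) = 0" if "w \<notin> words n n" for w f
    proof -
      have "w \<circ> \<sigma> \<noteq> \<iota>" if "\<sigma> permutes {1..n}" for \<sigma>
        using words_comp[OF that, of w n] \<iota> \<open>w \<notin> words n n\<close> by metis
      then show ?thesis by (simp add: \<Phi>_def)
    qed
    then show "\<Phi> \<in> word_funs n n" by (auto simp: word_funs_def funs_on_def)
    fix w
    have "(\<lambda>f. \<Sum>\<sigma>\<in>?P. (if w \<circ> \<sigma> = \<iota> then \<epsilon> \<sigma> else 0) * perm_act \<sigma> v f) \<in> W"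
      by (rule subspace_sum[OF sub]) (use W v in \<open>auto simp: perm_stable_def\<close>)
    moreover have "(\<lambda>f. \<Sum>\<sigma>\<in>?P. (if w \<circ> \<sigma> = \<iota> then \<epsilon> \<sigma> else 0) * perm_act \<sigma> v f) = (\<lambda>f. \<Phi> (w, f))"
      by (auto simp: \<Phi>_def perm_act_def intro!: ext sum.cong)
    ultimately show "(\<lambda>f. \<Phi> (w, f)) \<in> W" by simp
    fix \<tau> :: "nat \<Rightarrow> nat" and f :: "nat \<Rightarrow> nat" assume t: "\<tau> permutes {1..n}"
    have "\<Phi> (w \<circ> \<tau>, f \<circ> \<tau>)
      = (\<Sum>\<sigma>\<in>?P. if w \<circ> \<sigma> = \<iota> then \<epsilon> \<tau> * (\<epsilon> \<sigma> * v (f \<circ> \<sigma>)) else 0)"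
      unfolding \<Phi>_def prod.case
    proof (rule sum.reindex_bij_witness[where j = "\<lambda>\<sigma>. \<tau> \<circ> \<sigma>" and i = "\<lambda>\<sigma>. inv' \<tau> \<circ> \<sigma>"])
      fix \<sigma> assume "\<sigma> \<in> ?P"
      then have s: "\<sigma> permutes {1..n}" by simp
      show "inv' \<tau> \<circ> (\<tau> \<circ> \<sigma>) = \<sigma>" "\<tau> \<circ> (inv' \<tau> \<circ> \<sigma>) = \<sigma>"
        using permutes_inv_o[OF t] by (simp_all flip: comp_assoc)
      show "\<tau> \<circ> \<sigma> \<in> ?P" "inv' \<tau> \<circ> \<sigma> \<in> ?P"
        using s t permutes_inv[OF t] by (auto intro: permutes_compose)
      have "\<epsilon> \<tau> * (\<epsilon> (\<tau> \<circ> \<sigma>) * x) = \<epsilon> \<sigma> * x" for x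
        using char_square[OF t] by (simp add: char_comp[OF t s] flip: mult.assoc)
      then show "(if w \<circ> (\<tau> \<circ> \<sigma>) = \<iota> then \<epsilon> \<tau> * (\<epsilon> (\<tau> \<circ> \<sigma>) * v (f \<circ> (\<tau> \<circ> \<sigma>))) else 0)
        = (if w \<circ> \<tau> \<circ> \<sigma> = \<iota> then \<epsilon> \<sigma> * v (f \<circ> \<tau> \<circ> \<sigma>) else 0)"
        by (simp add: comp_assoc)
    qed
    also have "\<dots> = \<epsilon> \<tau> * \<Phi> (w, f)"
      unfolding \<Phi>_def prod.case sum_distrib_left by (rule sum.cong[OF refl]) simp
    finally show "\<Phi> (w \<circ> \<tau>, f \<circ> \<tau>) = \<epsilon> \<tau> * \<Phi> (w, f)" .
  qed
  moreover have "\<Phi> (\<iota>, f0) \<noteq> 0"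
  proof -
    have "\<iota> \<circ> \<sigma> = \<iota> \<longleftrightarrow> \<sigma> = id" if s: "\<sigma> permutes {1..n}" for \<sigma>
    proof
      assume a: "\<iota> \<circ> \<sigma> = \<iota>"
      show "\<sigma> = id"
      proof
        fix x
        show "\<sigma> x = id x"
        proof (cases "x \<in> {1..n}")
          case True
          then have "\<sigma> x \<in> {1..n}" using permutes_in_image[OF s] by blast
          moreover have "\<iota> (\<sigma> x) = \<iota> x" using a by (metis comp_apply)
          ultimately show ?thesis using True by (auto simp: \<iota>_def)
        next
          case False
          with s have "\<sigma> x = x" by (rule permutes_not_in)
          then show ?thesis by simp
        qed
      qed
    qed simp
    then have "\<Phi> (\<iota>, f0) = (\<Sum>\<sigma>\<in>?P. if \<sigma> = id then v f0 else 0)"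
      unfolding \<Phi>_def prod.case by (intro sum.cong refl) (auto simp: char_id)
    also have "\<dots> = v f0"
      using permutes_id[of "{1..n}"] finite_permutations[of "{1..n}"] by (simp add: sum.delta)
    finally show ?thesis using f0 by simp
  qed
  ultimately show ?thesis by fastforce
qed

text \<open>A highest weight vector \<open>\<Phi>\<close> of \<^term>\<open>schur n n \<epsilon> W\<close> is paired with the highest weight vector
  \<open>\<Psi>\<close> of the same weight that comes from a Specht module. The pair generates a module
  that contains no nonzero vector \<open>(0, y)\<close>. But if the map \<open>v \<mapsto> \<Sum>\<^sub>w \<langle>v, \<Psi> w\<rangle> \<Phi> w\<close>
  from the Specht module to \<open>W\<close> were zero, the operator with kernel \<open>\<langle>\<Psi> w, \<Psi> w'\<rangle>\<close> would
  send the pair to \<open>(0, c \<Psi>)\<close> with \<open>c \<noteq> 0\<close>.\<close>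

lemma specht_hom_exists:
  assumes W: "perm_stable n W" and nz: "W \<noteq> {0}"
  obtains \<eta> h where "\<eta> \<in> partitions n"
    "\<And>v. h v \<in> W" "\<And>u v. h (u + v) = h u + h v" "\<And>c v. h (\<lambda>f. c * v f) = (\<lambda>f. c * h v f)"
    "\<And>\<sigma> v. \<sigma> permutes {1..n} \<Longrightarrow> v \<in> specht_shape.specht_space n \<eta> \<Longrightarrow> h (perm_act \<sigma> v) = twist \<sigma> (h v)"
    "\<exists>v\<in>specht_shape.specht_space n \<eta>. h v \<noteq> 0"
proof -
  have sub: "cfun.subspace W" using W by (simp add: perm_stable_def)
  obtain v0 where "v0 \<in> W" "v0 \<noteq> 0" using nz cfun.subspace_0[OF sub] by blast
  then have nzs: "schur n n \<epsilon> W \<noteq> {0}" by (rule schur_nonzero[OF W])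
  obtain \<Phi> \<eta> where \<Phi>: "\<Phi> \<in> schur n n \<epsilon> W" "\<Phi> \<noteq> 0" and \<eta>: "\<eta> \<in> partitions n" "length \<eta> \<le> n"
    and cont: "\<And>w i p. \<Phi> (w, i) \<noteq> 0 \<Longrightarrow> content n w p = (if p < length \<eta> then \<eta> ! p else 0)"
    and raise: "\<And>p q. p < q \<Longrightarrow> q < n \<Longrightarrow> word_act n n (elem_mat n p q) \<Phi> = 0"
    by (rule highest_weight_exists[OF stable_schur[OF sub] nzs]) (rule that; assumption)
  interpret S: specht_shape n \<eta> by unfold_locales fact
  let ?S = "S.specht_space"
  define \<Psi> where "\<Psi> = S.specht_hw n"
  have \<Psi>: "\<Psi> \<in> schur n n triv ?S" "\<Psi> \<noteq> 0"
    unfolding \<Psi>_def by (rule S.specht_hw_schur, rule S.specht_hw_nonzero[OF \<eta>(2)])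
  let ?ip = "ip S.tabloids"
  define h where "h v = (\<lambda>f. \<Sum>w\<in>words n n. ?ip v (\<lambda>f. \<Psi> (w, f)) * \<Phi> (w, f))" for v
  have "\<exists>v\<in>?S. h v \<noteq> 0"
  proof (rule ccontr)
    assume h0: "\<not> (\<exists>v\<in>?S. h v \<noteq> 0)"
    define pair :: "((nat \<Rightarrow> nat) \<times> (nat \<Rightarrow> nat) \<Rightarrow> complex) \<Rightarrow> ((nat \<Rightarrow> nat) \<times> (nat \<Rightarrow> nat) \<Rightarrow> complex)
        \<Rightarrow> (nat \<Rightarrow> nat) \<times> ((nat \<Rightarrow> nat) + (nat \<Rightarrow> nat)) \<Rightarrow> complex"
      where "pair x y = (\<lambda>(w, i). case i of Inl f \<Rightarrow> x (w, f) | Inr f \<Rightarrow> y (w, f))" for x y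
    have pair_act: "word_act n n g (pair x y) = pair (word_act n n g x) (word_act n n g y)" for g x y
      by (auto simp: fun_eq_iff word_act_def pair_def split: sum.splits)
    have pair_kernel: "kernel_op n n a (pair x y) = pair (kernel_op n n a x) (kernel_op n n a y)" for a x y
      by (auto simp: fun_eq_iff kernel_op_def pair_def split: sum.splits)
    have pair_add: "pair x y + pair x' y' = pair (x + x') (y + y')" for x y x' y'
      by (auto simp: fun_eq_iff pair_def split: sum.splits)
    have pair_smult: "(\<lambda>b. c * pair x y b) = pair (\<lambda>b. c * x b) (\<lambda>b. c * y b)" for c x y
      by (auto simp: fun_eq_iff pair_def split: sum.splits)
    have pair_0: "pair 0 0 = 0"
      by (auto simp: fun_eq_iff pair_def split: sum.splits)
    have pair_eq: "x = x' \<and> y = y'" if "pair x y = pair x' y'" for x y x' y'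
    proof -
      have "pair x y (w, i) = pair x' y' (w, i)" for w i using that by simp
      from this[of _ "Inl _"] this[of _ "Inr _"] show ?thesis by (auto simp: pair_def fun_eq_iff)
    qed
    let ?U = "word_funs n n :: ((nat \<Rightarrow> nat) \<times> ((nat \<Rightarrow> nat) + (nat \<Rightarrow> nat)) \<Rightarrow> complex) set"
    have U: "stable_words n n ?U"
      by (auto simp: stable_words_def word_act_in) (simp add: word_funs_def subspace_funs_on)
    define lam :: "nat \<Rightarrow> complex" where "lam p = of_nat (if p < length \<eta> then \<eta> ! p else 0)" for p
    let ?M = "word_rep n n ?U"
    have vf: "\<Phi> \<in> word_funs n n" "\<Psi> \<in> word_funs n n" using \<Phi> \<Psi> by (auto simp: schur_def)
    have diag: "word_act n n (elem_mat n p p) \<Phi> = (\<lambda>b. lam p * \<Phi> b)"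
      "word_act n n (elem_mat n p p) \<Psi> = (\<lambda>b. lam p * \<Psi> b)" if "p < n" for p
      unfolding lam_def
      by (rule word_act_diag[OF that cont vf(1)], assumption,
          rule word_act_diag[OF that S.specht_hw_content vf(2)], simp add: \<Psi>_def)
    have raise': "word_act n n (elem_mat n p q) \<Psi> = 0" if "p < q" "q < n" for p q
      unfolding \<Psi>_def by (rule S.specht_hw_raise[OF that])
    interpret H: hw_vector n ?M "pair \<Phi> \<Psi>" lam
    proof (rule hw_vector.intro[OF gl_rep_words[OF U]], unfold_locales)
      show "pair \<Phi> \<Psi> \<in> carrier ?M"
        using vf by (auto simp: word_funs_def funs_on_def pair_def split: sum.splits)
    qed (simp_all add: pair_act raise raise' pair_0 diag pair_smult)
    let ?N = "H.hw_span"
    have N_sub: "cfun.subspace ?N"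
      by (rule cfun.subspaceI)
        (use H.hw_span_zero H.hw_span.add H.hw_span.smult in simp_all)
    have N: "stable_words n n ?N"
      using N_sub H.hw_span_in H.hw_span_stable by (auto simp: stable_words_def)
    define Y where "Y = {y \<in> schur n n triv ?S. pair 0 y \<in> ?N}"
    have "stable_words n n Y"
      unfolding stable_words_def
    proof (intro conjI ballI)
      show "cfun.subspace Y"
      proof (rule cfun.subspaceI)
        show "0 \<in> Y"
          using cfun.subspace_0[OF subspace_schur[OF S.specht_subspace]] cfun.subspace_0[OF N_sub]
          by (simp only: Y_def mem_Collect_eq pair_0)
        show "x + y \<in> Y" if "x \<in> Y" "y \<in> Y" for x y
        proof -
          have "pair 0 x + pair 0 y \<in> ?N" using that by (intro subspace_add[OF N_sub]) (auto simp: Y_def)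
          then have "pair 0 (x + y) \<in> ?N" unfolding pair_add by (simp only: add_0)
          then show ?thesis
            using that subspace_add[OF subspace_schur[OF S.specht_subspace]] unfolding Y_def by blast
        qed
        show "(\<lambda>b. c * x b) \<in> Y" if "x \<in> Y" for c x
        proof -
          have "(\<lambda>b. c * pair 0 x b) \<in> ?N" using that by (intro subspace_smult[OF N_sub]) (auto simp: Y_def)
          moreover have "(\<lambda>b. c * 0 b) = (0 :: (nat \<Rightarrow> nat) \<times> (nat \<Rightarrow> nat) \<Rightarrow> complex)" by (simp add: fun_eq_iff)
          ultimately have "pair 0 (\<lambda>b. c * x b) \<in> ?N" unfolding pair_smult by metis
          then show ?thesis
            using that subspace_smult[OF subspace_schur[OF S.specht_subspace]] unfolding Y_def by blast
        qed
      qed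
      show "Y \<subseteq> word_funs n n" by (auto simp: Y_def schur_def)
      fix g :: "complex mat" and y assume g: "g \<in> carrier_mat n n" and y: "y \<in> Y"
      have "word_act n n g (pair 0 y) \<in> ?N" using y N g by (auto simp: Y_def stable_words_def)
      then have "pair 0 (word_act n n g y) \<in> ?N" unfolding pair_act word_act_0 .
      then show "word_act n n g y \<in> Y"
        using y g stable_schur[OF S.specht_subspace, of n n triv] by (auto simp: Y_def stable_words_def)
    qed
    then have Y_all: "\<Psi> \<in> Y" if "y \<in> Y" "y \<noteq> 0" for y
      using S.schur_specht_transitive[OF _ _ that \<Psi>(1)] by (auto simp: Y_def)
    have "\<Psi> \<notin> Y"
    proof
      assume "\<Psi> \<in> Y"
      then have "pair 0 \<Psi> \<in> ?N" by (simp add: Y_def)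
      then obtain c where "pair 0 \<Psi> = c \<odot>\<^bsub>?M\<^esub> pair \<Phi> \<Psi>"
      proof (rule H.hw_span_weight)
        show "act ?M (elem_mat n p p) (pair 0 \<Psi>) = lam p \<odot>\<^bsub>?M\<^esub> pair 0 \<Psi>" if "p < n" for p
          unfolding with_act_simps fun_mod_simps pair_act pair_smult diag(2)[OF that] word_act_0
          by (simp add: zero_fun_def)
      qed
      then have "pair 0 \<Psi> = pair (\<lambda>b. c * \<Phi> b) (\<lambda>b. c * \<Psi> b)" by (simp add: pair_smult)
      then have "0 = (\<lambda>b. c * \<Phi> b)" "\<Psi> = (\<lambda>b. c * \<Psi> b)" using pair_eq by blast+
      moreover obtain b where "\<Phi> b \<noteq> 0" using \<Phi>(2) by (auto simp: fun_eq_iff)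
      ultimately have "c = 0" by (metis mult_eq_0_iff zero_fun_apply)
      then have "\<Psi> = 0" using \<open>\<Psi> = (\<lambda>b. c * \<Psi> b)\<close> by (metis (no_types, lifting) ext mult_zero_left zero_fun_apply)
      then show False using \<Psi>(2) by contradiction
    qed
    define a where "a w w' = ?ip (\<lambda>f. \<Psi> (w, f)) (\<lambda>f. \<Psi> (w', f))" for w w'
    obtain c where c: "c \<noteq> 0" "kernel_op n n a \<Psi> = (\<lambda>b. c * \<Psi> b)"
      using S.schur_specht_kernel[OF \<Psi>] \<Psi>(1) unfolding a_def by metis
    have "kernel_op n n a (pair \<Phi> \<Psi>) \<in> ?N"
      unfolding a_def
      by (rule stable_kernel_op[OF N H.hw_in_span]) (rule S.schur_ip_invariant[OF \<Psi>(1) \<Psi>(1)])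
    moreover have "kernel_op n n a \<Phi> = 0"
    proof (rule ext, clarify)
      fix w f
      have "h (\<lambda>f. \<Psi> (w, f)) = 0" using h0 schurD(2)[OF \<Psi>(1)] by blast
      then have "h (\<lambda>f. \<Psi> (w, f)) f = 0" by (metis zero_fun_apply)
      then show "kernel_op n n a \<Phi> (w, f) = 0 (w, f)" by (simp add: kernel_op_def a_def h_def)
    qed
    ultimately have "pair 0 (\<lambda>b. c * \<Psi> b) \<in> ?N" by (simp only: pair_kernel c)
    then have "(\<lambda>b. c * \<Psi> b) \<in> Y"
      using subspace_smult[OF subspace_schur[OF S.specht_subspace] \<Psi>(1)] unfolding Y_def by blast
    moreover have "(\<lambda>b. c * \<Psi> b) \<noteq> 0"
    proof
      assume a: "(\<lambda>b. c * \<Psi> b) = 0"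
      have "c * \<Psi> b = 0" for b using fun_cong[OF a, of b] by simp
      then show False using c(1) \<Psi>(2) by (auto simp: fun_eq_iff)
    qed
    ultimately show False using Y_all \<open>\<Psi> \<notin> Y\<close> by blast
  qed
  moreover have "h v \<in> W" for v
    unfolding h_def by (intro subspace_sum[OF sub] schurD(2)[OF \<Phi>(1)])
  moreover have "h (u + v) = h u + h v" for u v
    by (rule ext) (simp add: h_def ip_add_left algebra_simps sum.distrib)
  moreover have "h (\<lambda>f. c * v f) = (\<lambda>f. c * h v f)" for c v
    by (rule ext) (simp add: h_def ip_smult_left sum_distrib_left mult.assoc)
  moreover have "h (perm_act \<sigma> v) = twist \<sigma> (h v)" if s: "\<sigma> permutes {1..n}" for \<sigma> v
  proof
    fix f
    have "twist \<sigma> (h v) f = \<epsilon> \<sigma> * (\<Sum>w\<in>words n n. ?ip v (\<lambda>f. \<Psi> (w, f)) * \<Phi> (w, f \<circ> \<sigma>))"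
      by (simp add: twist_def perm_act_def h_def)
    also have "(\<Sum>w\<in>words n n. ?ip v (\<lambda>f. \<Psi> (w, f)) * \<Phi> (w, f \<circ> \<sigma>))
      = (\<Sum>w\<in>words n n. ?ip v (\<lambda>f. \<Psi> (w \<circ> \<sigma>, f)) * \<Phi> (w \<circ> \<sigma>, f \<circ> \<sigma>))"
      using sum.reindex_bij_betw[OF bij_betw_words_comp[OF s],
        of "\<lambda>w. ?ip v (\<lambda>f. \<Psi> (w, f)) * \<Phi> (w, f \<circ> \<sigma>)" n] by simp
    also have "\<dots> = (\<Sum>w\<in>words n n. \<epsilon> \<sigma> * (?ip (perm_act \<sigma> v) (\<lambda>f. \<Psi> (w, f)) * \<Phi> (w, f)))"
    proof (rule sum.cong[OF refl])
      fix w
      have "?ip v (\<lambda>f. \<Psi> (w \<circ> \<sigma>, f)) = ?ip (perm_act \<sigma> v) (\<lambda>f. \<Psi> (w, f))"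
        using ip_perm_act[OF S.comp_closed_tabloids s, of v "\<lambda>f. \<Psi> (w \<circ> \<sigma>, f)"]
        by (simp only: schur_perm_act[OF \<Psi>(1) s])
      then show "?ip v (\<lambda>f. \<Psi> (w \<circ> \<sigma>, f)) * \<Phi> (w \<circ> \<sigma>, f \<circ> \<sigma>)
        = \<epsilon> \<sigma> * (?ip (perm_act \<sigma> v) (\<lambda>f. \<Psi> (w, f)) * \<Phi> (w, f))"
        using schurD(3)[OF \<Phi>(1) s, of w f] by (simp add: algebra_simps)
    qed
    also have "\<dots> = \<epsilon> \<sigma> * h (perm_act \<sigma> v) f"
      unfolding h_def by (rule sum_distrib_left[symmetric])
    finally show "h (perm_act \<sigma> v) f = twist \<sigma> (h v) f"
      using char_square[OF s] by (simp flip: mult.assoc)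
  qed
  ultimately show ?thesis using that[OF \<eta>(1)] by blast
qed

text \<open>Schur's lemma, applied to the orthogonal projection onto the kernel.\<close>

lemma specht_hom_inj:
  assumes \<eta>: "\<eta> \<in> partitions n"
    and add: "\<And>u v. h (u + v) = h u + h v" and smult: "\<And>c v. h (\<lambda>f. c * v f) = (\<lambda>f. c * h v f)"
    and perm: "\<And>\<sigma> v. \<sigma> permutes {1..n} \<Longrightarrow> v \<in> specht_shape.specht_space n \<eta> \<Longrightarrow> h (perm_act \<sigma> v) = twist \<sigma> (h v)"
    and nz: "\<exists>v\<in>specht_shape.specht_space n \<eta>. h v \<noteq> 0"
    and v: "v \<in> specht_shape.specht_space n \<eta>" "h v = 0"
  shows "v = 0"
proof (rule ccontr)
  assume "v \<noteq> 0"
  interpret S: specht_shape n \<eta> by unfold_locales fact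
  let ?S = "S.specht_space"
  define K where "K = {v \<in> ?S. h v = 0}"
  have h0: "h 0 = 0" using smult[of 0 0] by (simp add: zero_fun_def)
  have Ksub: "cfun.subspace K"
  proof (rule cfun.subspaceI)
    show "0 \<in> K" using h0 cfun.subspace_0[OF S.specht_subspace] unfolding K_def by blast
    show "x + y \<in> K" if "x \<in> K" "y \<in> K" for x y
      using that subspace_add[OF S.specht_subspace, of x y] add[of x y] unfolding K_def
      by (simp only: mem_Collect_eq add_0)
    show "(\<lambda>f. c * x f) \<in> K" if "x \<in> K" for c x
      using that subspace_smult[OF S.specht_subspace, of x c] smult[of c x] unfolding K_def
      by (simp add: zero_fun_def)
  qed
  have KS: "K \<subseteq> ?S" by (auto simp: K_def)
  have Kperm: "perm_stable n K"
    unfolding perm_stable_def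
  proof (intro conjI Ksub allI impI ballI)
    fix \<sigma> u assume s: "\<sigma> permutes {1..n}" and u: "u \<in> K"
    have "twist \<sigma> 0 = 0" by (simp add: twist_def perm_act_def fun_eq_iff)
    then have "h (perm_act \<sigma> u) = 0" using perm[OF s] u unfolding K_def by simp
    then show "perm_act \<sigma> u \<in> K"
      using u s S.perm_stable_specht unfolding K_def perm_stable_def by blast
  qed
  have Ksupp: "K \<subseteq> funs_on S.tabloids" using KS S.specht_supp by blast
  interpret K: fun_subspace S.tabloids K
    using S.fin Ksub Ksupp by unfold_locales
  obtain c where c: "\<And>u. u \<in> ?S \<Longrightarrow> orth_proj S.tabloids K u = (\<lambda>f. c * u f)"
  proof (rule S.specht_endo_scalar[of "orth_proj S.tabloids K"])
    show "orth_proj S.tabloids K u \<in> funs_on S.tabloids" for u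
      using K.orth_proj(1) Ksupp by blast
    show "orth_proj S.tabloids K (perm_act \<sigma> u) = perm_act \<sigma> (orth_proj S.tabloids K u)"
      if "\<sigma> permutes {1..n}" for \<sigma> u
      by (rule orth_proj_perm_act[OF S.comp_closed_tabloids Kperm Ksupp that])
  qed (rule K.orth_proj_add K.orth_proj_smult | blast)+
  have vK: "v \<in> K" using v by (simp add: K_def)
  obtain f where f: "v f \<noteq> 0" using \<open>v \<noteq> 0\<close> by (auto simp: fun_eq_iff)
  have "v = (\<lambda>f. c * v f)" using c[OF v(1)] K.orth_proj_id[OF vK] by simp
  then have "v f = c * v f" by (rule fun_cong)
  then have "c = 1" using f by simp
  then have "u \<in> K" if "u \<in> ?S" for u
    using c[OF that] K.orth_proj(1)[of u] by simp
  then show False using nz by (auto simp: K_def)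
qed

subsection \<open>Direct sums of irreducible modules\<close>

definition irr_index :: "(nat list \<Rightarrow>\<^sub>0 int) \<Rightarrow> (nat list \<times> nat) set" where
  "irr_index c = {(\<eta>, k). k < nat (Poly_Mapping.lookup c \<eta>)}"

lemma finite_irr_index: "finite (irr_index c)"
proof -
  have "irr_index c \<subseteq> (SIGMA \<eta>:Poly_Mapping.keys c. {..<nat (Poly_Mapping.lookup c \<eta>)})"
    by (auto simp: irr_index_def in_keys_iff)
  then show ?thesis by (rule finite_subset) (intro finite_SigmaI finite_keys finite_lessThan)
qed

lemma irr_sum_simps:
  "carrier (irr_sum \<pi> c) = (\<Pi>\<^sub>E i\<in>irr_index c. carrier (\<pi> (fst i)))"
  "x \<oplus>\<^bsub>irr_sum \<pi> c\<^esub> y = (\<lambda>i\<in>irr_index c. x i \<oplus>\<^bsub>\<pi> (fst i)\<^esub> y i)"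
  "a \<odot>\<^bsub>irr_sum \<pi> c\<^esub> x = (\<lambda>i\<in>irr_index c. a \<odot>\<^bsub>\<pi> (fst i)\<^esub> x i)"
  "act (irr_sum \<pi> c) g x = (\<lambda>i\<in>irr_index c. act (\<pi> (fst i)) g (x i))"
proof -
  have *: "(\<lambda>(\<eta>, k). \<pi> \<eta>) = (\<lambda>i. \<pi> (fst i))" by auto
  have "finite {i \<in> irr_index c. P i}" for P using finite_irr_index by simp
  then show "carrier (irr_sum \<pi> c) = (\<Pi>\<^sub>E i\<in>irr_index c. carrier (\<pi> (fst i)))"
    by (simp add: irr_sum_def dsum_rep_def dsum_mod_def * flip: irr_index_def)
  show "x \<oplus>\<^bsub>irr_sum \<pi> c\<^esub> y = (\<lambda>i\<in>irr_index c. x i \<oplus>\<^bsub>\<pi> (fst i)\<^esub> y i)"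
    "a \<odot>\<^bsub>irr_sum \<pi> c\<^esub> x = (\<lambda>i\<in>irr_index c. a \<odot>\<^bsub>\<pi> (fst i)\<^esub> x i)"
    "act (irr_sum \<pi> c) g x = (\<lambda>i\<in>irr_index c. act (\<pi> (fst i)) g (x i))"
    by (simp_all add: irr_sum_def dsum_rep_def dsum_mod_def * flip: irr_index_def)
qed

lemma specht_simps:
  assumes "\<eta> \<in> partitions n"
  shows "carrier (specht n \<eta>) = specht_shape.specht_space n \<eta>" "add (specht n \<eta>) = (+)"
    "smult (specht n \<eta>) = (\<lambda>c f x. c * f x)" "act (specht n \<eta>) = perm_act"
  using assms
  by (simp_all add: specht_def specht_shape.specht_space_def[OF specht_shape.intro])

text \<open>Induction on the dimension: a nonzero map from a Specht module is injective, and since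
  permutations act by isometries the orthogonal complement of its image is again stable.\<close>

theorem specht_decomposition:
  assumes X: "comp_closed n X" and W: "perm_stable n W" "W \<subseteq> funs_on X"
  shows "\<exists>c. Poly_Mapping.keys c \<subseteq> partitions n \<and> (\<forall>\<eta>. 0 \<le> Poly_Mapping.lookup c \<eta>)
    \<and> rep_iso {\<sigma>. \<sigma> permutes {1..n}} (with_act (fun_mod W) twist) (irr_sum (specht n) c)"
proof -
  have finX: "finite X" using X by (simp add: comp_closed_def)
  have main: "\<exists>c. Poly_Mapping.keys c \<subseteq> partitions n \<and> (\<forall>\<eta>. 0 \<le> Poly_Mapping.lookup c \<eta>)
      \<and> rep_iso {\<sigma>. \<sigma> permutes {1..n}} (with_act (fun_mod W) twist) (irr_sum (specht n) c)"
    if "perm_stable n W" "W \<subseteq> funs_on X" "finite B" "cfun.independent B" "cfun.span B = W" for B W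
    using that
  proof (induction "card B" arbitrary: B W rule: less_induct)
    case (less B W)
    note W = less.prems(1,2) and B = less.prems(3-5)
    have sub: "cfun.subspace W" using W by (simp add: perm_stable_def)
    show ?case
    proof (cases "W = {0}")
      case True
      have I: "irr_index 0 = {}" by (auto simp: irr_index_def)
      have "rep_iso {\<sigma>. \<sigma> permutes {1..n}} (with_act (fun_mod W) twist) (irr_sum (specht n) 0)"
        by (rule rep_isoI[where h = "\<lambda>_ _. undefined"])
          (simp_all add: irr_sum_simps I True bij_betw_def restrict_def)
      then show ?thesis by (intro exI[of _ 0]) simp
    next
      case False
      obtain \<eta> h where \<eta>: "\<eta> \<in> partitions n" and hW: "\<And>v. h v \<in> W"
        and h_add: "\<And>u v. h (u + v) = h u + h v" and h_smult: "\<And>c v. h (\<lambda>f. c * v f) = (\<lambda>f. c * h v f)"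
        and h_perm: "\<And>\<sigma> v. \<sigma> permutes {1..n} \<Longrightarrow> v \<in> specht_shape.specht_space n \<eta> \<Longrightarrow> h (perm_act \<sigma> v) = twist \<sigma> (h v)"
        and h_nz: "\<exists>v\<in>specht_shape.specht_space n \<eta>. h v \<noteq> 0"
        using specht_hom_exists[OF W(1) False] by blast
      interpret S: specht_shape n \<eta> by unfold_locales fact
      let ?S = "S.specht_space"
      have h_ker: "v = 0" if "v \<in> ?S" "h v = 0" for v
        by (rule specht_hom_inj[of \<eta> h v, OF \<eta> h_add h_smult h_perm h_nz that])
      have h_inj: "inj_on h ?S"
      proof (rule inj_onI)
        fix x y assume xy: "x \<in> ?S" "y \<in> ?S" "h x = h y"
        have "h (x + (\<lambda>f. (-1) * y f)) = h x + (\<lambda>f. (-1) * h y f)" by (simp only: h_add h_smult)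
        also have "\<dots> = 0" using xy(3) by (simp add: fun_eq_iff)
        finally have *: "x + (\<lambda>f. (-1) * y f) = 0"
          by (rule h_ker[rotated])
            (intro subspace_add[OF S.specht_subspace] subspace_smult[OF S.specht_subspace] xy)
        have "x f = y f" for f using fun_cong[OF *, of f] by simp
        then show "x = y" by (rule ext)
      qed
      define H where "H = h ` ?S"
      have HW: "H \<subseteq> W" using hW by (auto simp: H_def)
      have Hsub: "cfun.subspace H"
      proof (rule cfun.subspaceI)
        have "h 0 = 0" using h_smult[of 0 0] by (simp add: zero_fun_def)
        then show "0 \<in> H" using cfun.subspace_0[OF S.specht_subspace] unfolding H_def by (metis image_eqI)
        show "x + y \<in> H" if xy: "x \<in> H" "y \<in> H" for x y
        proof -
          obtain v w where vw: "v \<in> ?S" "w \<in> ?S" "x = h v" "y = h w"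
            using xy by (auto simp: H_def)
          show ?thesis
            unfolding vw(3,4) h_add[symmetric] H_def
            by (intro imageI subspace_add[OF S.specht_subspace] vw(1,2))
        qed
        show "(\<lambda>f. c * x f) \<in> H" if x: "x \<in> H" for c x
        proof -
          obtain v where v: "v \<in> ?S" "x = h v"
            using x by (auto simp: H_def)
          show ?thesis
            unfolding v(2) h_smult[symmetric] H_def
            by (intro imageI subspace_smult[OF S.specht_subspace] v(1))
        qed
      qed
      have tw_perm: "perm_act \<sigma> x = (\<lambda>f. \<epsilon> \<sigma> * twist \<sigma> x f)" if "\<sigma> permutes {1..n}" for \<sigma> x
        using char_square[OF that] by (simp add: twist_def flip: mult.assoc)
      have Hperm: "perm_stable n H"
        unfolding perm_stable_def
      proof (intro conjI Hsub allI impI ballI)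
        fix \<sigma> x assume s: "\<sigma> permutes {1..n}" and "x \<in> H"
        then obtain v where v: "v \<in> ?S" "x = h v" by (auto simp: H_def)
        have "twist \<sigma> x = h (perm_act \<sigma> v)" using h_perm[OF s v(1)] v(2) by simp
        then have "twist \<sigma> x \<in> H"
          using v(1) s S.perm_stable_specht unfolding H_def perm_stable_def by blast
        then show "perm_act \<sigma> x \<in> H" unfolding tw_perm[OF s] by (rule subspace_smult[OF Hsub])
      qed
      have Hsupp: "H \<subseteq> funs_on X" using HW W by blast
      interpret P: fun_subspace X H using finX Hsub Hsupp by unfold_locales
      let ?P = "orth_proj X H"
      (* the orthogonal complement of the image, to which the induction hypothesis applies *)
      define W' where "W' = {u \<in> W. ?P u = 0}"
      have W'sub: "cfun.subspace W'"
      proof (rule cfun.subspaceI)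
        show "0 \<in> W'" using P.orth_proj_id[OF cfun.subspace_0[OF Hsub]] cfun.subspace_0[OF sub]
          unfolding W'_def by blast
        show "x + y \<in> W'" if "x \<in> W'" "y \<in> W'" for x y
          using that subspace_add[OF sub, of x y] P.orth_proj_add[of x y] unfolding W'_def
          by (simp only: mem_Collect_eq add_0)
        show "(\<lambda>f. c * x f) \<in> W'" if "x \<in> W'" for c x
          using that subspace_smult[OF sub, of x c] P.orth_proj_smult[of c x] unfolding W'_def
          by (simp add: zero_fun_def)
      qed
      have P_perm: "?P (perm_act \<sigma> u) = perm_act \<sigma> (?P u)" if "\<sigma> permutes {1..n}" for \<sigma> u
        by (rule orth_proj_perm_act[OF X Hperm Hsupp that])
      have P_twist: "?P (twist \<sigma> u) = twist \<sigma> (?P u)" if "\<sigma> permutes {1..n}" for \<sigma> u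
        unfolding twist_def P.orth_proj_smult P_perm[OF that] ..
      have W'perm: "perm_stable n W'"
        unfolding perm_stable_def
      proof (intro conjI W'sub allI impI ballI)
        fix \<sigma> x assume s: "\<sigma> permutes {1..n}" and x: "x \<in> W'"
        then have "?P (perm_act \<sigma> x) = 0" using P_perm[OF s, of x] by (simp add: W'_def perm_act_0)
        then show "perm_act \<sigma> x \<in> W'" using x s W(1) unfolding W'_def perm_stable_def by blast
      qed
      have W'W: "W' \<subseteq> W" by (auto simp: W'_def)
      obtain B' where B': "finite B'" "B' \<subseteq> W'" "cfun.independent B'" "cfun.span B' = W'"
        using finite_dim_subspace[OF finX W'sub] W'W W(2) by blast
      have "card B' < card B"
      proof -
        obtain v where v: "v \<in> ?S" "h v \<noteq> 0" using h_nz by blast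
        have "h v \<in> H" using v by (simp add: H_def)
        then have "h v \<notin> W'" using P.orth_proj_id[of "h v"] v(2) by (simp add: W'_def)
        then have ind: "cfun.independent (insert (h v) B')"
          using cfun.independent_insertI[of "h v" B'] B' by simp
        have "card (insert (h v) B') \<le> card B"
          using cfun.independent_span_bound[OF B(1) ind] B' hW W'W B(3) by blast
        moreover have "h v \<notin> B'" using \<open>h v \<notin> W'\<close> B' by blast
        ultimately show ?thesis using B' by simp
      qed
      then obtain c' where c': "Poly_Mapping.keys c' \<subseteq> partitions n" "\<forall>\<eta>. 0 \<le> Poly_Mapping.lookup c' \<eta>"
        "rep_iso {\<sigma>. \<sigma> permutes {1..n}} (with_act (fun_mod W') twist) (irr_sum (specht n) c')"
        using less.hyps[OF _ W'perm _ B'(1,3,4)] W'W W(2) by blast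
      let ?N = "irr_sum (specht n) c'"
      obtain g where g: "bij_betw g W' (carrier ?N)"
        "\<And>v w. v \<in> W' \<Longrightarrow> w \<in> W' \<Longrightarrow> g (v + w) = g v \<oplus>\<^bsub>?N\<^esub> g w"
        "\<And>a v. v \<in> W' \<Longrightarrow> g (\<lambda>f. a * v f) = a \<odot>\<^bsub>?N\<^esub> g v"
        "\<And>\<sigma> v. \<sigma> permutes {1..n} \<Longrightarrow> v \<in> W' \<Longrightarrow> g (twist \<sigma> v) = act ?N \<sigma> (g v)"
        using c'(3) by (auto simp: rep_iso_def)
      define c where "c = c' + frag_of \<eta>"
      (* the index of the new copy of the Specht module *)
      define i0 where "i0 = (\<eta>, nat (Poly_Mapping.lookup c' \<eta>))"
      have lookup: "Poly_Mapping.lookup c \<zeta> = Poly_Mapping.lookup c' \<zeta> + (if \<zeta> = \<eta> then 1 else 0)" for \<zeta>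
        by (simp add: c_def lookup_add)
      have index: "irr_index c = insert i0 (irr_index c')" and i0: "i0 \<notin> irr_index c'"
        using c'(2)[rule_format, of \<eta>]
        by (auto simp: irr_index_def lookup i0_def nat_add_distrib split: if_splits)
      have keys: "Poly_Mapping.keys c \<subseteq> partitions n"
        using c'(1) \<eta> keys_add[of c' "frag_of \<eta>"] by (auto simp: c_def)
      have nonneg: "\<forall>\<eta>. 0 \<le> Poly_Mapping.lookup c \<eta>" using c'(2) by (simp add: lookup)
      have part: "fst i \<in> partitions n" if "i \<in> irr_index c'" for i
        using that c'(1) by (auto simp: irr_index_def in_keys_iff subset_iff)
      define hi where "hi = inv_into ?S h"
      have hi: "hi (h v) = v" if "v \<in> ?S" for v using h_inj that by (simp add: hi_def)
      have hi_in: "hi u \<in> ?S" "h (hi u) = u" if "u \<in> H" for u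
        using that hi by (auto simp: H_def)
      define q where "q u = u - ?P u" for u
      have Pu: "?P u \<in> H" for u by (rule P.orth_proj(1))
      have q_in: "q u \<in> W'" if "u \<in> W" for u
      proof -
        have "?P u + ?P (q u) = ?P u"
          using P.orth_proj_add[of "?P u" "q u"] P.orth_proj_id[OF Pu] by (simp add: q_def)
        then have "?P (q u) = 0" by (metis add_cancel_right_right)
        moreover have "q u \<in> W" unfolding q_def using that Pu HW by (intro cfun.subspace_diff[OF sub]) auto
        ultimately show ?thesis by (simp add: W'_def)
      qed
      define G where "G u = (\<lambda>i\<in>irr_index c. if i = i0 then hi (?P u) else g (q u) i)" for u
      have G_i0: "G u i0 = hi (?P u)" for u by (simp add: G_def index)
      have G_i: "G u i = g (q u) i" if "i \<in> irr_index c'" for u i using that i0 by (auto simp: G_def index)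
      have g_in: "g u \<in> (\<Pi>\<^sub>E i\<in>irr_index c'. carrier (specht n (fst i)))" if "u \<in> W'" for u
        using bij_betwE[OF g(1)] that by (simp add: irr_sum_simps)
      have fst_i0: "fst i0 = \<eta>" by (simp add: i0_def)
      have G_eqI: "G u = x" if "x \<in> extensional (irr_index c)" "x i0 = hi (?P u)"
        "\<And>i. i \<in> irr_index c' \<Longrightarrow> x i = g (q u) i" for u x
        by (rule extensionalityI[of _ "irr_index c"])
          (use that i0 in \<open>auto simp: G_def index\<close>)
      have "rep_iso {\<sigma>. \<sigma> permutes {1..n}} (with_act (fun_mod W) twist) (irr_sum (specht n) c)"
      proof (rule rep_isoI[where h = G])
        show "bij_betw G (carrier (with_act (fun_mod W) twist)) (carrier (irr_sum (specht n) c))"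
        proof (rule bij_betwI')
          fix u v assume uv: "u \<in> carrier (with_act (fun_mod W) twist)" "v \<in> carrier (with_act (fun_mod W) twist)"
          show "G u = G v \<longleftrightarrow> u = v"
          proof
            assume eq: "G u = G v"
            have "hi (?P u) = hi (?P v)" using G_i0 eq by metis
            then have 1: "?P u = ?P v" using hi_in(2)[OF Pu] by metis
            have "g (q u) = g (q v)"
              using uv by (intro PiE_ext[OF g_in g_in]) (auto simp: q_in G_i[symmetric] eq)
            then have "q u = q v" using g(1) uv q_in by (auto simp: bij_betw_def inj_on_def)
            then show "u = v" using 1 unfolding q_def by (metis diff_add_cancel)
          qed simp
        next
          fix u assume "u \<in> carrier (with_act (fun_mod W) twist)"
          then have u: "u \<in> W" by simp
          show "G u \<in> carrier (irr_sum (specht n) c)"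
            unfolding irr_sum_simps
          proof (rule PiE_I)
            fix i assume "i \<in> irr_index c"
            then consider "i = i0" | "i \<in> irr_index c'" using index by auto
            then show "G u i \<in> carrier (specht n (fst i))"
            proof cases
              case 1
              then show ?thesis using hi_in(1)[OF Pu] by (simp add: G_i0 fst_i0 specht_simps[OF \<eta>])
            next
              case 2
              then show ?thesis using g_in[OF q_in[OF u]] by (auto simp: G_i)
            qed
          qed (simp add: G_def)
        next
          fix y assume "y \<in> carrier (irr_sum (specht n) c)"
          then have y: "y \<in> (\<Pi>\<^sub>E i\<in>irr_index c. carrier (specht n (fst i)))" by (simp add: irr_sum_simps)
          have s: "y i0 \<in> ?S" using y by (auto simp: index fst_i0 specht_simps[OF \<eta>] dest: PiE_mem[of _ _ _ i0])
          have "restrict y (irr_index c') \<in> carrier ?N"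
            using y by (auto simp: irr_sum_simps index)
          then obtain u' where u': "u' \<in> W'" "g u' = restrict y (irr_index c')"
            using g(1) unfolding bij_betw_def by (metis imageE)
          define u where "u = h (y i0) + u'"
          have uW: "u \<in> W" unfolding u_def using u'(1) W'W by (intro subspace_add[OF sub] hW) auto
          have "h (y i0) \<in> H" using s by (simp add: H_def)
          then have "?P u = h (y i0) + 0"
            unfolding u_def P.orth_proj_add using u'(1) by (simp only: P.orth_proj_id W'_def mem_Collect_eq)
          then have Pu: "?P u = h (y i0)" by (simp only: add_0_right)
          then have "q u = u'" unfolding q_def u_def by (simp only: add_diff_cancel_left')
          have "G u = y"
            by (rule G_eqI) (use y Pu s u'(2) \<open>q u = u'\<close> in \<open>auto simp: hi PiE_def\<close>)
          then show "\<exists>x\<in>carrier (with_act (fun_mod W) twist). y = G x" using uW by auto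
        qed
      next
        fix u v assume "u \<in> carrier (with_act (fun_mod W) twist)" "v \<in> carrier (with_act (fun_mod W) twist)"
        then have uv: "u \<in> W" "v \<in> W" by simp_all
        have quv: "q (u + v) = q u + q v" unfolding q_def P.orth_proj_add by (simp add: fun_eq_iff)
        have "?P (u + v) = h (hi (?P u) + hi (?P v))"
          unfolding P.orth_proj_add h_add hi_in(2)[OF Pu] ..
        then have "hi (?P (u + v)) = hi (?P u) + hi (?P v)"
          using hi[OF subspace_add[OF S.specht_subspace hi_in(1)[OF Pu] hi_in(1)[OF Pu]]] by metis
        moreover have "g (q (u + v)) = g (q u) \<oplus>\<^bsub>?N\<^esub> g (q v)"
          unfolding quv using q_in uv by (intro g(2))
        ultimately have "G (u + v) = G u \<oplus>\<^bsub>irr_sum (specht n) c\<^esub> G v"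
          by (intro G_eqI) (use i0 in \<open>simp_all add: irr_sum_simps index G_i0 G_i fst_i0 specht_simps[OF \<eta>]\<close>)
        then show "G (u \<oplus>\<^bsub>with_act (fun_mod W) twist\<^esub> v) = G u \<oplus>\<^bsub>irr_sum (specht n) c\<^esub> G v"
          unfolding with_act_simps fun_mod_simps .
      next
        fix a u assume "u \<in> carrier (with_act (fun_mod W) twist)"
        then have u: "u \<in> W" by simp
        have qu: "q (\<lambda>f. a * u f) = (\<lambda>f. a * q u f)"
          unfolding q_def P.orth_proj_smult by (simp add: fun_eq_iff algebra_simps)
        have "?P (\<lambda>f. a * u f) = h (\<lambda>f. a * hi (?P u) f)"
          unfolding P.orth_proj_smult h_smult hi_in(2)[OF Pu] ..
        then have "hi (?P (\<lambda>f. a * u f)) = (\<lambda>f. a * hi (?P u) f)"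
          using hi[OF subspace_smult[OF S.specht_subspace hi_in(1)[OF Pu]]] by metis
        moreover have "g (q (\<lambda>f. a * u f)) = a \<odot>\<^bsub>?N\<^esub> g (q u)"
          unfolding qu using q_in u by (intro g(3))
        ultimately have "G (\<lambda>f. a * u f) = a \<odot>\<^bsub>irr_sum (specht n) c\<^esub> G u"
          by (intro G_eqI) (use i0 in \<open>simp_all add: irr_sum_simps index G_i0 G_i fst_i0 specht_simps[OF \<eta>]\<close>)
        then show "G (a \<odot>\<^bsub>with_act (fun_mod W) twist\<^esub> u) = a \<odot>\<^bsub>irr_sum (specht n) c\<^esub> G u"
          unfolding with_act_simps fun_mod_simps .
      next
        fix \<sigma> :: "nat \<Rightarrow> nat" and u assume "\<sigma> \<in> {\<sigma>. \<sigma> permutes {1..n}}" "u \<in> carrier (with_act (fun_mod W) twist)"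
        then have s: "\<sigma> permutes {1..n}" and u: "u \<in> W" by simp_all
        have qu: "q (twist \<sigma> u) = twist \<sigma> (q u)"
          unfolding q_def P_twist[OF s] by (simp add: fun_eq_iff twist_def perm_act_def algebra_simps)
        have "?P (twist \<sigma> u) = h (perm_act \<sigma> (hi (?P u)))"
          unfolding P_twist[OF s] h_perm[OF s hi_in(1)[OF Pu]] hi_in(2)[OF Pu] ..
        moreover have "perm_act \<sigma> (hi (?P u)) \<in> ?S"
          using hi_in(1)[OF Pu] S.perm_stable_specht s unfolding perm_stable_def by blast
        ultimately have "hi (?P (twist \<sigma> u)) = perm_act \<sigma> (hi (?P u))"
          using hi by metis
        moreover have "g (q (twist \<sigma> u)) = act ?N \<sigma> (g (q u))"
          unfolding qu using q_in u by (intro g(4) s)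
        ultimately have "G (twist \<sigma> u) = act (irr_sum (specht n) c) \<sigma> (G u)"
          by (intro G_eqI) (use i0 in \<open>simp_all add: irr_sum_simps index G_i0 G_i fst_i0 specht_simps[OF \<eta>]\<close>)
        then show "G (act (with_act (fun_mod W) twist) \<sigma> u) = act (irr_sum (specht n) c) \<sigma> (G u)"
          unfolding with_act_simps .
      qed
      then show ?thesis using keys nonneg by blast
    qed
  qed
  obtain B where "finite B" "B \<subseteq> W" "cfun.independent B" "cfun.span B = W"
    using finite_dim_subspace[OF finX] W unfolding perm_stable_def by metis
  then show ?thesis using main W by blast
qed

end

section \<open>Associated graded modules\<close>

locale fun_filtration =
  fixes X :: "'i set" and F :: "nat \<Rightarrow> ('i \<Rightarrow> complex) set"
  assumes finX: "finite X" and F_sub: "cfun.subspace (F m)" and F_supp: "F m \<subseteq> funs_on X"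
    and F_mono: "m \<le> m' \<Longrightarrow> F m \<subseteq> F m'"
begin

definition F_pred :: "nat \<Rightarrow> ('i \<Rightarrow> complex) set" where
  "F_pred m = (if m = 0 then {0} else F (m - 1))"

abbreviation "gr m \<equiv> quot_mod (fun_mod (F m)) (F_pred m)"

definition coset :: "nat \<Rightarrow> ('i \<Rightarrow> complex) \<Rightarrow> ('i \<Rightarrow> complex) set" where
  "coset m a = (\<lambda>h. h + a) ` F_pred m"

lemma pred_sub: "cfun.subspace (F_pred m)"
  using F_sub cfun.subspace_single_0 by (simp add: F_pred_def)

lemma pred_le: "F_pred m \<subseteq> F m"
  using F_mono[of "m - 1" m] cfun.subspace_0[OF F_sub[of m]] by (auto simp: F_pred_def)

lemma F_le_pred: "k < m \<Longrightarrow> F k \<subseteq> F_pred m"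
  using F_mono[of k "m - 1"] by (auto simp: F_pred_def)

sublocale Fm: fun_subspace X "F m" for m
  using finX F_sub F_supp by unfold_locales

sublocale Fp: fun_subspace X "F_pred m" for m
  by (intro fun_subspace.intro finX pred_sub subset_trans[OF pred_le F_supp])

lemma a_r_coset_eq: "F_pred m +>\<^bsub>fun_mod (F m)\<^esub> a = coset m a"
  by (auto simp: a_r_coset_def r_coset_def coset_def)

lemma coset_eq_iff: "coset m a = coset m b \<longleftrightarrow> a - b \<in> F_pred m"
proof
  assume eq: "coset m a = coset m b"
  have "0 + a \<in> coset m a" unfolding coset_def by (rule imageI) (rule cfun.subspace_0[OF pred_sub])
  then have "0 + a \<in> coset m b" by (simp only: eq)
  then have "0 + a \<in> (\<lambda>h. h + b) ` F_pred m" unfolding coset_def .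
  then obtain h where h: "0 + a = h + b" "h \<in> F_pred m" by (rule imageE)
  have "a = h + b" using h(1) by (simp only: add_0)
  then have "a - b = h" by (simp only: add_diff_cancel_right')
  then show "a - b \<in> F_pred m" using h(2) by (simp only:)
next
  have *: "coset m a \<subseteq> coset m b" if "a - b \<in> F_pred m" for a b
  proof
    fix x assume "x \<in> coset m a"
    then obtain h where h: "h \<in> F_pred m" "x = h + a" by (auto simp: coset_def)
    have "x = (h + (a - b)) + b" unfolding h(2) by (simp add: fun_eq_iff)
    then show "x \<in> coset m b"
      unfolding coset_def using subspace_add[OF pred_sub h(1) that] by blast
  qed
  assume ab: "a - b \<in> F_pred m"
  have "- (a - b) \<in> F_pred m" by (rule cfun.subspace_neg[OF pred_sub ab])
  then have "b - a \<in> F_pred m" by (metis minus_diff_eq)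
  then show "coset m a = coset m b" using *[of a b] *[of b a] ab by blast
qed

lemma coset_pred: "a \<in> F_pred m \<Longrightarrow> coset m a = F_pred m"
proof -
  have "coset m 0 = F_pred m" unfolding coset_def by (auto simp: image_iff)
  then show "a \<in> F_pred m \<Longrightarrow> coset m a = F_pred m"
    using coset_eq_iff[of m a 0] by (metis diff_zero)
qed

lemma carrier_gr: "carrier (gr m) = coset m ` F m"
proof -
  have "carrier (gr m) = (\<Union>a\<in>F m. {F_pred m +>\<^bsub>fun_mod (F m)\<^esub> a})"
    by (simp add: quot_mod_def A_RCOSETS_def RCOSETS_def a_r_coset_def)
  then show ?thesis unfolding a_r_coset_eq by blast
qed

lemma zero_gr: "\<zero>\<^bsub>gr m\<^esub> = F_pred m"
  by (simp add: quot_mod_def)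

lemma add_gr: "coset m a \<oplus>\<^bsub>gr m\<^esub> coset m b = coset m (a + b)"
proof -
  have "coset m a \<oplus>\<^bsub>gr m\<^esub> coset m b = {(h + a) + (k + b) | h k. h \<in> F_pred m \<and> k \<in> F_pred m}"
    by (auto simp: quot_mod_def set_add_def set_mult_def coset_def)
  also have "\<dots> = coset m (a + b)"
  proof (intro equalityI subsetI)
    fix x assume "x \<in> {(h + a) + (k + b) | h k. h \<in> F_pred m \<and> k \<in> F_pred m}"
    then obtain h k where hk: "x = (h + a) + (k + b)" "h \<in> F_pred m" "k \<in> F_pred m" by blast
    have "x = (h + k) + (a + b)" unfolding hk(1) by (simp add: fun_eq_iff)
    then show "x \<in> coset m (a + b)" unfolding coset_def using subspace_add[OF pred_sub hk(2,3)] by blast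
  next
    fix x assume "x \<in> coset m (a + b)"
    then obtain h where h: "h \<in> F_pred m" "x = h + (a + b)" by (auto simp: coset_def)
    have "x = (h + a) + (0 + b)" unfolding h(2) by (simp add: fun_eq_iff)
    then show "x \<in> {(h + a) + (k + b) | h k. h \<in> F_pred m \<and> k \<in> F_pred m}"
      using h(1) cfun.subspace_0[OF pred_sub] by blast
  qed
  finally show ?thesis .
qed

lemma smult_gr: "c \<odot>\<^bsub>gr m\<^esub> coset m a = coset m (\<lambda>i. c * a i)"
proof -
  have "coset m (\<lambda>i. c * b i) = coset m (\<lambda>i. c * a i)" if b: "b \<in> coset m a" for b
  proof -
    obtain h where h: "h \<in> F_pred m" "b = h + a" using b by (auto simp: coset_def)
    have "(\<lambda>i. c * b i) - (\<lambda>i. c * a i) = (\<lambda>i. c * h i)"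
      unfolding h(2) by (simp add: fun_eq_iff algebra_simps)
    then show ?thesis unfolding coset_eq_iff using subspace_smult[OF pred_sub h(1)] by metis
  qed
  moreover have "coset m a \<noteq> {}"
    unfolding coset_def using cfun.subspace_0[OF pred_sub] by blast
  moreover have "c \<odot>\<^bsub>gr m\<^esub> coset m a = (\<Union>b\<in>coset m a. coset m (\<lambda>i. c * b i))"
    by (simp add: quot_mod_def a_r_coset_eq)
  ultimately show ?thesis by auto
qed

lemma abelian_monoid_gr: "abelian_monoid (gr m)"
proof (rule abelian_monoidI)
  show "\<zero>\<^bsub>gr m\<^esub> \<in> carrier (gr m)"
    using coset_pred[of 0 m] cfun.subspace_0[OF pred_sub] cfun.subspace_0[OF F_sub]
    unfolding zero_gr carrier_gr by (metis image_eqI)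
  fix x y assume "x \<in> carrier (gr m)" "y \<in> carrier (gr m)"
  then obtain a b where ab: "x = coset m a" "a \<in> F m" "y = coset m b" "b \<in> F m"
    by (auto simp: carrier_gr)
  show "x \<oplus>\<^bsub>gr m\<^esub> y \<in> carrier (gr m)"
    unfolding ab add_gr carrier_gr by (intro imageI subspace_add[OF F_sub] ab)
  show "x \<oplus>\<^bsub>gr m\<^esub> y = y \<oplus>\<^bsub>gr m\<^esub> x" unfolding ab add_gr by (simp only: add.commute)
  show "\<zero>\<^bsub>gr m\<^esub> \<oplus>\<^bsub>gr m\<^esub> x = x"
  proof -
    have "\<zero>\<^bsub>gr m\<^esub> = coset m 0" using coset_pred[of 0 m] cfun.subspace_0[OF pred_sub] zero_gr by metis
    then show ?thesis unfolding ab by (simp only: add_gr add_0)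
  qed
  fix z assume "z \<in> carrier (gr m)"
  then obtain c where c: "z = coset m c" by (auto simp: carrier_gr)
  show "x \<oplus>\<^bsub>gr m\<^esub> y \<oplus>\<^bsub>gr m\<^esub> z = x \<oplus>\<^bsub>gr m\<^esub> (y \<oplus>\<^bsub>gr m\<^esub> z)"
    unfolding ab c add_gr by (simp only: add.assoc)
qed

lemma finsum_gr_singleton:
  assumes "f a \<in> carrier (gr m)"
  shows "finsum (gr m) f {a} = f a"
proof -
  interpret abelian_monoid "gr m" by (rule abelian_monoid_gr)
  have "finsum (gr m) f {a} = f a \<oplus>\<^bsub>gr m\<^esub> finsum (gr m) f {}"
    by (rule finsum_insert) (use assms in auto)
  then show ?thesis using assms by simp
qed

lemma finsum_gr_empty: "finsum (gr m) f {} = F_pred m"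
proof -
  interpret abelian_monoid "gr m" by (rule abelian_monoid_gr)
  show ?thesis by (simp add: zero_gr)
qed

text \<open>The orthogonal projections of a vector to the steps of the filtration, each taken modulo
  the preceding step, describe an isomorphism with the associated graded module. Operators
  that preserve the filtration together with their adjoints commute with these projections.\<close>

theorem graded_iso:
  assumes D_F: "\<And>g m v. g \<in> G \<Longrightarrow> v \<in> F m \<Longrightarrow> D g v \<in> F m"
    and D'_F: "\<And>g m v. g \<in> G \<Longrightarrow> v \<in> F m \<Longrightarrow> D' g v \<in> F m"
    and D_diff: "\<And>g u v. g \<in> G \<Longrightarrow> D g (u - v) = D g u - D g v"
    and adj: "\<And>g u v. g \<in> G \<Longrightarrow> u \<in> funs_on X \<Longrightarrow> v \<in> funs_on X \<Longrightarrow> ip X (D g u) v = ip X u (D' g v)"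
    and A: "\<And>g m x a. g \<in> G \<Longrightarrow> a \<in> F m \<Longrightarrow> x m = coset m a \<Longrightarrow> A g x m = coset m (D g a)"
  shows "rep_iso G (with_act (fun_mod (\<Union>m. F m)) D) (with_act (dsum_mod UNIV gr) A)"
proof -
  let ?U = "\<Union>m. F m" and ?P = "\<lambda>m. orth_proj X (F m)"
  let ?V = "with_act (dsum_mod UNIV gr) A"
  have carrier_V: "carrier ?V = {x. (\<forall>m. x m \<in> coset m ` F m) \<and> finite {m. x m \<noteq> F_pred m}}"
    by (auto simp: dsum_mod_def carrier_gr zero_gr PiE_def)
  have add_V: "add ?V x y = (\<lambda>m. x m \<oplus>\<^bsub>gr m\<^esub> y m)" for x y
    by (simp add: dsum_mod_def restrict_def)
  have smult_V: "c \<odot>\<^bsub>?V\<^esub> x = (\<lambda>m. c \<odot>\<^bsub>gr m\<^esub> x m)" for c x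
    by (simp add: dsum_mod_def restrict_def)
  define h where "h v = (\<lambda>m. coset m (?P m v))" for v
  have late: "?P m v \<in> F_pred m" if "v \<in> F k" "k < m" for v k m
  proof -
    have "v \<in> F m" using that F_mono[of k m] by auto
    then have "?P m v = v" by (rule Fm.orth_proj_id)
    then show ?thesis using that F_le_pred by auto
  qed
  have U_sub: "u - v \<in> ?U" if uv: "u \<in> ?U" "v \<in> ?U" for u v
  proof -
    obtain k l where "u \<in> F k" "v \<in> F l" using uv by auto
    then have "u \<in> F (max k l)" "v \<in> F (max k l)" using F_mono[of k "max k l"] F_mono[of l "max k l"] by auto
    then show ?thesis using cfun.subspace_diff[OF F_sub[of "max k l"]] by blast
  qed
  have P_diff: "?P m (u - v) = ?P m u - ?P m v" for m u v
  proof -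
    have "?P m (u - v) + ?P m v = ?P m u"
      using Fm.orth_proj_add[of m "u - v" v] by (simp only: diff_add_cancel)
    then show ?thesis by (metis add_diff_cancel_right')
  qed
  have inj: "u = 0" if u: "u \<in> ?U" and z: "\<And>m. ?P m u \<in> F_pred m" for u
  proof -
    have "?P m u = 0" for m
    proof (induction m)
      case 0
      then show ?case using z[of 0] by (simp add: F_pred_def)
    next
      case (Suc m)
      have "?P (Suc m) u \<in> F m" using z[of "Suc m"] by (simp add: F_pred_def)
      moreover have "ip X (?P (Suc m) u) b = 0" if "b \<in> F m" for b
      proof -
        have "b \<in> F (Suc m)" using that F_mono[of m "Suc m"] by auto
        then have "ip X (u - ?P (Suc m) u) b = 0" by (rule Fm.orth_proj(2))
        moreover have "ip X (u - ?P m u) b = 0" by (rule Fm.orth_proj(2)[OF that])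
        ultimately show ?thesis unfolding ip_diff_left Suc.IH by simp
      qed
      ultimately show ?case by (rule Fm.orth_zero)
    qed
    moreover obtain k where "u \<in> F k" using u by auto
    then have "?P k u = u" by (rule Fm.orth_proj_id)
    ultimately show ?thesis by metis
  qed
  have "rep_iso G (with_act (fun_mod ?U) D) ?V"
  proof (rule rep_isoI[where h = h])
    show "bij_betw h (carrier (with_act (fun_mod ?U) D)) (carrier ?V)"
    proof (rule bij_betwI')
      fix u v assume "u \<in> carrier (with_act (fun_mod ?U) D)" "v \<in> carrier (with_act (fun_mod ?U) D)"
      then have uv: "u \<in> ?U" "v \<in> ?U" by simp_all
      show "h u = h v \<longleftrightarrow> u = v"
      proof
        assume "h u = h v"
        then have "coset m (?P m u) = coset m (?P m v)" for m unfolding h_def by (rule fun_cong)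
        then have "?P m (u - v) \<in> F_pred m" for m unfolding P_diff coset_eq_iff .
        then have "u - v = 0" by (rule inj[OF U_sub[OF uv]])
        then show "u = v" by (metis eq_iff_diff_eq_0)
      qed simp
    next
      fix u assume "u \<in> carrier (with_act (fun_mod ?U) D)"
      then obtain k where k: "u \<in> F k" by auto
      have "{m. h u m \<noteq> F_pred m} \<subseteq> {..k}"
        using late[OF k] coset_pred unfolding h_def by (auto simp: not_le[symmetric])
      then have "finite {m. h u m \<noteq> F_pred m}" by (rule finite_subset) simp
      moreover have "h u m \<in> coset m ` F m" for m unfolding h_def by (intro imageI Fm.orth_proj(1))
      ultimately show "h u \<in> carrier ?V" unfolding carrier_V by blast
    next
      fix x assume "x \<in> carrier ?V"
      then have x: "\<And>m. x m \<in> coset m ` F m" and K: "finite {m. x m \<noteq> F_pred m}"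
        unfolding carrier_V by auto
      let ?K = "{m. x m \<noteq> F_pred m}"
      have "\<exists>a. a \<in> F m \<and> x m = coset m a" for m using x[of m] by auto
      then obtain a where a: "\<And>m. a m \<in> F m" "\<And>m. x m = coset m (a m)" by metis
      define b where "b m = a m - orth_proj X (F_pred m) (a m)" for m
      have bF: "b m \<in> F m" for m
        unfolding b_def by (intro cfun.subspace_diff[OF F_sub] a(1) subsetD[OF pred_le] Fp.orth_proj(1))
      have xb: "x m = coset m (b m)" for m
      proof -
        have "a m - b m = orth_proj X (F_pred m) (a m)" by (simp add: b_def fun_eq_iff)
        then show ?thesis unfolding a(2) coset_eq_iff using Fp.orth_proj(1) by metis
      qed
      have b_orth: "ip X (b m) c = 0" if "c \<in> F_pred m" for m c
        unfolding b_def by (rule Fp.orth_proj(2)[OF that])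
      define v where "v = (\<Sum>k\<in>?K. b k)"
      define M where "M = Max (insert 0 ?K)"
      have "b k \<in> F M" if "k \<in> ?K" for k
      proof -
        have "k \<le> M" unfolding M_def using K that by (intro Max_ge) auto
        then show ?thesis using bF F_mono by blast
      qed
      then have vU: "v \<in> ?U" unfolding v_def using cfun.subspace_sum[OF F_sub[of M]] by blast
      have "h v m = x m" for m
      proof -
        have "?P m (b k) = (if k \<le> m then b k else 0)" for k
        proof (cases "k \<le> m")
          case True
          then have "b k \<in> F m" using bF F_mono by blast
          then show ?thesis using True Fm.orth_proj_id by simp
        next
          case False
          then have "F m \<subseteq> F_pred k" by (intro F_le_pred) simp
          then have "?P m (b k) = 0" using b_orth by (intro Fm.orth_proj_zero) blast
          then show ?thesis using False by simp
        qed
        then have Pv: "?P m v = (\<Sum>k\<in>?K. if k \<le> m then b k else 0)"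
          unfolding v_def Fm.orth_proj_sum by (intro sum.cong refl)
        have rest: "(\<Sum>k\<in>L. if k \<le> m then b k else 0) \<in> F_pred m" if "m \<notin> L" for L
        proof (rule cfun.subspace_sum[OF pred_sub])
          fix k assume "k \<in> L"
          then have "k \<noteq> m" using that by auto
          show "(if k \<le> m then b k else 0) \<in> F_pred m"
          proof (cases "k < m")
            case True
            have "b k \<in> F_pred m" by (rule subsetD[OF F_le_pred[OF True] bF])
            then show ?thesis using True by (simp only: less_imp_le if_True)
          next
            case False
            then have "\<not> k \<le> m" using \<open>k \<noteq> m\<close> by simp
            then show ?thesis using cfun.subspace_0[OF pred_sub] by (simp only: if_False)
          qed
        qed
        show ?thesis
        proof (cases "m \<in> ?K")
          case True
          have split: "?P m v = b m + (\<Sum>k\<in>?K - {m}. if k \<le> m then b k else 0)"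
            unfolding Pv sum.remove[OF K True] by (simp only: order_refl if_True)
          have "?P m v - b m = (\<Sum>k\<in>?K - {m}. if k \<le> m then b k else 0)"
            unfolding split by (rule add_diff_cancel_left')
          then have "?P m v - b m \<in> F_pred m" using rest[of "?K - {m}"] by (simp only:) blast
          then show ?thesis unfolding h_def xb coset_eq_iff .
        next
          case False
          then have "?P m v \<in> F_pred m" unfolding Pv by (rule rest)
          then show ?thesis using False coset_pred unfolding h_def by auto
        qed
      qed
      then have "x = h v" by (intro ext) simp
      then show "\<exists>v\<in>carrier (with_act (fun_mod ?U) D). x = h v" using vU by auto
    qed
  next
    fix u v
    show "h (u \<oplus>\<^bsub>with_act (fun_mod ?U) D\<^esub> v) = h u \<oplus>\<^bsub>?V\<^esub> h v"
      unfolding add_V unfolding h_def with_act_simps fun_mod_simps Fm.orth_proj_add add_gr ..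
  next
    fix c u
    show "h (c \<odot>\<^bsub>with_act (fun_mod ?U) D\<^esub> u) = c \<odot>\<^bsub>?V\<^esub> h u"
      unfolding smult_V unfolding h_def with_act_simps fun_mod_simps Fm.orth_proj_smult smult_gr ..
  next
    fix g u assume g: "g \<in> G" and "u \<in> carrier (with_act (fun_mod ?U) D)"
    then have u: "u \<in> funs_on X" using F_supp by auto
    have "?P m (D g u) = D g (?P m u)" for m
    proof (rule Fm.orth_proj_commute[where D' = "D' g"])
      have "u - ?P m u \<in> funs_on X"
        using Fm.orth_proj(1)[of m u] F_supp[of m] by (intro cfun.subspace_diff[OF subspace_funs_on] u) blast
      then show "ip X (D g (u - ?P m u)) v = ip X (u - ?P m u) (D' g v)" if "v \<in> F m" for v
        using that F_supp[of m] by (intro adj[OF g]) auto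
    qed (erule D_F[OF g] D'_F[OF g] | rule D_diff[OF g])+
    moreover have "A g (h u) m = coset m (D g (?P m u))" for m
      by (rule A[OF g Fm.orth_proj(1)]) (simp add: h_def)
    ultimately have "h (D g u) m = A g (h u) m" for m
      by (simp add: h_def)
    then show "h (act (with_act (fun_mod ?U) D) g u) = act ?V g (h u)"
      unfolding with_act_simps by (rule ext)
  qed
  then show ?thesis .
qed

end

section \<open>Alternating tensors\<close>

lemma permute_list_update:
  assumes "p permutes {..<length as}" "i < length as"
  shows "permute_list p (as[p i := b]) = (permute_list p as)[i := b]"
  by (rule nth_equalityI)
    (use assms permutes_in_image[OF assms(1)] permutes_inj[OF assms(1)] in
      \<open>auto simp: permute_list_def nth_list_update inj_eq\<close>)

lemma wedge_basis:
  "wedge (map basis_vec s) as = (if length as = length s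
    then \<Sum>p | p permutes {..<length s}. if permute_list p as = s then of_int (sign p) else 0 else 0)"
proof (cases "length as = length s")
  case True
  have "(\<Prod>i<length s. (map basis_vec s ! i) (as ! p i)) = (if permute_list p as = s then 1 else 0)"
    if p: "p permutes {..<length s}" for p
  proof (cases "permute_list p as = s")
    case eq: True
    have "(\<Prod>i<length s. (map basis_vec s ! i) (as ! p i)) = (\<Prod>i<length s. 1)"
    proof (rule prod.cong[OF refl])
      fix i assume "i \<in> {..<length s}"
      then show "(map basis_vec s ! i) (as ! p i) = 1"
        using arg_cong[OF eq, of "\<lambda>l. l ! i"] True by (simp add: permute_list_def basis_vec_def)
    qed
    then show ?thesis using eq by simp
  next
    case neq: False
    obtain i where i: "i < length s" "as ! p i \<noteq> s ! i"
    proof (rule ccontr)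
      assume "\<not> thesis"
      then have "as ! p i = s ! i" if "i < length s" for i using that \<open>\<And>i. i < length s \<Longrightarrow> as ! p i \<noteq> s ! i \<Longrightarrow> thesis\<close> by blast
      then have "permute_list p as = s"
        using True by (intro nth_equalityI) (simp_all add: permute_list_def)
      then show False using neq by contradiction
    qed
    then have "(\<Prod>i<length s. (map basis_vec s ! i) (as ! p i)) = 0"
      by (intro prod_zero) (auto simp: basis_vec_def intro!: bexI[of _ i])
    then show ?thesis using neq by simp
  qed
  then show ?thesis using True by (auto simp: wedge_def intro!: sum.cong)
qed (simp add: wedge_def)

definition linear_op :: "(('i \<Rightarrow> complex) \<Rightarrow> 'i \<Rightarrow> complex) \<Rightarrow> bool" where
  "linear_op A \<longleftrightarrow> (\<forall>f g x. A (\<lambda>b. f b + g b) x = A f x + A g x) \<and> (\<forall>c f x. A (\<lambda>b. c * f b) x = c * A f x)"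

lemma derivation_add:
  "linear_op A \<Longrightarrow> derivation A (t + u) = derivation A t + derivation A u"
  by (rule ext) (simp add: derivation_def linear_op_def sum.distrib)

lemma derivation_smult:
  "linear_op A \<Longrightarrow> derivation A (\<lambda>as. c * t as) = (\<lambda>as. c * derivation A t as)"
  by (rule ext) (simp add: derivation_def linear_op_def sum_distrib_left)

lemma linear_op_zero: "linear_op A \<Longrightarrow> A (\<lambda>b. 0) x = 0"
proof -
  assume "linear_op A"
  from this[unfolded linear_op_def, THEN conjunct2, rule_format, of 0 "\<lambda>b. 0" x]
  show ?thesis by simp
qed

lemma op_X_pow:
  "(op_X N ^^ i) f (q, l) = (if i = 0 then f (q, l) else if l < N then f (q, l - int i) else 0)"
proof (induction i arbitrary: l)
  case (Suc i)
  then show ?case by (auto simp: op_X_def algebra_simps)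
qed simp

lemma op_Y_pow: "(op_Y ^^ j) f (q, l) = of_int l ^ j * f (q, l)"
  by (induction j arbitrary: l) (auto simp: op_Y_def)

lemma op_monom_apply:
  "op_monom r N g i j f (p, l) = (if p < r \<and> (i = 0 \<or> l < N)
     then \<Sum>q<r. g $$ (p, q) * (of_int (l - int i) ^ j * f (q, l - int i)) else 0)"
  by (cases "i = 0"; cases "l < N") (simp_all add: op_monom_def op_mat_def op_X_pow op_Y_pow)

lemma linear_op_monom: "linear_op (op_monom r N g i j)"
  unfolding linear_op_def
  by (auto simp: op_monom_apply algebra_simps sum.distrib sum_distrib_left)

lemma linear_op_G: "linear_op (op_G r N a)"
  using linear_op_monom[unfolded linear_op_def]
  unfolding linear_op_def op_G_def sum_fun_apply
  by (auto simp: sum.distrib sum_distrib_left case_prod_unfold)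

definition single_coeff :: "nat \<Rightarrow> nat \<Rightarrow> nat \<Rightarrow> complex mat \<Rightarrow> coeffs" where
  "single_coeff r i j g = (\<lambda>i' j'. if i' = i \<and> j' = j then g else 0\<^sub>m r r)"

lemma op_G_single:
  "op_G r N (single_coeff r i j g) = op_monom r N g i j"
proof (rule ext)
  fix f
  show "op_G r N (single_coeff r i j g) f = op_monom r N g i j f"
  proof (cases "g = 0\<^sub>m r r")
    case True
    then have "{(i', j'). single_coeff r i j g i' j' \<noteq> 0\<^sub>m r r} = {}" by (auto simp: single_coeff_def)
    moreover have "op_monom r N g i j f (p, l) = 0" for p l
      using True by (simp add: op_monom_apply)
    then have "op_monom r N g i j f = 0" by (auto simp: fun_eq_iff)
    ultimately show ?thesis by (simp only: op_G_def sum.empty)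
  next
    case False
    then have "{(i', j'). single_coeff r i j g i' j' \<noteq> 0\<^sub>m r r} = {(i, j)}"
      by (auto simp: single_coeff_def split: if_splits)
    then show ?thesis by (simp add: op_G_def) (simp add: single_coeff_def)
  qed
qed

lemma single_coeff_filt:
  "g \<in> carrier_mat r r \<Longrightarrow> single_coeff r i j g \<in> filt_G r j"
proof -
  assume g: "g \<in> carrier_mat r r"
  have "finite {(i', j'). single_coeff r i j g i' j' \<noteq> 0\<^sub>m r r}"
    by (rule finite_subset[of _ "{(i, j)}"]) (auto simp: single_coeff_def split: if_splits)
  then show ?thesis using g by (auto simp: filt_G_def lie_G_def single_coeff_def)
qed

lemma filt_V_sub: "cfun.subspace (filt_V r N \<xi> m)"
  by (simp add: filt_V_def cfun.subspace_span)

lemma filt_V_mono: "m \<le> m' \<Longrightarrow> filt_V r N \<xi> m \<subseteq> filt_V r N \<xi> m'"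
  unfolding filt_V_def by (rule cfun.span_mono) (use order_trans in blast)

lemma filt_V_derivation:
  assumes a: "a \<in> filt_G r k" and t: "t \<in> filt_V r N \<xi> m"
  shows "derivation (op_G r N a) t \<in> filt_V r N \<xi> (k + m)"
proof -
  let ?D = "derivation (op_G r N a)"
  have lin: "linear_op (op_G r N a)" by (rule linear_op_G)
  have "filt_V r N \<xi> m \<subseteq> {t. ?D t \<in> filt_V r N \<xi> (k + m)}"
    unfolding filt_V_def[of _ _ _ m]
  proof (rule cfun.span_minimal)
    show "cfun.subspace {t. ?D t \<in> filt_V r N \<xi> (k + m)}"
    proof (rule cfun.subspaceI)
      have "?D 0 = 0"
        by (rule ext) (simp add: derivation_def linear_op_zero[OF lin])
      then show "0 \<in> {t. ?D t \<in> filt_V r N \<xi> (k + m)}"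
        using cfun.subspace_0[OF filt_V_sub] by simp
    qed (simp_all only: mem_Collect_eq derivation_add[OF lin] derivation_smult[OF lin]
        subspace_add[OF filt_V_sub] subspace_smult[OF filt_V_sub])
    show "{foldr (\<lambda>a. derivation (op_G r N a)) as (v_vec N \<xi>) |as ms.
        list_all2 (\<lambda>a m'. a \<in> filt_G r m') as ms \<and> sum_list ms \<le> m}
      \<subseteq> {t. ?D t \<in> filt_V r N \<xi> (k + m)}"
    proof clarify
      fix as ms assume "list_all2 (\<lambda>a m'. a \<in> filt_G r m') as ms" "sum_list ms \<le> m"
      then have "list_all2 (\<lambda>a m'. a \<in> filt_G r m') (a # as) (k # ms)" "sum_list (k # ms) \<le> k + m"
        using a by auto
      moreover have "?D (foldr (\<lambda>a. derivation (op_G r N a)) as (v_vec N \<xi>))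
        = foldr (\<lambda>a. derivation (op_G r N a)) (a # as) (v_vec N \<xi>)" by simp
      ultimately show "?D (foldr (\<lambda>a. derivation (op_G r N a)) as (v_vec N \<xi>)) \<in> filt_V r N \<xi> (k + m)"
        unfolding filt_V_def by (intro cfun.span_base) blast
    qed
  qed
  then show ?thesis using t by blast
qed

lemma filt_V_monom:
  assumes "g \<in> carrier_mat r r" "t \<in> filt_V r N \<xi> m"
  shows "derivation (op_monom r N g i j) t \<in> filt_V r N \<xi> (j + m)"
  using filt_V_derivation[OF single_coeff_filt[OF assms(1)] assms(2)] by (simp only: op_G_single)

subsection \<open>The module generated by the highest wedge\<close>

locale wedge_module =
  fixes r :: nat and N :: int and \<xi> :: "nat list"
  assumes len: "length \<xi> = r"
begin

abbreviation "n \<equiv> sum_list \<xi>"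

definition top_list :: "(nat \<times> int) list" where
  "top_list = concat (map (\<lambda>j. map (\<lambda>i. (j, i)) [N - int (\<xi> ! j)..N - 1]) [0..<length \<xi>])"

definition depth :: "nat \<times> int \<Rightarrow> int" where
  "depth a = N - snd a"

definition deeper :: "int \<Rightarrow> nat" where
  "deeper k = card {a \<in> set top_list. depth a > k}"

text \<open>Operators of the Lie algebra move basis vectors up, so no wedge reached from the top one
  has, below any level, more factors than the top one.\<close>

definition reachable :: "(nat \<times> int) list \<Rightarrow> bool" where
  "reachable as \<longleftrightarrow> length as = n \<and> (\<forall>a\<in>set as. fst a < r \<and> snd a < N)
     \<and> (\<forall>k. card {i. i < n \<and> depth (as ! i) > k} \<le> deeper k)"

definition alt_tensors :: "((nat \<times> int) list \<Rightarrow> complex) set" where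
  "alt_tensors = {t. (\<forall>as. t as \<noteq> 0 \<longrightarrow> reachable as)
     \<and> (\<forall>p as. p permutes {..<n} \<longrightarrow> length as = n \<longrightarrow> t (permute_list p as) = of_int (sign p) * t as)}"

lemma set_top_list: "set top_list = {(j, i). j < r \<and> N - int (\<xi> ! j) \<le> i \<and> i < N}"
  by (auto simp: top_list_def len)

lemma distinct_top_list: "distinct top_list"
proof -
  have "distinct (concat (map (\<lambda>j. map (\<lambda>i. (j, i)) [N - int (\<xi> ! j)..N - 1]) js))" if "distinct js" for js
    using that by (induction js) (auto simp: distinct_map inj_on_def)
  then show ?thesis unfolding top_list_def by simp
qed

lemma length_top_list: "length top_list = n"
proof -
  have "length top_list = sum_list (map (\<lambda>j. \<xi> ! j) [0..<length \<xi>])"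
    unfolding top_list_def length_concat by (simp add: comp_def)
  then show ?thesis by (simp add: map_nth)
qed

lemma v_vec_top: "v_vec N \<xi> = wedge (map basis_vec top_list)"
  by (simp add: v_vec_def top_list_def)

lemma deeper_top: "k \<ge> int n \<Longrightarrow> deeper k = 0"
proof -
  assume k: "k \<ge> int n"
  have "\<xi> ! j \<le> n" if "j < r" for j
    using that len by (metis elem_le_sum_list)
  then have "{a \<in> set top_list. depth a > k} = {}"
    using k by (force simp: set_top_list depth_def)
  then show ?thesis by (simp only: deeper_def card.empty)
qed

lemma reachable_depth:
  assumes "reachable as" "i < n"
  shows "depth (as ! i) \<in> {1..int n}"
proof -
  have "as ! i \<in> set as" using assms by (auto simp: reachable_def)
  then have "snd (as ! i) < N" using assms(1) unfolding reachable_def by blast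
  then have "1 \<le> depth (as ! i)" by (simp add: depth_def)
  moreover have "card {i. i < n \<and> depth (as ! i) > int n} \<le> 0"
    using assms(1) deeper_top[of "int n"] unfolding reachable_def by (metis order_refl)
  then have "{i. i < n \<and> depth (as ! i) > int n} = {}" by simp
  then have "depth (as ! i) \<le> int n" using assms(2) by (auto simp: not_less[symmetric])
  ultimately show ?thesis by simp
qed

text \<open>A finite set of words that contains all reachable ones, to have orthogonal projections.\<close>

definition box :: "(nat \<times> int) list set" where
  "box = {as. set as \<subseteq> {..<r} \<times> {N - int n..N - 1} \<and> length as = n}"

lemma finite_box: "finite box"
  unfolding box_def by (rule finite_lists_length_eq) auto

lemma reachable_box: "reachable as \<Longrightarrow> as \<in> box"
proof -
  assume v: "reachable as"
  have "a \<in> {..<r} \<times> {N - int n..N - 1}" if a: "a \<in> set as" for a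
  proof -
    obtain i where i: "i < length as" "a = as ! i" using a by (metis in_set_conv_nth)
    then have "depth a \<in> {1..int n}" using reachable_depth[OF v, of i] v by (auto simp: reachable_def)
    moreover have "fst a < r" using v a by (auto simp: reachable_def)
    ultimately show ?thesis by (cases a) (auto simp: depth_def)
  qed
  then show ?thesis using v by (auto simp: box_def reachable_def)
qed

lemma reachable_permute:
  assumes p: "p permutes {..<n}" and v: "reachable as"
  shows "reachable (permute_list p as)"
proof -
  have l: "length as = n" using v by (simp add: reachable_def)
  have "card {i. i < n \<and> depth (permute_list p as ! i) > k} = card {i. i < n \<and> depth (as ! i) > k}" for k
  proof (rule bij_betw_same_card[of p], rule bij_betw_byWitness[where f' = "inv' p"])
    have nth: "permute_list p as ! i = as ! p i" if "i < n" for i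
      using that l by (simp add: permute_list_def)
    show "p ` {i. i < n \<and> depth (permute_list p as ! i) > k} \<subseteq> {i. i < n \<and> depth (as ! i) > k}"
    proof clarify
      fix i assume i: "i < n" "depth (permute_list p as ! i) > k"
      then show "p i < n \<and> depth (as ! p i) > k"
        using permutes_in_image[OF p, of i] nth[OF i(1)] by simp
    qed
    show "inv' p ` {i. i < n \<and> depth (as ! i) > k} \<subseteq> {i. i < n \<and> depth (permute_list p as ! i) > k}"
    proof clarify
      fix i assume i: "i < n" "depth (as ! i) > k"
      have "inv' p i < n" using permutes_in_image[OF permutes_inv[OF p], of i] i by simp
      then show "inv' p i < n \<and> depth (permute_list p as ! inv' p i) > k"
        using nth[of "inv' p i"] permutes_inverses[OF p] i by simp
    qed
  qed (use permutes_inverses[OF p] in auto)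
  moreover have "set (permute_list p as) = set as" using p l by simp
  ultimately show ?thesis using v by (simp add: reachable_def)
qed

text \<open>No depth increases, so the number of factors beyond a given depth does not either.\<close>

lemma reachable_up:
  assumes v: "reachable (as[k := (q, l - int i)])" and k: "k < n" "length as = n"
    and as: "as ! k = (p, l)" "p < r" "i = 0 \<or> l < N"
  shows "reachable as"
proof -
  let ?as = "as[k := (q, l - int i)]"
  have "(q, l - int i) \<in> set ?as" using k by (intro set_update_memI) simp
  then have "l - int i < N" using v by (auto simp: reachable_def)
  then have l: "l < N" using as by auto
  have "fst a < r \<and> snd a < N" if a: "a \<in> set as" for a
  proof -
    obtain i' where i': "i' < n" "a = as ! i'" using a k by (metis in_set_conv_nth)
    show ?thesis
    proof (cases "i' = k")
      case True
      then show ?thesis using i' as l by simp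
    next
      case False
      then have "?as ! i' = a" using i' by simp
      then have "a \<in> set ?as" using i' k by (metis length_list_update nth_mem)
      then show ?thesis using v by (auto simp: reachable_def)
    qed
  qed
  moreover have "card {j. j < n \<and> depth (as ! j) > m} \<le> deeper m" for m
  proof -
    have "{j. j < n \<and> depth (as ! j) > m} \<subseteq> {j. j < n \<and> depth (?as ! j) > m}"
      using k as by (auto simp: nth_list_update depth_def)
    then have "card {j. j < n \<and> depth (as ! j) > m} \<le> card {j. j < n \<and> depth (?as ! j) > m}"
      by (intro card_mono) auto
    then show ?thesis using v by (auto simp: reachable_def intro: order_trans)
  qed
  ultimately show ?thesis using k by (simp add: reachable_def)
qed

lemma card_depth_distinct:
  assumes "distinct s" "length s = n"
  shows "card {i. i < n \<and> depth (s ! i) > k} = card {a \<in> set s. depth a > k}"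
proof (rule bij_betw_same_card[of "\<lambda>i. s ! i"])
  show "bij_betw (\<lambda>i. s ! i) {i. i < n \<and> depth (s ! i) > k} {a \<in> set s. depth a > k}"
    using assms by (auto simp: bij_betw_def inj_on_def nth_eq_iff_index_eq image_def in_set_conv_nth)
qed

lemma reachable_distinct_iff:
  assumes "distinct s" "length s = n"
  shows "reachable s \<longleftrightarrow> (\<forall>a\<in>set s. fst a < r \<and> snd a < N) \<and> (\<forall>k. card {a \<in> set s. depth a > k} \<le> deeper k)"
  using assms by (simp add: reachable_def card_depth_distinct)

lemma reachable_top: "reachable top_list"
  unfolding reachable_distinct_iff[OF distinct_top_list length_top_list]
  by (auto simp: deeper_def set_top_list)

lemma alt_sub: "cfun.subspace alt_tensors"
  by (rule cfun.subspaceI) (auto simp: alt_tensors_def algebra_simps, (metis add.left_neutral)+)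

lemma alt_length: "t \<in> alt_tensors \<Longrightarrow> length as \<noteq> n \<Longrightarrow> t as = 0"
  by (auto simp: alt_tensors_def reachable_def)

lemma alt_box: "alt_tensors \<subseteq> funs_on box"
  using reachable_box by (auto simp: alt_tensors_def funs_on_def)

lemma alt_distinct:
  assumes t: "t \<in> alt_tensors" "t as \<noteq> 0"
  shows "distinct as"
proof (rule ccontr)
  assume "\<not> distinct as"
  have l: "length as = n" using alt_length t by blast
  obtain i j where ij: "i < n" "j < n" "i \<noteq> j" "as ! i = as ! j"
    using \<open>\<not> distinct as\<close> l by (auto simp: distinct_conv_nth)
  have p: "transpose i j permutes {..<n}" using ij by (intro permutes_swap_id) auto
  have "permute_list (transpose i j) as = as"
    using ij l by (intro nth_equalityI) (auto simp: permute_list_def transpose_def)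
  moreover have "t (permute_list (transpose i j) as) = - t as"
    using t p l ij by (simp add: alt_tensors_def sign_swap_id)
  ultimately show False using t(2) by simp
qed

lemma derivation_alt:
  assumes A: "linear_op A" and t: "t \<in> alt_tensors"
    and up: "\<And>as k. length as = n \<Longrightarrow> k < n \<Longrightarrow> A (\<lambda>b. t (as[k := b])) (as ! k) \<noteq> 0 \<Longrightarrow> reachable as"
  shows "derivation A t \<in> alt_tensors"
  unfolding alt_tensors_def
proof (intro CollectI conjI allI impI)
  fix as assume nz: "derivation A t as \<noteq> 0"
  then obtain k where k: "k < length as" "A (\<lambda>b. t (as[k := b])) (as ! k) \<noteq> 0"
    unfolding derivation_def using sum.not_neutral_contains_not_neutral
    by (metis (no_types, lifting) lessThan_iff)
  have "length as = n"
  proof (rule ccontr)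
    assume "length as \<noteq> n"
    then have "(\<lambda>b. t (as[k := b])) = (\<lambda>b. 0)" using alt_length[OF t] by (intro ext) simp
    then show False using k(2) linear_op_zero[OF A] by simp
  qed
  then show "reachable as" using up k by simp
next
  fix p and as :: "(nat \<times> int) list" assume p: "p permutes {..<n}" and l: "length as = n"
  have inv: "as = permute_list (inv' p) (permute_list p as)"
    using permutes_inv_o(1)[OF p] permute_list_compose[of "inv' p" as p] permutes_inv[OF p] l by simp
  have "derivation A t (permute_list p as)
    = (\<Sum>k<n. A (\<lambda>b. t ((permute_list p as)[k := b])) (as ! p k))"
    using l by (simp add: derivation_def permute_list_def)
  also have "\<dots> = (\<Sum>k<n. (\<lambda>k. of_int (sign p) * A (\<lambda>b. t (as[k := b])) (as ! k)) (p k))"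
  proof (rule sum.cong[OF refl])
    fix k assume "k \<in> {..<n}"
    then have upd: "t ((permute_list p as)[k := b]) = of_int (sign p) * t (as[p k := b])" for b
      using permute_list_update[of p as k b] p l t by (simp add: alt_tensors_def flip: permute_list_update)
    show "A (\<lambda>b. t ((permute_list p as)[k := b])) (as ! p k)
      = (\<lambda>k. of_int (sign p) * A (\<lambda>b. t (as[k := b])) (as ! k)) (p k)"
      unfolding upd by (rule A[unfolded linear_op_def, THEN conjunct2, rule_format])
  qed
  also have "\<dots> = (\<Sum>k<n. of_int (sign p) * A (\<lambda>b. t (as[k := b])) (as ! k))"
    using sum.permute[OF p, of "\<lambda>k. of_int (sign p) * A (\<lambda>b. t (as[k := b])) (as ! k)"]
    by (simp add: comp_def)
  also have "\<dots> = of_int (sign p) * derivation A t as"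
    using l by (simp add: derivation_def sum_distrib_left)
  finally show "derivation A t (permute_list p as) = of_int (sign p) * derivation A t as" .
qed

lemma op_monom_up:
  assumes t: "t \<in> alt_tensors" and l: "length as = n" "k < n"
    and nz: "op_monom r N g i j (\<lambda>b. t (as[k := b])) (as ! k) \<noteq> 0"
  shows "reachable as"
proof -
  obtain p m where pm: "as ! k = (p, m)" by (cases "as ! k")
  have c: "p < r" "i = 0 \<or> m < N" and
    s: "(\<Sum>q<r. g $$ (p, q) * (of_int (m - int i) ^ j * t (as[k := (q, m - int i)]))) \<noteq> 0"
    using nz unfolding pm op_monom_apply by (auto split: if_splits)
  obtain q where "t (as[k := (q, m - int i)]) \<noteq> 0"
    using sum.not_neutral_contains_not_neutral[OF s] by auto
  then have "reachable (as[k := (q, m - int i)])" using t by (auto simp: alt_tensors_def)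
  then show ?thesis by (rule reachable_up[OF _ l(2,1) pm c])
qed

lemma derivation_monom_alt: "t \<in> alt_tensors \<Longrightarrow> derivation (op_monom r N g i j) t \<in> alt_tensors"
  by (rule derivation_alt[OF linear_op_monom]) (auto intro: op_monom_up)

lemma derivation_G_alt:
  assumes t: "t \<in> alt_tensors"
  shows "derivation (op_G r N a) t \<in> alt_tensors"
proof (rule derivation_alt[OF linear_op_G t])
  fix as k assume l: "length as = n" "k < n" and nz: "op_G r N a (\<lambda>b. t (as[k := b])) (as ! k) \<noteq> 0"
  have "(\<Sum>c | (case c of (i, j) \<Rightarrow> a i j \<noteq> 0\<^sub>m r r).
      (case c of (i, j) \<Rightarrow> op_monom r N (a i j) i j (\<lambda>b. t (as[k := b]))) (as ! k)) \<noteq> 0"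
    using nz unfolding op_G_def sum_fun_apply .
  then obtain c where "(case c of (i, j) \<Rightarrow> op_monom r N (a i j) i j (\<lambda>b. t (as[k := b]))) (as ! k) \<noteq> 0"
    by (rule sum.not_neutral_contains_not_neutral)
  then have "op_monom r N (a (fst c) (snd c)) (fst c) (snd c) (\<lambda>b. t (as[k := b])) (as ! k) \<noteq> 0"
    by (simp add: case_prod_unfold)
  then show "reachable as" by (rule op_monom_up[OF t l])
qed

lemma wedge_top_alt: "v_vec N \<xi> \<in> alt_tensors"
proof -
  have eq: "v_vec N \<xi> as = (if length as = n
    then \<Sum>p | p permutes {..<n}. if permute_list p as = top_list then of_int (sign p) else 0 else 0)" for as
    unfolding v_vec_top wedge_basis length_top_list ..
  show ?thesis
    unfolding alt_tensors_def
  proof (intro CollectI conjI allI impI)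
    fix as assume nz: "v_vec N \<xi> as \<noteq> 0"
    then have l: "length as = n" by (auto simp: eq split: if_splits)
    have "(\<Sum>p | p permutes {..<n}. if permute_list p as = top_list then of_int (sign p) else (0::complex)) \<noteq> 0"
      using nz l by (simp add: eq)
    then obtain p where "p \<in> {p. p permutes {..<n}}"
        "(if permute_list p as = top_list then of_int (sign p) else (0::complex)) \<noteq> 0"
      by (rule sum.not_neutral_contains_not_neutral)
    then have p: "p permutes {..<n}" "permute_list p as = top_list" by (auto split: if_splits)
    have "as = permute_list (inv' p) top_list"
      using permutes_inv_o(1)[OF p(1)] permute_list_compose[of "inv' p" as p] permutes_inv[OF p(1)] l p(2) by simp
    then show "reachable as" using reachable_permute[OF permutes_inv[OF p(1)] reachable_top] by simp
  next
    fix p and as :: "(nat \<times> int) list" assume p: "p permutes {..<n}" and l: "length as = n"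
    have "(\<Sum>q | q permutes {..<n}. if permute_list q (permute_list p as) = top_list then of_int (sign q) else 0)
      = (\<Sum>q | q permutes {..<n}. if permute_list q as = top_list then of_int (sign p * sign q) else (0::complex))"
    proof (rule sum.reindex_bij_witness[where j = "\<lambda>q. p \<circ> q" and i = "\<lambda>q. inv' p \<circ> q"])
      fix q assume "q \<in> {q. q permutes {..<n}}"
      then have q: "q permutes {..<n}" by simp
      show "inv' p \<circ> (p \<circ> q) = q" "p \<circ> (inv' p \<circ> q) = q"
        using permutes_inv_o[OF p] by (simp_all flip: comp_assoc)
      show "p \<circ> q \<in> {q. q permutes {..<n}}" "inv' p \<circ> q \<in> {q. q permutes {..<n}}"
        using p q permutes_inv[OF p] by (auto intro: permutes_compose)
      have perm: "permutation p" "permutation q"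
        using p q permutation_permutes by blast+
      have "sign p * sign (p \<circ> q) = sign q"
        using perm by (simp add: sign_compose flip: mult.assoc)
      moreover have "permute_list (p \<circ> q) as = permute_list q (permute_list p as)"
        using q l by (intro permute_list_compose) simp
      ultimately show "(if permute_list (p \<circ> q) as = top_list then of_int (sign p * sign (p \<circ> q)) else 0)
        = (if permute_list q (permute_list p as) = top_list then of_int (sign q) else (0::complex))" by simp
    qed
    also have "\<dots> = of_int (sign p) * (\<Sum>q | q permutes {..<n}. if permute_list q as = top_list then of_int (sign q) else 0)"
      unfolding sum_distrib_left by (rule sum.cong[OF refl]) simp
    finally show "v_vec N \<xi> (permute_list p as) = of_int (sign p) * v_vec N \<xi> as"
      using l by (simp add: eq)
  qed
qed

lemma filt_V_alt: "filt_V r N \<xi> m \<subseteq> alt_tensors"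
  unfolding filt_V_def
proof (rule cfun.span_minimal[OF _ alt_sub], clarify)
  fix as :: "coeffs list" and ms
  show "foldr (\<lambda>a. derivation (op_G r N a)) as (v_vec N \<xi>) \<in> alt_tensors"
    by (induction as) (simp_all add: wedge_top_alt derivation_G_alt)
qed

definition gen_module :: "((nat \<times> int) list \<Rightarrow> complex) set" where
  "gen_module = (\<Union>m. filt_V r N \<xi> m)"

lemma gen_sub: "cfun.subspace gen_module"
proof (rule cfun.subspaceI)
  show "0 \<in> gen_module" unfolding gen_module_def using cfun.subspace_0[OF filt_V_sub] by blast
  show "t + u \<in> gen_module" if "t \<in> gen_module" "u \<in> gen_module" for t u
  proof -
    from that(1) obtain k where k: "t \<in> filt_V r N \<xi> k" unfolding gen_module_def by blast
    from that(2) obtain l where l: "u \<in> filt_V r N \<xi> l" unfolding gen_module_def by blast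
    have "t \<in> filt_V r N \<xi> (max k l)" "u \<in> filt_V r N \<xi> (max k l)"
      by (rule subsetD[OF filt_V_mono k], simp, rule subsetD[OF filt_V_mono l], simp)
    then have "t + u \<in> filt_V r N \<xi> (max k l)" by (rule subspace_add[OF filt_V_sub])
    then show ?thesis unfolding gen_module_def by (rule UN_I[OF UNIV_I])
  qed
  show "(\<lambda>as. c * t as) \<in> gen_module" if "t \<in> gen_module" for c t
  proof -
    from that obtain k where "t \<in> filt_V r N \<xi> k" unfolding gen_module_def by blast
    then have "(\<lambda>as. c * t as) \<in> filt_V r N \<xi> k" by (rule subspace_smult[OF filt_V_sub])
    then show ?thesis unfolding gen_module_def by (rule UN_I[OF UNIV_I])
  qed
qed

lemma gen_monom: "g \<in> carrier_mat r r \<Longrightarrow> t \<in> gen_module \<Longrightarrow> derivation (op_monom r N g i j) t \<in> gen_module"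
  unfolding gen_module_def by (auto dest: filt_V_monom)

lemma gen_top: "v_vec N \<xi> \<in> gen_module"
proof -
  have "v_vec N \<xi> \<in> filt_V r N \<xi> 0"
    unfolding filt_V_def by (rule cfun.span_base) (auto intro!: exI[of _ "[]"])
  then show ?thesis by (auto simp: gen_module_def)
qed

text \<open>A polynomial in \<open>\<Y>\<close> that takes the value 1 at the level \<open>l'\<close> and 0 at the other levels of a
  wedge picks out one factor, which a power of \<open>\<X>\<close> and an elementary matrix then move.\<close>

lemma gen_move:
  assumes t: "wedge (map basis_vec s) \<in> gen_module" and s: "distinct s" "length s = n"
    and j: "j < n" "s ! j = (q, l')" and move: "l' \<le> l" "l < N" "p < r" "q < r"
  shows "wedge (map basis_vec (s[j := (p, l)])) \<in> gen_module"
proof -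
  let ?t = "wedge (map basis_vec s)" and ?s = "s[j := (p, l)]"
  define i where "i = nat (l - l')"
  define Z where "Z = snd ` set s - {l'}"
  define L :: "complex poly" where
    "L = Polynomial.smult (1 / (\<Prod>x\<in>Z. of_int l' - of_int x)) (\<Prod>x\<in>Z. [:- of_int x, 1:])"
  have finZ: "finite Z" by (simp add: Z_def)
  have L1: "poly L (of_int l') = 1"
    using finZ by (simp add: L_def poly_prod) (auto simp: Z_def)
  have L0: "poly L (of_int x) = 0" if "x \<in> snd ` set s" "x \<noteq> l'" for x
    using finZ that by (auto simp: L_def poly_prod Z_def)
  define T where "T = (\<lambda>as. \<Sum>d\<le>degree L. Polynomial.coeff L d * derivation (op_monom r N (elem_mat r p q) i d) ?t as)"
  have TU: "T \<in> gen_module"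
    unfolding T_def by (intro subspace_sum[OF gen_sub] gen_monom elem_mat_carrier t)
  have tsupp: "u \<in> set s" if "?t (as[k := u]) \<noteq> 0" "k < length as" for as k u
  proof -
    have l: "length as = n" using that s by (auto simp: wedge_basis split: if_splits)
    have "(\<Sum>p | p permutes {..<n}. if permute_list p (as[k := u]) = s then of_int (sign p) else (0::complex)) \<noteq> 0"
      using that l s by (simp add: wedge_basis)
    then obtain p where "p \<in> {p. p permutes {..<n}}"
        "(if permute_list p (as[k := u]) = s then of_int (sign p) else (0::complex)) \<noteq> 0"
      by (rule sum.not_neutral_contains_not_neutral)
    then have "p permutes {..<n}" "permute_list p (as[k := u]) = s" by (auto split: if_splits)
    then have "set s = set (as[k := u])" using l by (metis length_list_update set_permute_list)
    then show ?thesis using that by (simp add: set_update_memI)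
  qed
  have "T as = wedge (map basis_vec ?s) as" for as
  proof (cases "length as = n")
    case False
    then have "?t (as[k := b]) = 0" for k b using s by (simp add: wedge_basis)
    then have "T as = 0"
      by (simp add: T_def derivation_def linear_op_zero[OF linear_op_monom])
    then show ?thesis using False s by (simp add: wedge_basis)
  next
    case l: True
    have summand: "(\<Sum>d\<le>degree L. Polynomial.coeff L d * op_monom r N (elem_mat r p q) i d (\<lambda>b. ?t (as[k := b])) (as ! k))
      = (if as ! k = (p, l) then ?t (as[k := (q, l')]) else 0)" if k: "k < n" for k
    proof -
      obtain p1 l1 where a: "as ! k = (p1, l1)" by (cases "as ! k")
      have mon: "op_monom r N (elem_mat r p q) i d (\<lambda>b. ?t (as[k := b])) (as ! k)
        = (if p1 = p \<and> (i = 0 \<or> l1 < N) then of_int (l1 - int i) ^ d * ?t (as[k := (q, l1 - int i)]) else 0)" for d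
      proof -
        have "(\<Sum>q'<r. elem_mat r p q $$ (p1, q') * (of_int (l1 - int i) ^ d * ?t (as[k := (q', l1 - int i)])))
          = (\<Sum>q'<r. if q' = q then (if p1 = p then of_int (l1 - int i) ^ d * ?t (as[k := (q, l1 - int i)]) else 0) else 0)"
          if "p1 < r" using that by (intro sum.cong refl) auto
        then show ?thesis unfolding a op_monom_apply using move by (auto simp: sum.delta)
      qed
      have "(\<Sum>d\<le>degree L. Polynomial.coeff L d * op_monom r N (elem_mat r p q) i d (\<lambda>b. ?t (as[k := b])) (as ! k))
        = (if p1 = p \<and> (i = 0 \<or> l1 < N) then poly L (of_int (l1 - int i)) * ?t (as[k := (q, l1 - int i)]) else 0)"
        unfolding mon
        by (cases "p1 = p \<and> (i = 0 \<or> l1 < N)")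
          (simp_all only: if_True if_False mult_zero_right sum.neutral_const poly_altdef
            sum_distrib_right mult.assoc simp_thms)
      also have "\<dots> = (if as ! k = (p, l) then ?t (as[k := (q, l')]) else 0)"
      proof (cases "?t (as[k := (q, l1 - int i)]) = 0")
        case True
        moreover have "l - int i = l'" using move by (simp add: i_def)
        ultimately show ?thesis using a by auto
      next
        case False
        then have "(q, l1 - int i) \<in> set s" using tsupp k l by simp
        then have mem: "l1 - int i \<in> snd ` set s" by force
        have li: "l1 - int i = l' \<longleftrightarrow> l1 = l" using move by (auto simp: i_def)
        show ?thesis
        proof (cases "l1 = l")
          case True
          then have "l1 - int i = l'" using li by simp
          then show ?thesis using L1 a move True by simp
        next
          case False
          then have "poly L (of_int (l1 - int i)) = 0" using L0 mem li by blast
          then show ?thesis using False a by simp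
        qed
      qed
      finally show ?thesis .
    qed
    have "T as = (\<Sum>d\<le>degree L. \<Sum>k<n. Polynomial.coeff L d * op_monom r N (elem_mat r p q) i d (\<lambda>b. ?t (as[k := b])) (as ! k))"
      using l by (simp add: T_def derivation_def sum_distrib_left)
    also have "\<dots> = (\<Sum>k<n. \<Sum>d\<le>degree L. Polynomial.coeff L d * op_monom r N (elem_mat r p q) i d (\<lambda>b. ?t (as[k := b])) (as ! k))"
      by (rule sum.swap)
    also have "\<dots> = (\<Sum>k<n. if as ! k = (p, l) then ?t (as[k := (q, l')]) else 0)"
      by (rule sum.cong[OF refl]) (simp add: summand)
    also have "\<dots> = (\<Sum>k<n. \<Sum>\<pi> | \<pi> permutes {..<n}.
        if as ! k = (p, l) \<and> permute_list \<pi> (as[k := (q, l')]) = s then of_int (sign \<pi>) else 0)"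
      using l s by (intro sum.cong[OF refl]) (simp add: wedge_basis)
    also have "\<dots> = (\<Sum>\<pi> | \<pi> permutes {..<n}. \<Sum>k<n.
        if as ! k = (p, l) \<and> permute_list \<pi> (as[k := (q, l')]) = s then of_int (sign \<pi>) else 0)"
      by (rule sum.swap)
    also have "\<dots> = (\<Sum>\<pi> | \<pi> permutes {..<n}. if permute_list \<pi> as = ?s then of_int (sign \<pi>) else 0)"
    proof (rule sum.cong[OF refl])
      fix \<pi> assume "\<pi> \<in> {\<pi>. \<pi> permutes {..<n}}"
      then have \<pi>: "\<pi> permutes {..<n}" by simp
      have \<pi>lt: "\<pi> x < n \<longleftrightarrow> x < n" for x using permutes_in_image[OF \<pi>, of x] by simp
      have \<pi>inj: "\<pi> x = \<pi> y \<longleftrightarrow> x = y" for x y using permutes_inj[OF \<pi>] by (auto simp: inj_eq)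
      have "as ! k = (p, l) \<and> permute_list \<pi> (as[k := (q, l')]) = s \<longleftrightarrow> k = \<pi> j \<and> permute_list \<pi> as = ?s"
        if k: "k < n" for k
      proof
        assume a: "as ! k = (p, l) \<and> permute_list \<pi> (as[k := (q, l')]) = s"
        define m where "m = inv' \<pi> k"
        have m: "\<pi> m = k" "m < n" using permutes_inverses[OF \<pi>] \<pi>lt[of m] k by (auto simp: m_def)
        have upd: "(permute_list \<pi> as)[m := (q, l')] = s"
          using permute_list_update[of \<pi> as m "(q, l')"] a m \<pi> l by simp
        have "s ! m = (q, l')" using arg_cong[OF upd, of "\<lambda>z. z ! m"] m l by simp
        then have "m = j" using s j m by (metis nth_eq_iff_index_eq)
        moreover have "permute_list \<pi> as = s[m := (p, l)]"
        proof -
          have "permute_list \<pi> as ! m = (p, l)" using m l a by (simp add: permute_list_def)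
          then have "permute_list \<pi> as = (permute_list \<pi> as)[m := (p, l)]"
            by (metis list_update_id)
          then show ?thesis unfolding upd[symmetric] by simp
        qed
        ultimately show "k = \<pi> j \<and> permute_list \<pi> as = ?s" using m by simp
      next
        assume a: "k = \<pi> j \<and> permute_list \<pi> as = ?s"
        have "permute_list \<pi> as ! j = (p, l)" using a j s by simp
        then have "as ! k = (p, l)" using a j l by (simp add: permute_list_def)
        moreover have "permute_list \<pi> (as[k := (q, l')]) = (permute_list \<pi> as)[j := (q, l')]"
          using permute_list_update[of \<pi> as j] a \<pi> l j by simp
        then have "permute_list \<pi> (as[k := (q, l')]) = s" using a j by (metis list_update_id list_update_overwrite)
        ultimately show "as ! k = (p, l) \<and> permute_list \<pi> (as[k := (q, l')]) = s" by simp
      qed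
      then have "(\<Sum>k<n. if as ! k = (p, l) \<and> permute_list \<pi> (as[k := (q, l')]) = s then of_int (sign \<pi>) else 0)
        = (\<Sum>k<n. if k = \<pi> j then (if permute_list \<pi> as = ?s then of_int (sign \<pi>) else 0) else (0::complex))"
        by (intro sum.cong[OF refl]) auto
      also have "\<dots> = (if permute_list \<pi> as = ?s then of_int (sign \<pi>) else 0)"
        using \<pi>lt[of j] j by (simp add: sum.delta)
      finally show "(\<Sum>k<n. if as ! k = (p, l) \<and> permute_list \<pi> (as[k := (q, l')]) = s then of_int (sign \<pi>) else 0)
        = (if permute_list \<pi> as = ?s then of_int (sign \<pi>) else (0::complex))" .
    qed
    also have "\<dots> = wedge (map basis_vec ?s) as"
      using l s by (simp add: wedge_basis)
    finally show ?thesis .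
  qed
  then have "T = wedge (map basis_vec ?s)" by (rule ext)
  then show ?thesis using TU by simp
qed

lemma wedge_permute:
  assumes "\<pi> permutes {..<length s}"
  shows "wedge (map basis_vec (permute_list \<pi> s)) = (\<lambda>as. of_int (sign \<pi>) * wedge (map basis_vec s) as)"
proof
  fix as
  show "wedge (map basis_vec (permute_list \<pi> s)) as = of_int (sign \<pi>) * wedge (map basis_vec s) as"
  proof (cases "length as = length s")
    case l: True
    have "(\<Sum>p | p permutes {..<length s}. if permute_list p as = permute_list \<pi> s then of_int (sign p) else 0)
      = (\<Sum>p | p permutes {..<length s}. if permute_list p as = s then of_int (sign \<pi> * sign p) else (0::complex))"
    proof (rule sum.reindex_bij_witness[where j = "\<lambda>p. p \<circ> inv' \<pi>" and i = "\<lambda>p. p \<circ> \<pi>"])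
      fix p assume "p \<in> {p. p permutes {..<length s}}"
      then have p: "p permutes {..<length s}" by simp
      show "p \<circ> inv' \<pi> \<circ> \<pi> = p" "p \<circ> \<pi> \<circ> inv' \<pi> = p"
        using permutes_inv_o[OF assms] by (simp_all add: comp_assoc)
      show "p \<circ> inv' \<pi> \<in> {p. p permutes {..<length s}}" "p \<circ> \<pi> \<in> {p. p permutes {..<length s}}"
        using p assms permutes_inv[OF assms] by (auto intro: permutes_compose)
      have perm: "permutation p" "permutation \<pi>" "permutation (inv' \<pi>)"
        using p assms permutes_inv[OF assms] permutation_permutes by blast+
      have "permute_list (p \<circ> inv' \<pi>) as = permute_list (inv' \<pi>) (permute_list p as)"
        using permutes_inv[OF assms] l by (intro permute_list_compose) simp
      moreover have "permute_list (inv' \<pi>) (permute_list p as) = s \<longleftrightarrow> permute_list p as = permute_list \<pi> s"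
      proof
        assume "permute_list (inv' \<pi>) (permute_list p as) = s"
        then have "permute_list \<pi> s = permute_list (inv' \<pi> \<circ> \<pi>) (permute_list p as)"
          using assms l by (subst permute_list_compose) auto
        then show "permute_list p as = permute_list \<pi> s" using permutes_inv_o[OF assms] by simp
      next
        assume "permute_list p as = permute_list \<pi> s"
        then have "permute_list (inv' \<pi>) (permute_list p as) = permute_list (\<pi> \<circ> inv' \<pi>) s"
          using permutes_inv[OF assms] by (subst permute_list_compose) auto
        then show "permute_list (inv' \<pi>) (permute_list p as) = s" using permutes_inv_o[OF assms] by simp
      qed
      moreover have "sign \<pi> * sign (p \<circ> inv' \<pi>) = sign p"
        using perm by (simp add: sign_compose sign_inverse mult.left_commute)
      ultimately show "(if permute_list (p \<circ> inv' \<pi>) as = s then of_int (sign \<pi> * sign (p \<circ> inv' \<pi>)) else 0)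
        = (if permute_list p as = permute_list \<pi> s then of_int (sign p) else (0::complex))"
        by simp
    qed
    also have "\<dots> = of_int (sign \<pi>) * (\<Sum>p | p permutes {..<length s}. if permute_list p as = s then of_int (sign p) else 0)"
      unfolding sum_distrib_left by (rule sum.cong[OF refl]) simp
    finally show ?thesis using l by (simp add: wedge_basis)
  qed (simp add: wedge_basis)
qed

text \<open>Induction on the number of factors that are not among those of the top wedge: the deepest of
  these is moved down to a free place of the top wedge. The wedge obtained is in the module by
  induction, and \<open>gen_move\<close> leads back up from it.\<close>

lemma wedge_gen: "distinct s \<Longrightarrow> reachable s \<Longrightarrow> wedge (map basis_vec s) \<in> gen_module"
proof (induction "card (set s - set top_list)" arbitrary: s rule: less_induct)
  case less
  let ?A = "set s" and ?B = "set top_list"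
  have l: "length s = n" using less.prems by (simp add: reachable_def)
  have cA: "card ?A = n" using less.prems l by (simp add: distinct_card)
  have cB: "card ?B = n" using distinct_card[OF distinct_top_list] length_top_list by simp
  show ?case
  proof (cases "?A - ?B = {}")
    case True
    then have "?A = ?B" using cA cB by (intro card_subset_eq) auto
    then have "mset s = mset top_list"
      using less.prems(1) distinct_top_list by (simp add: set_eq_iff_mset_eq_distinct)
    then obtain \<pi> where \<pi>: "\<pi> permutes {..<length top_list}" "permute_list \<pi> top_list = s"
      by (rule mset_eq_permutation)
    have "wedge (map basis_vec s) = (\<lambda>as. of_int (sign \<pi>) * v_vec N \<xi> as)"
      using wedge_permute[OF \<pi>(1)] unfolding \<pi>(2) v_vec_top .
    then show ?thesis using subspace_smult[OF gen_sub gen_top] by simp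
  next
    case False
    define d where "d = Max (depth ` (?A - ?B))"
    have "d \<in> depth ` (?A - ?B)" unfolding d_def using False by (intro Max_in) auto
    then obtain a where a: "a \<in> ?A" "a \<notin> ?B" "depth a = d" by auto
    have dmax: "depth x \<le> d" if "x \<in> ?A" "x \<notin> ?B" for x
      unfolding d_def using that by (intro Max_ge) auto
    have "\<exists>b\<in>?B. b \<notin> ?A \<and> depth b \<ge> d"
    proof (rule ccontr)
      assume "\<not> (\<exists>b\<in>?B. b \<notin> ?A \<and> depth b \<ge> d)"
      then have "{b \<in> ?B. depth b > d - 1} \<subset> {x \<in> ?A. depth x > d - 1}" using a by force
      then have "card {b \<in> ?B. depth b > d - 1} < card {x \<in> ?A. depth x > d - 1}"
        by (intro psubset_card_mono) auto
      moreover have "card {x \<in> ?A. depth x > d - 1} \<le> deeper (d - 1)"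
        using less.prems reachable_distinct_iff[OF less.prems(1) l] by blast
      ultimately show False by (simp add: deeper_def)
    qed
    then obtain b where b: "b \<in> ?B" "b \<notin> ?A" "depth b \<ge> d" by blast
    obtain k where k: "k < n" "s ! k = a" using a l by (metis in_set_conv_nth)
    let ?s = "s[k := b]"
    have ds: "distinct ?s" using less.prems b by (intro distinct_list_update) auto
    have ls: "length ?s = n" using l by simp
    have set_s: "set ?s = insert b (?A - {a})"
      using set_update_distinct[OF less.prems(1), of k b] k l by simp
    have bB: "fst b < r" "snd b < N" using b by (auto simp: set_top_list)
    have aA: "fst a < r" "snd a < N" using a less.prems by (auto simp: reachable_def)
    have "reachable ?s"
      unfolding reachable_distinct_iff[OF ds ls]
    proof (intro conjI allI ballI)
      fix x assume "x \<in> set ?s"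
      then show "fst x < r" "snd x < N" using less.prems bB unfolding set_s by (auto simp: reachable_def)
    next
      fix m
      show "card {x \<in> set ?s. depth x > m} \<le> deeper m"
      proof (cases "m < d")
        case True
        then have "{x \<in> set ?s. depth x > m} = insert b ({x \<in> ?A. depth x > m} - {a})"
          using b unfolding set_s by auto
        moreover have "card (insert b ({x \<in> ?A. depth x > m} - {a})) = card {x \<in> ?A. depth x > m}"
        proof -
          have "card (insert b ({x \<in> ?A. depth x > m} - {a})) = Suc (card ({x \<in> ?A. depth x > m} - {a}))"
            using b by (intro card_insert_disjoint) auto
          also have "\<dots> = card {x \<in> ?A. depth x > m}"
            using a True by (intro card_Suc_Diff1) auto
          finally show ?thesis .
        qed
        ultimately show ?thesis
          using less.prems reachable_distinct_iff[OF less.prems(1) l] by auto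
      next
        case False
        then have "{x \<in> set ?s. depth x > m} \<subseteq> {x \<in> ?B. depth x > m}"
          using b dmax unfolding set_s by force
        then show ?thesis unfolding deeper_def by (intro card_mono) auto
      qed
    qed
    moreover have "card (set ?s - ?B) < card (?A - ?B)"
    proof -
      have "set ?s - ?B \<subseteq> ?A - ?B - {a}" unfolding set_s using b(1) by auto
      moreover have "a \<in> ?A - ?B" using a by simp
      ultimately have "set ?s - ?B \<subset> ?A - ?B" by blast
      then show ?thesis by (intro psubset_card_mono) auto
    qed
    ultimately have IH: "wedge (map basis_vec ?s) \<in> gen_module" using less.hyps ds by blast
    have "wedge (map basis_vec (?s[k := (fst a, snd a)])) \<in> gen_module"
      by (rule gen_move[OF IH ds ls k(1), where q = "fst b" and l' = "snd b"]) (use k l a b aA bB in \<open>auto simp: depth_def\<close>)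
    moreover have "?s[k := (fst a, snd a)] = s"
      unfolding prod.collapse list_update_overwrite using list_update_id[of s k] by (simp only: k(2))
    ultimately show ?thesis by simp
  qed
qed

text \<open>An alternating tensor \<open>t\<close> is a combination of wedges of words in its support. All \<open>n!\<close> orderings
  of the factors of a wedge occur among the words, hence the division by \<open>n!\<close>.\<close>

theorem gen_module_alt: "gen_module = alt_tensors"
proof
  show "gen_module \<subseteq> alt_tensors" unfolding gen_module_def using filt_V_alt by blast
  show "alt_tensors \<subseteq> gen_module"
  proof
    fix t assume t: "t \<in> alt_tensors"
    let ?e = "\<lambda>s. wedge (map basis_vec s)"
    have "(\<lambda>as. t s * ?e s as) \<in> gen_module" for s
    proof (cases "t s = 0")
      case True
      then have "(\<lambda>as. t s * ?e s as) = 0" by (simp add: fun_eq_iff)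
      then show ?thesis using cfun.subspace_0[OF gen_sub] by (simp only:)
    next
      case False
      then have "?e s \<in> gen_module"
        using wedge_gen alt_distinct[OF t] t by (auto simp: alt_tensors_def)
      then show ?thesis by (rule subspace_smult[OF gen_sub])
    qed
    then have "(\<lambda>as. \<Sum>s\<in>box. (1 / fact n) * (t s * ?e s as)) \<in> gen_module"
      by (rule subspace_sum[OF gen_sub])
    moreover have "(\<Sum>s\<in>box. (1 / fact n) * (t s * ?e s as)) = t as" for as
    proof (cases "length as = n")
      case l: True
      have "(\<Sum>s\<in>box. t s * ?e s as)
        = (\<Sum>s\<in>box. \<Sum>p | p permutes {..<n}. if s = permute_list p as then of_int (sign p) * t (permute_list p as) else 0)"
      proof (rule sum.cong[OF refl])
        fix s assume "s \<in> box"
        then have "length s = n" by (simp add: box_def)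
        then show "t s * ?e s as = (\<Sum>p | p permutes {..<n}. if s = permute_list p as then of_int (sign p) * t (permute_list p as) else 0)"
          using l by (auto simp: wedge_basis sum_distrib_left intro!: sum.cong)
      qed
      also have "\<dots> = (\<Sum>p | p permutes {..<n}. \<Sum>s\<in>box. if s = permute_list p as then of_int (sign p) * t (permute_list p as) else 0)"
        by (rule sum.swap)
      also have "\<dots> = (\<Sum>p | p permutes {..<n}. t as)"
      proof (rule sum.cong[OF refl])
        fix p assume "p \<in> {p. p permutes {..<n}}"
        then have tp: "t (permute_list p as) = of_int (sign p) * t as"
          using t l by (simp add: alt_tensors_def)
        have "t (permute_list p as) = 0" if "permute_list p as \<notin> box"
          using that t alt_box by (auto simp: funs_on_def)
        then have "(\<Sum>s\<in>box. if s = permute_list p as then of_int (sign p) * t (permute_list p as) else 0)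
          = of_int (sign p) * t (permute_list p as)"
          using finite_box by (simp add: sum.delta)
        also have "\<dots> = of_int (sign p * sign p) * t as" unfolding tp by (simp only: of_int_mult mult.assoc)
        finally show "(\<Sum>s\<in>box. if s = permute_list p as then of_int (sign p) * t (permute_list p as) else 0) = t as"
          by (simp only: sign_idempotent of_int_1 mult_1)
      qed
      also have "\<dots> = fact n * t as" using card_permutations[of "{..<n}" n] by simp
      finally have total: "(\<Sum>s\<in>box. t s * ?e s as) = fact n * t as" .
      show ?thesis unfolding sum_distrib_left[symmetric] total by simp
    next
      case False
      have "?e s as = 0" if "s \<in> box" for s using that False by (simp add: wedge_basis box_def)
      then show ?thesis using False alt_length[OF t] by simp
    qed
    ultimately show "t \<in> gen_module" by simp
  qed
qed

end

subsection \<open>The graded module as a module of alternating tensors\<close>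

lemma rep_iso_trans: "rep_iso G L M \<Longrightarrow> rep_iso G M M' \<Longrightarrow> rep_iso G L M'"
proof -
  assume "rep_iso G L M"
  then obtain h where h: "bij_betw h (carrier L) (carrier M)"
    "\<And>v w. v \<in> carrier L \<Longrightarrow> w \<in> carrier L \<Longrightarrow> h (v \<oplus>\<^bsub>L\<^esub> w) = h v \<oplus>\<^bsub>M\<^esub> h w"
    "\<And>c v. v \<in> carrier L \<Longrightarrow> h (c \<odot>\<^bsub>L\<^esub> v) = c \<odot>\<^bsub>M\<^esub> h v"
    "\<And>g v. g \<in> G \<Longrightarrow> v \<in> carrier L \<Longrightarrow> h (act L g v) = act M g (h v)"
    unfolding rep_iso_def by blast
  assume "rep_iso G M M'"
  then obtain k where k: "bij_betw k (carrier M) (carrier M')"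
    "\<And>v w. v \<in> carrier M \<Longrightarrow> w \<in> carrier M \<Longrightarrow> k (v \<oplus>\<^bsub>M\<^esub> w) = k v \<oplus>\<^bsub>M'\<^esub> k w"
    "\<And>c v. v \<in> carrier M \<Longrightarrow> k (c \<odot>\<^bsub>M\<^esub> v) = c \<odot>\<^bsub>M'\<^esub> k v"
    "\<And>g v. g \<in> G \<Longrightarrow> v \<in> carrier M \<Longrightarrow> k (act M g v) = act M' g (k v)"
    unfolding rep_iso_def by blast
  have hM: "h v \<in> carrier M" if "v \<in> carrier L" for v using h(1) that by (rule bij_betw_apply)
  show "rep_iso G L M'"
    by (rule rep_isoI[where h = "\<lambda>v. k (h v)"])
      (use bij_betw_trans[OF h(1) k(1)] in \<open>simp_all add: comp_def h(2-4) k(2-4) hM\<close>)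
qed

lemma rep_iso_sym:
  assumes "rep_iso G M M'"
    and "\<And>v w. v \<in> carrier M \<Longrightarrow> w \<in> carrier M \<Longrightarrow> v \<oplus>\<^bsub>M\<^esub> w \<in> carrier M"
    and "\<And>c v. v \<in> carrier M \<Longrightarrow> c \<odot>\<^bsub>M\<^esub> v \<in> carrier M"
    and "\<And>g v. g \<in> G \<Longrightarrow> v \<in> carrier M \<Longrightarrow> act M g v \<in> carrier M"
  shows "rep_iso G M' M"
proof -
  obtain h where h: "bij_betw h (carrier M) (carrier M')"
    "\<And>v w. v \<in> carrier M \<Longrightarrow> w \<in> carrier M \<Longrightarrow> h (v \<oplus>\<^bsub>M\<^esub> w) = h v \<oplus>\<^bsub>M'\<^esub> h w"
    "\<And>c v. v \<in> carrier M \<Longrightarrow> h (c \<odot>\<^bsub>M\<^esub> v) = c \<odot>\<^bsub>M'\<^esub> h v"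
    "\<And>g v. g \<in> G \<Longrightarrow> v \<in> carrier M \<Longrightarrow> h (act M g v) = act M' g (h v)"
    using assms(1) unfolding rep_iso_def by blast
  define k where "k = inv_into (carrier M) h"
  have k: "k y \<in> carrier M" "h (k y) = y" if "y \<in> carrier M'" for y
    using h(1) that unfolding k_def
    by (auto simp: bij_betw_def inv_into_into f_inv_into_f)
  have kh: "k (h x) = x" if "x \<in> carrier M" for x
    using h(1) that by (simp add: k_def bij_betw_def)
  show ?thesis
  proof (rule rep_isoI[where h = k])
    show "bij_betw k (carrier M') (carrier M)" unfolding k_def by (rule bij_betw_inv_into[OF h(1)])
    fix x y assume "x \<in> carrier M'" "y \<in> carrier M'"
    then show "k (x \<oplus>\<^bsub>M'\<^esub> y) = k x \<oplus>\<^bsub>M\<^esub> k y"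
      using kh[OF assms(2)[OF k(1) k(1)]] h(2)[OF k(1) k(1)] k(2) by metis
  next
    fix c x assume "x \<in> carrier M'"
    then show "k (c \<odot>\<^bsub>M'\<^esub> x) = c \<odot>\<^bsub>M\<^esub> k x"
      using kh[OF assms(3)[OF k(1)]] h(3)[OF k(1)] k(2) by metis
  next
    fix g x assume "g \<in> G" "x \<in> carrier M'"
    then show "k (act M' g x) = act M g (k x)"
      using kh[OF assms(4)[OF _ k(1)]] h(4)[OF _ k(1)] k(2) by metis
  qed
qed

definition mat_dagger :: "nat \<Rightarrow> complex mat \<Rightarrow> complex mat" where
  "mat_dagger r g = mat r r (\<lambda>(i, j). cnj (g $$ (j, i)))"

context wedge_module
begin

abbreviation "gl_op g \<equiv> derivation (op_monom r N g 0 0)"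

lemma gl_op_apply:
  assumes "\<And>k. k < length as \<Longrightarrow> fst (as ! k) < r"
  shows "gl_op g t as = (\<Sum>k<length as. \<Sum>q<r. g $$ (fst (as ! k), q) * t (as[k := (q, snd (as ! k))]))"
  unfolding derivation_def
proof (rule sum.cong[OF refl])
  fix k assume "k \<in> {..<length as}"
  then have "fst (as ! k) < r" using assms by simp
  then show "op_monom r N g 0 0 (\<lambda>b. t (as[k := b])) (as ! k)
    = (\<Sum>q<r. g $$ (fst (as ! k), q) * t (as[k := (q, snd (as ! k))]))"
    by (cases "as ! k") (simp add: op_monom_apply)
qed

lemma box_nth:
  assumes "as \<in> box" "k < n"
  shows "fst (as ! k) < r" "as ! k \<in> {..<r} \<times> {N - int n..N - 1}"
proof -
  have "as ! k \<in> set as" using assms by (auto simp: box_def)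
  then show 1: "as ! k \<in> {..<r} \<times> {N - int n..N - 1}" using assms unfolding box_def by blast
  then show "fst (as ! k) < r" by auto
qed

text \<open>Replacing the letter of one factor is undone by the reverse replacement in the same factor.\<close>

lemma gl_op_adjoint:
  "ip box (gl_op g u) v = ip box u (gl_op (mat_dagger r g) v)"
proof -
  let ?Z = "box \<times> {..<n} \<times> {..<r}"
  let ?upd = "\<lambda>as k q. as[k := (q, snd (as ! k))]"
  have expand: "gl_op h w as = (\<Sum>k<n. \<Sum>q<r. h $$ (fst (as ! k), q) * w (?upd as k q))" if "as \<in> box" for h w as
  proof -
    have l: "length as = n" using that by (simp add: box_def)
    show ?thesis using gl_op_apply[of as h w] box_nth(1)[OF that] l by simp
  qed
  have upd_box: "?upd as k q \<in> box" if "as \<in> box" "k < n" "q < r" for as k q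
  proof -
    have "set (?upd as k q) \<subseteq> insert (q, snd (as ! k)) (set as)" by (rule set_update_subset_insert)
    then show ?thesis using that box_nth(2)[OF that(1,2)] by (auto simp: box_def)
  qed
  have "ip box (gl_op g u) v = (\<Sum>as\<in>box. \<Sum>k<n. \<Sum>q<r. g $$ (fst (as ! k), q) * u (?upd as k q) * cnj (v as))"
    unfolding ip_def by (rule sum.cong[OF refl]) (simp add: expand sum_distrib_right)
  also have "\<dots> = (\<Sum>(as, k, q)\<in>?Z. g $$ (fst (as ! k), q) * u (?upd as k q) * cnj (v as))"
    by (simp add: sum.cartesian_product)
  also have "\<dots> = (\<Sum>(as, k, q)\<in>?Z. u as * (g $$ (q, fst (as ! k)) * cnj (v (?upd as k q))))"
  proof (rule sum.reindex_bij_witness[where i = "\<lambda>(as, k, q). (?upd as k q, k, fst (as ! k))"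
        and j = "\<lambda>(as, k, q). (?upd as k q, k, fst (as ! k))"])
    fix a assume "a \<in> ?Z"
    then obtain as k q where a: "a = (as, k, q)" "as \<in> box" "k < n" "q < r" by auto
    have l: "length as = n" using a by (simp add: box_def)
    have nth: "?upd as k q ! k = (q, snd (as ! k))" using l a by simp
    have undo: "?upd (?upd as k q) k (fst (as ! k)) = as"
      unfolding nth snd_conv list_update_overwrite prod.collapse by (rule list_update_id)
    show "(case case a of (as, k, q) \<Rightarrow> (?upd as k q, k, fst (as ! k)) of
      (as, k, q) \<Rightarrow> (?upd as k q, k, fst (as ! k))) = a"
      using undo nth by (simp add: a)
    then show "(case case a of (as, k, q) \<Rightarrow> (?upd as k q, k, fst (as ! k)) of
      (as, k, q) \<Rightarrow> (?upd as k q, k, fst (as ! k))) = a" .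
    show "(case a of (as, k, q) \<Rightarrow> (?upd as k q, k, fst (as ! k))) \<in> ?Z"
      using upd_box[OF a(2-4)] box_nth(1)[OF a(2,3)] a by simp
    then show "(case a of (as, k, q) \<Rightarrow> (?upd as k q, k, fst (as ! k))) \<in> ?Z" .
    show "(case case a of (as, k, q) \<Rightarrow> (?upd as k q, k, fst (as ! k)) of
        (as, k, q) \<Rightarrow> u as * (g $$ (q, fst (as ! k)) * cnj (v (?upd as k q))))
      = (case a of (as, k, q) \<Rightarrow> g $$ (fst (as ! k), q) * u (?upd as k q) * cnj (v as))"
      using undo nth by (simp add: a)
  qed
  also have "\<dots> = (\<Sum>as\<in>box. \<Sum>k<n. \<Sum>q<r. u as * (g $$ (q, fst (as ! k)) * cnj (v (?upd as k q))))"
    by (simp add: sum.cartesian_product)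
  also have "\<dots> = ip box u (gl_op (mat_dagger r g) v)"
    unfolding ip_def
  proof (rule sum.cong[OF refl])
    fix as assume as: "as \<in> box"
    have "cnj (gl_op (mat_dagger r g) v as)
      = (\<Sum>k<n. \<Sum>q<r. g $$ (q, fst (as ! k)) * cnj (v (?upd as k q)))"
      unfolding expand[OF as] cnj_sum
      by (intro sum.cong[OF refl]) (use box_nth(1)[OF as] in \<open>simp add: mat_dagger_def\<close>)
    then show "(\<Sum>k<n. \<Sum>q<r. u as * (g $$ (q, fst (as ! k)) * cnj (v (?upd as k q))))
      = u as * cnj (gl_op (mat_dagger r g) v as)"
      by (simp add: sum_distrib_left)
  qed
  finally show ?thesis .
qed

sublocale V: fun_filtration box "filt_V r N \<xi>"
proof
  show "filt_V r N \<xi> m \<subseteq> funs_on box" for m using filt_V_alt alt_box by blast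
qed (auto simp: finite_box filt_V_sub dest: subsetD[OF filt_V_mono])

lemma gl_op_filt: "g \<in> carrier_mat r r \<Longrightarrow> t \<in> filt_V r N \<xi> m \<Longrightarrow> gl_op g t \<in> filt_V r N \<xi> m"
  using filt_V_monom[of g r t N \<xi> m 0 0] by simp

lemma gl_op_pred:
  assumes "g \<in> carrier_mat r r" "t \<in> V.F_pred m"
  shows "gl_op g t \<in> V.F_pred m"
proof (cases "m = 0")
  case True
  have "gl_op g 0 = 0" by (rule ext) (simp add: derivation_def linear_op_zero[OF linear_op_monom])
  then show ?thesis using assms True by (simp add: V.F_pred_def)
next
  case False
  then show ?thesis using assms gl_op_filt by (simp add: V.F_pred_def)
qed

text \<open>The filtration is stable under \<open>gl\<^sub>r\<close> and under adjoints, so \<open>graded_iso\<close> applies. On the graded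
  module \<open>g \<otimes> 1\<close> acts by its only coefficient, that of \<open>x\<^sup>0 y\<^sup>0\<close>, which preserves degrees.\<close>

theorem graded_module_iso:
  "rep_iso (carrier_mat r r) (with_act (fun_mod alt_tensors) gl_op) (restrict_gl r (V_mod r N \<xi>))"
proof -
  have pred: "filt_V_pred r N \<xi> m = V.F_pred m" for m
    by (simp add: filt_V_pred_def V.F_pred_def)
  have gr: "gr_V r N \<xi> = V.gr" by (rule ext) (simp add: gr_V_def pred)
  define b where "b = (\<lambda>(g :: complex mat) (i::nat) (j::nat). if i = 0 \<and> j = 0 then g else 0\<^sub>m r r)"
  define A where "A = (\<lambda>g x m. finsum (V.gr m) (\<lambda>(i::nat, j::nat). \<Union>t\<in>x (m - j). V.coset m (derivation (op_monom r N (b g i j) i j) t))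
      {(i, j). j \<le> m \<and> b g i j \<noteq> 0\<^sub>m r r})"
  have eq: "restrict_gl r (V_mod r N \<xi>) = with_act (dsum_mod UNIV V.gr) A"
    by (simp add: restrict_gl_def V_mod_def with_act_def gr A_def b_def pred V.a_r_coset_eq)
  have U: "(\<Union>m. filt_V r N \<xi> m) = alt_tensors"
    using gen_module_alt by (simp add: gen_module_def)
  have "rep_iso (carrier_mat r r) (with_act (fun_mod (\<Union>m. filt_V r N \<xi> m)) gl_op) (with_act (dsum_mod UNIV V.gr) A)"
  proof (rule V.graded_iso[where D' = "\<lambda>g. gl_op (mat_dagger r g)"])
    fix g :: "complex mat" assume g: "g \<in> carrier_mat r r"
    show "gl_op g v \<in> filt_V r N \<xi> m" if "v \<in> filt_V r N \<xi> m" for m v by (rule gl_op_filt[OF g that])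
    show "gl_op (mat_dagger r g) v \<in> filt_V r N \<xi> m" if "v \<in> filt_V r N \<xi> m" for m v
      by (rule gl_op_filt[OF _ that]) (simp add: mat_dagger_def)
    show "ip box (gl_op g u) v = ip box u (gl_op (mat_dagger r g) v)" for u v by (rule gl_op_adjoint)
    show diff: "gl_op g (u - v) = gl_op g u - gl_op g v" for u v
    proof -
      have "gl_op g (u - v) + gl_op g v = gl_op g u"
        unfolding derivation_add[OF linear_op_monom, symmetric] by (simp only: diff_add_cancel)
      then show ?thesis by (metis add_diff_cancel_right')
    qed
    fix m x a assume a: "a \<in> filt_V r N \<xi> m" and x: "x m = V.coset m a"
    show "A g x m = V.coset m (gl_op g a)"
    proof (cases "g = 0\<^sub>m r r")
      case True
      have "{(i, j). j \<le> m \<and> b g i j \<noteq> 0\<^sub>m r r} = {}" using True by (auto simp: b_def)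
      then have "A g x m = V.F_pred m" unfolding A_def by (simp only: V.finsum_gr_empty)
      moreover have "op_monom r N g 0 0 f c = 0" for f c
        using True by (cases c) (simp add: op_monom_apply)
      then have "gl_op g a = 0" by (intro ext) (simp add: derivation_def)
      ultimately show ?thesis using V.coset_pred[OF cfun.subspace_0[OF V.pred_sub]] by metis
    next
      case False
      have idx: "{(i, j). j \<le> m \<and> b g i j \<noteq> 0\<^sub>m r r} = {(0, 0)}"
        using False by (auto simp: b_def split: if_splits)
      have "V.coset m (gl_op g t) = V.coset m (gl_op g a)" if t: "t \<in> V.coset m a" for t
      proof -
        obtain h where h: "t = h + a" "h \<in> V.F_pred m" using t unfolding V.coset_def by (rule imageE)
        have "gl_op g t = gl_op g h + gl_op g a" unfolding h(1) by (rule derivation_add[OF linear_op_monom])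
        then have "gl_op g t - gl_op g a = gl_op g h" by (simp only: add_diff_cancel_right')
        then show ?thesis unfolding V.coset_eq_iff using gl_op_pred[OF g h(2)] by (simp only:)
      qed
      moreover have "V.coset m a \<noteq> {}"
        unfolding V.coset_def using cfun.subspace_0[OF V.pred_sub] by blast
      ultimately have un: "(\<Union>t\<in>x m. V.coset m (gl_op g t)) = V.coset m (gl_op g a)"
        unfolding x by blast
      have "V.coset m (gl_op g a) \<in> carrier (V.gr m)"
        unfolding V.carrier_gr by (intro imageI gl_op_filt[OF g a])
      then have "A g x m = (\<lambda>(i, j). \<Union>t\<in>x (m - j). V.coset m (derivation (op_monom r N (b g i j) i j) t)) (0, 0)"
        unfolding A_def idx by (intro V.finsum_gr_singleton) (simp add: b_def un)
      then show ?thesis by (simp add: b_def un)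
    qed
  qed
  then show ?thesis unfolding eq U .
qed

end

section \<open>Parking functions\<close>

lemma length_filter_count: "finite A \<Longrightarrow> length (filter (\<lambda>x. x \<in> A) xs) = (\<Sum>d\<in>A. count_list xs d)"
proof (induction xs)
  case (Cons a xs)
  have "(\<Sum>d\<in>A. count_list (a # xs) d) = (\<Sum>d\<in>A. count_list xs d + (if a = d then 1 else 0))"
    by (rule sum.cong[OF refl]) simp
  also have "\<dots> = (\<Sum>d\<in>A. count_list xs d) + (if a \<in> A then 1 else 0)"
    using Cons.prems by (simp add: sum.distrib sum.delta')
  finally show ?case using Cons by simp
qed simp

locale parking_module = wedge_module +
  fixes \<rho> :: "nat list"
  assumes sorted_rho: "sorted_wrt (\<ge>) \<rho>"
    and count_rho: "count_list \<rho> j = (if j \<ge> 1 then transposed \<xi> j else 0)"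
begin

abbreviation "PF \<equiv> parking_functions n \<rho>"

lemma rho_le: "d \<in> set \<rho> \<Longrightarrow> 1 \<le> d \<and> d \<le> n"
proof -
  assume "d \<in> set \<rho>"
  then have c: "count_list \<rho> d \<noteq> 0" by (simp add: count_list_0_iff)
  then have d: "1 \<le> d" "transposed \<xi> d \<noteq> 0" using count_rho[of d] by (auto split: if_splits)
  then obtain j where "j < length \<xi>" "\<xi> ! j \<ge> d" unfolding transposed_def
    by (metis (mono_tags, lifting) card.empty empty_Collect_eq)
  then show ?thesis using d elem_le_sum_list[of j \<xi>] by simp
qed

text \<open>Both sides count the pairs \<open>(d, j)\<close> with \<open>k < d \<le> \<xi>\<^sub>j\<close>: the top wedge contains the letter \<open>j\<close>
  once at each depth \<open>d \<le> \<xi>\<^sub>j\<close>, and \<open>\<rho>\<close> has one part \<open>d\<close> for each \<open>j\<close> with \<open>\<xi>\<^sub>j \<ge> d\<close>.\<close>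

lemma deeper_rho: "deeper (int k) = card {i. i < length \<rho> \<and> \<rho> ! i > k}"
proof -
  have "card {i. i < length \<rho> \<and> \<rho> ! i > k} = length (filter (\<lambda>d. d > k) \<rho>)"
    by (simp add: length_filter_conv_card)
  also have "filter (\<lambda>d. d > k) \<rho> = filter (\<lambda>d. d \<in> {k<..n}) \<rho>"
    by (rule filter_cong[OF refl]) (use rho_le in auto)
  also have "length \<dots> = (\<Sum>d\<in>{k<..n}. count_list \<rho> d)" by (rule length_filter_count) simp
  also have "\<dots> = (\<Sum>d\<in>{k<..n}. card {j. j < length \<xi> \<and> \<xi> ! j \<ge> d})"
    by (rule sum.cong[OF refl]) (simp add: count_rho transposed_def)
  also have "\<dots> = card (SIGMA d:{k<..n}. {j. j < length \<xi> \<and> \<xi> ! j \<ge> d})"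
    by (rule card_SigmaI[symmetric]) auto
  also have "\<dots> = deeper (int k)"
    unfolding deeper_def
  proof (rule bij_betw_same_card[of "\<lambda>(d, j). (j, N - int d)"],
      rule bij_betw_byWitness[where f' = "\<lambda>(j, i). (nat (N - i), j)"])
    show "(\<lambda>(d, j). (j, N - int d)) ` (SIGMA d:{k<..n}. {j. j < length \<xi> \<and> \<xi> ! j \<ge> d})
      \<subseteq> {a \<in> set top_list. int k < depth a}"
      by (auto simp: set_top_list depth_def len)
    show "(\<lambda>(j, i). (nat (N - i), j)) ` {a \<in> set top_list. int k < depth a}
      \<subseteq> (SIGMA d:{k<..n}. {j. j < length \<xi> \<and> \<xi> ! j \<ge> d})"
    proof (rule image_subsetI)
      fix a assume "a \<in> {a \<in> set top_list. int k < depth a}"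
      moreover obtain j i where a: "a = (j, i)" by (cases a)
      ultimately have "(j, i) \<in> set top_list" "int k < depth (j, i)" by auto
      moreover from this have "\<xi> ! j \<le> n" using elem_le_sum_list[of j \<xi>] len by (auto simp: set_top_list)
      ultimately show "(case a of (j, i) \<Rightarrow> (nat (N - i), j)) \<in> (SIGMA d:{k<..n}. {j. j < length \<xi> \<and> \<xi> ! j \<ge> d})"
        unfolding a by (auto simp: set_top_list depth_def len)
    qed
  qed (auto simp: set_top_list depth_def)
  finally show ?thesis by simp
qed

lemma deeper_neg: "k \<le> 0 \<Longrightarrow> deeper k = n"
proof -
  assume "k \<le> 0"
  then have "{a \<in> set top_list. depth a > k} = set top_list" by (auto simp: set_top_list depth_def)
  then show ?thesis using distinct_card[OF distinct_top_list] length_top_list by (simp add: deeper_def)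
qed

lemma length_rho: "length \<rho> = n"
proof -
  have "{i. i < length \<rho> \<and> \<rho> ! i > 0} = {..<length \<rho>}"
    using rho_le nth_mem[of _ \<rho>] by fastforce
  then show ?thesis using deeper_rho[of 0] deeper_neg[of 0] by simp
qed

text \<open>Values that are too large are counted instead of small ones. The condition for \<open>k\<close> follows
  from the parking condition for \<open>s = n - deeper k\<close>, and the parking condition for \<open>s\<close> follows
  from the condition for \<open>k = \<rho> ! (n - s)\<close>.\<close>

lemma parking_iff:
  "f \<in> PF \<longleftrightarrow> f \<in> {1..n} \<rightarrow>\<^sub>E {1..n} \<and> (\<forall>k. card {x\<in>{1..n}. f x > k} \<le> deeper (int k))"
proof -
  have rho_mono: "\<rho> ! j \<le> \<rho> ! i" if "i \<le> j" "j < n" for i j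
    using sorted_rho that length_rho by (cases "i = j") (auto simp: sorted_wrt_iff_nth_less)
  have split: "card {x\<in>{1..n}. f x \<in> {1..k}} + card {x\<in>{1..n}. f x > k} = n"
    if "f \<in> {1..n} \<rightarrow>\<^sub>E {1..n}" for k
  proof -
    have "{1..n} = {x\<in>{1..n}. f x \<in> {1..k}} \<union> {x\<in>{1..n}. f x > k}"
    proof (rule equalityI; rule subsetI)
      fix x assume x: "x \<in> {1..n}"
      have "f x \<in> {1..n}" by (rule PiE_mem[OF that x])
      then show "x \<in> {x\<in>{1..n}. f x \<in> {1..k}} \<union> {x\<in>{1..n}. f x > k}" using x by simp linarith
    next
      fix x assume "x \<in> {x\<in>{1..n}. f x \<in> {1..k}} \<union> {x\<in>{1..n}. f x > k}"
      then show "x \<in> {1..n}" by blast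
    qed
    then have "card {1..n} = card ({x\<in>{1..n}. f x \<in> {1..k}} \<union> {x\<in>{1..n}. f x > k})" by (rule arg_cong)
    also have "\<dots> = card {x\<in>{1..n}. f x \<in> {1..k}} + card {x\<in>{1..n}. f x > k}"
      by (rule card_Un_disjoint) auto
    finally show ?thesis by simp
  qed
  show ?thesis
  proof
    assume f: "f \<in> PF"
    then have fE: "f \<in> {1..n} \<rightarrow>\<^sub>E {1..n}" by (simp add: parking_functions_def)
    have "card {x\<in>{1..n}. f x > k} \<le> deeper (int k)" for k
    proof -
      let ?c = "deeper (int k)"
      have "?c \<le> n" unfolding deeper_rho using length_rho card_mono[of "{..<n}" "{i. i < length \<rho> \<and> \<rho> ! i > k}"] by auto
      show ?thesis
      proof (cases "?c = n")
        case True
        then show ?thesis using split[OF fE, of k] by simp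
      next
        case False
        then have c: "?c < n" using \<open>?c \<le> n\<close> by simp
        have "\<rho> ! ?c \<le> k"
        proof (rule ccontr)
          assume "\<not> \<rho> ! ?c \<le> k"
          then have "{..?c} \<subseteq> {i. i < length \<rho> \<and> \<rho> ! i > k}"
            using rho_mono[of _ ?c] c length_rho by (auto simp: not_le intro: less_le_trans)
          then have "card {..?c} \<le> ?c" unfolding deeper_rho by (intro card_mono) auto
          then show False by simp
        qed
        then have "{x\<in>{1..n}. f x \<in> {1..\<rho> ! ?c}} \<subseteq> {x\<in>{1..n}. f x \<in> {1..k}}" by auto
        then have "card {x\<in>{1..n}. f x \<in> {1..\<rho> ! ?c}} \<le> card {x\<in>{1..n}. f x \<in> {1..k}}" by (intro card_mono) auto
        moreover have "\<forall>s\<in>{1..length \<rho>}. card {x\<in>{1..n}. f x \<in> {1..\<rho> ! (length \<rho> - s)}} \<ge> s"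
          using f unfolding parking_functions_def by blast
        from bspec[OF this, of "n - ?c"] have "n - ?c \<le> card {x\<in>{1..n}. f x \<in> {1..\<rho> ! ?c}}"
          using c by (simp add: length_rho)
        ultimately have "n - ?c \<le> card {x\<in>{1..n}. f x \<in> {1..k}}" by linarith
        then show ?thesis using split[OF fE, of k] c by simp
      qed
    qed
    then show "f \<in> {1..n} \<rightarrow>\<^sub>E {1..n} \<and> (\<forall>k. card {x\<in>{1..n}. f x > k} \<le> deeper (int k))"
      using fE by blast
  next
    assume f: "f \<in> {1..n} \<rightarrow>\<^sub>E {1..n} \<and> (\<forall>k. card {x\<in>{1..n}. f x > k} \<le> deeper (int k))"
    have "s \<le> card {x\<in>{1..n}. f x \<in> {1..\<rho> ! (length \<rho> - s)}}" if s: "s \<in> {1..length \<rho>}" for s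
    proof -
      let ?m = "\<rho> ! (length \<rho> - s)"
      have "{i. i < length \<rho> \<and> \<rho> ! i > ?m} \<subseteq> {..<n - s}"
      proof clarify
        fix i assume i: "i < length \<rho>" "\<rho> ! i > ?m"
        show "i < n - s"
        proof (rule ccontr)
          assume "\<not> i < n - s"
          then have "\<rho> ! i \<le> ?m" using rho_mono[of "length \<rho> - s" i] i length_rho by simp
          then show False using i by simp
        qed
      qed
      then have "deeper (int ?m) \<le> n - s" unfolding deeper_rho using card_mono[of "{..<n - s}"] by fastforce
      moreover have "card {x\<in>{1..n}. f x > ?m} \<le> deeper (int ?m)" using f by blast
      moreover have "card {x\<in>{1..n}. f x \<in> {1..?m}} + card {x\<in>{1..n}. f x > ?m} = n" using split f by blast
      moreover have "s \<le> n" using s length_rho by simp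
      ultimately show ?thesis by linarith
    qed
    then show "f \<in> PF" using f by (simp add: parking_functions_def)
  qed
qed

lemma comp_closed_PF: "comp_closed n PF"
  unfolding comp_closed_def
proof (intro conjI allI impI ballI)
  have "PF \<subseteq> {1..n} \<rightarrow>\<^sub>E {1..n}" by (auto simp: parking_functions_def)
  then show "finite PF" by (rule finite_subset) (intro finite_PiE; simp)
  fix \<sigma> f assume s: "\<sigma> permutes {1..n}" and f: "f \<in> PF"
  have "card {x\<in>{1..n}. (f \<circ> \<sigma>) x > k} = card {x\<in>{1..n}. f x > k}" for k
  proof (rule bij_betw_same_card[of \<sigma>], rule bij_betw_byWitness[where f' = "inv' \<sigma>"])
    show "\<sigma> ` {x\<in>{1..n}. (f \<circ> \<sigma>) x > k} \<subseteq> {x\<in>{1..n}. f x > k}"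
      using permutes_in_image[OF s] by auto
    show "inv' \<sigma> ` {x\<in>{1..n}. f x > k} \<subseteq> {x\<in>{1..n}. (f \<circ> \<sigma>) x > k}"
      using permutes_in_image[OF permutes_inv[OF s]] permutes_inverses[OF s] by auto
  qed (use permutes_inverses[OF s] in auto)
  moreover have "f \<circ> \<sigma> \<in> {1..n} \<rightarrow>\<^sub>E {1..n}"
  proof -
    have "f \<in> {1..n} \<rightarrow>\<^sub>E {1..n}" using f parking_iff by blast
    then show ?thesis using permutes_in_image[OF s] permutes_not_in[OF s]
      by (auto simp: PiE_def Pi_def extensional_def)
  qed
  ultimately show "f \<circ> \<sigma> \<in> PF" using f unfolding parking_iff by simp
qed

text \<open>A word in the basis vectors is a pair of a word of letters and a word of depths. Places are
  numbered from 0 in lists and from 1 in the words on which permutations act.\<close>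

definition to_list :: "(nat \<Rightarrow> nat) \<Rightarrow> (nat \<Rightarrow> nat) \<Rightarrow> (nat \<times> int) list" where
  "to_list w f = map (\<lambda>i. (w (Suc i), N - int (f (Suc i)))) [0..<n]"

definition letters_of :: "(nat \<times> int) list \<Rightarrow> nat \<Rightarrow> nat" where
  "letters_of as = restrict (\<lambda>x. fst (as ! (x - 1))) {1..n}"

definition depths_of :: "(nat \<times> int) list \<Rightarrow> nat \<Rightarrow> nat" where
  "depths_of as = restrict (\<lambda>x. nat (depth (as ! (x - 1)))) {1..n}"

lemma length_to_list [simp]: "length (to_list w f) = n"
  by (simp add: to_list_def)

lemma to_list_nth: "i < n \<Longrightarrow> to_list w f ! i = (w (Suc i), N - int (f (Suc i)))"
  by (simp add: to_list_def)

lemma Suc_image: "Suc ` {..<n} = {1..n}"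
  using image_Suc_lessThan by simp

lemma card_Suc: "card {i. i < n \<and> P (Suc i)} = card {x\<in>{1..n}. P x}"
proof -
  have "Suc ` {i. i < n \<and> P (Suc i)} = {x\<in>{1..n}. P x}"
  proof (rule equalityI; rule subsetI)
    fix x assume x: "x \<in> {x\<in>{1..n}. P x}"
    then have "x = Suc (x - 1)" "x - 1 \<in> {i. i < n \<and> P (Suc i)}" by auto
    then show "x \<in> Suc ` {i. i < n \<and> P (Suc i)}" by (rule image_eqI)
  qed auto
  then show ?thesis using card_image[of Suc "{i. i < n \<and> P (Suc i)}"] by simp
qed

lemma reachable_to_list:
  assumes w: "w \<in> words n r" and f: "f \<in> {1..n} \<rightarrow>\<^sub>E {1..n}"
  shows "reachable (to_list w f) \<longleftrightarrow> f \<in> PF"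
proof -
  have c: "card {i. i < n \<and> depth (to_list w f ! i) > k} = card {x\<in>{1..n}. int (f x) > k}" for k
    unfolding card_Suc[symmetric] by (rule arg_cong[of _ _ card]) (auto simp: to_list_nth depth_def)
  have ok: "\<forall>a\<in>set (to_list w f). fst a < r \<and> snd a < N"
  proof
    fix a assume "a \<in> set (to_list w f)"
    then obtain i where i: "i < n" "a = (w (Suc i), N - int (f (Suc i)))" by (auto simp: to_list_def)
    have "Suc i \<in> {1..n}" using i by simp
    then have "w (Suc i) < r" "f (Suc i) \<in> {1..n}" using words_lt[OF w] f by blast+
    then show "fst a < r \<and> snd a < N" using i by simp
  qed
  have "(\<forall>k. card {x\<in>{1..n}. int (f x) > k} \<le> deeper k) \<longleftrightarrow> (\<forall>k. card {x\<in>{1..n}. f x > k} \<le> deeper (int k))"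
  proof
    assume a: "\<forall>k. card {x\<in>{1..n}. f x > k} \<le> deeper (int k)"
    show "\<forall>k. card {x\<in>{1..n}. int (f x) > k} \<le> deeper k"
    proof
      fix k :: int
      show "card {x\<in>{1..n}. int (f x) > k} \<le> deeper k"
      proof (cases "k \<le> 0")
        case True
        have "card {x\<in>{1..n}. int (f x) > k} \<le> card {1..n}" by (intro card_mono) auto
        then show ?thesis using deeper_neg[OF True] by simp
      next
        case False
        then have "k = int (nat k)" by simp
        moreover have "{x\<in>{1..n}. int (f x) > int (nat k)} = {x\<in>{1..n}. f x > nat k}" by auto
        ultimately show ?thesis using a by metis
      qed
    qed
  next
    assume a: "\<forall>k. card {x\<in>{1..n}. int (f x) > k} \<le> deeper k"
    show "\<forall>k. card {x\<in>{1..n}. f x > k} \<le> deeper (int k)"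
    proof
      fix k :: nat
      show "card {x\<in>{1..n}. f x > k} \<le> deeper (int k)" using a[rule_format, of "int k"] by simp
    qed
  qed
  then show ?thesis using ok c f unfolding reachable_def parking_iff by simp
qed

lemma reachable_word:
  assumes v: "reachable as"
  shows "letters_of as \<in> words n r" "depths_of as \<in> PF" "to_list (letters_of as) (depths_of as) = as"
proof -
  have l: "length as = n" using v by (simp add: reachable_def)
  have nth: "as ! (x - 1) \<in> set as" if "x \<in> {1..n}" for x using that l by auto
  show w: "letters_of as \<in> words n r"
    unfolding words_def letters_of_def
    by (rule restrict_PiE_iff[THEN iffD2]) (use nth v in \<open>auto simp: reachable_def\<close>)
  have f: "depths_of as \<in> {1..n} \<rightarrow>\<^sub>E {1..n}"
    unfolding depths_of_def
  proof (rule restrict_PiE_iff[THEN iffD2], rule ballI)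
    fix x assume "x \<in> {1..n}"
    then have "x - 1 < n" by auto
    then show "nat (depth (as ! (x - 1))) \<in> {1..n}" using reachable_depth[OF v, of "x - 1"] by auto
  qed
  show eq: "to_list (letters_of as) (depths_of as) = as"
  proof (rule nth_equalityI)
    fix i assume "i < length (to_list (letters_of as) (depths_of as))"
    then have i: "i < n" by simp
    then have "depth (as ! i) \<ge> 1" using reachable_depth[OF v i] by simp
    then show "to_list (letters_of as) (depths_of as) ! i = as ! i"
      using i by (cases "as ! i") (simp add: to_list_nth letters_of_def depths_of_def depth_def)
  qed (simp add: l)
  show "depths_of as \<in> PF" using reachable_to_list[OF w f] eq v by simp
qed

lemma letters_to_list: "w \<in> words n r \<Longrightarrow> letters_of (to_list w f) = w"
  by (auto simp: letters_of_def to_list_nth fun_eq_iff words_def PiE_def extensional_def)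

lemma depths_to_list: "f \<in> {1..n} \<rightarrow>\<^sub>E {1..n} \<Longrightarrow> depths_of (to_list w f) = f"
  by (auto simp: depths_of_def to_list_nth depth_def fun_eq_iff PiE_def extensional_def)

definition sgn_char :: "(nat \<Rightarrow> nat) \<Rightarrow> complex" where
  "sgn_char \<sigma> = of_int (sign \<sigma>)"

sublocale S: perm_char n sgn_char
proof
  fix \<sigma> \<tau> :: "nat \<Rightarrow> nat" assume "\<sigma> permutes {1..n}" "\<tau> permutes {1..n}"
  then have "permutation \<sigma>" "permutation \<tau>" using permutation_permutes by blast+
  then show "sgn_char (\<sigma> \<circ> \<tau>) = sgn_char \<sigma> * sgn_char \<tau>" by (simp add: sgn_char_def sign_compose)
next
  fix \<sigma> :: "nat \<Rightarrow> nat"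
  have "sgn_char \<sigma> * sgn_char \<sigma> = of_int (sign \<sigma> * sign \<sigma>)" unfolding sgn_char_def of_int_mult ..
  then show "sgn_char \<sigma> * sgn_char \<sigma> = 1" by simp
qed

text \<open>The pairs \<open>(w, f)\<close> with a parking function \<open>f\<close> correspond to the reachable words, alternation
  becomes equivariance for the sign, and \<open>gl\<^sub>r\<close> acts on the letters only.\<close>

theorem alt_schur_iso:
  "rep_iso (carrier_mat r r) (with_act (fun_mod alt_tensors) gl_op)
    (word_rep n r (schur n r sgn_char (funs_on PF)))"
proof -
  let ?S = "schur n r sgn_char (funs_on PF)"
  define E where "E t = (\<lambda>(w, f). if w \<in> words n r \<and> f \<in> PF then t (to_list w f) else 0)"
    for t :: "(nat \<times> int) list \<Rightarrow> complex"
  have PF_E: "f \<in> {1..n} \<rightarrow>\<^sub>E {1..n}" if "f \<in> PF" for f using that parking_iff by blast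
  have E_S: "E t \<in> ?S" if t: "t \<in> alt_tensors" for t
    unfolding schur_def
  proof (intro CollectI conjI allI impI)
    show "E t \<in> word_funs n r" by (auto simp: E_def word_funs_def funs_on_def)
    show "(\<lambda>f. E t (w, f)) \<in> funs_on PF" for w by (auto simp: E_def funs_on_def)
    fix \<sigma> :: "nat \<Rightarrow> nat" and w f :: "nat \<Rightarrow> nat" assume s: "\<sigma> permutes {1..n}"
    define p where "p = map_permutation {1..n} (\<lambda>x. x - 1) \<sigma>"
    have inj: "inj_on (\<lambda>x. x - 1) {1..n}" by (auto simp: inj_on_def)
    have img: "(\<lambda>x. x - 1) ` {1..n} = {..<n}"
      unfolding Suc_image[symmetric] by (simp add: image_image)
    have p: "p permutes {..<n}"
      unfolding p_def by (rule map_permutation_permutes) (use s inj img in \<open>auto simp: bij_betw_def\<close>)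
    have sgn: "sign p = sign \<sigma>" unfolding p_def by (rule sign_map_permutation) (use s inj in auto)
    have p_nth: "p i = \<sigma> (Suc i) - 1" if "i < n" for i
      using map_permutation_apply[OF inj, of "Suc i" \<sigma>] that by (simp add: p_def)
    have "to_list (w \<circ> \<sigma>) (f \<circ> \<sigma>) = permute_list p (to_list w f)"
    proof (rule nth_equalityI)
      fix i assume "i < length (to_list (w \<circ> \<sigma>) (f \<circ> \<sigma>))"
      then have i: "i < n" by simp
      then have "\<sigma> (Suc i) \<in> {1..n}" using permutes_in_image[OF s, of "Suc i"] by simp
      then have "Suc (p i) = \<sigma> (Suc i)" "p i < n" using p_nth[OF i] by auto
      then show "to_list (w \<circ> \<sigma>) (f \<circ> \<sigma>) ! i = permute_list p (to_list w f) ! i"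
        using i by (simp add: to_list_nth permute_list_def)
    qed simp
    then have "t (to_list (w \<circ> \<sigma>) (f \<circ> \<sigma>)) = of_int (sign \<sigma>) * t (to_list w f)"
      using t p sgn by (simp add: alt_tensors_def)
    then show "E t (w \<circ> \<sigma>, f \<circ> \<sigma>) = sgn_char \<sigma> * E t (w, f)"
      using words_comp[OF s] comp_closed_iff[OF comp_closed_PF s] by (simp add: E_def sgn_char_def)
  qed
  have E_at: "t as = E t (letters_of as, depths_of as)" if "reachable as" for t as
    using reachable_word[OF that] by (simp add: E_def)
  show ?thesis
  proof (rule rep_isoI[where h = E])
    show "bij_betw E (carrier (with_act (fun_mod alt_tensors) gl_op)) (carrier (word_rep n r ?S))"
    proof (rule bij_betwI')
      fix t u assume tu: "t \<in> carrier (with_act (fun_mod alt_tensors) gl_op)" "u \<in> carrier (with_act (fun_mod alt_tensors) gl_op)"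
      show "E t = E u \<longleftrightarrow> t = u"
      proof
        assume eq: "E t = E u"
        show "t = u"
        proof
          fix as
          show "t as = u as"
          proof (cases "reachable as")
            case True
            then show ?thesis using E_at[OF True, of t] E_at[OF True, of u] eq by simp
          next
            case False
            have "t as = 0" "u as = 0" using tu False by (auto simp: alt_tensors_def)
            then show ?thesis by simp
          qed
        qed
      qed simp
    next
      fix t assume "t \<in> carrier (with_act (fun_mod alt_tensors) gl_op)"
      then show "E t \<in> carrier (word_rep n r ?S)" using E_S by simp
    next
      fix \<Phi> assume "\<Phi> \<in> carrier (word_rep n r ?S)"
      then have \<Phi>: "\<Phi> \<in> ?S" by simp
      define t where "t as = (if reachable as then \<Phi> (letters_of as, depths_of as) else 0)" for as
      have "t \<in> alt_tensors"
        unfolding alt_tensors_def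
      proof (intro CollectI conjI allI impI)
        show "reachable as" if "t as \<noteq> 0" for as using that by (auto simp: t_def split: if_splits)
        fix p and as :: "(nat \<times> int) list" assume p: "p permutes {..<n}" and l: "length as = n"
        define \<sigma> where "\<sigma> = map_permutation {..<n} Suc p"
        have inj: "inj_on Suc {..<n}" by simp
        have s: "\<sigma> permutes {1..n}"
          unfolding \<sigma>_def by (rule map_permutation_permutes) (use p Suc_image in \<open>auto simp: bij_betw_def\<close>)
        have sgn: "sign \<sigma> = sign p" unfolding \<sigma>_def by (rule sign_map_permutation) (use p in auto)
        have \<sigma>_nth: "\<sigma> x = Suc (p (x - 1))" if "x \<in> {1..n}" for x
          using map_permutation_apply[OF inj, of "x - 1" p] that by (auto simp: \<sigma>_def)
        have perm_nth: "permute_list p as ! (x - 1) = as ! (\<sigma> x - 1)" if "x \<in> {1..n}" for x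
        proof -
          have "x - 1 < length as" using that l by auto
          then show ?thesis using \<sigma>_nth[OF that] by (simp add: permute_list_def)
        qed
        have \<sigma>_in: "\<sigma> x \<in> {1..n} \<longleftrightarrow> x \<in> {1..n}" for x by (rule permutes_in_image[OF s])
        have letters: "letters_of (permute_list p as) = letters_of as \<circ> \<sigma>"
          unfolding letters_of_def by (rule ext) (use perm_nth \<sigma>_in in \<open>simp add: restrict_def\<close>)
        have depths: "depths_of (permute_list p as) = depths_of as \<circ> \<sigma>"
          unfolding depths_of_def by (rule ext) (use perm_nth \<sigma>_in in \<open>simp add: restrict_def\<close>)
        have undo: "as = permute_list (inv' p) (permute_list p as)"
          using permutes_inv_o(1)[OF p] permute_list_compose[of "inv' p" as p] permutes_inv[OF p] l by simp
        have "reachable (permute_list p as) \<longleftrightarrow> reachable as"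
          using reachable_permute[OF p, of as] reachable_permute[OF permutes_inv[OF p], of "permute_list p as"] undo
          by auto
        then show "t (permute_list p as) = of_int (sign p) * t as"
          using schurD(3)[OF \<Phi> s] by (simp add: t_def letters depths sgn_char_def sgn)
      qed
      moreover have "\<Phi> = E t"
      proof (rule ext, clarify)
        fix w f
        show "\<Phi> (w, f) = E t (w, f)"
        proof (cases "w \<in> words n r \<and> f \<in> PF")
          case True
          then have "reachable (to_list w f)" using reachable_to_list PF_E by blast
          then show ?thesis
            using True letters_to_list depths_to_list[OF PF_E] by (simp add: E_def t_def)
        next
          case False
          have "(\<lambda>f. \<Phi> (w, f)) \<in> funs_on PF" by (rule schurD(2)[OF \<Phi>])
          then have "\<Phi> (w, f) = 0" using False schurD(4)[OF \<Phi>, of w f] by (auto simp: funs_on_def)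
          have "E t (w, f) = 0" using False unfolding E_def by auto
          then show ?thesis using \<open>\<Phi> (w, f) = 0\<close> by simp
        qed
      qed
      ultimately show "\<exists>t\<in>carrier (with_act (fun_mod alt_tensors) gl_op). \<Phi> = E t" by auto
    qed
  next
    fix t u
    show "E (t \<oplus>\<^bsub>with_act (fun_mod alt_tensors) gl_op\<^esub> u) = E t \<oplus>\<^bsub>word_rep n r ?S\<^esub> E u"
      by (rule ext) (simp add: E_def split: prod.splits)
  next
    fix c t
    show "E (c \<odot>\<^bsub>with_act (fun_mod alt_tensors) gl_op\<^esub> t) = c \<odot>\<^bsub>word_rep n r ?S\<^esub> E t"
      by (rule ext) (simp add: E_def split: prod.splits)
  next
    fix g :: "complex mat" and t
    have "E (gl_op g t) (w, f) = word_act n r g (E t) (w, f)" for w f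
    proof (cases "w \<in> words n r \<and> f \<in> PF")
      case True
      have "gl_op g t (to_list w f)
        = (\<Sum>k<n. \<Sum>q<r. g $$ (w (Suc k), q) * t ((to_list w f)[k := (q, N - int (f (Suc k)))]))"
      proof -
        have "fst (to_list w f ! k) < r" if "k < length (to_list w f)" for k
          using that words_lt[of w n r "Suc k"] True by (simp add: to_list_nth)
        from gl_op_apply[OF this] show ?thesis by (simp add: to_list_nth)
      qed
      also have "\<dots> = (\<Sum>k<n. \<Sum>q<r. g $$ (w (Suc k), q) * t (to_list (w(Suc k := q)) f))"
      proof (rule sum.cong[OF refl], rule sum.cong[OF refl])
        fix k q assume "k \<in> {..<n}"
        then have "(to_list w f)[k := (q, N - int (f (Suc k)))] = to_list (w(Suc k := q)) f"
          by (intro nth_equalityI) (auto simp: to_list_nth nth_list_update)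
        then show "g $$ (w (Suc k), q) * t ((to_list w f)[k := (q, N - int (f (Suc k)))])
          = g $$ (w (Suc k), q) * t (to_list (w(Suc k := q)) f)" by simp
      qed
      also have "\<dots> = (\<Sum>x\<in>{1..n}. \<Sum>q<r. g $$ (w x, q) * t (to_list (w(x := q)) f))"
        unfolding Suc_image[symmetric] by (subst sum.reindex) (simp_all add: comp_def)
      also have "\<dots> = (\<Sum>x\<in>{1..n}. \<Sum>q<r. g $$ (w x, q) * E t (w(x := q), f))"
        using True words_upd[of w n r] by (intro sum.cong[OF refl]) (simp add: E_def)
      finally show ?thesis using True by (simp add: E_def word_act_def)
    next
      case False
      then show ?thesis by (auto simp: E_def word_act_def)
    qed
    then have "E (gl_op g t) x = word_act n r g (E t) x" for x by (cases x) simp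
    then show "E (act (with_act (fun_mod alt_tensors) gl_op) g t) = act (word_rep n r ?S) g (E t)"
      unfolding with_act_simps by (rule ext)
  qed
qed

end

section \<open>The Schur functor on direct sums\<close>

lemma lookup_frobenius_map:
  "Poly_Mapping.lookup (frobenius_map r c) \<eta> = (if length \<eta> \<le> r then Poly_Mapping.lookup c \<eta> else 0)"
proof -
  have "Poly_Mapping.lookup (frobenius_map r c) \<eta>
    = (\<Sum>i\<in>Poly_Mapping.keys c. if i = \<eta> then (if length \<eta> \<le> r then Poly_Mapping.lookup c \<eta> else 0) else 0)"
    unfolding frobenius_map_def frag_extend_def lookup_sum
    by (rule sum.cong[OF refl]) auto
  also have "\<dots> = (if length \<eta> \<le> r then Poly_Mapping.lookup c \<eta> else 0)"
    by (simp add: sum.delta in_keys_iff)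
  finally show ?thesis .
qed

context perm_char
begin

text \<open>The isomorphism \<open>h\<close> is applied to the coefficients of an invariant tensor. Each component is
  an invariant tensor with coefficients in one Specht module; those for partitions with more
  than \<open>r\<close> parts vanish, which is what the Frobenius map prescribes.\<close>

theorem schur_irr_sum:
  assumes W: "cfun.subspace W" and stable: "\<And>\<sigma> v. \<sigma> permutes {1..n} \<Longrightarrow> v \<in> W \<Longrightarrow> twist \<sigma> v \<in> W"
    and keys: "Poly_Mapping.keys c \<subseteq> partitions n"
    and iso: "rep_iso {\<sigma>. \<sigma> permutes {1..n}} (with_act (fun_mod W) twist) (irr_sum (specht n) c)"
  shows "rep_iso (carrier_mat r r) (word_rep n r (schur n r \<epsilon> W)) (irr_sum (gl_irrep r) (frobenius_map r c))"
proof -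
  let ?N = "irr_sum (specht n) c" and ?c' = "frobenius_map r c"
  let ?I = "irr_index c" and ?I' = "irr_index ?c'"
  let ?G = "irr_sum (gl_irrep r) ?c'"
  let ?F = "schur n r \<epsilon> W"
  let ?FS = "\<lambda>\<eta>. schur n r triv (specht_shape.specht_space n \<eta>)"
  obtain h where h_bij: "bij_betw h W (carrier ?N)"
    and h_add: "\<And>v w. v \<in> W \<Longrightarrow> w \<in> W \<Longrightarrow> h (v + w) = h v \<oplus>\<^bsub>?N\<^esub> h w"
    and h_smult: "\<And>a v. v \<in> W \<Longrightarrow> h (\<lambda>f. a * v f) = a \<odot>\<^bsub>?N\<^esub> h v"
    and h_twist: "\<And>\<sigma> v. \<sigma> permutes {1..n} \<Longrightarrow> v \<in> W \<Longrightarrow> h (twist \<sigma> v) = act ?N \<sigma> (h v)"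
    using iso by (auto simp: rep_iso_def)
  have part: "fst i \<in> partitions n" if "i \<in> ?I" for i
    using that keys by (auto simp: irr_index_def in_keys_iff subset_iff)
  have I': "i \<in> ?I' \<longleftrightarrow> i \<in> ?I \<and> length (fst i) \<le> r" for i
    by (cases i) (auto simp: irr_index_def lookup_frobenius_map split: if_splits)
  have carrier_N: "carrier ?N = (\<Pi>\<^sub>E i\<in>?I. specht_shape.specht_space n (fst i))"
    unfolding irr_sum_simps by (rule PiE_cong) (simp add: specht_simps part)
  have hi_add: "h (v + w) i = h v i + h w i" if "v \<in> W" "w \<in> W" "i \<in> ?I" for v w i
    using that by (simp add: h_add irr_sum_simps specht_simps part)
  have hi_smult: "h (\<lambda>f. a * v f) i = (\<lambda>f. a * h v i f)" if "v \<in> W" "i \<in> ?I" for a v i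
    using that by (simp add: h_smult irr_sum_simps specht_simps part)
  have hi_twist: "h (twist \<sigma> v) i = perm_act \<sigma> (h v i)" if "\<sigma> permutes {1..n}" "v \<in> W" "i \<in> ?I" for \<sigma> v i
    using that by (simp add: h_twist irr_sum_simps specht_simps part)
  have hi_in: "h v i \<in> specht_shape.specht_space n (fst i)" if "v \<in> W" "i \<in> ?I" for v i
    using bij_betw_apply[OF h_bij that(1)] that(2) unfolding carrier_N by blast
  have hi_0: "h 0 i = 0" if "i \<in> ?I" for i
    using hi_smult[OF cfun.subspace_0[OF W] that, of 0] by (simp add: zero_fun_def)
  have hi_sum: "h (\<lambda>f. \<Sum>a\<in>A. c a * v a f) i f = (\<Sum>a\<in>A. c a * h (v a) i f)"
    if "finite A" "\<And>a. a \<in> A \<Longrightarrow> v a \<in> W" "i \<in> ?I" for A c v i f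
    using that(1,2)
  proof (induction A rule: finite_induct)
    case empty
    then show ?case using hi_0[OF that(3)] by (simp add: zero_fun_def)
  next
    case (insert a A)
    have "(\<lambda>f. \<Sum>a\<in>insert a A. c a * v a f) = (\<lambda>f. c a * v a f) + (\<lambda>f. \<Sum>a\<in>A. c a * v a f)"
      using insert.hyps by (simp add: fun_eq_iff)
    moreover have "h ((\<lambda>f. c a * v a f) + (\<lambda>f. \<Sum>a\<in>A. c a * v a f)) i
      = h (\<lambda>f. c a * v a f) i + h (\<lambda>f. \<Sum>a\<in>A. c a * v a f) i"
      by (rule hi_add[OF _ _ that(3)]) (intro subspace_smult[OF W] subspace_sum[OF W] insert.prems; simp)+
    ultimately show ?case
      using insert by (simp add: hi_smult[OF _ that(3)])
  qed
  have h_inj: "v = w" if "v \<in> W" "w \<in> W" "\<And>i. i \<in> ?I \<Longrightarrow> h v i = h w i" for v w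
  proof -
    have "h v = h w"
      using bij_betw_apply[OF h_bij that(1)] bij_betw_apply[OF h_bij that(2)] that(3)
      unfolding carrier_N by (rule PiE_ext)
    then show ?thesis using h_bij that(1,2) by (auto simp: bij_betw_def inj_on_def)
  qed
  define Q where "Q \<eta> \<theta> \<longleftrightarrow> bij_betw \<theta> (?FS \<eta>) (carrier (gl_irrep r \<eta>))
      \<and> (\<forall>v\<in>?FS \<eta>. \<forall>w\<in>?FS \<eta>. \<theta> (v + w) = \<theta> v \<oplus>\<^bsub>gl_irrep r \<eta>\<^esub> \<theta> w)
      \<and> (\<forall>a. \<forall>v\<in>?FS \<eta>. \<theta> (\<lambda>b. a * v b) = a \<odot>\<^bsub>gl_irrep r \<eta>\<^esub> \<theta> v)
      \<and> (\<forall>g\<in>carrier_mat r r. \<forall>v\<in>?FS \<eta>. \<theta> (word_act n r g v) = act (gl_irrep r \<eta>) g (\<theta> v))" for \<eta> \<theta>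
  have "\<exists>\<theta>. Q \<eta> \<theta>" if "\<eta> \<in> partitions n \<and> length \<eta> \<le> r" for \<eta>
    using schur_specht_iso[of \<eta> n r] that by (simp add: rep_iso_def Q_def)
  then have "\<forall>\<eta>. \<exists>\<theta>. \<eta> \<in> partitions n \<and> length \<eta> \<le> r \<longrightarrow> Q \<eta> \<theta>" by blast
  from choice[OF this] obtain \<theta> where "\<forall>\<eta>. \<eta> \<in> partitions n \<and> length \<eta> \<le> r \<longrightarrow> Q \<eta> (\<theta> \<eta>)" by (rule exE)
  then have Q: "Q (fst i) (\<theta> (fst i))" if "i \<in> ?I'" for i using I'[of i] part[of i] that by simp
  have \<theta>: "\<And>i. i \<in> ?I' \<Longrightarrow> bij_betw (\<theta> (fst i)) (?FS (fst i)) (carrier (gl_irrep r (fst i)))"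
    "\<And>i v w. i \<in> ?I' \<Longrightarrow> v \<in> ?FS (fst i) \<Longrightarrow> w \<in> ?FS (fst i) \<Longrightarrow> \<theta> (fst i) (v + w) = \<theta> (fst i) v \<oplus>\<^bsub>gl_irrep r (fst i)\<^esub> \<theta> (fst i) w"
    "\<And>i a v. i \<in> ?I' \<Longrightarrow> v \<in> ?FS (fst i) \<Longrightarrow> \<theta> (fst i) (\<lambda>b. a * v b) = a \<odot>\<^bsub>gl_irrep r (fst i)\<^esub> \<theta> (fst i) v"
    "\<And>i g v. i \<in> ?I' \<Longrightarrow> g \<in> carrier_mat r r \<Longrightarrow> v \<in> ?FS (fst i) \<Longrightarrow> \<theta> (fst i) (word_act n r g v) = act (gl_irrep r (fst i)) g (\<theta> (fst i) v)"
    using Q[unfolded Q_def] by blast+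
  define comp where "comp \<Phi> i = (\<lambda>(w, f). if w \<in> words n r then h (\<lambda>f. \<Phi> (w, f)) i f else 0)" for \<Phi> i
  have slice: "(\<lambda>f. \<Phi> (w, f)) \<in> W" if "\<Phi> \<in> ?F" for \<Phi> w by (rule schurD(2)[OF that])
  have slice_twist: "twist \<sigma> (\<lambda>f. \<Phi> (w \<circ> \<sigma>, f)) = (\<lambda>f. \<Phi> (w, f))" if "\<Phi> \<in> ?F" "\<sigma> permutes {1..n}" for \<Phi> \<sigma> w
    using schurD(3)[OF that] char_square[OF that(2)]
    by (simp add: twist_def perm_act_def flip: mult.assoc)
  have comp_in: "comp \<Phi> i \<in> ?FS (fst i)" if \<Phi>: "\<Phi> \<in> ?F" and i: "i \<in> ?I" for \<Phi> i
    unfolding schur_def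
  proof (intro CollectI conjI allI impI)
    show "comp \<Phi> i \<in> word_funs n r" by (auto simp: comp_def word_funs_def funs_on_def)
    interpret specht_shape n "fst i" by unfold_locales (rule part[OF i])
    show "(\<lambda>f. comp \<Phi> i (w, f)) \<in> specht_shape.specht_space n (fst i)" for w
    proof (cases "w \<in> words n r")
      case True
      then show ?thesis using hi_in[OF slice[OF \<Phi>] i] by (simp add: comp_def)
    next
      case False
      then show ?thesis using cfun.subspace_0[OF specht_subspace] by (simp add: comp_def zero_fun_def)
    qed
    fix \<sigma> :: "nat \<Rightarrow> nat" and w f :: "nat \<Rightarrow> nat" assume s: "\<sigma> permutes {1..n}"
    have "h (\<lambda>f. \<Phi> (w, f)) i = perm_act \<sigma> (h (\<lambda>f. \<Phi> (w \<circ> \<sigma>, f)) i)"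
      using hi_twist[OF s slice[OF \<Phi>] i, of "w \<circ> \<sigma>"] slice_twist[OF \<Phi> s, of w] by simp
    then have "h (\<lambda>f. \<Phi> (w, f)) i f = h (\<lambda>f. \<Phi> (w \<circ> \<sigma>, f)) i (f \<circ> \<sigma>)" by (simp add: perm_act_def)
    then show "comp \<Phi> i (w \<circ> \<sigma>, f \<circ> \<sigma>) = 1 * comp \<Phi> i (w, f)"
      using words_comp[OF s] by (simp add: comp_def)
  qed
  have comp_add: "comp (\<Phi> + \<Psi>) i = comp \<Phi> i + comp \<Psi> i" if "\<Phi> \<in> ?F" "\<Psi> \<in> ?F" "i \<in> ?I" for \<Phi> \<Psi> i
  proof -
    have "(\<lambda>f. (\<Phi> + \<Psi>) (w, f)) = (\<lambda>f. \<Phi> (w, f)) + (\<lambda>f. \<Psi> (w, f))" for w by (simp add: fun_eq_iff)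
    then have "h (\<lambda>f. (\<Phi> + \<Psi>) (w, f)) i = h (\<lambda>f. \<Phi> (w, f)) i + h (\<lambda>f. \<Psi> (w, f)) i" for w
      using hi_add[OF slice[OF that(1)] slice[OF that(2)] that(3)] by simp
    then have "comp (\<Phi> + \<Psi>) i (w, f) = comp \<Phi> i (w, f) + comp \<Psi> i (w, f)" for w f
      unfolding comp_def prod.case by (cases "w \<in> words n r") (simp_all only: if_True if_False plus_fun_apply add_0)
    then have "comp (\<Phi> + \<Psi>) i x = (comp \<Phi> i + comp \<Psi> i) x" for x by (cases x) simp
    then show ?thesis by (rule ext)
  qed
  have comp_smult: "comp (\<lambda>b. a * \<Phi> b) i = (\<lambda>b. a * comp \<Phi> i b)" if "\<Phi> \<in> ?F" "i \<in> ?I" for a \<Phi> i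
    using hi_smult[OF slice[OF that(1)] that(2)] by (auto simp: comp_def fun_eq_iff)
  have comp_act: "comp (word_act n r g \<Phi>) i = word_act n r g (comp \<Phi> i)" if \<Phi>: "\<Phi> \<in> ?F" and i: "i \<in> ?I" for g \<Phi> i
  proof (rule ext, clarify)
    fix w f
    show "comp (word_act n r g \<Phi>) i (w, f) = word_act n r g (comp \<Phi> i) (w, f)"
    proof (cases "w \<in> words n r")
      case w: True
      have inner: "(\<lambda>f. \<Sum>q<r. g $$ (w x, q) * \<Phi> (w(x := q), f)) \<in> W" for x
        by (intro subspace_sum[OF W] slice[OF \<Phi>])
      have "comp (word_act n r g \<Phi>) i (w, f)
        = h (\<lambda>f. \<Sum>x\<in>{1..n}. 1 * (\<Sum>q<r. g $$ (w x, q) * \<Phi> (w(x := q), f))) i f"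
        using w by (simp add: comp_def word_act_def)
      also have "\<dots> = (\<Sum>x\<in>{1..n}. 1 * h (\<lambda>f. \<Sum>q<r. g $$ (w x, q) * \<Phi> (w(x := q), f)) i f)"
        by (rule hi_sum[OF _ _ i]) (simp_all add: inner)
      also have "\<dots> = (\<Sum>x\<in>{1..n}. \<Sum>q<r. g $$ (w x, q) * h (\<lambda>f. \<Phi> (w(x := q), f)) i f)"
        by (rule sum.cong[OF refl]) (simp add: hi_sum[OF _ _ i] slice[OF \<Phi>])
      also have "\<dots> = word_act n r g (comp \<Phi> i) (w, f)"
        using w words_upd[OF w] by (simp add: word_act_def comp_def)
      finally show ?thesis .
    next
      case False
      then show ?thesis by (simp add: comp_def word_act_def)
    qed
  qed
  have comp_zero: "\<Psi> = 0" if "\<Psi> \<in> ?FS (fst i)" "i \<in> ?I" "i \<notin> ?I'" for \<Psi> i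
  proof -
    interpret specht_shape n "fst i" by unfold_locales (rule part[OF that(2)])
    show ?thesis using schur_specht_zero[OF _ that(1)] that I'[of i] by simp
  qed
  have comp_inj: "\<Phi> = \<Psi>" if "\<Phi> \<in> ?F" "\<Psi> \<in> ?F" "\<And>i. i \<in> ?I \<Longrightarrow> comp \<Phi> i = comp \<Psi> i" for \<Phi> \<Psi>
  proof (rule ext, clarify)
    fix w f
    show "\<Phi> (w, f) = \<Psi> (w, f)"
    proof (cases "w \<in> words n r")
      case True
      have "h (\<lambda>f. \<Phi> (w, f)) i = h (\<lambda>f. \<Psi> (w, f)) i" if i: "i \<in> ?I" for i
      proof
        fix f
        show "h (\<lambda>f. \<Phi> (w, f)) i f = h (\<lambda>f. \<Psi> (w, f)) i f"
          using fun_cong[OF \<open>\<And>i. i \<in> ?I \<Longrightarrow> comp \<Phi> i = comp \<Psi> i\<close>[OF i], of "(w, f)"] True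
          by (simp add: comp_def)
      qed
      then have "(\<lambda>f. \<Phi> (w, f)) = (\<lambda>f. \<Psi> (w, f))" by (rule h_inj[OF slice[OF that(1)] slice[OF that(2)]])
      then show ?thesis by (rule fun_cong)
    next
      case False
      then show ?thesis using schurD(4)[OF that(1)] schurD(4)[OF that(2)] by simp
    qed
  qed
  have comp_surj: "\<exists>\<Phi>\<in>?F. \<forall>i\<in>?I. comp \<Phi> i = X i" if X: "\<And>i. i \<in> ?I \<Longrightarrow> X i \<in> ?FS (fst i)" for X
  proof -
    define u where "u w = (\<lambda>i\<in>?I. (\<lambda>f. X i (w, f)))" for w
    have "u w \<in> h ` W" for w
    proof -
      have "u w \<in> carrier ?N"
        unfolding carrier_N u_def by (rule restrict_PiE_iff[THEN iffD2]) (use schurD(2)[OF X] in blast)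
      then show ?thesis using h_bij by (simp add: bij_betw_def)
    qed
    then have "\<exists>v. v \<in> W \<and> h v = u w" for w by (metis imageE)
    then obtain v where v: "\<And>w. v w \<in> W" "\<And>w. h (v w) = u w" by metis
    have vi: "h (v w) i f = X i (w, f)" if "i \<in> ?I" for w i f using that by (simp add: v(2) u_def)
    define \<Phi> where "\<Phi> = (\<lambda>(w, f). v w f)"
    have "\<Phi> \<in> ?F"
      unfolding schur_def
    proof (intro CollectI conjI allI impI)
      have "v w = 0" if "w \<notin> words n r" for w
      proof (rule h_inj[OF v(1) cfun.subspace_0[OF W]])
        fix i assume i: "i \<in> ?I"
        show "h (v w) i = h 0 i"
          using schurD(4)[OF X[OF i] that] vi[OF i, of w] hi_0[OF i] by (simp add: fun_eq_iff)
      qed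
      then show "\<Phi> \<in> word_funs n r" by (auto simp: \<Phi>_def word_funs_def funs_on_def)
      show "(\<lambda>f. \<Phi> (w, f)) \<in> W" for w using v(1) by (simp add: \<Phi>_def)
      fix \<sigma> :: "nat \<Rightarrow> nat" and w f :: "nat \<Rightarrow> nat" assume s: "\<sigma> permutes {1..n}"
      have "twist \<sigma> (v (w \<circ> \<sigma>)) = v w"
      proof (rule h_inj[OF stable[OF s v(1)] v(1)])
        fix i assume i: "i \<in> ?I"
        show "h (twist \<sigma> (v (w \<circ> \<sigma>))) i = h (v w) i"
          unfolding hi_twist[OF s v(1) i]
          by (rule ext) (simp add: perm_act_def vi[OF i] schurD(3)[OF X[OF i] s])
      qed
      then have "\<epsilon> \<sigma> * v (w \<circ> \<sigma>) (f \<circ> \<sigma>) = v w f" by (metis twist_def perm_act_apply)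
      then have "\<epsilon> \<sigma> * v w f = (\<epsilon> \<sigma> * \<epsilon> \<sigma>) * v (w \<circ> \<sigma>) (f \<circ> \<sigma>)" by (simp add: mult.assoc)
      then show "\<Phi> (w \<circ> \<sigma>, f \<circ> \<sigma>) = \<epsilon> \<sigma> * \<Phi> (w, f)" using char_square[OF s] by (simp add: \<Phi>_def)
    qed
    moreover have "comp \<Phi> i = X i" if i: "i \<in> ?I" for i
    proof (rule ext, clarify)
      fix w f
      show "comp \<Phi> i (w, f) = X i (w, f)"
        using vi[OF i, of w f] schurD(4)[OF X[OF i], of w f] by (simp add: comp_def \<Phi>_def)
    qed
    ultimately show ?thesis by blast
  qed
  define E where "E \<Phi> = (\<lambda>i\<in>?I'. \<theta> (fst i) (comp \<Phi> i))" for \<Phi>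
  have I'I: "i \<in> ?I" if "i \<in> ?I'" for i using that I' by blast
  show ?thesis
  proof (rule rep_isoI[where h = E])
    show "bij_betw E (carrier (word_rep n r ?F)) (carrier ?G)"
    proof (rule bij_betwI')
      fix \<Phi> \<Psi> assume "\<Phi> \<in> carrier (word_rep n r ?F)" "\<Psi> \<in> carrier (word_rep n r ?F)"
      then have F: "\<Phi> \<in> ?F" "\<Psi> \<in> ?F" by simp_all
      show "E \<Phi> = E \<Psi> \<longleftrightarrow> \<Phi> = \<Psi>"
      proof
        assume eq: "E \<Phi> = E \<Psi>"
        have "comp \<Phi> i = comp \<Psi> i" if i: "i \<in> ?I" for i
        proof (cases "i \<in> ?I'")
          case True
          then have "\<theta> (fst i) (comp \<Phi> i) = \<theta> (fst i) (comp \<Psi> i)"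
            using fun_cong[OF eq, of i] by (simp add: E_def)
          then show ?thesis
            using \<theta>(1)[OF True] comp_in[OF F(1) i] comp_in[OF F(2) i] by (auto simp: bij_betw_def inj_on_def)
        next
          case False
          then show ?thesis using comp_zero[OF comp_in[OF F(1) i] i] comp_zero[OF comp_in[OF F(2) i] i] by metis
        qed
        then show "\<Phi> = \<Psi>" by (rule comp_inj[OF F])
      qed simp
    next
      fix \<Phi> assume "\<Phi> \<in> carrier (word_rep n r ?F)"
      then show "E \<Phi> \<in> carrier ?G"
        unfolding irr_sum_simps E_def
        by (intro restrict_PiE_iff[THEN iffD2] ballI bij_betw_apply[OF \<theta>(1)] comp_in) (simp_all add: I'I)
    next
      fix y assume "y \<in> carrier ?G"
      then have y: "y \<in> (\<Pi>\<^sub>E i\<in>?I'. carrier (gl_irrep r (fst i)))" by (simp add: irr_sum_simps)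
      define X where "X i = (if i \<in> ?I' then inv_into (?FS (fst i)) (\<theta> (fst i)) (y i) else 0)" for i
      have X': "X i \<in> ?FS (fst i)" "\<theta> (fst i) (X i) = y i" if i: "i \<in> ?I'" for i
      proof -
        have "y i \<in> \<theta> (fst i) ` ?FS (fst i)" using y i \<theta>(1)[OF i] by (auto simp: bij_betw_def)
        then show "X i \<in> ?FS (fst i)" "\<theta> (fst i) (X i) = y i"
          using i by (simp_all add: X_def inv_into_into f_inv_into_f)
      qed
      have "X i \<in> ?FS (fst i)" if i: "i \<in> ?I" for i
      proof (cases "i \<in> ?I'")
        case False
        interpret specht_shape n "fst i" by unfold_locales (rule part[OF i])
        show ?thesis using False cfun.subspace_0[OF subspace_schur[OF specht_subspace]] by (simp only: X_def if_False)
      qed (rule X'(1))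
      then obtain \<Phi> where \<Phi>: "\<Phi> \<in> ?F" "\<And>i. i \<in> ?I \<Longrightarrow> comp \<Phi> i = X i" using comp_surj by blast
      have "y = E \<Phi>"
      proof (rule PiE_ext[OF y])
        show "E \<Phi> \<in> (\<Pi>\<^sub>E i\<in>?I'. carrier (gl_irrep r (fst i)))"
          unfolding E_def
          by (intro restrict_PiE_iff[THEN iffD2] ballI bij_betw_apply[OF \<theta>(1)] comp_in \<Phi>(1)) (simp_all add: I'I)
        show "y i = E \<Phi> i" if "i \<in> ?I'" for i
          using that X'(2)[OF that] \<Phi>(2)[OF I'I[OF that]] by (simp add: E_def)
      qed
      then show "\<exists>\<Phi>\<in>carrier (word_rep n r ?F). y = E \<Phi>" using \<Phi>(1) by auto
    qed
  next
    fix \<Phi> \<Psi> assume "\<Phi> \<in> carrier (word_rep n r ?F)" "\<Psi> \<in> carrier (word_rep n r ?F)"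
    then have F: "\<Phi> \<in> ?F" "\<Psi> \<in> ?F" by simp_all
    have "E (\<Phi> + \<Psi>) = E \<Phi> \<oplus>\<^bsub>?G\<^esub> E \<Psi>"
      unfolding irr_sum_simps E_def
      by (rule restrict_ext) (simp only: restrict_apply' comp_add[OF F I'I] \<theta>(2) comp_in[OF F(1) I'I] comp_in[OF F(2) I'I])
    then show "E (\<Phi> \<oplus>\<^bsub>word_rep n r ?F\<^esub> \<Psi>) = E \<Phi> \<oplus>\<^bsub>?G\<^esub> E \<Psi>"
      unfolding with_act_simps fun_mod_simps .
  next
    fix a \<Phi> assume "\<Phi> \<in> carrier (word_rep n r ?F)"
    then have F: "\<Phi> \<in> ?F" by simp
    have "E (\<lambda>b. a * \<Phi> b) = a \<odot>\<^bsub>?G\<^esub> E \<Phi>"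
      unfolding irr_sum_simps E_def
      by (rule restrict_ext) (simp only: restrict_apply' comp_smult[OF F I'I] \<theta>(3) comp_in[OF F I'I])
    then show "E (a \<odot>\<^bsub>word_rep n r ?F\<^esub> \<Phi>) = a \<odot>\<^bsub>?G\<^esub> E \<Phi>"
      unfolding with_act_simps fun_mod_simps .
  next
    fix g :: "complex mat" and \<Phi> assume g: "g \<in> carrier_mat r r" and "\<Phi> \<in> carrier (word_rep n r ?F)"
    then have F: "\<Phi> \<in> ?F" by simp
    have "E (word_act n r g \<Phi>) = act ?G g (E \<Phi>)"
      unfolding irr_sum_simps E_def
      by (rule restrict_ext) (simp only: restrict_apply' comp_act[OF F I'I] \<theta>(4)[OF _ g] comp_in[OF F I'I])
    then show "E (act (word_rep n r ?F) g \<Phi>) = act ?G g (E \<Phi>)"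
      unfolding with_act_simps .
  qed
qed

end

theorem corollary3:
  fixes r n :: nat and N :: int and \<xi> \<rho> :: "nat list"
  assumes "length \<xi> = r" and "sorted_wrt (\<ge>) \<xi>" and "n = sum_list \<xi>"
    and "sorted_wrt (\<ge>) \<rho>"
    and "\<forall>j. count_list \<rho> j = (if j \<ge> 1 then transposed \<xi> j else 0)"
  shows "rep_iso (carrier_mat r r) (restrict_gl r (V_mod r N \<xi>))
    (irr_sum (gl_irrep r)
      (frobenius_map r (sym_class n (tensor_sign (perm_rep (parking_functions n \<rho>))))))"
proof -
  interpret parking_module r N \<xi> \<rho>
    using assms by unfold_locales auto
  let ?W = "funs_on PF" and ?P = "tensor_sign (perm_rep PF)"
  have n: "n = sum_list \<xi>" by (rule assms(3))
  have W: "perm_stable (sum_list \<xi>) ?W"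
    unfolding perm_stable_def
    using comp_closed_iff[OF comp_closed_PF] by (auto simp: subspace_funs_on) (auto simp: funs_on_def perm_act_def)
  have twist_W: "S.twist \<sigma> v \<in> ?W" if "\<sigma> permutes {1..sum_list \<xi>}" "v \<in> ?W" for \<sigma> v
    unfolding S.twist_def using W that by (intro subspace_smult) (auto simp: perm_stable_def)
  have P: "?P = with_act (fun_mod ?W) S.twist"
  proof -
    have "S.twist = (\<lambda>\<sigma> v x. of_int (sign \<sigma>) * perm_act \<sigma> v x)"
      by (intro ext) (simp add: S.twist_def sgn_char_def)
    then show ?thesis by (simp add: tensor_sign_def perm_rep_def with_act_def fun_mod_def funs_on_def)
  qed
  have G: "carrier (sym_group (sum_list \<xi>)) = {\<sigma>. \<sigma> permutes {1..sum_list \<xi>}}"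
    by (simp add: sym_group_def)
  have "\<exists>c. Poly_Mapping.keys c \<subseteq> partitions n \<and> (\<forall>\<eta>. 0 \<le> Poly_Mapping.lookup c \<eta>)
      \<and> rep_iso (carrier (sym_group n)) ?P (irr_sum (specht n) c)"
    using S.specht_decomposition[OF comp_closed_PF W] unfolding P n G by blast
  from someI_ex[OF this]
  have c: "Poly_Mapping.keys (sym_class n ?P) \<subseteq> partitions n"
    "rep_iso (carrier (sym_group n)) ?P (irr_sum (specht n) (sym_class n ?P))"
    unfolding sym_class_def by blast+
  have "rep_iso (carrier_mat r r) (word_rep n r (schur n r sgn_char ?W))
      (irr_sum (gl_irrep r) (frobenius_map r (sym_class n ?P)))"
    using S.schur_irr_sum[OF subspace_funs_on twist_W c[unfolded n P G]] unfolding P n by simp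
  moreover have "rep_iso (carrier_mat r r) (restrict_gl r (V_mod r N \<xi>)) (with_act (fun_mod alt_tensors) gl_op)"
    by (rule rep_iso_sym[OF graded_module_iso])
      (simp_all add: subspace_add[OF alt_sub] subspace_smult[OF alt_sub] derivation_monom_alt)
  ultimately show ?thesis
    using rep_iso_trans[OF rep_iso_trans[OF _ alt_schur_iso]] unfolding n by blast
qed

end
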